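(* Let $N\ge 1$, let $0<m_1\le\cdots\le m_N$, let $f_j,g_j\in C_0^\infty(\mathbb{R})$ be real-valued ($j=1,\dots,N$), and let $F=(F_j)_{1\le j\le N}:\mathbb{R}^{3N}\to\mathbb{R}^N$ be a smooth nonlinearity whose cubic homogeneous part $F^{\mathrm c}=(F^{\mathrm c}_j)$ has the mass-resonant form described in the context, with associated reduced nonlinearity $F^{\mathrm{c,red}}:\mathbb{H}_+\times\mathbb{C}^N\to\mathbb{C}^N$. Consider, for $\varepsilon>0$, the Cauchy problem $$(\partial_t^2-\partial_x^2+m_j^2)u_j=F_j(u,\partial_t u,\partial_x u),\quad (t,x)\in(0,\infty)\times\mathbb{R},\ j=1,\dots,N,$$ $$u_j(0,x)=\varepsilon f_j(x),\quad \partial_t u_j(0,x)=\varepsilon g_j(x),\quad x\in\mathbb{R},\ j=1,\dots,N,$$ for the $\mathbb{R}^N$-valued unknown $u=(u_j)_{1\le j\le N}$. Assume there exists an $N\times N$ positive (definite) Hermitian matrix $A$ such that $$\operatorname{Im}\left(AY\cdot F^{\mathrm{c,red}}(\omega,Y)\right)\le 0\qquad\text{for all }(\omega,Y)\in\mathbb{H}_+\times\mathbb{C}^N .$$ Then there exists $\varepsilon_0>0$ such that for every $\varepsilon\in(0,\varepsilon_0]$ the Cauchy problem admits a unique global classical solution $u$ on $[0,\infty)\times\mathbb{R}$. Moreover, there is a positive constant $C$, not depending on $\varepsilon$, such that $$\sum_{|\gamma|\le 1}\|\partial^\gamma u(t,\cdot)\|_{L^p(\mathbb{R})}\le C\varepsilon(1+t)^{-(1/2-1/p)}$$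 for all $t\ge 0$ and all $p\in[2,\infty]$.
   Context: Notation: $\partial=(\partial_t,\partial_x)$; for a multi-index $I=(I_0,I_1)\in\mathbb{N}_0^2$, $\partial^I=\partial_t^{I_0}\partial_x^{I_1}$ and $|I|=I_0+I_1$ (so $|I|\le1$ means $\partial^I\in\{1,\partial_t,\partial_x\}$). Mass resonance: for $j\in\{1,\dots,N\}$ and $a=(a_1,a_2,a_3)\in\{1,\dots,N\}^3$ let $$\mathscr S_j^a=\{\sigma=(\sigma_1,\sigma_2,\sigma_3)\in\{+1,-1\}^3: m_j=\sigma_1m_{a_1}+\sigma_2m_{a_2}+\sigma_3m_{a_3}\},$$ and let $\mathscr M_j$ be the set of $a$ with $\mathscr S_j^a\ne\emptyset$. Nonlinearity: $F_j$ is smooth and $F_j(u,\partial_tu,\partial_xu)=F_j^{\mathrm c}(u,\partial_tu,\partial_xu)+O((|u|+|\partial_tu|+|\partial_xu|)^4)$ near the origin, where $$F_j^{\mathrm c}=\sum_{a\in\mathscr M_j}\ \sum_{|I|,|J|,|K|\le1}F_{j,a}^{\mathrm c,I,J,K},\qquad F_{j,a}^{\mathrm c,I,J,K}(u,\partial_tu,\partial_xu)=C_{j,a}^{I,J,K}(\partial^Iu_{a_1})(\partial^Ju_{a_2})(\partial^Ku_{a_3}),$$ with real constants $C_{j,a}^{I,J,K}$. $\mathbb{H}_+=\{\omega=(\omega_0,\omega_1)\in\mathbb{R}^2:\omega_0>0,\ \omega_0^2-\omega_1^2=1\}$. Reduced nonlinearity: for $\omega\in\mathbb{H}_+$ and $k\in\{1,\dots,N\}$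 put $p_k^{(0,0)}(\omega)=1$, $p_k^{(1,0)}(\omega)=i\omega_0m_k$, $p_k^{(0,1)}(\omega)=-i\omega_1m_k$. For $Y\in\mathbb{C}^N$ write $Y_k^{(+1)}=Y_k$, $Y_k^{(-1)}=\overline{Y_k}$. Then $F^{\mathrm{c,red}}=(F_j^{\mathrm{c,red}})_{1\le j\le N}$ with $$F_j^{\mathrm{c,red}}(\omega,Y)=\frac1{m_j}\sum_{a\in\mathscr M_j}\sum_{\sigma\in\mathscr S_j^a}\sum_{|I|,|J|,|K|\le1}C_{j,a}^{I,J,K}\,p_{a_1}^I(\omega)p_{a_2}^J(\omega)p_{a_3}^K(\omega)\,\sigma_1^{|I|}\sigma_2^{|J|}\sigma_3^{|K|}\,Y_{a_1}^{(\sigma_1)}Y_{a_2}^{(\sigma_2)}Y_{a_3}^{(\sigma_3)}.$$ (That is, the coefficient is $F_{j,a}^{\mathrm c,I,J,K}$ evaluated at $u=(1,\dots,1)$, $\partial_tu=(i\omega_0m_k)_k$, $\partial_xu=(-i\omega_1m_k)_k$.) The scalar product on $\mathbb{C}^N$ is $Y\cdot Z=\sum_{k=1}^N\overline{Y_k}\,Z_k$ (conjugate-linear in the first argument). *)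

theory Defs
  imports
    "HOL-Analysis.Analysis"
    "HOL-Library.Landau_Symbols"
    "HOL-Probability.Essential_Supremum"
begin

section \<open>Smooth functions on Euclidean spaces\<close>

primrec Ck :: "nat \<Rightarrow> ('a::euclidean_space \<Rightarrow> 'b::real_normed_vector) \<Rightarrow> bool" where
  "Ck 0 f \<longleftrightarrow> continuous_on UNIV f"
| "Ck (Suc k) f \<longleftrightarrow>
     (\<forall>x. f differentiable (at x)) \<and> (\<forall>v. Ck k (\<lambda>x. frechet_derivative f (at x) v))"

definition smooth :: "('a::euclidean_space \<Rightarrow> 'b::real_normed_vector) \<Rightarrow> bool" where
  "smooth f \<longleftrightarrow> (\<forall>k. Ck k f)"

definition test_function :: "(real \<Rightarrow> real) \<Rightarrow> bool" where
  "test_function f \<longleftrightarrow> smooth f \<and> compact (closure {x. f x \<noteq> 0})"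

section \<open>Partial derivatives on the closed half plane\<close>

text \<open>
  Functions of \<open>(t, x) \<in> [0, \<infinity>) \<times> \<real>\<close> are total functions on pairs, of which only the values
  at \<open>t \<ge> 0\<close> matter; accordingly the time derivative at \<open>t = 0\<close> is one-sided.
\<close>

definition Dt :: "(real \<times> real \<Rightarrow> 'b::real_normed_vector) \<Rightarrow> real \<times> real \<Rightarrow> 'b" where
  "Dt u = (\<lambda>(t, x). vector_derivative (\<lambda>s. u (s, x)) (at t within {0..}))"

definition Dx :: "(real \<times> real \<Rightarrow> 'b::real_normed_vector) \<Rightarrow> real \<times> real \<Rightarrow> 'b" where
  "Dx u = (\<lambda>(t, x). vector_derivative (\<lambda>y. u (t, y)) (at x))"

definition pd :: "nat \<times> nat \<Rightarrow> (real \<times> real \<Rightarrow> 'b::real_normed_vector) \<Rightarrow> real \<times> real \<Rightarrow> 'b" where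
  "pd I u = (Dt ^^ fst I) ((Dx ^^ snd I) u)"

primrec Ck_half :: "nat \<Rightarrow> (real \<times> real \<Rightarrow> 'b::real_normed_vector) \<Rightarrow> bool" where
  "Ck_half 0 u \<longleftrightarrow> continuous_on ({0..} \<times> UNIV) u"
| "Ck_half (Suc k) u \<longleftrightarrow>
     continuous_on ({0..} \<times> UNIV) u \<and>
     (\<forall>t\<ge>0. \<forall>x. (\<lambda>s. u (s, x)) differentiable (at t within {0..}) \<and>
                (\<lambda>y. u (t, y)) differentiable (at x)) \<and>
     Ck_half k (Dt u) \<and> Ck_half k (Dx u)"

section \<open>Multi-indices and mass resonance\<close>

definition mlen :: "nat \<times> nat \<Rightarrow> nat" where
  "mlen I = fst I + snd I"

definition MI1 :: "(nat \<times> nat) set" where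
  "MI1 = {I. mlen I \<le> 1}"

definition res_signs :: "('n \<Rightarrow> real) \<Rightarrow> 'n \<Rightarrow> 'n \<times> 'n \<times> 'n \<Rightarrow> (int \<times> int \<times> int) set" where
  "res_signs m j a = (case a of (a1, a2, a3) \<Rightarrow>
     {(s1, s2, s3). s1 \<in> {1, -1} \<and> s2 \<in> {1, -1} \<and> s3 \<in> {1, -1} \<and>
        m j = of_int s1 * m a1 + of_int s2 * m a2 + of_int s3 * m a3})"

definition res_set :: "('n \<Rightarrow> real) \<Rightarrow> 'n \<Rightarrow> ('n \<times> 'n \<times> 'n) set" where
  "res_set m j = {a. res_signs m j a \<noteq> {}}"

section \<open>The cubic part of the nonlinearity and its reduction\<close>

type_synonym 'n jet = "(real ^ 'n) \<times> (real ^ 'n) \<times> (real ^ 'n)"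

type_synonym 'n coeffs =
  "'n \<Rightarrow> 'n \<times> 'n \<times> 'n \<Rightarrow> nat \<times> nat \<Rightarrow> nat \<times> nat \<Rightarrow> nat \<times> nat \<Rightarrow> real"

text \<open>
  In the following two definitions the last branch only concerns \<open>I = (0, 1)\<close>: both functions
  are used for \<open>I \<in> MI1\<close> only.
\<close>

definition jet_comp :: "nat \<times> nat \<Rightarrow> 'n \<Rightarrow> 'n::finite jet \<Rightarrow> real" where
  "jet_comp I k z = (case z of (u, ut, ux) \<Rightarrow>
     if I = (0, 0) then u $ k else if I = (1, 0) then ut $ k else ux $ k)"

definition p_symb :: "('n \<Rightarrow> real) \<Rightarrow> real \<times> real \<Rightarrow> nat \<times> nat \<Rightarrow> 'n \<Rightarrow> complex" where
  "p_symb m \<omega> I k =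
     (if I = (0, 0) then 1
      else if I = (1, 0) then \<i> * of_real (fst \<omega> * m k)
      else - \<i> * of_real (snd \<omega> * m k))"

definition F_cubic :: "('n::finite \<Rightarrow> real) \<Rightarrow> 'n coeffs \<Rightarrow> 'n \<Rightarrow> 'n jet \<Rightarrow> real" where
  "F_cubic m c j z =
     (\<Sum>(a1, a2, a3) \<in> res_set m j. \<Sum>I\<in>MI1. \<Sum>J\<in>MI1. \<Sum>K\<in>MI1.
        c j (a1, a2, a3) I J K * jet_comp I a1 z * jet_comp J a2 z * jet_comp K a3 z)"

definition cubic_expansion ::
    "('n::finite \<Rightarrow> real) \<Rightarrow> 'n coeffs \<Rightarrow> ('n jet \<Rightarrow> real ^ 'n) \<Rightarrow> bool" where
  "cubic_expansion m c F \<longleftrightarrow>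
     (\<forall>j. (\<lambda>z. F z $ j - F_cubic m c j z)
        \<in> O[nhds 0](\<lambda>(u, ut, ux). (norm u + norm ut + norm ux) ^ 4))"

definition hyperboloid_plus :: "(real \<times> real) set" where
  "hyperboloid_plus = {(\<omega>0, \<omega>1). \<omega>0 > 0 \<and> \<omega>0\<^sup>2 - \<omega>1\<^sup>2 = 1}"

definition conj_sign :: "int \<Rightarrow> complex \<Rightarrow> complex" where
  "conj_sign s z = (if s = 1 then z else cnj z)"

definition F_red ::
    "('n::finite \<Rightarrow> real) \<Rightarrow> 'n coeffs \<Rightarrow> real \<times> real \<Rightarrow> complex ^ 'n \<Rightarrow> complex ^ 'n" where
  "F_red m c \<omega> Y = (\<chi> j. 1 / of_real (m j) *
     (\<Sum>(a1, a2, a3) \<in> res_set m j. \<Sum>(s1, s2, s3) \<in> res_signs m j (a1, a2, a3).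
      \<Sum>I\<in>MI1. \<Sum>J\<in>MI1. \<Sum>K\<in>MI1.
        of_real (c j (a1, a2, a3) I J K) *
        p_symb m \<omega> I a1 * p_symb m \<omega> J a2 * p_symb m \<omega> K a3 *
        of_int (s1 ^ mlen I * s2 ^ mlen J * s3 ^ mlen K) *
        conj_sign s1 (Y $ a1) * conj_sign s2 (Y $ a2) * conj_sign s3 (Y $ a3)))"

section \<open>Hermitian matrices\<close>

definition cdot :: "complex ^ 'n \<Rightarrow> complex ^ 'n \<Rightarrow> complex" where
  "cdot Y Z = (\<Sum>k\<in>UNIV. cnj (Y $ k) * Z $ k)"

definition hermitian :: "complex ^ 'n ^ 'n \<Rightarrow> bool" where
  "hermitian A \<longleftrightarrow> (\<forall>i j. A $ i $ j = cnj (A $ j $ i))"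

text \<open>For Hermitian \<open>A\<close> the number \<open>cdot Y (A *v Y)\<close> is real.\<close>

definition positive_definite :: "complex ^ 'n ^ 'n \<Rightarrow> bool" where
  "positive_definite A \<longleftrightarrow> (\<forall>Y. Y \<noteq> 0 \<longrightarrow> Re (cdot Y (A *v Y)) > 0)"

section \<open>The Cauchy problem\<close>

definition classical_solution ::
    "('n::finite \<Rightarrow> real) \<Rightarrow> ('n jet \<Rightarrow> real ^ 'n) \<Rightarrow> ('n \<Rightarrow> real \<Rightarrow> real) \<Rightarrow> ('n \<Rightarrow> real \<Rightarrow> real)
      \<Rightarrow> real \<Rightarrow> (real \<times> real \<Rightarrow> real ^ 'n) \<Rightarrow> bool" where
  "classical_solution m F f g \<epsilon> u \<longleftrightarrow>
     Ck_half 2 u \<and>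
     (\<forall>t>0. \<forall>x. \<forall>j.
        pd (2, 0) u (t, x) $ j - pd (0, 2) u (t, x) $ j + (m j)\<^sup>2 * u (t, x) $ j
          = F (u (t, x), pd (1, 0) u (t, x), pd (0, 1) u (t, x)) $ j) \<and>
     (\<forall>x. \<forall>j. u (0, x) $ j = \<epsilon> * f j x \<and> pd (1, 0) u (0, x) $ j = \<epsilon> * g j x)"

section \<open>Lebesgue norms on the real line\<close>

text \<open>
  The norm takes the value \<open>\<infinity>\<close> for functions outside \<open>L\<^sup>p\<close>, hence an upper bound by a finite
  number includes membership in \<open>L\<^sup>p\<close>. The case distinction on the integral is needed since
  \<^term>\<open>(powr)\<close> is not available on \<^typ>\<open>ennreal\<close>.
\<close>

definition Lp_norm :: "ennreal \<Rightarrow> (real \<Rightarrow> 'b::real_normed_vector) \<Rightarrow> ennreal" where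
  "Lp_norm p h =
     (if p = \<infinity> then esssup lborel (\<lambda>x. ennreal (norm (h x)))
      else let q = enn2real p; S = (\<integral>\<^sup>+x. ennreal (norm (h x) powr q) \<partial>lborel)
        in if S = \<infinity> then \<infinity> else ennreal (enn2real S powr (1 / q)))"

end

theory Submission
  imports Defs
begin

text \<open>
  Since the nonlinearity has no quadratic part, it may be cut off to a globally Lipschitz one, for which the
  characteristic form of the system has a global solution depending smoothly on the parameter \<open>\<epsilon>\<close>. In hyperbolic
  coordinates \<open>t + 2B = e\<^sup>s cosh z\<close>, \<open>x = e\<^sup>s sinh z\<close> the rescaled unknown \<open>w = e\<^bsup>s/2\<^esup> u\<close> satisfies, up to
  terms decaying in \<open>s\<close>, an ordinary differential equation in \<open>s\<close> for each \<open>z\<close>: harmonic oscillators with frequencies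
  \<open>m\<^sub>j e\<^sup>s\<close> and the cubic nonlinearity as forcing. Removing the oscillation turns the resonant part of the
  forcing into the reduced nonlinearity, so the quadratic form of \<open>A\<close> is nonincreasing up to nonresonant terms, which
  are integrated by parts in \<open>s\<close>. This pointwise bound and weighted energy estimates for up to three derivatives
  in \<open>z\<close>, which may grow slowly, close a bootstrap argument. The resulting bound \<open>O(\<epsilon> t\<^bsup>-1/2\<^esup>)\<close> on the jet keeps the
  solution where the cut-off is inactive, and with finite propagation speed it yields all the norms.
\<close>

text \<open>In the oscillator equation the second z-derivative is a forcing with factor e^{-s}, an
  integrable error only if it grows more slowly than e^s; by Sobolev's inequality this asks for
  energies of three derivatives. The weight in z, needed because passing from the hyperbolic frame
  to (t, x) costs cosh z per factor, is not boost invariant, and at top order the resulting cross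
  term forces growth. Lower down the cross term is paid with the next energy at a gain e^{-s}; the
  exponents 13/10, 3/10, 1/10, 1/10 close this scheme. The pointwise bound must not grow at all,
  which only dissipativity gives: nonresonant terms contribute mu^4 and errors mu * ep + mu^4 to
  quantities of size mu^2, so that mu = L * ep closes for small ep. The argument starts on a
  hyperboloid, where smallness with all derivatives comes from smoothness in ep and vanishing at ep
  = 0. As the apex is moved to t = -2B, the part of the half plane reached by the data lies beyond
  that hyperboloid, which itself meets negative times; hence the cut-off equation is solved for both
  signs of t.\<close>

notation scaleR (infixr "*R" 75)
notation has_vector_derivative (infix "hvd" 50)
abbreviation (input) hrd :: "(real => real) => real => real filter => bool" (infix "hrd" 50)
 where "f hrd D == (f has_field_derivative D)"

section \<open>Calculus of continuously differentiable functions\<close>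

abbreviation dd :: "'a::euclidean_space => ('a => 'b::real_normed_vector) => 'a => 'b" where
 "dd v f \<equiv> (%x. frechet_derivative f (at x) v)"

lemma Ck_SucI:
 assumes "!!x. (f has_derivative f' x) (at x)" and "!!v. Ck k (%x. f' x v)"
 shows "Ck (Suc k) f"
proof -
 have "frechet_derivative f (at x) = f' x" for x
  using frechet_derivative_at[OF assms(1)] by simp
 then show ?thesis
  using assms by (auto simp: differentiable_def)
qed

lemma dd_eq: "(f has_derivative f') (at x) ==> dd v f x = f' v"
 using frechet_derivative_at by metis

lemma Ck_has_derivative: "Ck (Suc k) f ==> (f has_derivative (%v. dd v f x)) (at x)"
 using frechet_derivative_works by auto

lemma Ck_dd: "Ck (Suc k) f ==> Ck k (dd v f)"
 by simp

lemma Ck_SucD: "Ck (Suc k) f ==> Ck k f"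
proof (induction k arbitrary: f)
 case 0
 then show ?case
  by (auto intro!: differentiable_imp_continuous_on simp: differentiable_on_def)
next
 case (Suc k)
 have "f differentiable at x" for x
  using Suc.prems by (subst (asm) Ck.simps) auto
 moreover have "Ck k (dd v f)" for v
  using Suc.prems by (intro Suc.IH) (subst (asm) Ck.simps, auto)
 ultimately show ?case
  by simp
qed

lemma Ck_mono: "Ck n f ==> k <= n ==> Ck k f"
 by (induction n) (metis le_zero_eq, metis Ck_SucD le_Suc_eq)

lemma Ck_continuous: "Ck k f ==> continuous_on S f"
 using Ck_mono[of k f 0] continuous_on_subset by auto

lemma Ck_const [intro]: "Ck k (%x. c)"
 by (induction k arbitrary: c) (auto intro!: Ck_SucI[of _ "%x v. 0"] simp: continuous_on_const)

lemma Ck_bounded_linear: "bounded_linear f ==> Ck k f"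
proof (cases k)
 case (Suc n)
 assume "bounded_linear f"
 then show ?thesis
  unfolding Suc by (intro Ck_SucI[of f "%x. f"] bounded_linear_imp_has_derivative Ck_const)
qed (auto intro: linear_continuous_on)

lemma Ck_id [intro]: "Ck k (%x. x)"
 by (intro Ck_bounded_linear bounded_linear_ident)

lemma Ck_linear_compose: "bounded_linear L ==> Ck k f ==> Ck k (%x. L (f x))"
proof (induction k arbitrary: f)
 case 0
 then show ?case
  by (auto intro: linear_continuous_on_compose linear_conv_bounded_linear bounded_linear.continuous_on)
next
 case (Suc k)
 show ?case
  by (rule Ck_SucI[where f'="%x v. L (dd v f x)"])
   (use Suc Ck_has_derivative bounded_linear.has_derivative in blast, rule Suc.IH, use Suc in auto)
qed

lemma Ck_add [intro]: "Ck k f ==> Ck k g ==> Ck k (%x. f x + g x)"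
proof (induction k arbitrary: f g)
 case 0
 then show ?case by (auto intro: continuous_on_add)
next
 case (Suc k)
 show ?case
  by (rule Ck_SucI[where f'="%x v. dd v f x + dd v g x"])
   (use Suc.prems Ck_has_derivative has_derivative_add in blast, rule Suc.IH, use Suc in auto)
qed

lemma Ck_minus [intro]: "Ck k f ==> Ck k (%x. - f x)"
 by (rule Ck_linear_compose[of uminus]) (auto intro: bounded_linear_minus bounded_linear_ident)

lemma Ck_diff [intro]: "Ck k f ==> Ck k g ==> Ck k (%x. f x - g x)"
 using Ck_add[of k f "%x. - g x"] by auto

lemma Ck_sum [intro]: "(!!i. i : I ==> Ck k (f i)) ==> Ck k (%x. \<Sum>i\<in>I. f i x)"
 by (induction I rule: infinite_finite_induct) auto

lemma Ck_bilinear: "bounded_bilinear B ==> Ck k f ==> Ck k g ==> Ck k (%x. B (f x) (g x))"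
proof (induction k arbitrary: f g)
 case 0
 then show ?case by (auto intro: bounded_bilinear.continuous_on)
next
 case (Suc k)
 have k: "Ck k f" "Ck k g" "!!v. Ck k (dd v f)" "!!v. Ck k (dd v g)"
  using Suc.prems Ck_SucD by auto
 show ?case
  by (rule Ck_SucI[where f'="%x v. B (f x) (dd v g x) + B (dd v f x) (g x)"])
   (rule bounded_bilinear.FDERIV[OF Suc.prems(1) Ck_has_derivative[OF Suc.prems(2)]
     Ck_has_derivative[OF Suc.prems(3)]], intro Ck_add Suc.IH Suc.prems k)
qed

lemmas Ck_scaleR [intro] = Ck_bilinear[OF bounded_bilinear_scaleR]
lemmas Ck_mult [intro] = Ck_bilinear[OF bounded_bilinear_mult]
lemmas Ck_inner [intro] = Ck_bilinear[OF bounded_bilinear_inner]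
lemmas Ck_fst [intro] = Ck_linear_compose[OF bounded_linear_fst]
lemmas Ck_snd [intro] = Ck_linear_compose[OF bounded_linear_snd]

lemma linear_eq_sum_Basis:
 assumes "linear f"
 shows "f v = (\<Sum>b\<in>Basis. (v \<bullet> b) *R f b)"
proof -
 have "f v = f (\<Sum>b\<in>Basis. (v \<bullet> b) *R b)"
  by (simp add: euclidean_representation)
 also have "... = (\<Sum>b\<in>Basis. (v \<bullet> b) *R f b)"
  using assms by (simp add: linear_sum linear_cmul)
 finally show ?thesis .
qed

lemma dd_eq_sum_Basis: "Ck (Suc k) f ==> dd v f x = (\<Sum>b\<in>Basis. (v \<bullet> b) *R dd b f x)"
 by (rule linear_eq_sum_Basis) (use Ck_has_derivative has_derivative_linear in blast)

text \<open>The chain rule differentiates \<open>g\<close> in the direction \<open>dd v f x\<close>,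
  which moves with \<open>x\<close>, while the induction hypothesis only covers fixed directions.
  Expanding that direction in the basis moves the dependence on \<open>x\<close> into scalar
  coefficients.\<close>

lemma Ck_compose: "Ck k g ==> Ck k f ==> Ck k (%x. g (f x))"
proof (induction k arbitrary: g)
 case 0
 then show ?case by (auto intro: continuous_on_compose2)
next
 case (Suc k)
 have k: "Ck k f" "Ck k (%x. dd b g (f x))" "Ck k (dd v f)" for b v
  using Ck_SucD[OF Suc.prems(2)] Suc.IH[OF Ck_dd[OF Suc.prems(1)] Ck_SucD[OF Suc.prems(2)]]
   Ck_dd[OF Suc.prems(2)] by blast+
 show ?case
 proof (rule Ck_SucI[where f'="%x v. \<Sum>b\<in>Basis. (dd v f x \<bullet> b) *R dd b g (f x)"])
  fix x
  have "((%x. g (f x)) has_derivative (%v. dd (dd v f x) g (f x))) (at x)"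
   using has_derivative_compose[OF Ck_has_derivative[OF Suc.prems(2)] Ck_has_derivative[OF Suc.prems(1)]]
   by simp
  then show "((%x. g (f x)) has_derivative (%v. \<Sum>b\<in>Basis. (dd v f x \<bullet> b) *R dd b g (f x))) (at x)"
   by (subst (asm) dd_eq_sum_Basis[OF Suc.prems(1)])
 next
  show "Ck k (%x. \<Sum>b\<in>Basis. (dd v f x \<bullet> b) *R dd b g (f x))" for v
   by (intro Ck_sum Ck_scaleR Ck_inner k Ck_const)
 qed
qed

lemma Ck_Pair [intro]:
 fixes f :: "'a::euclidean_space => 'b::euclidean_space" and g :: "'a => 'c::euclidean_space"
 assumes "Ck k f" "Ck k g"
 shows "Ck k (%x. (f x, g x))"
proof -
 have "Ck k (%x. (f x, 0) + (0, g x))"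
  by (intro Ck_add Ck_linear_compose[of "%y. (y, 0)"] Ck_linear_compose[of "%y. (0, y)"] assms
    bounded_linear_Pair bounded_linear_ident bounded_linear_zero)
 then show ?thesis by simp
qed

lemma Ck_vec_lambda:
 fixes f :: "'n::finite => 'a::euclidean_space => real"
 assumes "!!i. Ck k (f i)"
 shows "Ck k (%x. \<chi> i. f i x)"
proof -
 have "(%x. \<chi> i. f i x) = (%x. \<Sum>i\<in>UNIV. f i x *R axis i 1)"
  by (auto simp: vec_eq_iff axis_def if_distrib[of "%y. _ * y"] cong: if_cong)
 moreover have "Ck k (%x. \<Sum>i\<in>UNIV. f i x *R (axis i 1 :: real^'n))"
  by (intro Ck_sum Ck_scaleR assms Ck_const)
 ultimately show ?thesis by simp
qed

lemma Ck_derivatives: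
 assumes "!!n x. (D n hrd D (Suc n) x) (at x)"
 shows "Ck k (D n)"
proof (induction k arbitrary: n)
 case 0
 then show ?case
  using DERIV_isCont[OF assms] by (simp add: continuous_at_imp_continuous_on)
next
 case (Suc k)
 show ?case
 proof (rule Ck_SucI[where f'="%x v. D (Suc n) x * v"])
  show "(D n has_derivative (*) (D (Suc n) x)) (at x)" for x
   using assms by (simp add: has_field_derivative_def)
  show "Ck k (%x. D (Suc n) x * v)" for v
   by (intro Ck_mult Suc.IH Ck_const)
 qed
qed

lemma Ck_exp: "Ck k (exp :: real => real)"
 by (rule Ck_derivatives[where n=0 and D="%_. exp"]) (auto intro: DERIV_exp)

lemma Ck_cosh: "Ck k (cosh :: real => real)"
 and Ck_sinh: "Ck k (sinh :: real => real)"
proof -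
 have "Ck k (%x::real. (1/2) *R (exp x + exp (- x)))" "Ck k (%x::real. (1/2) *R (exp x - exp (- x)))"
  by (intro Ck_scaleR Ck_add Ck_diff Ck_const Ck_compose[OF Ck_exp] Ck_minus Ck_id)+
 moreover have "cosh = (%x::real. (1/2) *R (exp x + exp (- x)))"
  "sinh = (%x::real. (1/2) *R (exp x - exp (- x)))"
  by (auto simp: cosh_def sinh_def)
 ultimately show "Ck k (cosh :: real => real)" "Ck k (sinh :: real => real)"
  by simp_all
qed

lemma has_real_derivative_pos_part_power:
 "((%x::real. max 0 x ^ Suc (Suc n)) hrd real (Suc (Suc n)) * max 0 x ^ Suc n) (at x)"
proof -
 consider "x < 0" | "x = 0" | "x > 0" by linarith
 then show ?thesis
 proof cases
  case 1
  have "((%x::real. 0) hrd 0) (at x)" by simp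
  then show ?thesis
   using 1 by (subst DERIV_cong_ev[where g="%_. 0" and y=x and v=0])
    (auto intro!: eventually_mono[OF eventually_nhds_in_open[of "{..<0}"]])
 next
  case 3
  have "((%x::real. x ^ Suc (Suc n)) hrd real (Suc (Suc n)) * x ^ Suc n) (at x)"
   using DERIV_pow[of "Suc (Suc n)" x] by simp
  then show ?thesis
   using 3 by (subst DERIV_cong_ev[where g="%x. x ^ Suc (Suc n)" and y=x and v="real (Suc (Suc n)) * x ^ Suc n"])
    (auto intro!: eventually_mono[OF eventually_nhds_in_open[of "{0<..}"]] simp: max_def)
 next
  case 2
  have "((%h. max 0 h ^ Suc (Suc n) / h) \<longlongrightarrow> (0::real)) (at 0)"
  proof (rule Lim_null_comparison)
   show "\<forall>\<^sub>F h in at 0. norm (max 0 h ^ Suc (Suc n) / h) <= max (0::real) h ^ Suc n"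
    by (rule always_eventually) (auto simp: max_def)
   show "((%h::real. max 0 h ^ Suc n) \<longlongrightarrow> 0) (at 0)"
    by (rule tendsto_eq_intros refl)+ simp
  qed
  then show ?thesis using 2 by (simp add: DERIV_def)
 qed
qed

text \<open>A substitute for flat functions such as exp (-1/x): the cut-off needs only finitely many
  derivatives, and this family is closed under differentiation up to constants.\<close>

lemma Ck_pos_part_power: "Ck k (%x::real. max 0 x ^ (k + 1))"
proof (induction k)
 case 0
 then show ?case by (auto intro!: continuous_intros)
next
 case (Suc k)
 show ?case
 proof (rule Ck_SucI[where f'="%x v. (real (Suc (Suc k)) * max 0 x ^ (k + 1)) * v"])
  show "((%x. max 0 x ^ (Suc k + 1)) has_derivative (*) (real (Suc (Suc k)) * max 0 x ^ (k + 1))) (at x)" for x :: real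
   using has_real_derivative_pos_part_power[of k x] by (simp add: has_field_derivative_def)
  show "Ck k (%x. real (Suc (Suc k)) * max 0 x ^ (k + 1) * v)" for v
   by (intro Ck_mult Suc.IH Ck_const)
 qed
qed

section \<open>Derivatives along lines and symmetry of second derivatives\<close>

lemma has_derivative_along_line:
 assumes "(f has_derivative f') (at (x + h *R v))"
 shows "((%h. f (x + h *R v)) hvd f' v) (at h)"
proof -
 have "((%h. x + h *R v) has_derivative (%h. h *R v)) (at h)"
  by (auto intro!: derivative_eq_intros)
 from has_derivative_compose[OF this] assms
 have "((%h. f (x + h *R v)) has_derivative (%h. f' (h *R v))) (at h)" by blast
 moreover have "f' (k *R v) = k *R f' v" for k
  using has_derivative_linear[OF assms] by (simp add: linear_cmul)
 ultimately show ?thesis by (simp add: has_vector_derivative_def)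
qed

lemma dd_along_line:
 "Ck (Suc k) f ==> ((%h. f (x + h *R v)) hvd dd v f (x + h *R v)) (at h)"
 using has_derivative_along_line[OF Ck_has_derivative] by blast

text \<open>Both iterated derivatives are values of the second difference quotient up to an error that
 tends to zero.\<close>

lemma second_difference_quotient:
 fixes f :: "'a::real_normed_vector => real"
 assumes S: "ball x r \<subseteq> S" and r: "r > 0"
  and f: "!!y. y : S ==> (f has_derivative Df y) (at y)"
  and fv: "!!y. y : S ==> ((%y. Df y v) has_derivative Dv y) (at y)"
  and h: "0 < h" "h * (norm v + norm w) < r"
 shows "\<exists>y. dist y x <= h * (norm v + norm w) \<and>
  f (x + h *R v + h *R w) - f (x + h *R v) - f (x + h *R w) + f x = h^2 * Dv y w"
proof -
 have near: "x + a *R v + b *R w : S" "dist (x + a *R v + b *R w) x <= h * (norm v + norm w)"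
  if "0 <= a" "a <= h" "0 <= b" "b <= h" for a b
 proof -
  have "norm (a *R v + b *R w) <= a * norm v + b * norm w"
   using norm_triangle_ineq[of "a *R v" "b *R w"] that by simp
  also have "... <= h * norm v + h * norm w"
   using that by (intro add_mono mult_right_mono) auto
  finally show *: "dist (x + a *R v + b *R w) x <= h * (norm v + norm w)"
   by (simp add: dist_norm algebra_simps)
  then show "x + a *R v + b *R w : S"
   using h S by (auto simp: dist_commute)
 qed
 let ?g = "%a. f (x + h *R w + a *R v) - f (x + a *R v)"
 have "\<exists>a. 0 < a \<and> a < h \<and> ?g h - ?g 0 = (h - 0) * (Df (x + h *R w + a *R v) v - Df (x + a *R v) v)"
 proof (rule MVT2)
  fix a :: real assume a: "0 <= a" "a <= h"
  have "x + h *R w + a *R v : S" "x + a *R v : S"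
   using near(1)[of a h] near(1)[of a 0] a h by (auto simp: algebra_simps)
  then show "(?g hrd Df (x + h *R w + a *R v) v - Df (x + a *R v) v) (at a)"
   by (intro DERIV_diff) (use f has_derivative_along_line in
     \<open>force simp: has_real_derivative_iff_has_vector_derivative\<close>)+
 qed (use h in auto)
 then obtain a where a: "0 < a" "a < h"
  and A: "?g h - ?g 0 = h * (Df (x + h *R w + a *R v) v - Df (x + a *R v) v)" by auto
 let ?k = "%b. Df (x + a *R v + b *R w) v"
 have "\<exists>b. 0 < b \<and> b < h \<and> ?k h - ?k 0 = (h - 0) * Dv (x + a *R v + b *R w) w"
 proof (rule MVT2)
  fix b :: real assume b: "0 <= b" "b <= h"
  have "x + a *R v + b *R w : S"
   using near(1)[of a b] a b by auto
  then show "(?k hrd Dv (x + a *R v + b *R w) w) (at b)"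
   using has_derivative_along_line[OF fv] by (simp add: has_real_derivative_iff_has_vector_derivative)
 qed (use h in auto)
 then obtain b where b: "0 < b" "b < h" and "?k h - ?k 0 = h * Dv (x + a *R v + b *R w) w" by auto
 then have "?g h - ?g 0 = h^2 * Dv (x + a *R v + b *R w) w"
  using A by (simp add: power2_eq_square algebra_simps)
 then show ?thesis
  using near(2)[of a b] a b by (intro exI[of _ "x + a *R v + b *R w"]) (auto simp: algebra_simps)
qed

text \<open>Schwarz's theorem: the second difference is symmetric in \<open>v\<close> and
  \<open>w\<close>, so the two mixed derivatives agree at two points near \<open>x\<close>, and
  continuity at \<open>x\<close> does the rest. Open set and derivatives are explicit because the
  lemma also serves \<open>Dt\<close> and \<open>Dx\<close>, which commute only at positive
  times.\<close>

lemma mixed_derivatives_commute: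
 fixes f :: "'a::real_normed_vector => real"
 assumes S: "open S" "x : S"
  and f: "!!y. y : S ==> (f has_derivative Df y) (at y)"
  and fv: "!!y. y : S ==> ((%y. Df y v) has_derivative Dv y) (at y)"
  and fw: "!!y. y : S ==> ((%y. Df y w) has_derivative Dw y) (at y)"
  and cv: "isCont (%y. Dv y w) x" and cw: "isCont (%y. Dw y v) x"
 shows "Dv x w = Dw x v"
proof (rule ccontr)
 assume "Dv x w ~= Dw x v"
 then have e: "dist (Dv x w) (Dw x v) / 2 > 0" (is "?e > 0") by auto
 obtain d1 where d1: "d1 > 0" "!!y. dist y x < d1 ==> dist (Dv y w) (Dv x w) < ?e"
  using cv e unfolding continuous_at_eps_delta by blast
 obtain d2 where d2: "d2 > 0" "!!y. dist y x < d2 ==> dist (Dw y v) (Dw x v) < ?e"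
  using cw e unfolding continuous_at_eps_delta by blast
 obtain r where r: "r > 0" "ball x r \<subseteq> S"
  using S openE by blast
 define \<rho> where "\<rho> = min r (min d1 d2)"
 have \<rho>: "\<rho> > 0" using r d1 d2 by (simp add: \<rho>_def)
 \<comment> \<open>The added 1 covers \<open>v = w = 0\<close>; the points found below lie within
   \<rho>/2 of \<open>x\<close>.\<close>
 define h where "h = \<rho> / (2 * (norm v + norm w + 1))"
 have h: "h > 0" unfolding h_def using \<rho> by (intro divide_pos_pos) (auto intro: add_nonneg_pos)
 have "h * (norm v + norm w) <= h * (norm v + norm w + 1)"
  using h by (intro mult_left_mono) auto
 also have "... = \<rho> / 2"
  unfolding h_def by (simp add: field_simps add_nonneg_eq_0_iff)
 also have "... < \<rho>" using \<rho> by simp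
 finally have hb: "h * (norm v + norm w) < \<rho>" .
 obtain y where y: "dist y x <= h * (norm v + norm w)"
  "f (x + h *R v + h *R w) - f (x + h *R v) - f (x + h *R w) + f x = h^2 * Dv y w"
  using second_difference_quotient[OF r(2,1) f fv h, of w] hb unfolding \<rho>_def by auto
 obtain y' where y': "dist y' x <= h * (norm w + norm v)"
  "f (x + h *R w + h *R v) - f (x + h *R w) - f (x + h *R v) + f x = h^2 * Dw y' v"
  using second_difference_quotient[OF r(2,1) f fw h, of v] hb unfolding \<rho>_def by (auto simp: add.commute)
 have "h^2 * Dv y w = h^2 * Dw y' v"
  unfolding y(2)[symmetric] y'(2)[symmetric] by (simp add: algebra_simps)
 then have "Dv y w = Dw y' v"
  using h by simp
 moreover have "dist (Dv y w) (Dv x w) < ?e" "dist (Dw y' v) (Dw x v) < ?e"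
  using y(1) y'(1) hb d1(2) d2(2) by (auto simp: \<rho>_def add.commute)
 ultimately show False
  using dist_triangle_half_l[of "Dv x w" "Dv y w" "2 * ?e" "Dw x v"] by (auto simp: dist_commute)
qed

lemma dd_commute_real:
 fixes f :: "'a::euclidean_space => real"
 assumes "Ck 2 f"
 shows "dd w (dd v f) x = dd v (dd w f) x"
proof -
 have 2: "Ck (Suc (Suc 0)) f" using assms by (simp add: numeral_2_eq_2)
 have 1: "Ck (Suc 0) (dd u f)" for u by (rule Ck_dd[OF 2])
 have 0: "isCont (dd u (dd u' f)) x" for u u'
  using Ck_continuous[OF Ck_dd[OF 1], of UNIV] by (simp add: continuous_on_eq_continuous_at)
 show ?thesis
  by (rule mixed_derivatives_commute[of UNIV x f "%y v. dd v f y" v "%y w. dd w (dd v f) y" w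
     "%y v. dd v (dd w f) y", simplified])
   (use Ck_has_derivative[OF 2] Ck_has_derivative[OF 1] 0 in auto)
qed

lemma dd_linear_compose:
 assumes "bounded_linear L" "Ck (Suc k) f"
 shows "dd v (%y. L (f y)) x = L (dd v f x)"
 using dd_eq[OF bounded_linear.has_derivative[OF assms(1) Ck_has_derivative[OF assms(2)]]] .

lemma dd_commute:
 fixes f :: "'a::euclidean_space => 'b::euclidean_space"
 assumes "Ck 2 f"
 shows "dd w (dd v f) x = dd v (dd w f) x"
proof (rule euclidean_eqI)
 fix b :: 'b assume "b : Basis"
 have L: "bounded_linear (%y. y \<bullet> b)" by (rule bounded_linear_inner_left)
 have 2: "Ck (Suc (Suc 0)) f" using assms by (simp add: numeral_2_eq_2)
 have 1: "Ck (Suc 0) (dd u f)" for u by (rule Ck_dd[OF 2])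
 have "dd v (dd w f) x \<bullet> b = dd v (dd w (%y. f y \<bullet> b)) x" for v w
  using dd_linear_compose[OF L 1] dd_linear_compose[OF L 2] by simp
 then show "dd w (dd v f) x \<bullet> b = dd v (dd w f) x \<bullet> b"
  using dd_commute_real[of "%y. f y \<bullet> b"] Ck_inner[OF assms Ck_const] by simp
qed

section \<open>Transport equations\<close>

lemma onorm_scaleR_le: "norm c <= \<eta> ==> onorm (%k::real. k *R c) <= \<eta>"
 by (rule onorm_le) (simp add: mult.commute[of \<eta>] mult_left_mono)

text \<open>Travelling from \<open>x\<close> to \<open>y\<close> one coordinate at a time, each leg
  stays where its partial derivative differs from the value at \<open>x\<close> by at most
  \<open>ep / n\<close>; the \<open>n\<close> legs add up to the permitted error.\<close>

lemma has_derivative_from_partials: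
 fixes f :: "'a::euclidean_space => 'b::real_normed_vector"
 assumes S: "open S" "x : S"
  and f: "!!b y. b : Basis ==> y : S ==> ((%h. f (y + h *R b)) hvd f' b y) (at 0)"
  and cont: "!!b. b : Basis ==> isCont (f' b) x"
 shows "(f has_derivative (%v. \<Sum>b\<in>Basis. (v \<bullet> b) *R f' b x)) (at x)"
 unfolding has_derivative_at_alt
proof (intro conjI allI impI)
 show "bounded_linear (%v. \<Sum>b\<in>Basis. (v \<bullet> b) *R f' b x)"
  by (intro bounded_linear_sum bounded_linear_scaleR_left[THEN bounded_linear_compose] bounded_linear_inner_left)
next
 fix ep :: real assume "ep > 0"
 define n where "n = real (DIM('a))"
 have n: "n > 0" by (simp add: n_def)
 have "\<forall>b\<in>Basis. \<exists>d>0. \<forall>y. dist y x < d --> y : S \<and> dist (f' b y) (f' b x) <= ep / n"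
 proof
  fix b :: 'a assume b: "b : Basis"
  obtain d1 where "d1 > 0" "!!y. dist y x < d1 ==> dist (f' b y) (f' b x) < ep / n"
   using cont[OF b] \<open>ep > 0\<close> n unfolding continuous_at_eps_delta by (metis divide_pos_pos)
  moreover obtain d2 where "d2 > 0" "!!y. dist y x < d2 ==> y : S"
   using S unfolding open_dist by blast
  ultimately show "\<exists>d>0. \<forall>y. dist y x < d --> y : S \<and> dist (f' b y) (f' b x) <= ep / n"
   by (intro exI[of _ "min d1 d2"]) (auto intro: less_imp_le)
 qed
 then obtain d where d: "!!b. b : Basis ==> d b > 0"
  and dS: "!!b y. b : Basis ==> dist y x < d b ==> y : S \<and> dist (f' b y) (f' b x) <= ep / n"
  by metis
 define \<delta> where "\<delta> = Min (d ` Basis)"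
 have \<delta>: "\<delta> > 0" using d by (simp add: \<delta>_def)
 have \<delta>d: "\<delta> <= d b" if "b : Basis" for b using that by (simp add: \<delta>_def)
 show "\<exists>d>0. \<forall>y. norm (y - x) < d -->
   norm (f y - f x - (\<Sum>b\<in>Basis. ((y - x) \<bullet> b) *R f' b x)) <= ep * norm (y - x)"
 proof (intro exI[of _ "\<delta> / n"] conjI allI impI)
  show "\<delta> / n > 0" using \<delta> n by simp
  fix y assume y: "norm (y - x) < \<delta> / n"
  define v where "v = y - x"
  have nv: "n * norm v < \<delta>" using y n by (simp add: v_def field_simps)
  \<comment> \<open>Induction on the set \<open>B\<close> of coordinates already moved;
    \<open>B = Basis\<close> is the claim.\<close>
  have "norm (f (x + (\<Sum>b\<in>B. (v \<bullet> b) *R b)) - f x - (\<Sum>b\<in>B. (v \<bullet> b) *R f' b x))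
    <= card B * (ep / n * norm v)" if "B \<subseteq> Basis" for B
   using finite_subset[OF that finite_Basis] that
  proof (induction B rule: finite_induct)
   case (insert b B)
   then have b: "b : Basis" by auto
   define s where "s = x + (\<Sum>b\<in>B. (v \<bullet> b) *R b)"
   have near: "dist (s + th *R b) x < \<delta>" if "th : closed_segment 0 (v \<bullet> b)" for th
   proof -
    have th: "\<bar>th\<bar> <= \<bar>v \<bullet> b\<bar>"
     using that by (auto simp: closed_segment_eq_real_ivl split: if_splits)
    have "dist (s + th *R b) x = norm ((\<Sum>b\<in>B. (v \<bullet> b) *R b) + th *R b)"
     by (simp add: s_def dist_norm algebra_simps)
    also have "... <= (\<Sum>b\<in>B. norm ((v \<bullet> b) *R b)) + norm (th *R b)"
     by (intro order_trans[OF norm_triangle_ineq] add_mono norm_sum order_refl)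
    also have "... <= (\<Sum>b\<in>B. norm v) + norm v"
     using insert.prems b th
     by (intro add_mono sum_mono) (auto intro: Basis_le_norm order_trans[OF _ Basis_le_norm] simp: subset_iff)
    also have "... = card (insert b B) * norm v"
     using insert.hyps by (simp add: algebra_simps)
    also have "... <= n * norm v"
     using insert.prems insert.hyps unfolding n_def
     by (intro mult_right_mono of_nat_mono card_mono) auto
    finally show ?thesis using nv by simp
   qed
   \<comment> \<open>With the linear part subtracted, the derivative is the oscillation of
     \<open>f' b\<close>, which the mean value inequality turns into the error of this leg.\<close>
   let ?\<psi> = "%th. f (s + th *R b) - th *R f' b x"
   have "norm (?\<psi> (v \<bullet> b) - ?\<psi> 0) <= ep / n * norm (v \<bullet> b - 0)"
   proof (rule differentiable_bound[of "closed_segment 0 (v \<bullet> b)" ?\<psi> "%th h. h *R (f' b (s + th *R b) - f' b x)"])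
    fix th assume th: "th : closed_segment 0 (v \<bullet> b)"
    have "((%h. f ((s + th *R b) + h *R b)) hvd f' b (s + th *R b)) (at (th - th))"
     using f[OF b] dS[OF b] near[OF th] \<delta>d[OF b] by force
    moreover have "((%h. h - th) hvd 1) (at th)"
     by (auto intro!: derivative_eq_intros)
    ultimately have "((%h. f (s + h *R b)) hvd f' b (s + th *R b)) (at th)"
     using vector_diff_chain_at[of "%h. h - th" 1 th] by (fastforce simp: o_def algebra_simps)
    then have "(?\<psi> hvd f' b (s + th *R b) - f' b x) (at th)"
     by (intro has_vector_derivative_diff) (auto intro!: derivative_eq_intros)
    then show "(?\<psi> has_derivative (%h. h *R (f' b (s + th *R b) - f' b x)))
      (at th within closed_segment 0 (v \<bullet> b))"
     unfolding has_vector_derivative_def by (rule has_derivative_at_withinI)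
    have "norm (f' b (s + th *R b) - f' b x) <= ep / n"
     using dS[OF b] near[OF th] \<delta>d[OF b] by (force simp: dist_norm)
    then show "onorm (%h. h *R (f' b (s + th *R b) - f' b x)) <= ep / n"
     by (rule onorm_scaleR_le)
   qed auto
   also have "... <= ep / n * norm v"
    using \<open>ep > 0\<close> n Basis_le_norm[OF b, of v] by (intro mult_left_mono) auto
   finally have *: "norm (?\<psi> (v \<bullet> b) - ?\<psi> 0) <= ep / n * norm v" .
   have "f (x + (\<Sum>b\<in>insert b B. (v \<bullet> b) *R b)) - f x - (\<Sum>b\<in>insert b B. (v \<bullet> b) *R f' b x)
     = (?\<psi> (v \<bullet> b) - ?\<psi> 0) + (f s - f x - (\<Sum>b\<in>B. (v \<bullet> b) *R f' b x))"
    using insert.hyps by (simp add: s_def algebra_simps)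
   also have "norm ... <= ep / n * norm v + card B * (ep / n * norm v)"
    using insert * by (intro order_trans[OF norm_triangle_ineq] add_mono) (auto simp: s_def)
   also have "... = card (insert b B) * (ep / n * norm v)"
    using insert.hyps by (simp add: algebra_simps add_divide_distrib)
   finally show ?case .
  qed simp
  from this[OF order_refl] show "norm (f y - f x - (\<Sum>b\<in>Basis. ((y - x) \<bullet> b) *R f' b x)) <= ep * norm (y - x)"
   using n by (simp add: v_def euclidean_representation n_def[symmetric])
 qed
qed

lemma Ck_1_dd_continuous:
 assumes "Ck 1 f"
 shows "continuous_on S (%(q, v). dd v f q)"
proof -
 have 1: "Ck (Suc 0) f" using assms by simp
 have "continuous_on S (%p. \<Sum>b\<in>Basis. (snd p \<bullet> b) *R dd b f (fst p))"
  by (intro continuous_intros continuous_on_compose2[OF Ck_continuous[OF Ck_dd[OF 1], of UNIV]]) auto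
 then show ?thesis
  by (simp add: dd_eq_sum_Basis[OF 1, symmetric] case_prod_unfold)
qed

text \<open>Uniformity in pairs of point and direction is essential: in the differentiation of
  solutions the direction contains the candidate derivative and varies with the point. It comes from
  uniform continuity of \<open>dd v f (q + h *R v)\<close> on a compact set.\<close>

lemma difference_quotient_uniform:
 fixes f :: "'a::euclidean_space => 'b::real_normed_vector"
 assumes f: "Ck 1 f" and C: "compact C" and \<eta>: "\<eta> > 0"
 shows "\<exists>h0>0. \<forall>h. 0 < \<bar>h\<bar> --> \<bar>h\<bar> < h0 -->
  (\<forall>(q, v)\<in>C. norm ((1 / h) *R (f (q + h *R v) - f q) - dd v f q) <= \<eta>)"
proof -
 have 1: "Ck (Suc 0) f" using f by simp
 let ?\<phi> = "%((q, v), h). dd v f (q + h *R v)"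
 have "continuous_on (C \<times> {-1..1}) (%p. (%(q, v). dd v f q) (fst (fst p) + snd p *R snd (fst p), snd (fst p)))"
  by (intro continuous_on_compose2[OF Ck_1_dd_continuous[OF f, of UNIV]] continuous_intros) auto
 then have "continuous_on (C \<times> {-1..1}) ?\<phi>"
  by (simp add: case_prod_unfold)
 moreover have "compact (C \<times> {-1..1::real})"
  using C by (intro compact_Times) auto
 ultimately have "uniformly_continuous_on (C \<times> {-1..1}) ?\<phi>"
  by (intro compact_uniformly_continuous)
 then obtain d where d: "d > 0"
  "!!p p'. p : C \<times> {-1..1} ==> p' : C \<times> {-1..1} ==> dist p' p < d ==> dist (?\<phi> p') (?\<phi> p) < \<eta>"
  using \<eta> unfolding uniformly_continuous_on_def by blast
 show ?thesis
 proof (intro exI[of _ "min d 1"] conjI allI impI ballI, safe)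
  show "min d 1 > 0" using d by simp
  fix h :: real and q v assume h: "0 < \<bar>h\<bar>" "\<bar>h\<bar> < min d 1" and C: "(q, v) : C"
  let ?\<psi> = "%th. f (q + th *R v) - th *R dd v f q"
  have "norm (?\<psi> h - ?\<psi> 0) <= \<eta> * norm (h - 0)"
  proof (rule differentiable_bound[of "closed_segment 0 h" ?\<psi> "%th k. k *R (dd v f (q + th *R v) - dd v f q)"])
   fix th assume "th : closed_segment 0 h"
   then have th: "\<bar>th\<bar> <= \<bar>h\<bar>"
    by (auto simp: closed_segment_eq_real_ivl split: if_splits)
   have "(?\<psi> hvd dd v f (q + th *R v) - dd v f q) (at th)"
    by (intro has_vector_derivative_diff dd_along_line[OF 1]) (auto intro!: derivative_eq_intros)
   then show "(?\<psi> has_derivative (%k. k *R (dd v f (q + th *R v) - dd v f q))) (at th within closed_segment 0 h)"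
    unfolding has_vector_derivative_def by (rule has_derivative_at_withinI)
   have "dist (?\<phi> ((q, v), th)) (?\<phi> ((q, v), 0)) < \<eta>"
    using C th h by (intro d(2)) (auto simp: dist_Pair_Pair)
   then have "norm (dd v f (q + th *R v) - dd v f q) <= \<eta>"
    by (simp add: dist_norm)
   then show "onorm (%k. k *R (dd v f (q + th *R v) - dd v f q)) <= \<eta>"
    by (rule onorm_scaleR_le)
  qed auto
  moreover have "(1 / h) *R (f (q + h *R v) - f q) - dd v f q = (1 / h) *R (?\<psi> h - ?\<psi> 0)"
   using h by (simp add: algebra_simps)
  ultimately show "norm ((1 / h) *R (f (q + h *R v) - f q) - dd v f q) <= \<eta>"
   using h by (simp add: pos_divide_le_eq)
 qed
qed

section \<open>Mild solutions of semilinear transport systems\<close>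

locale transport =
 fixes P Q :: "'a::euclidean_space => 'a" and e :: "'z::euclidean_space"
 assumes P: "bounded_linear P" and Q: "bounded_linear Q"
  and norm_P: "norm (P y) <= norm y" and norm_Q: "norm (Q y) <= norm y"
  and proj [simp]: "P (P y) = P y" "P (Q y) = 0" "Q (P y) = 0" "Q (Q y) = Q y"
  and PQ: "P y + Q y = y" and norm_e: "norm e <= 1"
begin

definition free :: "('z => 'a) => real \<times> 'z => 'a" where
 "free V0 = (%(t, zt). P (V0 (zt + t *R e)) + Q (V0 (zt - t *R e)))"

definition ray :: "(real \<times> 'z => 'a) => real \<times> 'z => real => 'a" where
 "ray g = (%(t, zt) sg. t *R (P (g (t * sg, zt + (t * (1 - sg)) *R e)) + Q (g (t * sg, zt - (t * (1 - sg)) *R e))))"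

definition duh :: "(real \<times> 'z => 'a) => real \<times> 'z => 'a" where
 "duh g p = integral {0..1} (ray g p)"

text \<open>The integral equation of \<open>\<partial>\<^sub>t V = \<partial>\<^sub>e (P V - Q V) + g\<close> with data \<open>V0\<close> at time \<open>0\<close>; the time
 integral is scaled to the unit interval so that negative times need no separate treatment.\<close>

definition mild :: "('z => 'a) => (real \<times> 'z => 'a) => (real \<times> 'z => 'a) => bool" where
 "mild V0 g V \<longleftrightarrow> (\<forall>p. V p = free V0 p + duh g p)"

end

text \<open>A two-sided domain of dependence. Rays of speed at most 1 issuing from its points
  towards time 0 stay inside, so every estimate can be made on one compact set.\<close>

definition diamond :: "'z::real_normed_vector => real => (real \<times> 'z) set" where
 "diamond zt0 R = {p. \<bar>fst p\<bar> + norm (snd p - zt0) <= R}"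

lemma diamond_time: "p : diamond zt0 R ==> \<bar>fst p\<bar> <= R"
 using norm_ge_zero[of "snd p - zt0"] unfolding diamond_def mem_Collect_eq by linarith

lemma compact_diamond: "compact (diamond (zt0 :: 'z::euclidean_space) R)"
proof (rule compact_eq_bounded_closed[THEN iffD2], rule conjI)
 show "bounded (diamond zt0 R)"
  by (rule bounded_subset[of "{-R..R} \<times> cball zt0 R"])
   (auto simp: diamond_def dist_norm norm_minus_commute intro!: bounded_Times,
    (smt (verit) norm_ge_zero)+)
 show "closed (diamond zt0 R)"
  unfolding diamond_def by (intro closed_Collect_le continuous_intros)
qed

lemma continuous_bounded_on_diamond:
 fixes f :: "real \<times> 'z::euclidean_space => 'b::real_normed_vector"
 assumes "continuous_on UNIV f"
 obtains B where "B > 0" "!!p. p : diamond zt0 R ==> norm (f p) <= B"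
proof -
 have "bounded (f ` diamond zt0 R)"
  by (intro compact_imp_bounded compact_continuous_image compact_diamond continuous_on_subset[OF assms]) auto
 then show ?thesis
  using that unfolding bounded_pos by auto
qed

context transport
begin

lemma ray_diamond:
 assumes "(t, zt) : diamond zt0 R" "0 <= sg" "sg <= 1"
 shows "(t * sg, zt + (t * (1 - sg)) *R e) : diamond zt0 R" "(t * sg, zt - (t * (1 - sg)) *R e) : diamond zt0 R"
proof -
 have "norm ((t * (1 - sg)) *R e) <= \<bar>t\<bar> * (1 - sg) * 1"
  using assms norm_e by (simp add: abs_mult mult_left_le)
 moreover have "\<bar>t * sg\<bar> + \<bar>t\<bar> * (1 - sg) = \<bar>t\<bar>"
  using assms by (simp add: abs_mult algebra_simps)
 moreover have "norm (zt + (t * (1 - sg)) *R e - zt0) <= norm (zt - zt0) + norm ((t * (1 - sg)) *R e)"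
  using norm_triangle_ineq[of "zt - zt0" "(t * (1 - sg)) *R e"] by (simp add: algebra_simps)
 moreover have "norm (zt - (t * (1 - sg)) *R e - zt0) <= norm (zt - zt0) + norm ((t * (1 - sg)) *R e)"
  using norm_triangle_ineq4[of "zt - zt0" "(t * (1 - sg)) *R e"] by (simp add: algebra_simps)
 ultimately show "(t * sg, zt + (t * (1 - sg)) *R e) : diamond zt0 R" "(t * sg, zt - (t * (1 - sg)) *R e) : diamond zt0 R"
  using assms by (auto simp: diamond_def)
qed

lemmas continuous_on_P [continuous_intros] = bounded_linear.continuous_on[OF P]
lemmas continuous_on_Q [continuous_intros] = bounded_linear.continuous_on[OF Q]

lemma continuous_ray:
 assumes "continuous_on UNIV g"
 shows "continuous_on S (%(p, sg). ray g p sg)"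
 unfolding ray_def case_prod_unfold
 by (intro continuous_intros continuous_on_compose2[OF assms]) auto

lemma ray_integrable:
 assumes "continuous_on UNIV g"
 shows "ray g p integrable_on {0..1}"
proof (rule integrable_continuous_real)
 show "continuous_on {0..1} (ray g p)"
  using continuous_on_compose2[OF continuous_ray[OF assms, of UNIV], of "{0..1}" "%sg. (p, sg)"]
  by (simp add: continuous_on_Pair continuous_on_const continuous_on_id)
qed

lemma continuous_duh:
 assumes "continuous_on UNIV g"
 shows "continuous_on UNIV (duh g)"
 using integral_continuous_on_param[of UNIV 0 1 "ray g"] continuous_ray[OF assms]
 unfolding duh_def by simp

lemma continuous_free:
 assumes "continuous_on UNIV V0"
 shows "continuous_on UNIV (free V0)"
 unfolding free_def case_prod_unfold
 by (intro continuous_intros continuous_on_compose2[OF assms]) auto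

lemma duh_diff:
 assumes "continuous_on UNIV g" "continuous_on UNIV h"
 shows "duh (%q. g q - h q) p = duh g p - duh h p"
proof -
 have "ray (%q. g q - h q) p = (%sg. ray g p sg - ray h p sg)"
  by (auto simp: ray_def case_prod_unfold bounded_linear.linear[OF P] bounded_linear.linear[OF Q]
    linear_diff algebra_simps)
 then show ?thesis
  unfolding duh_def using ray_integrable assms by (simp add: integral_diff)
qed

lemma duh_scaleR:
 assumes "continuous_on UNIV g"
 shows "duh (%q. c *R g q) p = c *R duh g p"
proof -
 have "ray (%q. c *R g q) p = (%sg. c *R ray g p sg)"
  by (auto simp: ray_def case_prod_unfold bounded_linear.linear[OF P] bounded_linear.linear[OF Q]
    linear_cmul algebra_simps)
 then show ?thesis
  unfolding duh_def by simp
qed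

text \<open>The majorant enters through an antiderivative \<open>H\<close>, so that one lemma serves
  the powers of the Picard iteration and the exponentials of Gronwall's argument. The factor 2
  arises because the \<open>P\<close> and \<open>Q\<close> parts are bounded separately.\<close>

lemma duh_norm_le:
 assumes g: "continuous_on UNIV g" and p: "(t, zt) : diamond zt0 R"
  and h: "!!s \<xi>. (s, \<xi>) : diamond zt0 R ==> norm (g (s, \<xi>)) <= h \<bar>s\<bar>"
  and H: "!!s. (H hrd h s) (at s)"
 shows "norm (duh g (t, zt)) <= 2 * (H \<bar>t\<bar> - H 0)"
proof -
 have "((%sg. 2 * (\<bar>t\<bar> * h (\<bar>t\<bar> * sg))) has_integral (2 * H (\<bar>t\<bar> * 1) - 2 * H (\<bar>t\<bar> * 0))) {0..1}"
 proof (rule fundamental_theorem_of_calculus)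
  fix sg :: real
  have "((%sg. 2 * H (\<bar>t\<bar> * sg)) hrd 2 * (h (\<bar>t\<bar> * sg) * \<bar>t\<bar>)) (at sg)"
   by (intro DERIV_cmult DERIV_chain2[OF H]) (auto intro!: derivative_eq_intros)
  then show "((%sg. 2 * H (\<bar>t\<bar> * sg)) hvd 2 * (\<bar>t\<bar> * h (\<bar>t\<bar> * sg))) (at sg within {0..1})"
   by (auto simp: has_real_derivative_iff_has_vector_derivative mult_ac intro: has_vector_derivative_at_within)
 qed simp
 moreover have "norm (ray g (t, zt) sg) <= 2 * (\<bar>t\<bar> * h (\<bar>t\<bar> * sg))" if sg: "sg : {0..1}" for sg
 proof -
  have "\<bar>t * sg\<bar> = \<bar>t\<bar> * sg" using sg by (simp add: abs_mult)
  then have "norm (P (g (t * sg, zt + (t * (1 - sg)) *R e)) + Q (g (t * sg, zt - (t * (1 - sg)) *R e)))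
    <= h (\<bar>t\<bar> * sg) + h (\<bar>t\<bar> * sg)"
   using h[OF ray_diamond(1)[OF p]] h[OF ray_diamond(2)[OF p]] sg
   by (intro order_trans[OF norm_triangle_ineq] add_mono order_trans[OF norm_P] order_trans[OF norm_Q]) force+
  from mult_left_mono[OF this, of "\<bar>t\<bar>"] show ?thesis
   by (simp add: ray_def)
 qed
 ultimately have "norm (integral {0..1} (ray g (t, zt))) <= 2 * H (\<bar>t\<bar> * 1) - 2 * H (\<bar>t\<bar> * 0)"
  using integral_norm_bound_integral[OF ray_integrable[OF g] has_integral_integrable] by (metis integral_unique)
 then show ?thesis
  by (simp add: duh_def)
qed

text \<open>The maximum of exp (- lm |t|) |V| over the compact diamond is compared with itself: for
  \<open>lm = 4 * L + 1\<close> the Duhamel term returns at most half of it, which is absorbed. No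
  differentiability of \<open>V\<close> is involved.\<close>

lemma gronwall:
 assumes V: "continuous_on UNIV V" and g: "continuous_on UNIV g" and R: "R >= 0" and L: "L >= 0" and \<eta>: "\<eta> >= 0"
  and eq: "!!p. p : diamond zt0 R ==> V p = A p + duh g p"
  and A: "!!p. p : diamond zt0 R ==> norm (A p) <= \<delta>"
  and gV: "!!p. p : diamond zt0 R ==> norm (g p) <= \<eta> + L * norm (V p)"
  and p: "p : diamond zt0 R"
 shows "norm (V p) <= 2 * (\<delta> + 2 * \<eta> * R) * exp ((4 * L + 1) * R)"
proof -
 define lm where "lm = 4 * L + 1"
 have lm: "lm > 0" "lm ~= 0" "2 * L <= lm / 2" using L by (auto simp: lm_def)
 let ?f = "%p. exp (- lm * \<bar>fst p\<bar>) * norm (V p)"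
 have "continuous_on (diamond zt0 R) ?f"
  by (intro continuous_intros continuous_on_subset[OF V]) auto
 from continuous_attains_sup[OF compact_diamond _ this] p
 obtain q where q: "q : diamond zt0 R" and max: "!!p. p : diamond zt0 R ==> ?f p <= ?f q" by blast
 define S where "S = ?f q"
 have S: "S >= 0" by (simp add: S_def)
 have VS: "norm (V p) <= S * exp (lm * \<bar>fst p\<bar>)" if "p : diamond zt0 R" for p
  using max[OF that] unfolding S_def[symmetric] by (simp add: exp_minus field_simps)
 obtain t zt where tz: "q = (t, zt)" by fastforce
 have t: "\<bar>t\<bar> <= R" using diamond_time[OF q] by (simp add: tz)
 have "norm (duh g q) <= 2 * ((\<eta> * \<bar>t\<bar> + L * S / lm * exp (lm * \<bar>t\<bar>)) - (\<eta> * 0 + L * S / lm * exp (lm * 0)))"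
  unfolding tz
 proof (rule duh_norm_le[OF g q[unfolded tz], where h="%s. \<eta> + L * S * exp (lm * s)"])
  fix s \<xi> assume s: "(s, \<xi>) : diamond zt0 R"
  show "norm (g (s, \<xi>)) <= \<eta> + L * S * exp (lm * \<bar>s\<bar>)"
   using gV[OF s] mult_left_mono[OF VS[OF s] L] by simp
 next
  show "((%s. \<eta> * s + L * S / lm * exp (lm * s)) hrd \<eta> + L * S * exp (lm * s)) (at s)" for s
   using lm by (auto intro!: derivative_eq_intros)
 qed
 also have "... <= 2 * \<eta> * R + 2 * L * (S / lm * exp (lm * \<bar>t\<bar>))"
 proof -
  have "2 * (\<eta> * \<bar>t\<bar>) <= 2 * (\<eta> * R)" using mult_left_mono[OF t \<eta>] by simp
  moreover have "0 <= 2 * (L * S / lm)" using L S lm by simp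
  ultimately show ?thesis by (simp add: algebra_simps)
 qed
 also have "2 * L * (S / lm * exp (lm * \<bar>t\<bar>)) <= lm / 2 * (S / lm * exp (lm * \<bar>t\<bar>))"
  using lm S by (intro mult_right_mono) auto
 also have "... = S / 2 * exp (lm * \<bar>t\<bar>)" using lm by simp
 finally have "norm (V q) <= (\<delta> + 2 * \<eta> * R) + S / 2 * exp (lm * \<bar>t\<bar>)"
  using eq[OF q] A[OF q] norm_triangle_ineq[of "A q" "duh g q"] by simp
 then have "exp (- lm * \<bar>t\<bar>) * norm (V q) <= exp (- lm * \<bar>t\<bar>) * (\<delta> + 2 * \<eta> * R + S / 2 * exp (lm * \<bar>t\<bar>))"
  by (intro mult_left_mono) auto
 then have "S <= exp (- lm * \<bar>t\<bar>) * (\<delta> + 2 * \<eta> * R) + S / 2"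
  unfolding S_def by (simp add: tz exp_minus field_simps)
 moreover have "\<delta> + 2 * \<eta> * R >= 0"
  using A[OF q] norm_ge_zero[of "A q"] R \<eta> by (intro add_nonneg_nonneg mult_nonneg_nonneg) linarith+
 then have "exp (- lm * \<bar>t\<bar>) * (\<delta> + 2 * \<eta> * R) <= 1 * (\<delta> + 2 * \<eta> * R)"
  using lm by (intro mult_right_mono) auto
 ultimately have S2: "S <= 2 * (\<delta> + 2 * \<eta> * R)" by simp
 have "\<bar>fst p\<bar> <= R" by (rule diamond_time[OF p])
 then have "S * exp (lm * \<bar>fst p\<bar>) <= 2 * (\<delta> + 2 * \<eta> * R) * exp (lm * R)"
  using S S2 lm by (intro mult_mono) auto
 then show ?thesis using VS[OF p] by (simp add: lm_def)
qed

text \<open>Global in the unknown but only local in the point. This is the condition that survives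
  linearisation at a continuous solution, whose coefficients need not be bounded on the whole space,
  and it still gives solutions for all times.\<close>

definition lip :: "((real \<times> 'z) \<times> 'a => 'a) => bool" where
 "lip G \<longleftrightarrow> (\<forall>R. \<exists>L\<ge>0. \<forall>p\<in>diamond 0 R. \<forall>y y'. norm (G (p, y) - G (p, y')) <= L * norm (y - y'))"

text \<open>Picard iteration on each diamond. Every iteration integrates once more in time, so the
  increments carry \<open>1 / fact n\<close> and their sum converges for every \<open>R\<close>
  without any smallness of the time interval.\<close>

lemma mild_exists:
 assumes G: "continuous_on UNIV G" "lip G" and V0: "continuous_on UNIV V0"
 obtains V where "continuous_on UNIV V" "mild V0 (%p. G (p, V p)) V"
proof -
 define it where "it = rec_nat (free V0) (%_ V p. free V0 p + duh (%q. G (q, V q)) p)"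
 have it_0: "it 0 = free V0" and it_Suc: "it (Suc n) = (%p. free V0 p + duh (%q. G (q, it n q)) p)" for n
  by (simp_all add: it_def)
 have cG: "continuous_on UNIV (%q. G (q, V q))" if "continuous_on UNIV V" for V
  by (intro continuous_on_compose2[OF G(1)] continuous_intros that) auto
 have cit: "continuous_on UNIV (it n)" for n
 proof (induction n)
  case (Suc n)
  then show ?case unfolding it_Suc
   by (intro continuous_intros continuous_free V0 continuous_duh cG)
 qed (simp add: it_0 continuous_free V0)
 \<comment> \<open>As a telescoping series the limit is accessible to the Weierstrass test, on all
   diamonds simultaneously.\<close>
 define V where "V p = it 0 p + (\<Sum>n. it (Suc n) p - it n p)" for p
 have lim: "uniform_limit (diamond 0 R) it V sequentially" for R
 proof -
  obtain L where L: "L >= 0" "!!p y y'. p : diamond 0 R ==> norm (G (p, y) - G (p, y')) <= L * norm (y - y')"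
   using G(2) unfolding lip_def by meson
  have "continuous_on UNIV (%p. it (Suc 0) p - it 0 p)"
   by (intro continuous_intros cit)
  then obtain C where C: "C > 0" "!!p. p : diamond 0 R ==> norm (it (Suc 0) p - it 0 p) <= C"
   using continuous_bounded_on_diamond by blast
  have step: "norm (it (Suc n) (t, zt) - it n (t, zt)) <= C * (2 * L) ^ n * \<bar>t\<bar> ^ n / fact n"
   if "(t, zt) : diamond 0 R" for n t zt
   using that
  proof (induction n arbitrary: t zt)
   case 0
   then show ?case using C by simp
  next
   case (Suc n)
   have "it (Suc (Suc n)) (t, zt) - it (Suc n) (t, zt) = duh (%q. G (q, it (Suc n) q) - G (q, it n q)) (t, zt)"
    unfolding it_Suc[of "Suc n"] it_Suc[of n]
    using duh_diff[OF cG[OF cit[of "Suc n"]] cG[OF cit[of n]]] by (simp add: it_Suc)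
   also have "norm ... <= 2 * (L * (C * (2 * L) ^ n / fact n) * \<bar>t\<bar> ^ Suc n / real (Suc n)
     - L * (C * (2 * L) ^ n / fact n) * 0 ^ Suc n / real (Suc n))"
   proof (rule duh_norm_le[OF _ Suc.prems, where h="%s. L * (C * (2 * L) ^ n / fact n) * s ^ n"])
    show "continuous_on UNIV (%q. G (q, it (Suc n) q) - G (q, it n q))"
     by (intro continuous_on_diff cG cit)
    fix s and \<xi> :: 'z assume s: "(s, \<xi>) : diamond 0 R"
    have "norm (G ((s, \<xi>), it (Suc n) (s, \<xi>)) - G ((s, \<xi>), it n (s, \<xi>))) <= L * norm (it (Suc n) (s, \<xi>) - it n (s, \<xi>))"
     by (rule L(2)[OF s])
    also have "... <= L * (C * (2 * L) ^ n * \<bar>s\<bar> ^ n / fact n)"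
     by (intro mult_left_mono Suc.IH s L)
    finally show "norm (G ((s, \<xi>), it (Suc n) (s, \<xi>)) - G ((s, \<xi>), it n (s, \<xi>)))
      <= L * (C * (2 * L) ^ n / fact n) * \<bar>s\<bar> ^ n" by simp
   next
    fix s :: real
    have "((%s. L * (C * (2 * L) ^ n / fact n) / real (Suc n) * s ^ Suc n) has_real_derivative
      L * (C * (2 * L) ^ n / fact n) / real (Suc n) * (real (Suc n) * s ^ n)) (at s)"
     using DERIV_pow[of "Suc n" s] by (intro DERIV_cmult) simp
    then show "((%s. L * (C * (2 * L) ^ n / fact n) * s ^ Suc n / real (Suc n)) has_real_derivative
      L * (C * (2 * L) ^ n / fact n) * s ^ n) (at s)"
     by (simp add: mult.assoc del: of_nat_Suc power_Suc)
   qed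
   also have "... = C * (2 * L) ^ Suc n * \<bar>t\<bar> ^ Suc n / fact (Suc n)"
    by (simp add: field_simps)
   finally show ?case .
  qed
  have "uniform_limit (diamond 0 R) (%n p. \<Sum>i<n. it (Suc i) p - it i p)
    (%p. \<Sum>n. it (Suc n) p - it n p) sequentially"
  proof (rule Weierstrass_m_test[where M="%n. C * ((2 * L * R) ^ n / fact n)"])
   fix n and p :: "real \<times> 'z" assume p: "p : diamond 0 R"
   then have t: "\<bar>fst p\<bar> <= R" by (rule diamond_time)
   have "norm (it (Suc n) p - it n p) <= C * (2 * L) ^ n * \<bar>fst p\<bar> ^ n / fact n"
    using step[of "fst p" "snd p" n] p by simp
   also have "... <= C * (2 * L) ^ n * R ^ n / fact n"
    using t C L by (intro divide_right_mono mult_left_mono power_mono) auto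
   finally show "norm (it (Suc n) p - it n p) <= C * ((2 * L * R) ^ n / fact n)"
    by (simp add: power_mult_distrib)
  next
   show "summable (%n. C * ((2 * L * R) ^ n / fact n))"
    using summable_exp[of "2 * L * R"] by (intro summable_mult) (simp add: field_simps)
  qed
  then have "uniform_limit (diamond 0 R) (%n p. it 0 p + (\<Sum>i<n. it (Suc i) p - it i p)) V sequentially"
   unfolding V_def by (intro uniform_limit_add) (auto intro: uniform_limit_const)
  then show ?thesis
   by (subst (asm) sum_lessThan_telescope) simp
 qed
 have cV: "continuous_on UNIV V"
 proof (rule continuous_at_imp_continuous_on, rule ballI)
  fix p :: "real \<times> 'z"
  let ?R = "\<bar>fst p\<bar> + norm (snd p) + 1"
  let ?O = "{q :: real \<times> 'z. \<bar>fst q\<bar> + norm (snd q) < ?R}"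
  have "continuous_on (diamond 0 ?R) V"
   by (rule uniform_limit_theorem[OF _ lim]) (auto intro!: always_eventually continuous_on_subset[OF cit])
  then have "continuous_on ?O V"
   by (rule continuous_on_subset) (auto simp: diamond_def)
  moreover have "open ?O" by (intro open_Collect_less continuous_intros)
  moreover have "p : ?O" by simp
  ultimately show "isCont V p" using continuous_on_eq_continuous_at by blast
 qed
 have "V p = free V0 p + duh (%q. G (q, V q)) p" for p
 proof -
  define R where "R = \<bar>fst p\<bar> + norm (snd p)"
  have p: "p : diamond 0 R" by (simp add: R_def diamond_def)
  obtain L where L: "L >= 0" "!!p y y'. p : diamond 0 R ==> norm (G (p, y) - G (p, y')) <= L * norm (y - y')"
   using G(2) unfolding lip_def by meson
  have "(%n. duh (%q. G (q, it n q)) p) \<longlonglongrightarrow> duh (%q. G (q, V q)) p"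
  proof (rule LIMSEQ_I)
   fix r :: real assume "r > 0"
   define c where "c = r / (2 * L * R + 1) / 2"
   have R: "R >= 0" by (simp add: R_def)
   have den: "2 * L * R + 1 > 0" using L R by (simp add: add_nonneg_pos)
   have c: "c > 0" using \<open>r > 0\<close> den by (simp add: c_def)
   obtain N where N: "!!n q. n >= N ==> q : diamond 0 R ==> dist (it n q) (V q) < c"
    using lim[of R] c unfolding uniform_limit_sequentially_iff by blast
   show "\<exists>N. \<forall>n\<ge>N. norm (duh (%q. G (q, it n q)) p - duh (%q. G (q, V q)) p) < r"
   proof (intro exI[of _ N] allI impI)
    fix n assume n: "n >= N"
    have "duh (%q. G (q, it n q)) p - duh (%q. G (q, V q)) p = duh (%q. G (q, it n q) - G (q, V q)) (fst p, snd p)"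
     by (simp add: duh_diff cG cit cV)
    also have "norm ... <= 2 * (L * c * \<bar>fst p\<bar> - L * c * 0)"
     using p
    proof (intro duh_norm_le[where h="%s. L * c" and H="%s. L * c * s" and R=R])
     show "continuous_on UNIV (%q. G (q, it n q) - G (q, V q))"
      by (intro continuous_on_diff cG cit cV)
     show "norm (G ((s, \<xi>), it n (s, \<xi>)) - G ((s, \<xi>), V (s, \<xi>))) <= L * c"
      if s: "(s, \<xi>) : diamond 0 R" for s \<xi>
      using N[OF n s] by (intro order_trans[OF L(2)[OF s]] mult_left_mono L) (auto simp: dist_norm)
     show "((%s. L * c * s) hrd L * c) (at s)" for s
      by (auto intro!: derivative_eq_intros)
    qed simp
    also have "... <= (2 * L * R) * c"
     using L c mult_left_mono[of "\<bar>fst p\<bar>" R "2 * L * c"] by (auto simp: R_def algebra_simps)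
    also have "... <= (2 * L * R + 1) * c"
     using c by (intro mult_right_mono) auto
    also have "... = r / 2"
    proof -
     have "X * (r / X / 2) = r / 2" if "X > 0" for X :: real using that by simp
     from this[OF den] show ?thesis unfolding c_def .
    qed
    also have "... < r" using \<open>r > 0\<close> by simp
    finally show "norm (duh (%q. G (q, it n q)) p - duh (%q. G (q, V q)) p) < r" .
   qed
  qed
  then have "(%n. it (Suc n) p) \<longlonglongrightarrow> free V0 p + duh (%q. G (q, V q)) p"
   unfolding it_Suc by (intro tendsto_intros)
  moreover have "(%n. it (Suc n) p) \<longlonglongrightarrow> V p"
   using tendsto_uniform_limitI[OF lim p] by (rule LIMSEQ_Suc)
  ultimately show ?thesis by (rule LIMSEQ_unique[rotated])
 qed
 with cV that show ?thesis unfolding mild_def by blast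
qed


end

section \<open>Differentiability of mild solutions\<close>

lemma has_vector_derivative_from_quotient:
 assumes "((%h. (1 / h) *R (f h - f 0)) \<longlongrightarrow> D) (at 0)"
 shows "(f hvd D) (at 0)"
proof -
 have "((%h. norm ((1 / h) *R (f h - f 0) - D)) \<longlongrightarrow> 0) (at 0)"
  using assms by (intro tendsto_norm_zero LIM_zero)
 moreover have "norm ((1 / h) *R (f h - f 0) - D) = norm (f (0 + h) - f 0 - h *R D) / norm h" if "h ~= 0" for h
 proof -
  have "(1 / h) *R (f h - f 0) - D = (1 / h) *R (f h - f 0 - h *R D)"
   using that by (simp add: algebra_simps)
  then show ?thesis by simp
 qed
 ultimately have "((%h. norm (f (0 + h) - f 0 - h *R D) / norm h) \<longlongrightarrow> 0) (at 0)"
  by (elim Lim_transform_eventually) (auto simp: eventually_at_filter)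
 then show ?thesis
  by (simp add: has_vector_derivative_def has_derivative_at bounded_linear_scaleR_left)
qed

lemma scaled_integral_derivative:
 fixes k :: "real => 'b::banach"
 assumes k: "continuous_on UNIV k"
 shows "((%t. integral {0..1} (%sg. t *R k (t * sg))) hvd k t) (at t)"
proof -
 define T where "T = \<bar>t\<bar> + 1"
 obtain K where K: "!!s. s : {-T..T} ==> (K hvd k s) (at s within {-T..T})"
  using antiderivative_continuous[OF continuous_on_subset[OF k subset_UNIV], of "-T" T] by blast
 have "integral {0..1} (%sg. s *R k (s * sg)) = K s - K 0" if s: "s : {-T<..<T}" for s
 proof -
  have "((%sg. s *R k (s * sg)) has_integral (K (s * 1) - K (s * 0))) {0..1}"
  proof (rule fundamental_theorem_of_calculus)
   fix sg :: real assume sg: "sg : {0..1}"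
   then have "\<bar>s * sg\<bar> <= \<bar>s\<bar>" by (simp add: abs_mult mult_left_le)
   then have in_T: "s * sg : {-T<..<T}" using s by auto
   then have "(K hvd k (s * sg)) (at (s * sg))"
    using K[of "s * sg"] at_within_interior[of "s * sg" "{-T..T}"] by auto
   moreover have "((%sg. s * sg) hvd s) (at sg within {0..1})"
    by (auto intro!: derivative_eq_intros)
   ultimately show "((%sg. K (s * sg)) hvd s *R k (s * sg)) (at sg within {0..1})"
    using vector_diff_chain_within[of "%sg. s * sg" s sg "{0..1}" K "k (s * sg)"]
    by (simp add: o_def has_vector_derivative_at_within)
  qed simp
  from integral_unique[OF this] show ?thesis by simp
 qed
 moreover have "((%s. K s - K 0) hvd k t) (at t)"
 proof -
  have t: "t : {-T<..<T}" by (auto simp: T_def)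
  then have "(K hvd k t) (at t)"
   using K[of t] at_within_interior[of t "{-T..T}"] by auto
  then show ?thesis by (auto intro!: derivative_eq_intros)
 qed
 ultimately show ?thesis
  by (elim has_vector_derivative_transform_within_open[of _ _ _ "{-T<..<T}"]) (auto simp: T_def)
qed

lemma has_vector_derivative_shift:
 assumes "(g hvd D) (at (a + h))"
 shows "((%h. g (a + h)) hvd D) (at h)"
proof -
 have "((%h. a + h) has_derivative (%h. h)) (at h)"
  by (auto intro!: derivative_eq_intros)
 from has_derivative_compose[OF this] assms show ?thesis
  unfolding has_vector_derivative_def by blast
qed

lemma has_derivative_two_partials:
 fixes f :: "real * real => 'b::real_normed_vector"
 assumes "open S" "(s, r) : S"
  and f1: "!!s r. (s, r) : S ==> ((%s. f (s, r)) hvd f1 (s, r)) (at s)"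
  and f2: "!!s r. (s, r) : S ==> ((%r. f (s, r)) hvd f2 (s, r)) (at r)"
  and "isCont f1 (s, r)" "isCont f2 (s, r)"
 shows "(f has_derivative (%v. fst v *R f1 (s, r) + snd v *R f2 (s, r))) (at (s, r))"
proof -
 define f' where "f' b = (if b = (1, 0::real) then f1 else f2)" for b :: "real * real"
 have shift: "((%h. g (a + h)) hvd D) (at 0)" if "(g hvd D) (at a)"
  for g :: "real => 'b" and D a
  using has_vector_derivative_shift[of g D a 0] that by simp
 have B: "(Basis :: (real * real) set) = {(1, 0), (0, 1)}"
  by (auto simp: Basis_prod_def)
 have "(f has_derivative (%v. \<Sum>b\<in>Basis. (v \<bullet> b) *R f' b (s, r))) (at (s, r))"
 proof (rule has_derivative_from_partials[OF assms(1,2)])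
  fix b y :: "real * real" assume b: "b : Basis" and y: "y : S"
  obtain a c where ac: "y = (a, c)" by fastforce
  from b have "b = (1, 0) \<or> b = (0, 1)" by (simp add: B)
  then show "((%h. f (y + h *R b)) hvd f' b y) (at 0)"
   using shift[OF f1[of a c]] shift[OF f2[of a c]] y by (elim disjE) (simp_all add: ac f'_def)
 next
  show "isCont (f' b) (s, r)" for b
   using assms(5,6) by (simp add: f'_def)
 qed
 then show ?thesis
  by (simp add: B f'_def inner_prod_def)
qed

context transport
begin

lemma mild_translate:
 assumes "mild V0 g V"
 shows "V (t, zt + c) = free (%\<xi>. V0 (\<xi> + c)) (t, zt) + duh (%p. g (fst p, snd p + c)) (t, zt)"
 using assms unfolding mild_def free_def duh_def ray_def by (simp add: algebra_simps)

lemma free_diff: "free (%\<xi>. V0 \<xi> - W0 \<xi>) p = free V0 p - free W0 p"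
 by (simp add: free_def case_prod_unfold bounded_linear.linear[OF P] bounded_linear.linear[OF Q] linear_diff)

lemma free_scaleR: "free (%\<xi>. c *R V0 \<xi>) p = c *R free V0 p"
 by (simp add: free_def case_prod_unfold bounded_linear.linear[OF P] bounded_linear.linear[OF Q] linear_cmul
   algebra_simps)

lemma free_norm_le:
 assumes "p : diamond 0 R" "!!\<xi>. norm \<xi> <= R ==> norm (V0 \<xi>) <= \<delta>"
 shows "norm (free V0 p) <= 2 * \<delta>"
proof -
 obtain t zt where p: "p = (t, zt)" by fastforce
 have "norm (t *R e) <= \<bar>t\<bar>" using norm_e by (simp add: mult_left_le)
 then have "norm (zt + t *R e) <= R" "norm (zt - t *R e) <= R"
  using assms(1) norm_triangle_ineq[of zt "t *R e"] norm_triangle_ineq4[of zt "t *R e"]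
  by (auto simp: p diamond_def)
 then have "norm (P (V0 (zt + t *R e))) <= \<delta>" "norm (Q (V0 (zt - t *R e))) <= \<delta>"
  using assms(2) norm_P norm_Q order_trans by blast+
 then show ?thesis
  unfolding p free_def using norm_triangle_mono by fastforce
qed

text \<open>The difference quotient minus the candidate \<open>W\<close>, called \<open>X\<close>
  below, satisfies an integral equation with small data and a source bounded by a small number plus
  a multiple of \<open>X\<close>; Gronwall's inequality makes it small.\<close>

lemma mild_direction_derivative:
 assumes G: "Ck 1 G" "lip G" and V0: "Ck 1 V0"
  and V: "continuous_on UNIV V" "mild V0 (%p. G (p, V p)) V"
  and W: "continuous_on UNIV W" "mild (dd d V0) (%p. dd ((0, d), W p) G (p, V p)) W"
 shows "((%h. V (t, zt + h *R d)) hvd W (t, zt)) (at 0)"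
proof -
 have "((%h. (1 / h) *R (V (t, zt + h *R d) - V (t, zt))) \<longlongrightarrow> W (t, zt)) (at 0)"
  unfolding tendsto_iff
 proof (intro allI impI)
  fix r :: real assume r: "r > 0"
  define R where "R = \<bar>t\<bar> + norm zt"
  have R: "R >= 0" and p: "(t, zt) : diamond 0 R" by (auto simp: R_def diamond_def)
  obtain L where L: "L >= 0"
   "!!p y y'. p : diamond 0 (R + norm d) ==> norm (G (p, y) - G (p, y')) <= L * norm (y - y')"
   using G(2) unfolding lip_def by meson
  \<comment> \<open>The factor that Gronwall's inequality puts on \<eta> below, with free part at
    most 2\<eta> and source error \<eta>; thus \<open>K\<close> times \<eta> is
    \<open>r / 2\<close>.\<close>
  define K where "K = 2 * (2 + 2 * R) * exp ((4 * L + 1) * R)"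
  have K: "K > 0" using R by (simp add: K_def add_pos_nonneg)
  define \<eta> where "\<eta> = r / K / 2"
  have \<eta>: "\<eta> > 0" using r K by (simp add: \<eta>_def)
  have "compact ((%p. ((p, V p), ((0, d), W p))) ` diamond 0 R)"
   by (intro compact_continuous_image compact_diamond continuous_intros
     continuous_on_subset[OF V(1)] continuous_on_subset[OF W(1)]) auto
  from difference_quotient_uniform[OF G(1) this \<eta>]
  obtain h1 where h1: "h1 > 0" and G1: "!!h p. 0 < \<bar>h\<bar> ==> \<bar>h\<bar> < h1 ==> p : diamond 0 R ==>
    norm ((1 / h) *R (G ((p, V p) + h *R ((0, d), W p)) - G (p, V p)) - dd ((0, d), W p) G (p, V p)) <= \<eta>"
   unfolding ball_simps prod.case by blast
  have "compact (cball (0::'z) R \<times> {d})" by (intro compact_Times) auto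
  from difference_quotient_uniform[OF V0 this \<eta>]
  obtain h2 where h2: "h2 > 0" and V2: "!!h \<xi>. 0 < \<bar>h\<bar> ==> \<bar>h\<bar> < h2 ==> norm \<xi> <= R ==>
    norm ((1 / h) *R (V0 (\<xi> + h *R d) - V0 \<xi>) - dd d V0 \<xi>) <= \<eta>"
   unfolding mem_Times_iff Ball_def by (auto simp: dist_norm)
  have "dist ((1 / h) *R (V (t, zt + h *R d) - V (t, zt))) (W (t, zt)) < r"
   if h: "h ~= 0" "\<bar>h\<bar> < min 1 (min h1 h2)" for h
  proof -
   have h': "0 < \<bar>h\<bar>" "\<bar>h\<bar> < h1" "\<bar>h\<bar> < h2" using h by auto
   let ?s = "%p :: real \<times> 'z. (fst p, snd p + h *R d)"
   define X where "X p = (1 / h) *R (V (?s p) - V p) - W p" for p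
   define g where "g p = (1 / h) *R (G (?s p, V (?s p)) - G (p, V p)) - dd ((0, d), W p) G (p, V p)" for p
   have cG: "continuous_on UNIV (%p. G (p, V p))"
    by (intro continuous_on_compose2[OF Ck_continuous[OF G(1), of UNIV]] continuous_intros V) auto
   have cGs: "continuous_on UNIV (%p. G (?s p, V (?s p)))"
    by (intro continuous_on_compose2[OF cG] continuous_intros) auto
   have cW: "continuous_on UNIV (%p. dd ((0, d), W p) G (p, V p))"
    using continuous_on_compose2[OF Ck_1_dd_continuous[OF G(1), of UNIV], of UNIV "%p. ((p, V p), ((0, d), W p))"]
    by (simp add: continuous_on_Pair continuous_on_const continuous_on_id V(1) W(1))
   have cX: "continuous_on UNIV X"
    unfolding X_def by (intro continuous_intros continuous_on_compose2[OF V(1)] V(1) W(1)) auto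
   have cg: "continuous_on UNIV g"
    unfolding g_def by (intro continuous_intros cGs cG cW)
   have "norm (X (t, zt)) <= 2 * (2 * \<eta> + 2 * \<eta> * R) * exp ((4 * L + 1) * R)"
   proof (rule gronwall[OF cX cg R L(1) less_imp_le[OF \<eta>] _ _ _ p])
    fix p assume "p : diamond (0::'z) R"
    show "X p = free (%\<xi>. (1 / h) *R (V0 (\<xi> + h *R d) - V0 \<xi>) - dd d V0 \<xi>) p + duh g p"
    proof -
     have Vp: "V p = free V0 p + duh (%p. G (p, V p)) p"
      using V(2) unfolding mild_def by (rule spec)
     have Wp: "W p = free (dd d V0) p + duh (%p. dd ((0, d), W p) G (p, V p)) p"
      using W(2) unfolding mild_def by (rule spec)
     have Vs: "V (?s p) = free (%\<xi>. V0 (\<xi> + h *R d)) p + duh (%p. G (?s p, V (?s p))) p"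
      using mild_translate[OF V(2), of "fst p" "snd p"] by simp
     have "duh g p = (1 / h) *R (duh (%p. G (?s p, V (?s p))) p - duh (%p. G (p, V p)) p)
       - duh (%p. dd ((0, d), W p) G (p, V p)) p"
      unfolding g_def by (subst duh_diff, intro continuous_intros cGs cG, rule cW,
        subst duh_scaleR, intro continuous_intros cGs cG, subst duh_diff, rule cGs, rule cG, rule refl)
     then show ?thesis
      unfolding X_def Vs Wp free_diff free_scaleR by (subst Vp) (simp add: algebra_simps)
    qed
   next
    fix p :: "real \<times> 'z" assume p: "p : diamond 0 R"
    show "norm (free (%\<xi>. (1 / h) *R (V0 (\<xi> + h *R d) - V0 \<xi>) - dd d V0 \<xi>) p) <= 2 * \<eta>"
     by (rule free_norm_le[OF p V2[OF h'(1,3)]])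
    have "norm (h *R d) <= norm d" using h by (simp add: mult_left_le_one_le)
    then have "?s p : diamond 0 (R + norm d)"
     using p norm_triangle_ineq[of "snd p" "h *R d"] by (auto simp: diamond_def)
    then have "norm (G (?s p, V (?s p)) - G (?s p, V p + h *R W p)) <= L * norm (V (?s p) - (V p + h *R W p))"
     by (rule L)
    also have "V (?s p) - (V p + h *R W p) = h *R X p"
     using h by (simp add: X_def algebra_simps)
    finally have "norm ((1 / h) *R (G (?s p, V (?s p)) - G (?s p, V p + h *R W p))) <= L * norm (X p)"
     using h by (simp only: norm_scaleR) (simp add: field_simps)
    \<comment> \<open>The first bracket compares two unknowns at the same shifted point and is
      Lipschitz in \<open>X\<close>; the second is a difference quotient of \<open>G\<close> along a
      direction from a compact set, hence uniformly small.\<close>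
    moreover have "g p = (1 / h) *R (G (?s p, V (?s p)) - G (?s p, V p + h *R W p)) +
     ((1 / h) *R (G ((p, V p) + h *R ((0, d), W p)) - G (p, V p)) - dd ((0, d), W p) G (p, V p))"
     unfolding g_def by (cases p) (simp add: algebra_simps)
    ultimately show "norm (g p) <= \<eta> + L * norm (X p)"
     using G1[OF h'(1,2) p] norm_triangle_ineq by (smt (verit))
   qed
   also have "... = K * \<eta>" by (simp add: K_def algebra_simps)
   also have "... < r" using K r by (simp add: \<eta>_def)
   finally show ?thesis by (simp add: X_def dist_norm)
  qed
  then show "\<forall>\<^sub>F h in at 0. dist ((1 / h) *R (V (t, zt + h *R d) - V (t, zt))) (W (t, zt)) < r"
   using h1 h2 unfolding eventually_at by (intro exI[of _ "min 1 (min h1 h2)"]) auto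
 qed
 then show ?thesis
  by (intro has_vector_derivative_from_quotient) simp
qed


text \<open>Along the ray \<open>y - s *R e\<close> the \<open>P\<close> part is a constant plus an
  integral in \<open>s\<close> with continuous integrand, hence differentiable. Together with the
  derivative in direction \<open>e\<close> this gives the derivative at fixed position.\<close>

lemma mild_P_time_derivative:
 assumes g: "continuous_on UNIV g" and V: "mild V0 g V" and W: "continuous_on UNIV W"
  and VW: "!!t zt. ((%h. V (t, zt + h *R e)) hvd W (t, zt)) (at 0)"
 shows "((%s. P (V (s, zt))) hvd P (W (t, zt)) + P (g (t, zt))) (at t)"
proof -
 have PV: "P (V (s, y - s *R e)) = P (V0 y) + integral {0..1} (%sg. s *R P (g (s * sg, y - (s * sg) *R e)))" for s y
 proof -
  have "P (duh g (s, y - s *R e)) = integral {0..1} (%sg. P (ray g (s, y - s *R e) sg))"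
   unfolding duh_def using integral_linear[OF ray_integrable[OF g] P] by (simp add: o_def)
  also have "(%sg. P (ray g (s, y - s *R e) sg)) = (%sg. s *R P (g (s * sg, y - (s * sg) *R e)))"
   by (simp add: ray_def bounded_linear.linear[OF P] linear_cmul linear_add algebra_simps)
  finally show ?thesis
   using V by (simp add: mild_def free_def bounded_linear.linear[OF P] linear_add)
 qed
 have time: "((%s. P (V (s, y - s *R e))) hvd P (g (s, y - s *R e))) (at s)" for s y
  unfolding PV
  by (rule has_vector_derivative_eq_rhs, rule has_vector_derivative_add, rule has_vector_derivative_const,
    rule scaled_integral_derivative[where k="%s. P (g (s, y - s *R e))"])
   (intro continuous_intros continuous_on_compose2[OF g], auto)
 \<comment> \<open>The first argument moves along a ray and the second changes the ray; on the line
   \<open>(s, s - t)\<close> the two motions cancel and the position is \<open>zt\<close> for every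
   \<open>s\<close>.\<close>
 define A where "A p = P (V (fst p, zt + (t + snd p - fst p) *R e))" for p
 define A1 where "A1 p = P (g (fst p, zt + (t + snd p - fst p) *R e))" for p
 define A2 where "A2 p = P (W (fst p, zt + (t + snd p - fst p) *R e))" for p
 have "continuous_on UNIV A1" "continuous_on UNIV A2"
  unfolding A1_def A2_def by (intro continuous_intros continuous_on_compose2[OF g] continuous_on_compose2[OF W]; auto)+
 moreover have "((%s. A (s, r)) hvd A1 (s, r)) (at s)" for s r
  using time[of "zt + (t + r) *R e" s] by (simp add: A_def A1_def algebra_simps)
 moreover have "((%r. A (s, r)) hvd A2 (s, r)) (at r)" for s r
 proof -
  have "((%h. V (s, zt + (t + r - s) *R e + h *R e)) hvd W (s, zt + (t + r - s) *R e)) (at (r - r))"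
   using VW by simp
  moreover have "((%r'. r' - r) hvd 1) (at r)"
   by (auto intro!: derivative_eq_intros)
  ultimately have "((%r'. V (s, zt + (t + r - s) *R e + (r' - r) *R e)) has_vector_derivative
    W (s, zt + (t + r - s) *R e)) (at r)"
   using vector_diff_chain_at[of "%r'. r' - r" 1 r] by (fastforce simp: o_def)
  from bounded_linear.has_vector_derivative[OF P this] show ?thesis
   by (simp add: A_def A2_def algebra_simps)
 qed
 ultimately have "(A has_derivative (%v. fst v *R A1 (t, 0) + snd v *R A2 (t, 0))) (at (t, t - t))"
  using has_derivative_two_partials[of UNIV t 0 A A1 A2] by (auto simp: continuous_on_eq_continuous_at)
 moreover have "((%s. (s, s - t)) has_derivative (%h. (h, h))) (at t)"
  by (auto intro!: derivative_eq_intros)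
 ultimately have "((%s. A (s, s - t)) has_derivative (%h. h *R A1 (t, 0) + h *R A2 (t, 0))) (at t)"
  using has_derivative_compose[of "%s. (s, s - t)" "%h. (h, h)" t UNIV A] by fastforce
 then show ?thesis
  by (simp add: has_vector_derivative_def A_def A1_def A2_def algebra_simps)
qed

end

context transport
begin

lemma transport_swap: "transport Q P (- e)"
 using P Q norm_P norm_Q PQ norm_e by (intro transport.intro) (simp_all add: add.commute)

text \<open>Exchanging the projections and reversing \<open>e\<close> describes the same solutions,
  so every statement about \<open>P\<close> has its counterpart for \<open>Q\<close>.\<close>

lemma mild_swap: "transport.mild Q P (- e) = mild"
proof -
 interpret sw: transport Q P "- e" by (rule transport_swap)
 show ?thesis
  unfolding sw.mild_def mild_def sw.free_def free_def sw.duh_def duh_def sw.ray_def ray_def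
  by (simp add: add.commute algebra_simps fun_eq_iff)
qed

lemma mild_time_derivative:
 assumes g: "continuous_on UNIV g" and V: "mild V0 g V" and W: "continuous_on UNIV W"
  and VW: "!!t zt. ((%h. V (t, zt + h *R e)) hvd W (t, zt)) (at 0)"
 shows "((%s. V (s, zt)) hvd P (W (t, zt)) - Q (W (t, zt)) + g (t, zt)) (at t)"
proof -
 interpret sw: transport Q P "- e" by (rule transport_swap)
 have "((%h. V (t, zt + h *R (- e))) hvd - W (t, zt)) (at 0)" for t zt
 proof -
  have "((%h. - h) hvd (- 1)) (at (0::real))"
   by (auto intro!: derivative_eq_intros)
  from vector_diff_chain_at[OF this, of "%h. V (t, zt + h *R e)"] VW[of t zt]
  show ?thesis by (simp add: o_def)
 qed
 with sw.mild_P_time_derivative[OF g _ continuous_on_minus[OF W]] V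
 have "((%s. Q (V (s, zt))) hvd Q (- W (t, zt)) + Q (g (t, zt))) (at t)"
  unfolding mild_swap by blast
 from has_vector_derivative_add[OF mild_P_time_derivative[OF g V W VW, of zt t] this]
 have "((%s. V (s, zt)) has_vector_derivative
   (P (W (t, zt)) + P (g (t, zt))) + (Q (- W (t, zt)) + Q (g (t, zt)))) (at t)"
  by (simp only: PQ)
 moreover have "(P (W (t, zt)) + P (g (t, zt))) + (Q (- W (t, zt)) + Q (g (t, zt)))
   = P (W (t, zt)) - Q (W (t, zt)) + g (t, zt)"
  using PQ[of "g (t, zt)"] by (simp add: bounded_linear.linear[OF Q] linear_neg algebra_simps)
 ultimately show ?thesis by simp
qed

text \<open>The linearised source is affine in \<open>y\<close> with coefficients depending
  continuously on the point, hence bounded on every diamond.\<close>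

lemma linearized_lip:
 assumes G: "Ck 1 G" and V: "continuous_on UNIV V"
 shows "lip (%(p, y). dd ((0, d), y) G (p, V p))"
 unfolding lip_def
proof
 fix R
 have 1: "Ck (Suc 0) G" using G by simp
 have "continuous_on UNIV (%p. dd (0, b) G (p, V p))" for b
  by (rule continuous_on_compose2[OF Ck_continuous[OF Ck_dd[OF 1], of UNIV], of UNIV "%p. (p, V p)"])
   (auto intro: continuous_on_Pair continuous_on_id V)
 then have "\<forall>b. \<exists>B. \<forall>p\<in>diamond 0 R. norm (dd (0, b) G (p, V p)) <= B"
  using continuous_bounded_on_diamond by meson
 then obtain B where B: "!!b p. p : diamond 0 R ==> norm (dd (0, b) G (p, V p)) <= B b" by metis
 have lin: "linear (%v. dd v G (p, V p))" for p
  using Ck_has_derivative[OF 1] has_derivative_linear by blast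
 show "\<exists>L\<ge>0. \<forall>p\<in>diamond 0 R. \<forall>y y'. norm ((%(p, y). dd ((0, d), y) G (p, V p)) (p, y) -
   (%(p, y). dd ((0, d), y) G (p, V p)) (p, y')) <= L * norm (y - y')"
 proof (intro exI[of _ "\<Sum>b\<in>Basis. \<bar>B b\<bar>"] conjI ballI allI)
  show "0 <= (\<Sum>b\<in>(Basis::'a set). \<bar>B b\<bar>)" by (intro sum_nonneg) auto
  fix p :: "real \<times> 'z" and y y' :: 'a assume p: "p : diamond 0 R"
  have "dd ((0, d), y) G (p, V p) - dd ((0, d), y') G (p, V p) = dd (0, y - y') G (p, V p)"
   using linear_diff[OF lin[of p], of "((0, d), y)" "((0, d), y')"] by simp
  also have "... = (\<Sum>b\<in>Basis. ((y - y') \<bullet> b) *R dd (0, b) G (p, V p))"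
   by (rule linear_eq_sum_Basis[of "%y. dd (0, y) G (p, V p)"])
    (use linear_compose[OF bounded_linear.linear[OF bounded_linear_Pair[OF bounded_linear_zero bounded_linear_ident]] lin]
     in \<open>simp add: o_def\<close>)
  also have "norm ... <= (\<Sum>b\<in>Basis. norm (y - y') * \<bar>B b\<bar>)"
   by (intro sum_norm_le) (auto intro!: mult_mono Basis_le_norm order_trans[OF B[OF p]])
  finally show "norm ((%(p, y). dd ((0, d), y) G (p, V p)) (p, y) -
    (%(p, y). dd ((0, d), y) G (p, V p)) (p, y')) <= (\<Sum>b\<in>Basis. \<bar>B b\<bar>) * norm (y - y')"
   by (simp add: sum_distrib_left mult.commute)
 qed
qed

lemma linearized_Ck:
 fixes G :: "(real \<times> 'z) \<times> 'a => 'a"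
 assumes G: "Ck (Suc k) G" and V: "Ck k V"
 shows "Ck k (%(p, y). dd ((0, d), y) G (p, V p))"
proof -
 have lin: "linear (%v. dd v G q)" for q
  using Ck_has_derivative[OF G] has_derivative_linear by blast
 have eq: "dd ((0, d), y) G (p, V p) = dd ((0, d), 0) G (p, V p) + (\<Sum>b\<in>Basis. (y \<bullet> b) *R dd (0, b) G (p, V p))" for p y
 proof -
  have "dd ((0, d), y) G (p, V p) = dd ((0, d), 0) G (p, V p) + dd (0, y) G (p, V p)"
   using linear_add[OF lin[of "(p, V p)"], where ?b1.0="((0, d), 0)" and ?b2.0="(0, y)"] by simp
  also have "dd (0, y) G (p, V p) = (\<Sum>b\<in>Basis. (y \<bullet> b) *R dd (0, b) G (p, V p))"
   by (rule linear_eq_sum_Basis[of "%y. dd (0, y) G (p, V p)"])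
    (use linear_compose[OF bounded_linear.linear[OF bounded_linear_Pair[OF bounded_linear_zero bounded_linear_ident]] lin]
     in \<open>simp add: o_def\<close>)
  finally show ?thesis .
 qed
 have "Ck k (%q. dd v G (fst q, V (fst q)))" for v :: "(real \<times> 'z) \<times> 'a"
  by (rule Ck_compose[OF Ck_dd[OF G], of "%q. (fst q, V (fst q))"])
   (intro Ck_Pair Ck_fst Ck_id Ck_compose[OF V])
 then have "Ck k (%q. dd ((0, d), 0) G (fst q, V (fst q)) + (\<Sum>b\<in>Basis. (snd q \<bullet> b) *R dd (0, b) G (fst q, V (fst q))))"
  by (intro Ck_add Ck_sum Ck_scaleR Ck_inner Ck_snd Ck_id Ck_const)
 then show ?thesis
  unfolding case_prod_unfold eq[symmetric] .
qed

text \<open>Each spatial derivative is the mild solution of the linearised equation, whose source is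
  C^k once \<open>V\<close> is. The induction hypothesis is thus applied twice, first to
  \<open>V\<close> and then to that solution, which is why \<open>G\<close>, \<open>V\<close> and
  \<open>V0\<close> are generalised.\<close>

theorem mild_Ck:
 assumes "Ck k G" "lip G" "Ck k V0" "continuous_on UNIV V" "mild V0 (%p. G (p, V p)) V"
 shows "Ck k V"
 using assms
proof (induction k arbitrary: G V V0)
 case (Suc k)
 have Vk: "Ck k V"
  by (rule Suc.IH[OF Ck_SucD[OF Suc.prems(1)] Suc.prems(2) Ck_SucD[OF Suc.prems(3)] Suc.prems(4,5)])
 have G1: "Ck 1 G" and V01: "Ck 1 V0"
  using Ck_mono[OF Suc.prems(1)] Ck_mono[OF Suc.prems(3)] by (metis One_nat_def Suc_le_mono le0)+
 have "\<exists>W. Ck k W \<and> (\<forall>t zt. ((%h. V (t, zt + h *R d)) hvd W (t, zt)) (at 0))" for d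
 proof -
  let ?G = "%(p, y). dd ((0, d), y) G (p, V p)"
  have Gk: "Ck k ?G" by (rule linearized_Ck[OF Suc.prems(1) Vk])
  have lip: "lip ?G" by (rule linearized_lip[OF G1 Suc.prems(4)])
  have V0k: "Ck k (dd d V0)" by (rule Ck_dd[OF Suc.prems(3)])
  obtain W where W: "continuous_on UNIV W" "mild (dd d V0) (%p. ?G (p, W p)) W"
   using mild_exists[OF Ck_continuous[OF Gk] lip Ck_continuous[OF V0k]] by blast
  have "Ck k W" by (rule Suc.IH[OF Gk lip V0k W])
  moreover have "((%h. V (t, zt + h *R d)) hvd W (t, zt)) (at 0)" for t zt
   using W by (intro mild_direction_derivative[OF G1 Suc.prems(2) V01 Suc.prems(4,5)]) auto
  ultimately show ?thesis by blast
 qed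
 then obtain W where W: "!!d. Ck k (W d)"
  and VW: "!!d t zt. ((%h. V (t, zt + h *R d)) hvd W d (t, zt)) (at 0)"
  by metis
 have cG: "continuous_on UNIV (%p. G (p, V p))"
  by (intro continuous_on_compose2[OF Ck_continuous[OF G1, of UNIV]] continuous_intros Suc.prems(4)) auto
 \<comment> \<open>Spatial directions use the linearised solutions; the time derivative is read off
   from the transport equation itself.\<close>
 define V' where "V' b = (if fst b = 0 then W (snd b) else (%p. P (W e p) - Q (W e p) + G (p, V p)))"
  for b :: "real \<times> 'z"
 have V'k: "Ck k (V' b)" for b
  unfolding V'_def
  by (auto intro!: W Ck_add Ck_diff Ck_linear_compose[OF P] Ck_linear_compose[OF Q]
    Ck_compose[OF Ck_SucD[OF Suc.prems(1)]] Ck_Pair Ck_id Vk)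
 have "((%h. V (y + h *R b)) hvd V' b y) (at 0)" if "b : Basis" for b y
 proof (cases "fst b = 0")
  case True
  then show ?thesis
   using VW[of "fst y" "snd y" "snd b"] by (cases b; cases y) (simp add: V'_def)
 next
  case False
  then have b: "b = (1, 0)" using that by (auto simp: Basis_prod_def)
  have "((%s. V (s, snd y)) hvd V' b y) (at (fst y + 0))"
   using mild_time_derivative[OF cG Suc.prems(5) Ck_continuous[OF W] VW, of "snd y" "fst y"]
   by (simp add: V'_def b)
  from has_vector_derivative_shift[OF this] show ?thesis
   by (cases y) (simp add: b)
 qed
 moreover have "isCont (V' b) x" for b x
  using Ck_continuous[OF V'k] continuous_on_eq_continuous_at[OF open_UNIV] by blast
 ultimately have "(V has_derivative (%v. \<Sum>b\<in>Basis. (v \<bullet> b) *R V' b x)) (at x)" for x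
  by (rule has_derivative_from_partials[OF open_UNIV UNIV_I])
 then show ?case
  by (rule Ck_SucI) (intro Ck_sum Ck_scaleR Ck_const V'k)
qed simp

end

section \<open>Global solutions for truncated nonlinearities\<close>

declare Ck.simps(2) [simp del]

section \<open>Cutting off the nonlinearity\<close>

lemma Ck_bounded_growth:
 fixes h :: "'a::euclidean_space => 'b::real_normed_vector"
 assumes h: "Ck 1 h" and C: "C >= 0"
  and b: "!!b th. b : Basis ==> 0 <= th ==> th <= 1 ==> norm (dd b h (x + th *R (y - x))) <= C"
 shows "norm (h y - h x) <= (C * DIM('a)) * norm (y - x)"
proof -
 have 1: "Ck (Suc 0) h" using h by simp
 have "norm (h (x + 1 *R (y - x)) - h (x + 0 *R (y - x))) <= (C * DIM('a) * norm (y - x)) * norm (1 - 0 :: real)"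
 proof (rule differentiable_bound[of "{0..1}" "%th. h (x + th *R (y - x))" "%th k. k *R dd (y - x) h (x + th *R (y - x))"])
  fix th :: real assume th: "th : {0..1}"
  show "((%th. h (x + th *R (y - x))) has_derivative (%k. k *R dd (y - x) h (x + th *R (y - x)))) (at th within {0..1})"
   using dd_along_line[OF 1] unfolding has_vector_derivative_def by (rule has_derivative_at_withinI)
  have "norm (dd (y - x) h (x + th *R (y - x))) <= (\<Sum>b\<in>(Basis::'a set). norm (y - x) * C)"
   unfolding dd_eq_sum_Basis[OF 1, where v="y - x"]
   using th b by (intro sum_norm_le) (auto intro!: mult_mono Basis_le_norm)
  then show "onorm (%k. k *R dd (y - x) h (x + th *R (y - x))) <= C * DIM('a) * norm (y - x)"
   by (intro onorm_scaleR_le) (simp add: mult_ac)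
 qed auto
 then show ?thesis by simp
qed

lemma Ck_power_growth:
 fixes h :: "'a::euclidean_space => 'b::real_normed_vector"
 assumes "Ck 1 h" "h 0 = 0" "C >= 0"
  and b: "!!b y. b : Basis ==> norm (dd b h y) <= C * norm y ^ k"
 shows "norm (h y) <= (C * DIM('a)) * norm y ^ Suc k"
proof -
 have "norm (dd b h (0 + th *R (y - 0))) <= C * norm y ^ k" if "b : Basis" "0 <= th" "th <= 1" for b th
  using that assms(3)
  by (intro order_trans[OF b] mult_left_mono power_mono) (auto simp: mult_left_le_one_le)
 from Ck_bounded_growth[OF assms(1) _ this] assms(2,3) show ?thesis
  by (simp add: mult_ac)
qed

lemma dd_eq_0_outside:
 assumes "!!y. norm y >= r ==> h y = 0" "norm y > r"
 shows "dd b h y = 0"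
proof -
 have "open {y :: 'a. norm y > r}" by (intro open_Collect_less continuous_intros)
 then have "(h has_derivative (%v. 0)) (at y)"
  by (rule has_derivative_transform_within_open[OF has_derivative_const[of 0]]) (use assms in auto)
 then show ?thesis by (rule dd_eq)
qed

lemma Ck_compact_support_bounded:
 fixes h :: "'a::euclidean_space => 'b::real_normed_vector"
 assumes "Ck k h" "!!y. norm y > r ==> h y = 0"
 obtains C where "C > 0" "!!y. norm (h y) <= C"
proof -
 have "bounded (h ` cball 0 r)"
  by (intro compact_imp_bounded compact_continuous_image Ck_continuous[OF assms(1)] compact_cball)
 then obtain C where C: "C > 0" "!!y. y : cball 0 r ==> norm (h y) <= C"
  unfolding bounded_pos by auto
 moreover have "norm (h y) <= C" for y
  using C assms(2)[of y] by (cases "norm y <= r") auto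
 ultimately show ?thesis using that by blast
qed

text \<open>A first difference is of order h^3 and a second difference of order h^3 as well, while
  they equal h and h^2 times a derivative near 0; continuity of the second derivatives then leaves
  only the value 0.\<close>

lemma derivatives_vanish_of_cubic:
 fixes f :: "'a::euclidean_space => real"
 assumes f: "Ck 2 f" and r: "r > 0" and C: "C > 0" and cub: "!!y. norm y < r ==> \<bar>f y\<bar> <= C * norm y ^ 3"
 shows "dd v f 0 = 0" "dd w (dd v f) 0 = 0"
proof -
 have 2: "Ck (Suc (Suc 0)) f" using f by (simp add: numeral_2_eq_2)
 have 1: "Ck (Suc 0) (dd u f)" for u by (rule Ck_dd[OF 2])
 have f0: "f 0 = 0" using cub[of 0] r by simp
 show "dd v f 0 = 0"
 proof -
  have "((%h. f (0 + h *R v)) hvd dd v f (0 + 0 *R v)) (at 0)"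
   by (rule dd_along_line[OF 2])
  then have "((%h. (f (h *R v) - f 0) / h) \<longlongrightarrow> dd v f 0) (at 0)"
   by (simp add: has_real_derivative_iff_has_vector_derivative[symmetric] DERIV_def)
  moreover have "((%h. (f (h *R v) - f 0) / h) \<longlongrightarrow> 0) (at 0)"
  proof (rule Lim_null_comparison)
   show "((%h. C * norm v ^ 3 * h^2) \<longlongrightarrow> 0) (at 0)"
    by (rule tendsto_eq_intros refl)+ simp
   have "norm ((f (h *R v) - f 0) / h) <= C * norm v ^ 3 * h^2" if "h ~= 0" "\<bar>h\<bar> < r / (norm v + 1)" for h
   proof -
    have "\<bar>h\<bar> * (norm v + 1) < r"
     using that(2) by (simp add: pos_less_divide_eq add_nonneg_pos)
    then have "norm (h *R v) < r" using abs_ge_zero[of h] by (simp add: algebra_simps)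
    from cub[OF this] show ?thesis
     using that(1) f0 by (simp add: field_simps power_mult_distrib power2_eq_square power3_eq_cube abs_mult)
   qed
   moreover have "r / (norm v + 1) > 0" using r by (simp add: add_nonneg_pos)
   ultimately show "\<forall>\<^sub>F h in at 0. norm ((f (h *R v) - f 0) / h) <= C * norm v ^ 3 * h^2"
    unfolding eventually_at by (intro exI[of _ "r / (norm v + 1)"]) auto
  qed
  ultimately show ?thesis by (rule LIM_unique)
 qed
 show "dd w (dd v f) 0 = 0"
 proof (rule ccontr)
  assume "dd w (dd v f) 0 ~= 0"
  then have c: "\<bar>dd w (dd v f) 0\<bar> / 2 > 0" (is "?c > 0") by simp
  have "isCont (dd w (dd v f)) 0"
   using Ck_continuous[OF Ck_dd[OF 1], of UNIV] by (simp add: continuous_on_eq_continuous_at)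
  then obtain d where d: "d > 0" "!!y. dist y 0 < d ==> dist (dd w (dd v f) y) (dd w (dd v f) 0) < ?c"
   using c unfolding continuous_at_eps_delta by blast
  define n where "n = norm v + norm w + 1"
  have n: "n >= 1" "norm v + norm w <= n" by (auto simp: n_def)
  \<comment> \<open>The first two entries keep all points in the balls of radius \<open>r\<close>
    and \<open>d\<close>; the third makes the cubic bound on the second difference contradict a
    nonzero limit.\<close>
  define h where "h = Min {r / (2 * n), d / (2 * n), ?c / (4 * C * n ^ 3)}"
  have h: "h > 0" using r d c C n by (auto simp: h_def)
  have hr: "h <= r / (2 * n)" "h <= d / (2 * n)" "h <= ?c / (4 * C * n ^ 3)" by (auto simp: h_def)
  have hn: "h * n <= r / 2" "h * n <= d / 2" "h * (4 * C * n ^ 3) <= ?c"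
   using hr n C by (auto simp: field_simps)
  have "h * (norm v + norm w) <= h * n" using n h by (intro mult_left_mono) auto
  then have hvw: "h * (norm v + norm w) < r" "h * (norm v + norm w) < d"
   using hn r d by linarith+
  obtain y where y: "dist y 0 <= h * (norm v + norm w)"
   "f (0 + h *R v + h *R w) - f (0 + h *R v) - f (0 + h *R w) + f 0 = h^2 * dd w (dd v f) y"
   using second_difference_quotient[OF subset_UNIV r Ck_has_derivative[OF 2] Ck_has_derivative[OF 1] h hvw(1)] by blast
  have small: "\<bar>f x\<bar> <= C * (h * n) ^ 3" if "norm x <= h * (norm v + norm w)" for x
   using that hvw(1) \<open>h * (norm v + norm w) <= h * n\<close> C
   by (intro order_trans[OF cub] mult_left_mono power_mono) auto
  have "norm (h *R v + h *R w) <= h * (norm v + norm w)"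
   using norm_triangle_ineq[of "h *R v" "h *R w"] h by (simp add: algebra_simps)
  moreover have "norm (h *R v) <= h * (norm v + norm w)" "norm (h *R w) <= h * (norm v + norm w)"
   using h by (auto simp: algebra_simps)
  ultimately have "h^2 * \<bar>dd w (dd v f) y\<bar> <= 3 * (C * (h * n) ^ 3)"
   using small[of "h *R v + h *R w"] small[of "h *R v"] small[of "h *R w"] y(2) f0
   by (simp add: abs_mult[symmetric, of "h^2", simplified])
  also have "... = h^2 * (3 * C * n ^ 3 * h)"
   by (simp add: power_mult_distrib power2_eq_square power3_eq_cube)
  finally have "\<bar>dd w (dd v f) y\<bar> <= 3 * C * n ^ 3 * h" using h by simp
  also have "... <= h * (4 * C * n ^ 3)" using h C n by simp
  also have "... <= ?c" by (rule hn(3))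
  finally have "\<bar>dd w (dd v f) y\<bar> <= ?c" .
  moreover have "\<bar>dd w (dd v f) y - dd w (dd v f) 0\<bar> < ?c"
   using d(2)[of y] y(1) hvw(2) by (simp add: dist_real_def)
  ultimately show False by linarith
 qed
qed

text \<open>Derivatives up to order three occur because the energy estimates differentiate the
  nonlinearity three times in z. One constant serves all orders.\<close>

definition cubic_growth :: "real => ('a::euclidean_space => 'b::euclidean_space) => bool" where
 "cubic_growth C F \<longleftrightarrow> C > 0 \<and> (\<forall>y. norm (F y) <= C * norm y ^ 3) \<and>
  (\<forall>y. \<forall>a\<in>Basis. norm (dd a F y) <= C * norm y ^ 2) \<and>
  (\<forall>y. \<forall>a\<in>Basis. \<forall>b\<in>Basis. norm (dd b (dd a F) y) <= C * norm y) \<and>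
  (\<forall>y. \<forall>a\<in>Basis. \<forall>b\<in>Basis. \<forall>c\<in>Basis. norm (dd c (dd b (dd a F)) y) <= C)"

lemma cubic_growthD:
 assumes "cubic_growth C F"
 shows "C > 0" "norm (F y) <= C * norm y ^ 3"
  "a : Basis ==> norm (dd a F y) <= C * norm y ^ 2"
  "a : Basis ==> b : Basis ==> norm (dd b (dd a F) y) <= C * norm y"
  "a : Basis ==> b : Basis ==> c : Basis ==> norm (dd c (dd b (dd a F)) y) <= C"
 using assms unfolding cubic_growth_def by blast+

lemma cubic_growth_mono:
 assumes "cubic_growth C F" "C <= C'"
 shows "cubic_growth C' F"
 unfolding cubic_growth_def
proof (intro conjI allI ballI)
 note D = cubic_growthD[OF assms(1)]
 have le: "x <= C' * b" if "x <= C * b" "b >= 0" for x b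
  using that mult_right_mono[OF assms(2) that(2)] by linarith
 show "C' > 0" using D(1) assms(2) by linarith
 fix y
 show "norm (F y) <= C' * norm y ^ 3" by (rule le[OF D(2)]) simp
 fix a :: 'a assume a: "a : Basis"
 show "norm (dd a F y) <= C' * (norm y)^2" by (rule le[OF D(3)[OF a]]) simp
 fix b :: 'a assume b: "b : Basis"
 show "norm (dd b (dd a F) y) <= C' * norm y" by (rule le[OF D(4)[OF a b]]) simp
 fix c :: 'a assume c: "c : Basis"
 show "norm (dd c (dd b (dd a F)) y) <= C'" by (rule order_trans[OF D(5)[OF a b c] assms(2)])
qed

lemma norm_fst_snd_le: "norm (fst x) <= norm x" "norm (snd x) <= norm x"
 using norm_fst_le[of "fst x" "snd x"] norm_snd_le[of "snd x" "fst x"] by auto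

text \<open>Only the third derivatives need a direct bound, by compactness. Integrating from the
  origin, where \<open>F\<close> and its first two derivatives vanish, gains one power of |y| and
  one factor of the dimension per step.\<close>

lemma cubic_growth_of_compact_support:
 fixes F :: "'a::euclidean_space => 'b::euclidean_space"
 assumes F: "Ck 4 F" and supp: "!!y. norm y >= R ==> F y = 0"
  and r: "r > 0" and C0: "C0 > 0" and cub: "!!y. norm y < r ==> norm (F y) <= C0 * norm y ^ 3"
 obtains C where "cubic_growth C F"
proof -
 have F4: "Ck (Suc 3) F" using F by simp
 have F3: "Ck (Suc 2) (dd a F)" for a using Ck_dd[OF F4] by (simp add: eval_nat_numeral)
 have F2: "Ck (Suc 1) (dd b (dd a F))" for a b using Ck_dd[OF F3] by (simp add: eval_nat_numeral)
 have F1: "Ck 1 (dd c (dd b (dd a F)))" for a b c by (rule Ck_dd[OF F2])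
 have F2': "Ck 2 F" by (rule Ck_mono[OF F]) simp
 have vanish: "dd a F 0 = 0" "dd b (dd a F) 0 = 0" for a b
 proof -
  have L: "bounded_linear (%y. y \<bullet> i)" for i :: 'b by (rule bounded_linear_inner_left)
  have "dd a F 0 \<bullet> i = 0" "dd b (dd a F) 0 \<bullet> i = 0" if i: "i : Basis" for i
  proof -
   have c: "Ck 2 (%y. F y \<bullet> i)" by (intro Ck_inner F2' Ck_const)
   have d: "\<bar>F y \<bullet> i\<bar> <= C0 * norm y ^ 3" if "norm y < r" for y
    using Basis_le_norm[OF i, of "F y"] cub[OF that] by linarith
   have "dd a (%y. F y \<bullet> i) 0 = 0" "dd b (dd a (%y. F y \<bullet> i)) 0 = 0"
    by (rule derivatives_vanish_of_cubic[OF c r C0 d], assumption)+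
   then show "dd a F 0 \<bullet> i = 0" "dd b (dd a F) 0 \<bullet> i = 0"
    unfolding dd_linear_compose[OF L F4] by (simp_all add: dd_linear_compose[OF L F3])
  qed
  then show "dd a F 0 = 0" "dd b (dd a F) 0 = 0" by (auto intro: euclidean_eqI)
 qed
 \<comment> \<open>A derivative is known to vanish only in the open exterior; enlarging the radius
   by 1 restores the closed form needed for the next order.\<close>
 have s1: "dd a F y = 0" if "norm y >= R + 1" for a y
  by (rule dd_eq_0_outside[OF supp]) (use that in auto)
 have s2: "dd b (dd a F) y = 0" if "norm y >= R + 2" for a b y
  by (rule dd_eq_0_outside[OF s1]) (use that in auto)
 have s3: "dd c (dd b (dd a F)) y = 0" if "norm y > R + 2" for a b c y
  by (rule dd_eq_0_outside[OF s2]) (use that in auto)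
 have "\<exists>C. \<forall>y. norm (dd c (dd b (dd a F)) y) <= C" for a b c
  using Ck_compact_support_bounded[OF F1 s3] by metis
 then obtain D where D: "!!a b c y. norm (dd c (dd b (dd a F)) y) <= D a b c" by metis
 define C3 where "C3 = (\<Sum>a\<in>Basis. \<Sum>b\<in>Basis. \<Sum>c\<in>Basis. \<bar>D a b c\<bar>)"
 have C3: "C3 >= 0" by (auto simp: C3_def intro!: sum_nonneg)
 have 3: "norm (dd c (dd b (dd a F)) y) <= C3 * norm y ^ 0" if "a : Basis" "b : Basis" "c : Basis" for a b c y
 proof -
  have "norm (dd c (dd b (dd a F)) y) <= \<bar>D a b c\<bar>" using D[where a=a and b=b and c=c and y=y] by linarith
  also have "... <= (\<Sum>c\<in>Basis. \<bar>D a b c\<bar>)" using that by (intro member_le_sum) auto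
  also have "... <= (\<Sum>b\<in>Basis. \<Sum>c\<in>Basis. \<bar>D a b c\<bar>)"
   using that by (intro member_le_sum[of b _ "%b. \<Sum>c\<in>Basis. \<bar>D a b c\<bar>"]) (auto intro!: sum_nonneg)
  also have "... <= C3"
   unfolding C3_def using that by (intro member_le_sum[of a _ "%a. \<Sum>b\<in>Basis. \<Sum>c\<in>Basis. \<bar>D a b c\<bar>"]) (auto intro!: sum_nonneg)
  finally show ?thesis by simp
 qed
 define d where "d = real DIM('a)"
 have d: "d >= 1" using DIM_positive[where 'a='a] unfolding d_def by linarith
 have 2: "norm (dd b (dd a F) y) <= C3 * d * norm y ^ 1" if "a : Basis" "b : Basis" for a b y
  using Ck_power_growth[OF Ck_mono[OF F2] vanish(2) C3 3[OF that]] by (simp add: d_def)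
 have 1: "norm (dd a F y) <= C3 * d * d * norm y ^ 2" if "a : Basis" for a y
  using Ck_power_growth[OF Ck_mono[OF F3] vanish(1) _ 2[OF that]] C3 d by (simp add: d_def numeral_2_eq_2)
 have F0: "F 0 = 0" using cub[of 0] r by simp
 have 0: "norm (F y) <= C3 * d * d * d * norm y ^ 3" for y
  using Ck_power_growth[OF Ck_mono[OF F] F0 _ 1] C3 d by (simp add: d_def numeral_3_eq_3 numeral_2_eq_2)
 have le: "C3 <= C3 * d * d * d" "C3 * d <= C3 * d * d * d" "C3 * d * d <= C3 * d * d * d"
 proof -
  have *: "x <= x * d" if "x >= 0" for x using that d by (simp add: mult_left_mono[of 1 d x, simplified])
  have "C3 <= C3 * d" "C3 * d <= C3 * d * d" "C3 * d * d <= C3 * d * d * d"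
   using C3 d by (auto intro!: *)
  then show "C3 <= C3 * d * d * d" "C3 * d <= C3 * d * d * d" "C3 * d * d <= C3 * d * d * d" by linarith+
 qed
 define C where "C = C3 * d * d * d + 1"
 have C: "C > 0" "C3 <= C" "C3 * d <= C" "C3 * d * d <= C" "C3 * d * d * d <= C"
  using le C3 d by (auto simp: C_def add_nonneg_pos)
 have "norm (F y) <= C * norm y ^ 3" for y
  using 0[of y] mult_right_mono[OF C(5), of "norm y ^ 3"] by simp
 moreover have "norm (dd a F y) <= C * norm y ^ 2" if "a : Basis" for a y
  using 1[OF that, of y] mult_right_mono[OF C(4), of "norm y ^ 2"] by simp
 moreover have "norm (dd b (dd a F) y) <= C * norm y" if "a : Basis" "b : Basis" for a b y
  using 2[OF that, of y] mult_right_mono[OF C(3), of "norm y"] by simp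
 moreover have "norm (dd c (dd b (dd a F)) y) <= C" if "a : Basis" "b : Basis" "c : Basis" for a b c y
  using 3[OF that, of y] C(2) by simp
 ultimately have "cubic_growth C F"
  unfolding cubic_growth_def using C(1) by (intro conjI allI ballI)
 then show ?thesis by (rule that)
qed

text \<open>Two nested positive parts: the inner one vanishes for |y| at most 1, which gives the
  value 1, and is at least 1 as soon as |y|^2 - 1 is, which gives the value 0.\<close>

lemma smooth_cutoff:
 obtains cut :: "'a::euclidean_space => real"
 where "Ck k cut" "!!y. norm y <= 1 ==> cut y = 1" "!!y. norm y >= 2 ==> cut y = 0"
proof
 let ?p = "%x::real. max 0 x ^ (k + 1)"
 let ?cut = "%y::'a. ?p (1 - ?p (y \<bullet> y - 1))"
 show "Ck k ?cut"
  by (rule Ck_compose[OF Ck_pos_part_power], rule Ck_diff[OF Ck_const], rule Ck_compose[OF Ck_pos_part_power])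
   (intro Ck_diff Ck_inner Ck_id Ck_const)
 show "?cut y = 1" if "norm y <= 1" for y
  using that by (simp add: dot_square_norm abs_square_le_1 max_absorb1)
 show "?cut y = 0" if "norm y >= 2" for y
 proof -
  have "2 ^ 2 <= (norm y)^2" using that by (intro power_mono) auto
  then have "1 <= y \<bullet> y - 1" by (simp add: dot_square_norm)
  then have "1 <= ?p (y \<bullet> y - 1)" by (intro one_le_power) auto
  then show ?thesis by (simp add: max_absorb1)
 qed
qed

lemma truncation:
 fixes F :: "'a::euclidean_space => 'b::euclidean_space"
 assumes F: "smooth F" and k: "k >= 4"
  and r: "r > 0" and C0: "C0 > 0" and cub: "!!y. norm y < r ==> norm (F y) <= C0 * norm y ^ 3"
 obtains Ft C where "Ck k Ft" "!!y. norm y <= 1 ==> Ft y = F y" "cubic_growth C Ft"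
  "!!y y'. norm (Ft y - Ft y') <= C * norm (y - y')"
proof -
 obtain cut :: "'a => real" where cut: "Ck k cut" "!!y. norm y <= 1 ==> cut y = 1" "!!y. norm y >= 2 ==> cut y = 0"
  using smooth_cutoff by blast
 define Ft where "Ft y = cut y *R F y" for y
 have Ft: "Ck k Ft"
  unfolding Ft_def using F cut(1) by (intro Ck_scaleR) (auto simp: smooth_def)
 have supp: "Ft y = 0" if "norm y >= 2" for y using cut(3)[OF that] by (simp add: Ft_def)
 have eq: "Ft y = F y" if "norm y <= 1" for y using cut(2)[OF that] by (simp add: Ft_def)
 have "norm (Ft y) <= C0 * norm y ^ 3" if "norm y < min r 1" for y
  using cub[of y] eq[of y] that by simp
 then obtain C where C: "cubic_growth C Ft"
  by (rule cubic_growth_of_compact_support[OF Ck_mono[OF Ft k] supp, where r="min r 1", rotated 3]) (use r C0 in auto)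
 note CD = cubic_growthD[OF C]
 have "norm (dd b Ft y) <= C * 9" if b: "b : Basis" for b y
 proof (cases "norm y > 2")
  case True
  have "dd b Ft y = 0" by (rule dd_eq_0_outside[of 2]) (use supp True in auto)
  then show ?thesis using CD(1) by simp
 next
  case False
  have "norm (dd b Ft y) <= C * norm y ^ 2" by (rule CD(3)[OF b])
  also have "... <= C * 3 ^ 2" using False CD(1) by (intro mult_left_mono power_mono) auto
  finally show ?thesis by simp
 qed
 moreover have "Ck 1 Ft" by (rule Ck_mono[OF Ft]) (use k in simp)
 ultimately have lip: "norm (Ft y - Ft y') <= C * 9 * DIM('a) * norm (y - y')" for y y'
  using CD(1) by (intro Ck_bounded_growth) auto
 define C' where "C' = C * (9 * DIM('a) + 1)"
 have C': "C <= C'" "C * 9 * DIM('a) <= C'"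
  using CD(1) by (auto simp: C'_def algebra_simps)
 have "cubic_growth C' Ft" by (rule cubic_growth_mono[OF C C'(1)])
 moreover have "norm (Ft y - Ft y') <= C' * norm (y - y')" for y y'
  using lip[of y y'] mult_right_mono[OF C'(2), of "norm (y - y')"] by simp
 ultimately show ?thesis using that Ft eq by blast
qed


section \<open>The Klein-Gordon system in characteristic variables\<close>

type_synonym 'n vec3 = "(real ^ 'n) \<times> (real ^ 'n) \<times> (real ^ 'n)"

lemma (in transport) mild_initial: "mild V0 g V ==> V (0, zt) = V0 zt"
 by (simp add: mild_def free_def duh_def ray_def PQ)

definition et :: "real * (real * real)" where "et = (1, (0, 0))"
definition ex :: "real * (real * real)" where "ex = (0, (1, 0))"

definition mass :: "('n::finite => real) => real ^ 'n => real ^ 'n" where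
 "mass m v = (\<chi> j. m j * v $ j)"

lemma bounded_linear_mass: "bounded_linear (mass m)"
proof -
 have "linear (mass m)"
  by (rule linearI) (simp_all add: mass_def vec_eq_iff algebra_simps)
 then show ?thesis by (rule linear_conv_bounded_linear[THEN iffD1])
qed

text \<open>The unknown is \<open>(p, q, u)\<close> with \<open>p = u\<^sub>t + u\<^sub>x\<close> travelling to the left and \<open>q = u\<^sub>t - u\<^sub>x\<close>, \<open>u\<close>
 travelling to the right. The size \<open>ep\<close> of the data is carried along as a second, inert space
 variable: smooth dependence on \<open>ep\<close> then comes for free.\<close>

definition leftgoing :: "'n::finite vec3 => 'n vec3" where "leftgoing y = (fst y, 0)"
definition rightgoing :: "'n::finite vec3 => 'n vec3" where "rightgoing y = (0, snd y)"

lemma bounded_linear_leftgoing: "bounded_linear leftgoing"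
 and bounded_linear_rightgoing: "bounded_linear rightgoing"
 unfolding leftgoing_def[abs_def] rightgoing_def[abs_def]
 by (intro bounded_linear_Pair bounded_linear_fst bounded_linear_snd bounded_linear_zero)+

interpretation kg: transport leftgoing rightgoing "(1, 0) :: real * real"
 by (rule transport.intro)
  (auto simp: bounded_linear_leftgoing bounded_linear_rightgoing leftgoing_def rightgoing_def
   norm_fst_snd_le zero_prod_def[symmetric])

definition kg_source :: "('n::finite => real) => ('n vec3 => real ^ 'n) => 'n vec3 => real ^ 'n" where
 "kg_source m F = (%(p, q, u). F (u, (1/2) *R (p + q), (1/2) *R (p - q)) - mass m (mass m u))"


lemma Ck_kg_source:
 assumes "Ck k F"
 shows "Ck k (kg_source m F)"
 unfolding kg_source_def case_prod_unfold
 by (intro Ck_diff Ck_compose[OF assms] Ck_Pair Ck_scaleR Ck_add Ck_const Ck_fst Ck_snd Ck_id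
   Ck_linear_compose[OF bounded_linear_mass])

lemma kg_source_lipschitz:
 assumes F: "!!y y'. norm (F y - F y') <= L * norm (y - y')"
 obtains L' where "L' >= 0" "!!y y'. norm (kg_source m F y - kg_source m F y') <= L' * norm (y - y')"
proof -
 have mm: "bounded_linear (%u. mass m (mass m u))"
  by (rule bounded_linear_compose[OF bounded_linear_mass bounded_linear_mass])
 then obtain K where K: "!!u. norm (mass m (mass m u)) <= norm u * K" "K > 0"
  using bounded_linear.pos_bounded by blast
 have jet: "bounded_linear (%y :: 'a vec3. (snd (snd y), (1/2) *R (fst y + fst (snd y)), (1/2) *R (fst y - fst (snd y))))"
  (is "bounded_linear ?j")
  by (intro bounded_linear_Pair bounded_linear_const_scaleR bounded_linear_add bounded_linear_sub
    bounded_linear_fst_comp bounded_linear_snd_comp bounded_linear_ident)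
 then obtain K' where K': "!!y. norm (?j y) <= norm y * K'" "K' > 0"
  using bounded_linear.pos_bounded by blast
 have "norm (kg_source m F y - kg_source m F y') <= (\<bar>L\<bar> * K' + K) * norm (y - y')" for y y'
 proof -
  have "kg_source m F y - kg_source m F y' = (F (?j y) - F (?j y')) - mass m (mass m (snd (snd (y - y'))))"
   by (simp add: kg_source_def case_prod_unfold linear_diff[OF bounded_linear.linear[OF mm], simplified o_def])
  also have "norm ... <= norm (F (?j y) - F (?j y')) + norm (mass m (mass m (snd (snd (y - y')))))"
   by (rule norm_triangle_ineq4)
  also have "norm (F (?j y) - F (?j y')) <= \<bar>L\<bar> * norm (?j y - ?j y')"
   by (rule order_trans[OF F]) (intro mult_right_mono, auto)
  also have "?j y - ?j y' = ?j (y - y')" by (simp add: algebra_simps scaleR_diff_right)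
  also have "\<bar>L\<bar> * norm (?j (y - y')) <= \<bar>L\<bar> * (norm (y - y') * K')"
   by (intro mult_left_mono K') auto
  also have "norm (mass m (mass m (snd (snd (y - y'))))) <= norm (y - y') * K"
   using K(2) order_trans[OF norm_fst_snd_le(2)[of "snd (y - y')"] norm_fst_snd_le(2)[of "y - y'"]]
   by (intro order_trans[OF K(1)] mult_right_mono) auto
  finally show ?thesis by (simp add: algebra_simps)
 qed
 moreover have "\<bar>L\<bar> * K' + K >= 0" using K K' by simp
 ultimately show ?thesis using that by blast
qed

lemma smooth_real_derivative:
 fixes f :: "real => real"
 assumes "smooth f"
 shows "(f hrd dd 1 f x) (at x)" "Ck k f" "Ck k (dd 1 f)"
proof -
 have S: "Ck (Suc k) f" for k using assms by (simp only: smooth_def)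
 show "Ck k f" "Ck k (dd 1 f)" using Ck_SucD[OF S] Ck_dd[OF S] by auto
 have "((%h. f (0 + h *R 1)) hvd dd 1 f (0 + x *R 1)) (at x)"
  by (rule dd_along_line[OF S])
 then show "(f hrd dd 1 f x) (at x)"
  by (simp add: has_real_derivative_iff_has_vector_derivative)
qed

text \<open>Regularity is that of the mild solution of the first-order system. It remains to show
  that a solution of the system comes from a scalar field per component, i.e. that
  \<open>q = u_t - u_x\<close> persists, and to read support and the case \<open>ep = 0\<close> off
  the Gronwall estimate.\<close>

theorem kg_solution:
 fixes m :: "'n::finite => real" and F :: "'n vec3 => real ^ 'n" and f g :: "'n => real => real"
 assumes F: "Ck k F" and k: "k >= 2" and F0: "F 0 = 0" and L: "!!y y'. norm (F y - F y') <= L * norm (y - y')"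
  and fs: "!!j. smooth (f j)" and gs: "!!j. smooth (g j)"
  and B: "!!j x. \<bar>x\<bar> > B ==> f j x = 0 \<and> g j x = 0"
 obtains u :: "real * (real * real) => real ^ 'n" where
  "Ck k u"
  "!!p. dd et (dd et u) p - dd ex (dd ex u) p = F (u p, dd et u p, dd ex u p) - mass m (mass m (u p))"
  "!!x ep j. u (0, x, ep) $ j = ep * f j x" "!!x ep j. dd et u (0, x, ep) $ j = ep * g j x"
  "!!t x ep. \<bar>x\<bar> > \<bar>t\<bar> + B ==> u (t, x, ep) = 0" "!!t x. u (t, x, 0) = 0"
proof -
 let ?P = "leftgoing :: 'n vec3 => _" and ?Q = "rightgoing :: 'n vec3 => _"
 define H where "H = kg_source m F"
 \<comment> \<open>Both characteristic derivatives have the source \<open>H\<close>; the third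
   component, travelling to the right, has \<open>u_t + u_x = p\<close> as its source.\<close>
 define G where "G = (%(pt :: real * real * real, y). (H y, H y, fst y))"
 define fv where "fv x = (\<chi> j. f j x)" for x
 define fv' where "fv' x = (\<chi> j. dd 1 (f j) x)" for x
 define gv where "gv x = (\<chi> j. g j x)" for x
 define U0 where "U0 = (%(x, ep::real). ep *R (gv x + fv' x, gv x - fv' x, fv x))"
 have Hk: "Ck k H" unfolding H_def by (rule Ck_kg_source[OF F])
 have Gk: "Ck k G" unfolding G_def case_prod_unfold
  by (intro Ck_Pair Ck_compose[OF Hk] Ck_fst Ck_snd Ck_id)
 obtain LH where LH: "LH >= 0" "!!y y'. norm (H y - H y') <= LH * norm (y - y')"
  using kg_source_lipschitz[OF L] unfolding H_def by blast
 have Glip: "norm (G (pt, y) - G (pt, y')) <= (2 * LH + 1) * norm (y - y')" for pt y y'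
 proof -
  have "norm (G (pt, y) - G (pt, y')) <= norm (H y - H y') + (norm (H y - H y') + norm (fst (y - y')))"
  proof -
   have "G (pt, y) - G (pt, y') = (H y - H y', H y - H y', fst (y - y'))" by (simp add: G_def)
   then show ?thesis
    using norm_Pair_le[of "H y - H y'" "(H y - H y', fst (y - y'))"] norm_Pair_le[of "H y - H y'" "fst (y - y')"]
    by simp
  qed
  also have "... <= LH * norm (y - y') + (LH * norm (y - y') + norm (y - y'))"
   by (intro add_mono LH norm_fst_snd_le)
  finally show ?thesis by (simp add: algebra_simps)
 qed
 have lipG: "kg.lip G"
  unfolding kg.lip_def using Glip LH by (auto intro!: exI[of _ "2 * LH + 1"])
 have U0k: "Ck k U0"
  unfolding U0_def case_prod_unfold fv_def fv'_def gv_def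
  by (intro Ck_scaleR Ck_Pair Ck_add Ck_diff Ck_vec_lambda Ck_snd Ck_id
    Ck_compose[OF smooth_real_derivative(2)[OF fs]] Ck_compose[OF smooth_real_derivative(3)[OF fs]]
    Ck_compose[OF smooth_real_derivative(2)[OF gs]] Ck_fst)
 obtain U where U: "continuous_on UNIV U" "kg.mild U0 (%p. G (p, U p)) U"
  using kg.mild_exists[OF Ck_continuous[OF Gk] lipG Ck_continuous[OF U0k]] by blast
 have Uk: "Ck k U" by (rule kg.mild_Ck[OF Gk lipG U0k U])
 obtain k2 where k2: "k = Suc (Suc k2)" using k by (metis Suc_le_D numeral_2_eq_2 Suc_le_mono)
 have cG: "continuous_on UNIV (%p. G (p, V p))" if "continuous_on UNIV V" for V
  by (intro continuous_on_compose2[OF Ck_continuous[OF Gk, of UNIV]] continuous_intros that) auto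
 have Ut: "dd et U p = ?P (dd ex U p) - ?Q (dd ex U p) + G (p, U p)" for p
 proof -
  obtain t zt where p: "p = (t, zt)" by (rule prod.exhaust)
  have VW: "((%h. U (t, zt + h *R (1, 0))) hvd dd ex U (t, zt)) (at 0)" for t zt
   using dd_along_line[OF Uk[unfolded k2], of "(t, zt)" ex 0] by (simp add: ex_def zero_prod_def[symmetric])
  have "((%s. U (s, zt)) hvd ?P (dd ex U (t, zt)) - ?Q (dd ex U (t, zt)) + G ((t, zt), U (t, zt))) (at t)"
   using kg.mild_time_derivative[OF cG[OF U(1)] U(2) Ck_continuous[OF Ck_dd[OF Uk[unfolded k2]]] VW] .
  moreover have "((%s. U (s, zt)) hvd dd et U (t, zt)) (at t)"
   using dd_along_line[OF Uk[unfolded k2], of "(0, zt)" et t] by (simp add: et_def zero_prod_def[symmetric])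
  ultimately show ?thesis unfolding p by (rule vector_derivative_unique_at[rotated])
 qed
 define pp where "pp = (%y. fst (U y))"
 define q where "q = (%y. fst (snd (U y)))"
 define u where "u = (%y. snd (snd (U y)))"
 have ck: "Ck k pp" "Ck k q" "Ck k u"
  unfolding pp_def q_def u_def by (intro Ck_fst Ck_snd Uk)+
 have Ck1: "Ck (Suc (Suc k2)) U" using Uk k2 by simp
 have comp: "dd v pp y = fst (dd v U y)" "dd v q y = fst (snd (dd v U y))" "dd v u y = snd (snd (dd v U y))" for v y
  unfolding pp_def q_def u_def
  using dd_linear_compose[OF bounded_linear_fst Ck1]
   dd_linear_compose[OF bounded_linear_fst_comp[OF bounded_linear_snd] Ck1]
   dd_linear_compose[OF bounded_linear_snd_comp[OF bounded_linear_snd] Ck1] by simp_all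
 have eqs: "dd et pp y = dd ex pp y + H (U y)" "dd et q y = H (U y) - dd ex q y" "dd et u y = pp y - dd ex u y" for y
  unfolding comp Ut by (simp_all add: leftgoing_def rightgoing_def G_def pp_def)
 have c2: "Ck 2 u" "Ck 1 u" "Ck 1 pp" "Ck 1 q"
  by (rule Ck_mono[OF ck(3)] Ck_mono[OF ck(1)] Ck_mono[OF ck(2)]; use k in simp)+
 have c11: "Ck (Suc 0) pp" "Ck (Suc 0) q" "Ck (Suc 0) (dd v u)" "Ck (Suc 0) u" for v
  using c2 Ck_dd[of "Suc 0" u v] by (simp_all add: numeral_2_eq_2)
 have dadd: "dd v (%y. a y - b y) y = dd v a y - dd v b y" if "Ck (Suc 0) a" "Ck (Suc 0) b"
  for v y and a b :: "real * real * real => real ^ 'n"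
  using dd_eq[OF has_derivative_diff[OF Ck_has_derivative[OF that(1)] Ck_has_derivative[OF that(2)]]] by simp
 have utt: "dd et (dd et u) y - dd ex (dd ex u) y = H (U y)" for y
 proof -
  have "dd et (dd et u) y = dd et (%y. pp y - dd ex u y) y"
   by (rule arg_cong[where f="%h. dd et h y"]) (simp add: eqs fun_eq_iff)
  also have "... = dd et pp y - dd et (dd ex u) y" by (rule dadd[OF c11(1,3)])
  also have "dd et (dd ex u) y = dd ex (dd et u) y" by (rule dd_commute[OF c2(1)])
  also have "... = dd ex (%y. pp y - dd ex u y) y"
   by (rule arg_cong[where f="%h. dd ex h y"]) (simp add: eqs fun_eq_iff)
  also have "... = dd ex pp y - dd ex (dd ex u) y" by (rule dadd[OF c11(1,3)])
  finally show ?thesis using eqs(1)[of y] by simp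
 qed
 have init: "U (0, zt) = U0 zt" for zt
  by (rule kg.mild_initial[OF U(2)])
 have ux0: "dd ex u (0, x, ep) = ep *R fv' x" for x ep
 proof -
  have "((%h. u (0, h, ep)) hvd dd ex u (0, x, ep)) (at x)"
   using dd_along_line[OF c11(4), of "(0, 0, ep)" ex x] by (simp add: ex_def)
  then have "((%h. u (0, h, ep) $ j) hrd dd ex u (0, x, ep) $ j) (at x)" for j
   unfolding has_real_derivative_iff_has_vector_derivative
   by (rule bounded_linear.has_vector_derivative[OF bounded_linear_vec_nth])
  moreover have "((%h. u (0, h, ep) $ j) hrd ep * dd 1 (f j) x) (at x)" for j
   unfolding u_def init by (simp add: U0_def fv_def DERIV_cmult smooth_real_derivative(1)[OF fs])
  ultimately have "dd ex u (0, x, ep) $ j = ep * dd 1 (f j) x" for j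
   using DERIV_unique by blast
  then show ?thesis by (simp add: vec_eq_iff fv'_def)
 qed
 have ut0: "dd et u (0, x, ep) = ep *R gv x" for x ep
  unfolding eqs(3) ux0 unfolding pp_def init by (simp add: U0_def algebra_simps)
 \<comment> \<open>The constraint. Subtracting the equations for \<open>u\<close> and
   \<open>q\<close> shows that it is constant along \<open>et + ex\<close>, and it vanishes at time
   0 by the choice of the data.\<close>
 define r where "r y = (dd et u y - dd ex u y) - q y" for y
 have r1: "Ck (Suc 0) r" unfolding r_def by (intro Ck_diff c11)
 have "dd (et + ex) r y = 0" for y
 proof -
  have lin: "linear (%v. dd v r y)" using Ck_has_derivative[OF r1] has_derivative_linear by blast
  have dr: "dd v r y = (dd v (dd et u) y - dd v (dd ex u) y) - dd v q y" for v
   unfolding r_def by (simp add: dadd c11 Ck_diff)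
  have "dd (et + ex) r y = dd et r y + dd ex r y" using linear_add[OF lin] .
  also have "... = (dd et (dd et u) y - dd ex (dd ex u) y) - (dd et q y + dd ex q y)"
   unfolding dr using dd_commute[OF c2(1), where w=ex and v=et and x=y] by (simp add: algebra_simps)
  finally show ?thesis using utt[of y] eqs(2)[of y] by simp
 qed
 then have "((%h. r (y + h *R (et + ex))) has_derivative (%h. 0)) (at h)" for y h
  using dd_along_line[OF r1, of y "et + ex" h] by (simp add: has_vector_derivative_def)
 then have "\<exists>c. \<forall>h\<in>UNIV. r (y + h *R (et + ex)) = c" for y
  by (rule has_derivative_zero_constant[OF convex_UNIV])
 then have rc: "r (y + h *R (et + ex)) = r (y + 0 *R (et + ex))" for y h
  by (metis UNIV_I)
 have r0: "r y = 0" for y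
 proof -
  obtain t x ep where y: "y = (t, x, ep)" by (metis prod.exhaust)
  have "r y = r (0, x - t, ep)"
   using rc[of "(0, x - t, ep)" t] by (simp add: y et_def ex_def)
  also have "... = 0"
   unfolding r_def ut0 ux0 unfolding q_def init by (simp add: U0_def algebra_simps)
  finally show ?thesis .
 qed
 have H_eq: "H (U y) = F (u y, dd et u y, dd ex u y) - mass m (mass m (u y))" for y
 proof -
  have q: "q y = dd et u y - dd ex u y" using r0[of y] by (simp add: r_def)
  have pp: "pp y = dd et u y + dd ex u y" using eqs(3)[of y] by simp
  have "(1/2) *R (pp y + q y) = dd et u y" "(1/2) *R (pp y - q y) = dd ex u y"
   unfolding q pp by (simp_all add: algebra_simps flip: scaleR_left_distrib)
  then show ?thesis by (simp add: H_def kg_source_def case_prod_unfold pp_def q_def u_def)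
 qed
 have H0: "H 0 = 0"
  by (simp add: H_def kg_source_def case_prod_unfold zero_prod_def[symmetric] F0
    linear_0[OF bounded_linear.linear[OF bounded_linear_mass]])
 have Gb: "norm (G (pt, y)) <= 0 + (2 * LH + 1) * norm y" for pt y
  using Glip[of pt y 0] H0 by (simp add: G_def zero_prod_def[symmetric])
 have zero: "V p = 0" if V: "continuous_on UNIV V" "kg.mild V0 (%p. G (p, V p)) V"
  and V0: "!!p. p : diamond zt0 R ==> kg.free V0 p = 0" and p: "p : diamond zt0 R" and R: "R >= 0" for V V0 zt0 R p
 proof -
  have "norm (V p) <= 2 * (0 + 2 * 0 * R) * exp ((4 * (2 * LH + 1) + 1) * R)"
  proof (rule kg.gronwall[OF V(1) cG[OF V(1)] R _ order_refl _ _ _ p])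
   show "V p = kg.free V0 p + kg.duh (%p. G (p, V p)) p" for p
    using V(2) unfolding kg.mild_def by blast
  qed (use LH V0 Gb in auto)
  then show ?thesis by simp
 qed
 have supp: "u (t, x, ep) = 0" if x: "\<bar>x\<bar> > \<bar>t\<bar> + B" for t x ep
 proof -
  have U00: "U0 zt = 0" if "\<bar>fst zt\<bar> > B" for zt
  proof -
   have o: "open {x :: real. \<bar>x\<bar> > B}" by (intro open_Collect_less continuous_intros)
   have "dd 1 (f j) x = 0" if "\<bar>x\<bar> > B" for j x
    using dd_eq[OF has_derivative_transform_within_open[OF has_derivative_const[of 0] o, of x "f j"]] that B by auto
   then show ?thesis using B that by (simp add: U0_def case_prod_unfold fv_def fv'_def gv_def vec_eq_iff zero_prod_def)
  qed
  \<comment> \<open>Finite propagation speed: every ray from the domain of dependence of this point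
    meets time 0 at distance more than \<open>B\<close> from the origin, where the data
    vanish.\<close>
  have "U (t, x, ep) = 0"
  proof (rule zero[OF U, of "(x, ep)" "\<bar>t\<bar>"])
   fix p assume p: "p : diamond (x, ep) \<bar>t\<bar>"
   obtain s y d where p': "p = (s, y, d)" by (metis prod.exhaust)
   have "\<bar>y - x\<bar> <= norm (snd p - (x, ep))"
    using norm_fst_le[of "y - x" "d - ep"] by (simp add: p')
   then have "\<bar>s\<bar> + \<bar>y - x\<bar> <= \<bar>t\<bar>" using p by (simp add: diamond_def p')
   then have "\<bar>y + s\<bar> > B" "\<bar>y - s\<bar> > B" using x by linarith+
   then show "kg.free U0 p = 0" by (simp add: kg.free_def p' U00 leftgoing_def rightgoing_def zero_prod_def)
  qed (auto simp: diamond_def)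
  then show ?thesis by (simp add: u_def)
 qed
 have eps0: "u (t, x, 0) = 0" for t x
 proof -
  \<comment> \<open>Freezing the parameter at 0 gives a solution with zero data everywhere, to which
    the Gronwall estimate applies; the restriction alone is not a function on the space of the
    transport system.\<close>
  define V where "V p = U (fst p, fst (snd p), 0)" for p :: "real * real * real"
  have "V (t, x, 0) = 0"
  proof (rule zero[of V "%_. 0" "(x, 0)" "\<bar>t\<bar>"])
   show "continuous_on UNIV V"
    unfolding V_def by (intro continuous_on_compose2[OF U(1)] continuous_intros) auto
   show "kg.mild (%_. 0) (%p. G (p, V p)) V"
    unfolding kg.mild_def
   proof
    fix p
    have "V p = kg.free U0 (fst p, fst (snd p), 0) + kg.duh (%p. G (p, U p)) (fst p, fst (snd p), 0)"
     unfolding V_def using U(2) unfolding kg.mild_def by blast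
    also have "kg.free U0 (fst p, fst (snd p), 0) = kg.free (%_. 0) p"
     by (simp add: kg.free_def U0_def case_prod_unfold zero_prod_def[symmetric])
    also have "kg.duh (%p. G (p, U p)) (fst p, fst (snd p), 0) = kg.duh (%p. G (p, V p)) p"
     unfolding kg.duh_def kg.ray_def by (simp add: case_prod_unfold V_def G_def)
    finally show "V p = kg.free (%_. 0) p + kg.duh (%p. G (p, V p)) p" .
   qed
  qed (auto simp: diamond_def kg.free_def leftgoing_def rightgoing_def zero_prod_def)
  then show ?thesis by (simp add: u_def V_def)
 qed
 show ?thesis
 proof (rule that[of u])
  show "Ck k u" by (rule ck)
  show "dd et (dd et u) p - dd ex (dd ex u) p = F (u p, dd et u p, dd ex u p) - mass m (mass m (u p))" for p
   unfolding utt H_eq ..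
  show "u (0, x, ep) $ j = ep * f j x" for x ep j
   unfolding u_def init by (simp add: U0_def fv_def)
  show "dd et u (0, x, ep) $ j = ep * g j x" for x ep j
   unfolding ut0 by (simp add: gv_def)
 qed (use supp eps0 in auto)
qed

section \<open>Weighted inequalities in the hyperbolic variable\<close>

lemma integral_Cauchy_Schwarz:
 fixes f g :: "real => real"
 assumes f: "continuous_on {a..b} f" and g: "continuous_on {a..b} g"
 shows "integral {a..b} (%x. f x * g x) <= sqrt (integral {a..b} (%x. (f x)\<^sup>2)) * sqrt (integral {a..b} (%x. (g x)\<^sup>2))"
proof -
 define A where "A = integral {a..b} (%x. (f x)\<^sup>2)"
 define B where "B = integral {a..b} (%x. f x * g x)"
 define C where "C = integral {a..b} (%x. (g x)\<^sup>2)"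
 have iA: "(%x. (f x)\<^sup>2) integrable_on {a..b}" and iB: "(%x. f x * g x) integrable_on {a..b}"
  and iC: "(%x. (g x)\<^sup>2) integrable_on {a..b}"
  by (intro integrable_continuous_real continuous_intros f g)+
 have A: "A >= 0" and C: "C >= 0" unfolding A_def C_def by (intro integral_nonneg iA iC; simp)+
 have quad: "0 <= A - 2 * l * B + l^2 * C" for l
 proof -
  have "((%x. (f x)\<^sup>2 - (2 * l) * (f x * g x) + l^2 * (g x)^2) has_integral A - (2 * l) * B + l^2 * C) {a..b}"
   unfolding A_def B_def C_def
   by (intro has_integral_add has_integral_diff has_integral_mult_right integrable_integral iA iB iC)
  moreover have "0 <= (f x)^2 - (2 * l) * (f x * g x) + l^2 * (g x)^2" for x
   using zero_le_power2[of "f x - l * g x"] by (simp add: power2_diff power_mult_distrib mult_ac)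
  ultimately show ?thesis
   by (rule has_integral_nonneg)
 qed
 have "B^2 <= A * C"
 proof (cases "C = 0")
  case True
  have "B = 0"
  proof (rule ccontr)
   assume "B ~= 0"
   then show False using quad[of "(A + 1) / (2 * B)"] True by simp
  qed
  then show ?thesis using A C by simp
 next
  case False
  then show ?thesis using quad[of "B / C"] C by (simp add: field_simps power2_eq_square)
 qed
 then have "B <= sqrt (A * C)" by (rule real_le_rsqrt)
 then show ?thesis by (simp add: A_def B_def C_def real_sqrt_mult)
qed

text \<open>The exponent 3/2 is chosen so that the square of the weight dominates cosh^3: each of
  the three jets in the nonlinearity costs a factor cosh z, and a product of three weighted
  quantities has two weights to spare. The same relation later turns the weighted bound into decay
  in t.\<close>

definition om :: "real => real" where "om z = cosh (3/2 * z)"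
definition om' :: "real => real" where "om' z = 3/2 * sinh (3/2 * z)"

lemma om_pos: "om z > 0" and om_ge_1: "om z >= 1"
 by (simp_all add: om_def cosh_real_pos cosh_real_ge_1)

lemma om_derivative: "(om hrd om' z) (at z within S)"
 unfolding om_def[abs_def] om'_def by (auto intro!: derivative_eq_intros)

lemma om'_bound: "\<bar>om' z\<bar> <= 3/2 * om z"
proof -
 have "\<bar>sinh x\<bar> <= cosh x" for x :: real
 proof -
  have "sinh x <= cosh x" "- sinh x <= cosh x" by (simp_all add: sinh_def cosh_def field_simps)
  then show ?thesis by linarith
 qed
 then show ?thesis by (simp add: om_def om'_def abs_mult)
qed

lemma continuous_om [continuous_intros]: "continuous_on S om" "continuous_on S om'"
 unfolding om_def[abs_def] om'_def[abs_def] by (intro continuous_intros)+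

lemma cosh_cubed_le_om: "cosh z ^ 3 <= 4 * (om z)^2"
proof -
 have "cosh z = cosh \<bar>z\<bar>" "om z = om \<bar>z\<bar>" by (auto simp: om_def abs_if)
 moreover have "cosh y ^ 3 <= 4 * (om y)^2" if y: "y >= 0" for y
 proof -
  have "cosh y <= exp y" using y by (simp add: cosh_def)
  then have "cosh y ^ 3 <= exp y ^ 3" by (intro power_mono) (auto simp: cosh_real_nonneg)
  also have "... = 4 * (exp (3/2 * y) / 2)^2"
   by (simp add: power_divide exp_of_nat_mult[symmetric] power2_eq_square exp_add[symmetric])
  also have "... <= 4 * (om y)^2"
   by (intro mult_left_mono power_mono) (auto simp: om_def cosh_def)
  finally show ?thesis .
 qed
 ultimately show ?thesis by (metis abs_ge_zero)
qed

definition wL2 :: "real => (real => 'b::real_normed_vector) => real" where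
 "wL2 R h = integral {-R..R} (%z. (om z)\<^sup>2 * (norm (h z))^2)"

lemma wL2_integrable: "continuous_on UNIV h ==> (%z. (om z)\<^sup>2 * (norm (h z))^2) integrable_on {-R..R}"
 by (intro integrable_continuous_real continuous_intros) (auto intro: continuous_on_subset)

lemma wL2_nonneg: "wL2 R h >= 0"
 unfolding wL2_def by (cases "(%z. (om z)\<^sup>2 * (norm (h z))^2) integrable_on {-R..R}")
  (auto intro: integral_nonneg simp: not_integrable_integral)

lemma wL2_Cauchy_Schwarz:
 assumes "continuous_on UNIV h" "continuous_on UNIV k"
 shows "integral {-R..R} (%z. (om z)\<^sup>2 * (norm (h z) * norm (k z))) <= sqrt (wL2 R h) * sqrt (wL2 R k)"
proof -
 have "continuous_on {-R..R} (%z. om z * norm (h z))" "continuous_on {-R..R} (%z. om z * norm (k z))"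
  by (intro continuous_intros continuous_on_subset[OF assms(1)] continuous_on_subset[OF assms(2)]; simp)+
 from integral_Cauchy_Schwarz[OF this] show ?thesis
  unfolding wL2_def by (simp add: power_mult_distrib power2_eq_square mult_ac)
qed

lemma inner_self_derivative:
 fixes g :: "real => 'b::real_inner"
 assumes "(g hvd g') (at x within S)"
 shows "((%x. g x \<bullet> g x) hrd 2 * (g x \<bullet> g')) (at x within S)"
 using bounded_bilinear.has_vector_derivative[OF bounded_bilinear_inner assms assms]
 by (simp add: has_real_derivative_iff_has_vector_derivative inner_commute)

text \<open>The fundamental theorem for the square of the weighted function, started at the end
  point \<open>-R\<close>, where it vanishes. The weight is differentiated too and, changing at
  relative rate at most 3/2, contributes the term with factor 3.\<close>

lemma sobolev:
 fixes f f' :: "real => 'b::real_inner"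
 assumes f: "!!z. (f hvd f' z) (at z)" and c: "continuous_on UNIV f'"
  and supp: "!!z. \<bar>z\<bar> >= R ==> f z = 0"
 shows "(om z)^2 * (norm (f z))^2 <= 3 * wL2 R f + 2 * (sqrt (wL2 R f) * sqrt (wL2 R f'))"
proof (cases "\<bar>z\<bar> < R")
 case False
 then show ?thesis using supp[of z] wL2_nonneg[of R f] wL2_nonneg[of R f'] by simp
next
 case True
 have cf: "continuous_on UNIV f"
  using f by (auto intro!: continuous_at_imp_continuous_on has_vector_derivative_continuous)
 let ?g = "%z. 2 * om z * om' z * (f z \<bullet> f z) + (om z)^2 * (2 * (f z \<bullet> f' z))"
 let ?h = "%z. 3 * ((om z)^2 * (norm (f z))^2) + 2 * ((om z)^2 * (norm (f z) * norm (f' z)))"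
 have sub: "continuous_on A f" "continuous_on A f'" for A
  using cf c continuous_on_subset by blast+
 have ih: "?h integrable_on {-R..b}" for b
  by (intro integrable_continuous_real continuous_intros sub)
 have "((%z. (om z)\<^sup>2 * (f z \<bullet> f z)) hrd ?g z) (at z within A)" for z A
  by (rule derivative_eq_intros om_derivative inner_self_derivative[OF has_vector_derivative_at_within[OF f]] refl)+
   (simp add: algebra_simps)
 then have hi: "(?g has_integral (om z)\<^sup>2 * (f z \<bullet> f z) - (om (-R))\<^sup>2 * (f (-R) \<bullet> f (-R))) {-R..z}"
  using True by (intro fundamental_theorem_of_calculus) (auto simp: has_real_derivative_iff_has_vector_derivative)
 have ig: "?g integrable_on {-R..z}" by (rule has_integral_integrable[OF hi])
 have "f (-R) = 0" using supp[of "-R"] by simp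
 then have "(om z)^2 * (f z \<bullet> f z) = integral {-R..z} ?g"
  using integral_unique[OF hi] by simp
 moreover have "integral {-R..z} ?g <= integral {-R..z} ?h"
 proof (rule integral_le)
  show "?g x <= ?h x" for x
  proof -
   have "2 * om x * om' x * (f x \<bullet> f x) <= 2 * om x * (3/2 * om x) * (f x \<bullet> f x)"
    using om_pos[of x] om'_bound[of x] by (intro mult_right_mono mult_left_mono) auto
   moreover have "(om x)^2 * (2 * (f x \<bullet> f' x)) <= (om x)^2 * (2 * (norm (f x) * norm (f' x)))"
    using norm_cauchy_schwarz by (intro mult_left_mono) auto
   ultimately show ?thesis
    unfolding power2_norm_eq_inner by (simp add: power2_eq_square[of "om x"] algebra_simps)
  qed
 qed (rule ig ih)+
 moreover have "integral {-R..z} ?h <= integral {-R..R} ?h"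
  using True by (intro integral_subset_le ih) (auto intro!: add_nonneg_nonneg mult_nonneg_nonneg)
 moreover have "integral {-R..R} ?h = 3 * wL2 R f + 2 * integral {-R..R} (%z. (om z)\<^sup>2 * (norm (f z) * norm (f' z)))"
 proof -
  have "(%z. (om z)\<^sup>2 * (norm (f z) * norm (f' z))) integrable_on {-R..R}"
   by (intro integrable_continuous_real continuous_intros sub)
  then show ?thesis
   unfolding wL2_def using wL2_integrable[OF cf]
   by (subst integral_add) (auto intro: integrable_on_mult_right)
 qed
 ultimately show ?thesis
  using wL2_Cauchy_Schwarz[OF cf c, of R] by (simp add: power2_norm_eq_inner)
qed

text \<open>The inequality is linear for the square root of \<open>E\<close>, which need not be
  differentiable where \<open>E\<close> vanishes; so \<open>sqrt (E s + d)\<close> is used and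
  \<open>d\<close> tends to 0. Subtracting a particular solution gives the nonincreasing quantity
  \<open>Y\<close>, and \<open>l < ga\<close> keeps its coefficient positive.\<close>

lemma sqrt_gronwall:
 fixes E :: "real => real"
 assumes E: "!!s. s : {s0..S} ==> (E hrd D s) (at s within {s0..S})"
  and E0: "!!s. s : {s0..S} ==> E s >= 0"
  and D: "!!s. s : {s0..S} ==> D s <= 2 * l * E s + 2 * sqrt (E s) * (h * exp (ga * s))"
  and l: "0 <= l" "l < ga" and h: "h >= 0" and s: "s : {s0..S}"
 shows "sqrt (E s) <= exp (l * (s - s0)) * sqrt (E s0) + h / (ga - l) * exp (ga * s)"
proof -
 have main: "sqrt (E s) <= exp (l * (s - s0)) * sqrt (E s0 + d) + h / (ga - l) * exp (ga * s)" if d: "d > 0" for d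
 proof -
  define y where "y s = sqrt (E s + d)" for s
  define Y where "Y s = exp (- l * s) * y s - h / (ga - l) * exp ((ga - l) * s)" for s
  have y: "(y hrd D s / (2 * y s)) (at s within {s0..S})" if "s : {s0..S}" for s
  proof -
   have "((%s. E s + d) hrd D s) (at s within {s0..S})"
    using DERIV_add[OF E[OF that] DERIV_const] by simp
   moreover have "E s + d > 0" using E0[OF that] d by simp
   ultimately show ?thesis
    unfolding y_def[abs_def] by (auto intro!: DERIV_chain2[OF DERIV_real_sqrt, THEN DERIV_cong] simp: field_simps)
  qed
  have y_pos: "y s > 0" "E s <= (y s)^2" "sqrt (E s) <= y s" if "s : {s0..S}" for s
   using E0[OF that] d by (auto simp: y_def)
  have s0: "s0 : {s0..S}" "s0 <= s" using s by auto
  have "\<exists>x\<in>{s0..s}. Y s - Y s0 = (%k. (exp (- l * x) * (D x / (2 * y x) - l * y x) - h * exp ((ga - l) * x)) * k) (s - s0)"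
  proof (rule mvt_very_simple[OF s0(2)])
   fix x assume "s0 <= x" "x <= s"
   then have x: "x : {s0..S}" using s by auto
   have "(Y hrd exp (- l * x) * (D x / (2 * y x) - l * y x) - h * exp ((ga - l) * x)) (at x within {s0..S})"
    unfolding Y_def[abs_def]
    by (rule derivative_eq_intros y[OF x] refl)+ (use l y_pos(1)[OF x] in \<open>simp add: field_simps\<close>)
   then show "(Y has_derivative (%k. (exp (- l * x) * (D x / (2 * y x) - l * y x) - h * exp ((ga - l) * x)) * k)) (at x within {s0..s})"
    unfolding has_field_derivative_def by (rule has_derivative_subset) (use s in auto)
  qed
  then obtain x where x: "x : {s0..s}"
   and Yx: "Y s - Y s0 = (exp (- l * x) * (D x / (2 * y x) - l * y x) - h * exp ((ga - l) * x)) * (s - s0)" by blast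
  have xS: "x : {s0..S}" using x s by auto
  have "D x <= 2 * l * (y x)^2 + 2 * y x * (h * exp (ga * x))"
   using l h y_pos[OF xS] E0[OF xS] by (intro order_trans[OF D[OF xS]] add_mono mult_mono) auto
  then have "D x / (2 * y x) <= l * y x + h * exp (ga * x)"
   using y_pos(1)[OF xS] by (simp add: field_simps power2_eq_square)
  then have "exp (- l * x) * (D x / (2 * y x) - l * y x) <= exp (- l * x) * (h * exp (ga * x))"
   by (intro mult_left_mono) auto
  also have "... = h * exp ((ga - l) * x)" by (simp add: algebra_simps exp_diff exp_minus field_simps)
  finally have "Y s - Y s0 <= 0"
   unfolding Yx using s0 by (intro mult_nonpos_nonneg) auto
  then have "exp (- l * s) * y s <= exp (- l * s0) * y s0 + h / (ga - l) * exp ((ga - l) * s)"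
   using l h unfolding Y_def by (smt (verit) divide_nonneg_pos exp_ge_zero mult_nonneg_nonneg)
  then have "exp (l * s) * (exp (- l * s) * y s) <= exp (l * s) * (exp (- l * s0) * y s0 + h / (ga - l) * exp ((ga - l) * s))"
   by (intro mult_left_mono) auto
  moreover have "exp (l * s) * (exp (- l * s) * y s) = y s" by (simp add: exp_minus)
  moreover have "exp (l * s) * (exp (- l * s0) * y s0 + h / (ga - l) * exp ((ga - l) * s))
    = exp (l * (s - s0)) * y s0 + h / (ga - l) * exp (ga * s)"
   by (simp add: algebra_simps exp_diff exp_minus exp_add[symmetric] divide_simps)
  ultimately have "y s <= exp (l * (s - s0)) * y s0 + h / (ga - l) * exp (ga * s)" by metis
  from order_trans[OF y_pos(3)[OF s] this] show ?thesis by (simp only: y_def)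
 qed
 have "((%d. exp (l * (s - s0)) * sqrt (E s0 + d) + h / (ga - l) * exp (ga * s)) \<longlongrightarrow>
   exp (l * (s - s0)) * sqrt (E s0 + 0) + h / (ga - l) * exp (ga * s)) (at_right 0)"
  by (intro tendsto_intros)
 moreover have "\<forall>\<^sub>F d in at_right 0. sqrt (E s) <= exp (l * (s - s0)) * sqrt (E s0 + d) + h / (ga - l) * exp (ga * s)"
  using main by (simp add: eventually_at_right_less eventually_at_filter)
 ultimately show ?thesis
  using tendsto_lowerbound by fastforce
qed

text \<open>Were the value 2c reached, compactness would give a first time for it. Up to that time
  the weak bound holds, so \<open>step\<close> yields the strong bound c there, a contradiction. The
  maximum over z need never be shown continuous in s.\<close>

lemma bootstrap:
 fixes f :: "real * real => real"
 assumes f: "continuous_on ({s0..S} \<times> {-R..R}) f" and c: "c > 0"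
  and init: "!!z. z : {-R..R} ==> f (s0, z) < 2 * c"
  and step: "!!s'. s' : {s0..S} ==> (!!s z. s : {s0..s'} ==> z : {-R..R} ==> f (s, z) <= 2 * c) ==>
   (!!z. z : {-R..R} ==> f (s', z) <= c)"
  and s: "s : {s0..S}" and z: "z : {-R..R}"
 shows "f (s, z) <= c"
proof -
 let ?K = "{s0..S} \<times> {-R..R}"
 let ?A = "{p : ?K. f p : {2 * c..}}"
 have "closed (?K \<inter> f -` {2 * c..})"
  by (intro continuous_closed_preimage[OF f] closed_Times closed_atLeastAtMost closed_atLeast)
 moreover have "?K \<inter> f -` {2 * c..} = ?A" by auto
 ultimately have "closed ?A" by simp
 then have A: "compact ?A"
  using compact_Int_closed[of ?K ?A] by (auto simp: compact_Times Int_absorb1 intro!: Int_absorb1)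
 have "?A = {}"
 proof (rule ccontr)
  assume "?A ~= {}"
  moreover have "continuous_on ?A fst" by (intro continuous_intros)
  ultimately obtain p where p: "p : ?A" and min: "!!q. q : ?A ==> fst p <= fst q"
   using continuous_attains_inf[OF A] by blast
  obtain s1 z1 where p': "p = (s1, z1)" by fastforce
  have s1: "s1 : {s0..S}" "z1 : {-R..R}" "f (s1, z1) >= 2 * c" using p p' by auto
  have "s1 ~= s0" using init[of z1] s1 by auto
  then have lt: "s0 < s1" using s1 by auto
  have before: "f (s, z) <= 2 * c" if "s : {s0..s1}" "z : {-R..R}" for s z
  proof (cases "s < s1")
   case True
   then show ?thesis using min[of "(s, z)"] that s1 p' by force
  next
   case False
   then have s: "s = s1" using that by auto
   have "continuous_on {s0..s1} (%s. f (s, z))"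
    using that s1 by (intro continuous_on_compose2[OF f] continuous_intros) auto
   then have "((%s. f (s, z)) \<longlongrightarrow> f (s1, z)) (at s1 within {s0..s1})"
    using lt by (auto simp: continuous_on_def)
   \<comment> \<open>At the first time itself the weak bound holds as a limit of earlier
     values.\<close>
   then have lim: "((%s. f (s, z)) \<longlongrightarrow> f (s1, z)) (at_left s1)"
    using lt by (simp add: at_within_Icc_at_left)
   have "\<forall>\<^sub>F s in at_left s1. f (s, z) <= 2 * c"
    using eventually_at_left_real[OF lt]
   proof (rule eventually_mono)
    fix s assume "s : {s0<..<s1}"
    then show "f (s, z) <= 2 * c" using min[of "(s, z)"] that s1 p' by force
   qed
   from tendsto_upperbound[OF lim this] show ?thesis by (simp add: s)
  qed
  from step[OF s1(1) before s1(2)] s1(3) c show False by auto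
 qed
 then have "f (s', z') <= 2 * c" if "s' : {s0..S}" "z' : {-R..R}" for s' z'
  using that by force
 then show ?thesis using step[OF s _ z] s by auto
qed

section \<open>The weighted energy\<close>

lemma mass_inner: "mass m x \<bullet> y = x \<bullet> mass m y"
 by (simp add: inner_vec_def mass_def algebra_simps)

text \<open>The factor \<open>exp (- 2 * s)\<close> offsets the first-order term \<open>fs\<close>
  of the equation and the coefficient 1/4 its zeroth-order term. What remains in the derivative are
  terms of good sign, a divergence in z and the source.\<close>

definition energy :: "('n::finite => real) => real => (real * real => real ^ 'n) => (real * real => real ^ 'n)
  => (real * real => real ^ 'n) => real => real" where
 "energy m R f fz fs s = integral {-R..R} (%z. (om z)\<^sup>2 *
  (exp (- 2 * s) * (fs (s, z) \<bullet> fs (s, z) + fz (s, z) \<bullet> fz (s, z) + (1/4) * (f (s, z) \<bullet> f (s, z)))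
   + mass m (f (s, z)) \<bullet> mass m (f (s, z))))"

lemma continuous_on_pair_compose:
 "continuous_on UNIV h ==> continuous_on A a ==> continuous_on A b ==> continuous_on A (%x. h (a x, b x))"
 by (rule continuous_on_compose2[of UNIV h A "%x. (a x, b x)"]) (auto intro: continuous_on_Pair)

text \<open>The two bounds reflect that the weight \<open>om\<close> is not invariant under boosts: absorbing the
 resulting cross term costs a factor \<open>e\<^sup>1\<^sup>.\<^sup>1\<^sup>s\<close> in general, but nothing if one more derivative
 is under control.\<close>

lemma energy_inequality:
 fixes f fs fz fzz fsz N :: "real * real => real ^ 'n::finite"
 assumes f_s: "!!s z. ((%s. f (s, z)) hvd fs (s, z)) (at s)"
  and fz_s: "!!s z. ((%s. fz (s, z)) hvd fsz (s, z)) (at s)"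
  and fs_s: "!!s z. ((%s. fs (s, z)) has_vector_derivative
    fs (s, z) - (1/4) *R f (s, z) + fzz (s, z) - exp (2 * s) *R mass m (mass m (f (s, z))) + exp s *R N (s, z)) (at s)"
  and fz_z: "!!s z. ((%z. fz (s, z)) hvd fzz (s, z)) (at z)"
  and fs_z: "!!s z. ((%z. fs (s, z)) hvd fsz (s, z)) (at z)"
  and cont: "continuous_on UNIV f" "continuous_on UNIV fs" "continuous_on UNIV fz" "continuous_on UNIV fzz"
   "continuous_on UNIV fsz" "continuous_on UNIV N"
  and supp: "!!s z. s : {s0..S} ==> \<bar>z\<bar> >= R ==> fs (s, z) = 0" and R: "R >= 0"
 obtains D where "!!s. s : {s0..S} ==> (energy m R f fz fs hrd D s) (at s within {s0..S})"
  "!!s. s : {s0..S} ==> D s <= 2 * 1.1 * energy m R f fz fs s +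
    2 * sqrt (energy m R f fz fs s) * sqrt (wL2 R (%z. N (s, z)))"
  "!!s. s : {s0..S} ==> D s <= 2 * sqrt (energy m R f fz fs s) *
    (3 * exp (- s) * sqrt (wL2 R (%z. fz (s, z))) + sqrt (wL2 R (%z. N (s, z))))"
proof -
 let ?e = "%s z. (om z)\<^sup>2 * (exp (- 2 * s) * (fs (s, z) \<bullet> fs (s, z) + fz (s, z) \<bullet> fz (s, z) + (1/4) * (f (s, z) \<bullet> f (s, z)))
   + mass m (f (s, z)) \<bullet> mass m (f (s, z)))"
 let ?d = "%s z. (om z)\<^sup>2 * (- 2 * exp (- 2 * s) * (fz (s, z) \<bullet> fz (s, z) + (1/4) * (f (s, z) \<bullet> f (s, z)))
   + 2 * exp (- 2 * s) * (fzz (s, z) \<bullet> fs (s, z) + fz (s, z) \<bullet> fsz (s, z)) + 2 * exp (- s) * (N (s, z) \<bullet> fs (s, z)))"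
 have cm: "continuous_on A (%x. mass m (h x))" if "continuous_on A h" for A and h :: "'x::topological_space => real ^ 'n"
  using that by (rule bounded_linear.continuous_on[OF bounded_linear_mass])
 note ci = continuous_on_add continuous_on_diff continuous_on_mult continuous_on_power continuous_on_inner continuous_on_scaleR
  continuous_on_norm continuous_on_exp continuous_on_minus continuous_om continuous_om[THEN continuous_on_compose2, OF _ subset_UNIV]
  continuous_on_const continuous_on_id continuous_on_fst continuous_on_snd cm cont[THEN continuous_on_pair_compose]
 have e_deriv: "((%s. ?e s z) hrd ?d s z) (at s within A)" for s z A
 proof -
  note w = has_vector_derivative_at_within
  have mf: "((%s. mass m (f (s, z))) hvd mass m (fs (s, z))) (at s within A)"
   by (rule bounded_linear.has_vector_derivative[OF bounded_linear_mass w[OF f_s]])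
  have "((%s. ?e s z) hrd (om z)\<^sup>2 *
   ((- 2 * exp (- 2 * s)) * (fs (s, z) \<bullet> fs (s, z) + fz (s, z) \<bullet> fz (s, z) + (1/4) * (f (s, z) \<bullet> f (s, z))) +
   exp (- 2 * s) * (2 * (fs (s, z) \<bullet> (fs (s, z) - (1/4) *R f (s, z) + fzz (s, z) - exp (2 * s) *R mass m (mass m (f (s, z))) + exp s *R N (s, z)))
    + 2 * (fz (s, z) \<bullet> fsz (s, z)) + (1/4) * (2 * (f (s, z) \<bullet> fs (s, z))))
   + 2 * (mass m (f (s, z)) \<bullet> mass m (fs (s, z))))) (at s within A)"
   by (rule derivative_eq_intros inner_self_derivative[OF w[OF f_s]] inner_self_derivative[OF w[OF fs_s]]
     inner_self_derivative[OF w[OF fz_s]] inner_self_derivative[OF mf] refl)+ (simp add: algebra_simps)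
  moreover have "exp (- 2 * s) * exp (2 * s) = 1" "exp (- 2 * s) * exp s = exp (- s)"
   by (simp_all add: exp_add[symmetric])
  then have "exp (- 2 * s) * (fs (s, z) \<bullet> (exp (2 * s) *R mass m (mass m (f (s, z))))) = mass m (f (s, z)) \<bullet> mass m (fs (s, z))"
   "exp (- 2 * s) * (fs (s, z) \<bullet> (exp s *R N (s, z))) = exp (- s) * (N (s, z) \<bullet> fs (s, z))"
   using mass_inner[of m "fs (s, z)" "mass m (f (s, z))"]
   by (simp_all add: inner_commute mult.assoc[symmetric])
  ultimately show ?thesis
   by (elim DERIV_cong) (simp add: inner_add_right inner_diff_right inner_commute algebra_simps)
 qed
 define D where "D s = integral {-R..R} (?d s)" for s
 have DE: "(energy m R f fz fs hrd D s) (at s within {s0..S})" if "s : {s0..S}" for s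
 proof -
  have "((%s. integral (cbox (-R) R) (?e s)) has_field_derivative integral (cbox (-R) R) (?d s)) (at s within {s0..S})"
  proof (rule leibniz_rule_field_derivative[OF _ _ _ that])
   show "?e s integrable_on cbox (- R) R" for s
    by (intro integrable_continuous ci)
   show "continuous_on ({s0..S} \<times> cbox (- R) R) (%(s, z). ?d s z)"
    unfolding case_prod_unfold by (intro ci)
  qed (use e_deriv in auto)
  then show ?thesis by (simp add: energy_def[abs_def] D_def)
 qed
 let ?a = "%s z. exp (- s) *R fz (s, z)" and ?b = "%s z. exp (- s) *R fs (s, z)"
 \<comment> \<open>The integrand after integration by parts:
   \<open>fzz \<bullet> fs + fz \<bullet> fsz\<close> is a z-derivative, whose boundary terms vanish
   with \<open>fs\<close>; the weight that was differentiated leaves the cross term with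
   \<open>om z * om' z\<close>.\<close>
 let ?d' = "%s z. (om z)\<^sup>2 * (- 2 * exp (- 2 * s) * (fz (s, z) \<bullet> fz (s, z) + (1/4) * (f (s, z) \<bullet> f (s, z)))
   + 2 * exp (- s) * (N (s, z) \<bullet> fs (s, z))) - 4 * om z * om' z * exp (- 2 * s) * (fz (s, z) \<bullet> fs (s, z))"
 have D_eq: "D s = integral {-R..R} (?d' s)" "?d' s integrable_on {-R..R}" if s: "s : {s0..S}" for s
 proof -
  let ?q = "%z. 2 * exp (- 2 * s) * (2 * om z * om' z * (fz (s, z) \<bullet> fs (s, z))
    + (om z)^2 * (fzz (s, z) \<bullet> fs (s, z) + fz (s, z) \<bullet> fsz (s, z)))"
  have "((%z. 2 * exp (- 2 * s) * ((om z)^2 * (fz (s, z) \<bullet> fs (s, z)))) hrd ?q z) (at z within A)" for z A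
  proof -
   have "((%z. fz (s, z) \<bullet> fs (s, z)) hrd fz (s, z) \<bullet> fsz (s, z) + fzz (s, z) \<bullet> fs (s, z)) (at z within A)"
    unfolding has_real_derivative_iff_has_vector_derivative
    by (rule bounded_bilinear.has_vector_derivative[OF bounded_bilinear_inner
       has_vector_derivative_at_within[OF fz_z] has_vector_derivative_at_within[OF fs_z]])
   from DERIV_cmult[OF DERIV_mult[OF DERIV_power[OF om_derivative[of z A], where n=2] this], of "2 * exp (- 2 * s)"]
   show ?thesis by (elim DERIV_cong) (simp add: algebra_simps)
  qed
  then have "(?q has_integral 2 * exp (- 2 * s) * ((om R)^2 * (fz (s, R) \<bullet> fs (s, R)))
    - 2 * exp (- 2 * s) * ((om (-R))^2 * (fz (s, -R) \<bullet> fs (s, -R)))) {-R..R}"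
   using R by (intro fundamental_theorem_of_calculus) (auto simp: has_real_derivative_iff_has_vector_derivative)
  then have q0: "(?q has_integral 0) {-R..R}" using supp[OF s, of R] supp[OF s, of "-R"] by simp
  have "(?d s has_integral D s) {-R..R}"
   unfolding D_def by (intro integrable_integral integrable_continuous_real ci)
  from has_integral_diff[OF this q0] have "((%z. ?d s z - ?q z) has_integral D s) {-R..R}" by simp
  moreover have "(%z. ?d s z - ?q z) = ?d' s"
   by (rule ext) (simp add: algebra_simps)
  ultimately have "(?d' s has_integral D s) {-R..R}" by (simp only:)
  then show "D s = integral {-R..R} (?d' s)" "?d' s integrable_on {-R..R}"
   by (auto simp: has_integral_iff)
 qed
 have e2: "exp (- 2 * s) = exp (- s) * exp (- s)" for s :: real by (simp add: exp_add[symmetric])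
 have nb: "(norm (exp (- s) *R v))^2 = exp (- 2 * s) * (v \<bullet> v)" for s and v :: "real ^ 'n"
  unfolding power2_norm_eq_inner e2 by simp
 have wb: "wL2 R (?b s) <= energy m R f fz fs s" for s
  unfolding wL2_def energy_def
 proof (rule integral_le)
  show "(%z. (om z)\<^sup>2 * (norm (?b s z))^2) integrable_on {-R..R}"
   by (intro wL2_integrable ci)
  show "?e s integrable_on {-R..R}"
   by (intro integrable_continuous_real ci)
  show "(om z)^2 * (norm (?b s z))^2 <= ?e s z" for z
  proof (intro mult_left_mono)
   have "0 <= exp (- 2 * s) * (fz (s, z) \<bullet> fz (s, z))" "0 <= exp (- 2 * s) * (f (s, z) \<bullet> f (s, z))"
    "0 <= mass m (f (s, z)) \<bullet> mass m (f (s, z))" by simp_all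
   then show "(norm (?b s z))^2 <= exp (- 2 * s) * (fs (s, z) \<bullet> fs (s, z) + fz (s, z) \<bullet> fz (s, z) + (1/4) * (f (s, z) \<bullet> f (s, z)))
   + mass m (f (s, z)) \<bullet> mass m (f (s, z))"
    unfolding nb by (simp add: algebra_simps)
  qed simp
 qed
 have ints: "(%z. (om z)\<^sup>2 * (norm (?b s z) * norm (N (s, z)))) integrable_on {-R..R}"
  "(%z. (om z)\<^sup>2 * (norm (?b s z) * norm (fz (s, z)))) integrable_on {-R..R}"
  "?e s integrable_on {-R..R}" for s
  by (intro integrable_continuous_real ci)+
 have CS: "integral {-R..R} (%z. (om z)\<^sup>2 * (norm (?b s z) * norm (h (s, z)))) <=
   sqrt (energy m R f fz fs s) * sqrt (wL2 R (%z. h (s, z)))" if "continuous_on UNIV h" for s and h :: "real * real => real ^ 'n"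
 proof -
  have "continuous_on UNIV (?b s)" "continuous_on UNIV (%z. h (s, z))"
   by (intro ci continuous_on_pair_compose[OF that])+
  from wL2_Cauchy_Schwarz[OF this, of R] show ?thesis
   by (rule order_trans) (intro mult_right_mono real_sqrt_le_mono wb real_sqrt_ge_zero wL2_nonneg)
 qed
 have Nb: "2 * exp (- s) * (N (s, z) \<bullet> fs (s, z)) <= 2 * (norm (?b s z) * norm (N (s, z)))" for s z
  using norm_cauchy_schwarz[of "N (s, z)" "?b s z"] by (simp add: mult_ac)
 have cross: "- 4 * om z * om' z * exp (- 2 * s) * (fz (s, z) \<bullet> fs (s, z)) <= (om z)^2 * (6 * (norm (?a s z) * norm (?b s z)))" for s z
 proof -
  have "- 4 * om z * om' z * exp (- 2 * s) * (fz (s, z) \<bullet> fs (s, z)) = (4 * om z) * ((- om' z) * (?a s z \<bullet> ?b s z))"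
   unfolding e2 by (simp add: algebra_simps)
  also have "... <= (4 * om z) * ((3/2 * om z) * (norm (?a s z) * norm (?b s z)))"
  proof (intro mult_left_mono)
   have "(- om' z) * (?a s z \<bullet> ?b s z) <= \<bar>om' z\<bar> * \<bar>?a s z \<bullet> ?b s z\<bar>"
    by (metis abs_ge_self abs_minus_cancel abs_mult)
   also have "... <= (3/2 * om z) * (norm (?a s z) * norm (?b s z))"
    using om'_bound[of z] Cauchy_Schwarz_ineq2[of "?a s z" "?b s z"] om_pos[of z] by (intro mult_mono) auto
   finally show "- om' z * (?a s z \<bullet> ?b s z) <= 3 / 2 * om z * (norm (?a s z) * norm (?b s z))" .
  qed (use om_pos[of z] in simp)
  finally show ?thesis by (simp add: power2_eq_square mult_ac)
 qed
 show ?thesis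
 proof (rule that[OF DE])
  fix s assume s: "s : {s0..S}"
  have "D s <= integral {-R..R} (%z. 2 * 1.1 * ?e s z + 2 * ((om z)^2 * (norm (?b s z) * norm (N (s, z)))))"
   unfolding D_eq(1)[OF s]
  proof (rule integral_le[OF D_eq(2)[OF s]])
   show "(%z. 2 * 1.1 * ?e s z + 2 * ((om z)^2 * (norm (?b s z) * norm (N (s, z))))) integrable_on {-R..R}"
    by (intro integrable_add integrable_on_mult_right ints)
   fix z
   define x y where "x = norm (?a s z)" and "y = norm (?b s z)"
   have xy: "x^2 = exp (- 2 * s) * (fz (s, z) \<bullet> fz (s, z))" "y^2 = exp (- 2 * s) * (fs (s, z) \<bullet> fs (s, z))"
    unfolding x_def y_def nb by simp_all
   have "- 2 * x^2 + 6 * (x * y) <= 2 * 1.1 * (x^2 + y^2)"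
   proof -
    \<comment> \<open>The claim amounts to 30xy <= 21x^2 + 11y^2, a positive form since 21 * 11 >
      15^2; the rate 1.1 is a round value slightly above the optimal one.\<close>
    have "0 <= (21 * x - 15 * y)^2" by simp
    then have "0 <= 441 * x^2 - 630 * (x * y) + 225 * y^2" by (simp add: power2_eq_square algebra_simps)
    moreover have "0 <= y^2" by simp
    ultimately have "30 * (x * y) <= 21 * x^2 + 11 * y^2" by linarith
    then show ?thesis by simp
   qed
   then have "(om z)^2 * (- 2 * x^2 + 6 * (x * y)) <= (om z)^2 * (2 * 1.1 * (x^2 + y^2))"
    by (intro mult_left_mono) auto
   moreover have "0 <= (om z)^2 * (exp (- 2 * s) * (f (s, z) \<bullet> f (s, z)))" "0 <= (om z)^2 * (mass m (f (s, z)) \<bullet> mass m (f (s, z)))"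
    by simp_all
   moreover have "(om z)^2 * (2 * exp (- s) * (N (s, z) \<bullet> fs (s, z))) <= (om z)^2 * (2 * (norm (?b s z) * norm (N (s, z))))"
    using Nb[of s z] by (intro mult_left_mono) auto
   moreover have "?d' s z = (om z)^2 * (- 2 * x^2 + 6 * (x * y)) - (om z)\<^sup>2 * (6 * (norm (?a s z) * norm (?b s z)))
     + - 4 * om z * om' z * exp (- 2 * s) * (fz (s, z) \<bullet> fs (s, z))
     - (1/2) * ((om z)^2 * (exp (- 2 * s) * (f (s, z) \<bullet> f (s, z)))) + (om z)^2 * (2 * exp (- s) * (N (s, z) \<bullet> fs (s, z)))"
    unfolding xy unfolding x_def y_def by (simp add: algebra_simps del: norm_scaleR)
   moreover have "2 * 1.1 * ?e s z + 2 * ((om z)^2 * (norm (?b s z) * norm (N (s, z)))) =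
     (om z)^2 * (2 * 1.1 * (x^2 + y^2)) + (11/20) * ((om z)^2 * (exp (- 2 * s) * (f (s, z) \<bullet> f (s, z))))
     + (22/10) * ((om z)^2 * (mass m (f (s, z)) \<bullet> mass m (f (s, z)))) + (om z)^2 * (2 * (norm (?b s z) * norm (N (s, z))))"
    unfolding xy by (simp add: algebra_simps del: norm_scaleR)
   ultimately show "?d' s z <= 2 * 1.1 * ?e s z + 2 * ((om z)^2 * (norm (?b s z) * norm (N (s, z))))"
    using cross[of z s] by linarith
  qed
  also have "... = 2 * 1.1 * energy m R f fz fs s + 2 * integral {-R..R} (%z. (om z)\<^sup>2 * (norm (?b s z) * norm (N (s, z))))"
   unfolding energy_def by (subst integral_add, rule integrable_on_mult_right, rule ints, rule integrable_on_mult_right,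
     rule ints, simp only: integral_mult_right)
  finally show "D s <= 2 * 1.1 * energy m R f fz fs s + 2 * sqrt (energy m R f fz fs s) * sqrt (wL2 R (%z. N (s, z)))"
   using CS[OF cont(6), of s] by simp
  have "D s <= integral {-R..R} (%z. 6 * exp (- s) * ((om z)^2 * (norm (?b s z) * norm (fz (s, z))))
    + 2 * ((om z)^2 * (norm (?b s z) * norm (N (s, z)))))"
   unfolding D_eq(1)[OF s]
  proof (rule integral_le[OF D_eq(2)[OF s]])
   show "(%z. 6 * exp (- s) * ((om z)^2 * (norm (?b s z) * norm (fz (s, z))))
    + 2 * ((om z)^2 * (norm (?b s z) * norm (N (s, z))))) integrable_on {-R..R}"
    by (intro integrable_add integrable_on_mult_right ints)
   fix z
   have "0 <= (om z)^2 * (exp (- 2 * s) * (f (s, z) \<bullet> f (s, z)))" "0 <= (om z)^2 * (exp (- 2 * s) * (fz (s, z) \<bullet> fz (s, z)))"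
    by simp_all
   moreover have "(om z)^2 * (2 * exp (- s) * (N (s, z) \<bullet> fs (s, z))) <= (om z)^2 * (2 * (norm (?b s z) * norm (N (s, z))))"
    using Nb[of s z] by (intro mult_left_mono) auto
   moreover have "?d' s z = - 4 * om z * om' z * exp (- 2 * s) * (fz (s, z) \<bullet> fs (s, z))
     - 2 * ((om z)^2 * (exp (- 2 * s) * (fz (s, z) \<bullet> fz (s, z))))
     - (1/2) * ((om z)^2 * (exp (- 2 * s) * (f (s, z) \<bullet> f (s, z)))) + (om z)^2 * (2 * exp (- s) * (N (s, z) \<bullet> fs (s, z)))"
    by (simp add: algebra_simps)
   moreover have "6 * exp (- s) * ((om z)^2 * (norm (?b s z) * norm (fz (s, z)))) = (om z)^2 * (6 * (norm (?a s z) * norm (?b s z)))"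
    by simp
   moreover have "2 * ((om z)^2 * (norm (?b s z) * norm (N (s, z)))) = (om z)^2 * (2 * (norm (?b s z) * norm (N (s, z))))"
    by simp
   ultimately show "?d' s z <= 6 * exp (- s) * ((om z)^2 * (norm (?b s z) * norm (fz (s, z))))
    + 2 * ((om z)^2 * (norm (?b s z) * norm (N (s, z))))"
    using cross[of z s] by linarith
  qed
  also have "... = 6 * exp (- s) * integral {-R..R} (%z. (om z)\<^sup>2 * (norm (?b s z) * norm (fz (s, z))))
    + 2 * integral {-R..R} (%z. (om z)\<^sup>2 * (norm (?b s z) * norm (N (s, z))))"
   by (subst integral_add, rule integrable_on_mult_right, rule ints, rule integrable_on_mult_right,
     rule ints, simp only: integral_mult_right)
  also have "... <= 6 * exp (- s) * (sqrt (energy m R f fz fs s) * sqrt (wL2 R (%z. fz (s, z))))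
    + 2 * (sqrt (energy m R f fz fs s) * sqrt (wL2 R (%z. N (s, z))))"
   by (intro add_mono mult_left_mono CS cont) auto
  finally show "D s <= 2 * sqrt (energy m R f fz fs s) *
    (3 * exp (- s) * sqrt (wL2 R (%z. fz (s, z))) + sqrt (wL2 R (%z. N (s, z))))"
   by (simp add: algebra_simps)
 qed
qed

section \<open>The equation in hyperbolic coordinates\<close>

lemma dd_eq_0_open:
 assumes "open X" "!!y. y : X ==> h y = 0" "y : X"
 shows "dd v h y = 0"
proof -
 have "(h has_derivative (%v. 0)) (at y)"
  by (rule has_derivative_transform_within_open[OF has_derivative_const[of 0] assms(1,3)]) (use assms(2) in auto)
 then show ?thesis by (rule dd_eq)
qed

text \<open>\<open>T1\<close>, \<open>T2\<close> and \<open>T3\<close> are the first three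
  derivatives of \<open>F\<close> along a curve with value \<open>J0\<close> and derivatives
  \<open>J1\<close>, \<open>J2\<close>, \<open>J3\<close> (Faa di Bruno). Each is built from the
  previous one applied to \<open>dd b F\<close>, so that only derivatives in fixed directions
  appear.\<close>

definition T1 :: "('a::euclidean_space => 'b::euclidean_space) => 'a => 'a => 'b" where
 "T1 F J0 J1 = (\<Sum>b\<in>Basis. (J1 \<bullet> b) *R dd b F J0)"

definition T2 :: "('a::euclidean_space => 'b::euclidean_space) => 'a => 'a => 'a => 'b" where
 "T2 F J0 J1 J2 = (\<Sum>b\<in>Basis. (J2 \<bullet> b) *R dd b F J0 + (J1 \<bullet> b) *R T1 (dd b F) J0 J1)"

definition T3 :: "('a::euclidean_space => 'b::euclidean_space) => 'a => 'a => 'a => 'a => 'b" where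
 "T3 F J0 J1 J2 J3 = (\<Sum>b\<in>Basis. (J3 \<bullet> b) *R dd b F J0 + (J2 \<bullet> b) *R T1 (dd b F) J0 J1
  + ((J2 \<bullet> b) *R T1 (dd b F) J0 J1 + (J1 \<bullet> b) *R T2 (dd b F) J0 J1 J2))"

lemma T1_derivative:
 assumes F: "Ck 1 F" and J: "(J0 hvd J1) (at z)"
 shows "((%z. F (J0 z)) hvd T1 F (J0 z) J1) (at z)"
proof -
 have 1: "Ck (Suc 0) F" using F by simp
 have "((%z. F (J0 z)) has_derivative (%h. dd (h *R J1) F (J0 z))) (at z)"
  using has_derivative_compose[OF J[unfolded has_vector_derivative_def] Ck_has_derivative[OF 1]] .
 moreover have "linear (%v. dd v F (J0 z))"
  using Ck_has_derivative[OF 1] has_derivative_linear by blast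
 then have "dd (h *R J1) F (J0 z) = h *R dd J1 F (J0 z)" for h by (simp add: linear_cmul)
 ultimately show ?thesis
  by (simp add: has_vector_derivative_def T1_def dd_eq_sum_Basis[OF 1, where v=J1, symmetric])
qed

lemma inner_coeff_derivative:
 assumes "(J hvd J') (at z)"
 shows "((%z. J z \<bullet> b) hrd J' \<bullet> b) (at z)"
 unfolding has_real_derivative_iff_has_vector_derivative
 by (rule bounded_linear.has_vector_derivative[OF bounded_linear_inner_left assms])

lemma scaleR_coeff_derivative:
 assumes "(J hvd J') (at z)" "(G hvd G') (at z)"
 shows "((%z. (J z \<bullet> b) *R G z) hvd (J' \<bullet> b) *R G z + (J z \<bullet> b) *R G') (at z)"
 using has_vector_derivative_scaleR[OF inner_coeff_derivative[OF assms(1)] assms(2), of b]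
 by (simp add: add.commute)

lemma T2_derivative:
 assumes F: "Ck 2 F" and J0: "(J0 hvd J1 z) (at z)" and J1: "(J1 hvd J2) (at z)"
 shows "((%z. T1 F (J0 z) (J1 z)) hvd T2 F (J0 z) (J1 z) J2) (at z)"
proof -
 have F': "Ck 1 (dd b F)" for b using Ck_dd[of 1 F b] F by (simp add: numeral_2_eq_2)
 show ?thesis
  unfolding T1_def[of F] T2_def
  by (rule has_vector_derivative_sum, rule scaleR_coeff_derivative[OF J1], rule T1_derivative[OF F' J0])
qed

lemma T3_derivative:
 assumes F: "Ck 3 F" and J0: "(J0 hvd J1 z) (at z)" and J1: "(J1 hvd J2 z) (at z)"
  and J2: "(J2 hvd J3) (at z)"
 shows "((%z. T2 F (J0 z) (J1 z) (J2 z)) hvd T3 F (J0 z) (J1 z) (J2 z) J3) (at z)"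
proof -
 have F': "Ck 2 (dd b F)" "Ck 1 (dd b F)" for b
  using Ck_dd[of 2 F b] F Ck_mono[of 2 "dd b F" 1] by (auto simp: numeral_3_eq_3 numeral_2_eq_2)
 show ?thesis
  unfolding T2_def[of F] T3_def
  by (rule has_vector_derivative_sum, rule has_vector_derivative_add,
    rule scaleR_coeff_derivative[OF J2], rule T1_derivative[OF F'(2) J0],
    rule scaleR_coeff_derivative[OF J1], rule T2_derivative[OF F'(1) J0 J1])
qed

lemma T1_bound:
 fixes F :: "'a::euclidean_space => 'b::euclidean_space"
 assumes "!!b. b : Basis ==> norm (dd b F J0) <= c"
 shows "norm (T1 F J0 J1) <= DIM('a) * (norm J1 * c)"
proof -
 have "norm (T1 F J0 J1) <= (\<Sum>b\<in>(Basis::'a set). norm J1 * c)"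
  unfolding T1_def using assms by (intro sum_norm_le) (auto intro!: mult_mono Basis_le_norm)
 then show ?thesis by simp
qed

lemma T2_bound:
 fixes F :: "'a::euclidean_space => 'b::euclidean_space"
 assumes "!!b. b : Basis ==> norm (dd b F J0) <= c1"
  "!!b c. b : Basis ==> c : Basis ==> norm (dd c (dd b F) J0) <= c2"
 shows "norm (T2 F J0 J1 J2) <= DIM('a) * (norm J2 * c1 + norm J1 * (DIM('a) * (norm J1 * c2)))"
proof -
 have "norm (T2 F J0 J1 J2) <= (\<Sum>b\<in>(Basis::'a set). norm J2 * c1 + norm J1 * (DIM('a) * (norm J1 * c2)))"
  unfolding T2_def using assms
  by (intro sum_norm_le order_trans[OF norm_triangle_ineq] add_mono) (auto intro!: mult_mono Basis_le_norm T1_bound)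
 then show ?thesis by simp
qed

lemma T3_bound:
 fixes F :: "'a::euclidean_space => 'b::euclidean_space"
 assumes "!!b. b : Basis ==> norm (dd b F J0) <= c1"
  "!!b c. b : Basis ==> c : Basis ==> norm (dd c (dd b F) J0) <= c2"
  "!!b c d. b : Basis ==> c : Basis ==> d : Basis ==> norm (dd d (dd c (dd b F)) J0) <= c3"
 shows "norm (T3 F J0 J1 J2 J3) <= DIM('a) * (norm J3 * c1 + norm J2 * (DIM('a) * (norm J1 * c2))
  + (norm J2 * (DIM('a) * (norm J1 * c2))
   + norm J1 * (DIM('a) * (norm J2 * c2 + norm J1 * (DIM('a) * (norm J1 * c3))))))"
proof -
 have "norm (T3 F J0 J1 J2 J3) <= (\<Sum>b\<in>(Basis::'a set). norm J3 * c1 + norm J2 * (DIM('a) * (norm J1 * c2))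
  + (norm J2 * (DIM('a) * (norm J1 * c2))
   + norm J1 * (DIM('a) * (norm J2 * c2 + norm J1 * (DIM('a) * (norm J1 * c3))))))"
  unfolding T3_def
 proof (rule sum_norm_le)
  fix b :: 'a assume b: "b : Basis"
  have 1: "norm (T1 (dd b F) J0 J1) <= DIM('a) * (norm J1 * c2)" by (rule T1_bound) (use assms b in auto)
  have 2: "norm (T2 (dd b F) J0 J1 J2) <= DIM('a) * (norm J2 * c2 + norm J1 * (DIM('a) * (norm J1 * c3)))"
   by (rule T2_bound) (use assms b in auto)
  show "norm ((J3 \<bullet> b) *R dd b F J0 + (J2 \<bullet> b) *R T1 (dd b F) J0 J1
  + ((J2 \<bullet> b) *R T1 (dd b F) J0 J1 + (J1 \<bullet> b) *R T2 (dd b F) J0 J1 J2)) <=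
  norm J3 * c1 + norm J2 * (DIM('a) * (norm J1 * c2))
  + (norm J2 * (DIM('a) * (norm J1 * c2))
   + norm J1 * (DIM('a) * (norm J2 * c2 + norm J1 * (DIM('a) * (norm J1 * c3)))))"
   by (intro order_trans[OF norm_triangle_ineq] add_mono; simp only: norm_scaleR;
     intro mult_mono 1 2 assms(1) b Basis_le_norm) auto
 qed
 then show ?thesis by simp
qed

lemma continuous_T:
 assumes F: "Ck 3 F" and c: "continuous_on A j0" "continuous_on A j1" "continuous_on A j2" "continuous_on A j3"
 shows "continuous_on A (%x. F (j0 x))" "continuous_on A (%x. T1 F (j0 x) (j1 x))"
  "continuous_on A (%x. T2 F (j0 x) (j1 x) (j2 x))" "continuous_on A (%x. T3 F (j0 x) (j1 x) (j2 x) (j3 x))"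
proof -
 have F3: "Ck (Suc (Suc (Suc 0))) F" using F by (simp add: numeral_3_eq_3)
 note F2 = Ck_dd[OF F3] note F1 = Ck_dd[OF F2] note F0 = Ck_dd[OF F1]
 have comp: "continuous_on A (%x. G (j0 x))" if "Ck k G" for k and G :: "'a => 'b"
  by (rule continuous_on_compose2[OF Ck_continuous[OF that, of UNIV] c(1)]) auto
 show "continuous_on A (%x. F (j0 x))" by (rule comp[OF F])
 show "continuous_on A (%x. T1 F (j0 x) (j1 x))"
  unfolding T1_def by (intro continuous_on_sum continuous_on_scaleR continuous_on_inner continuous_on_const c comp[OF F2])
 show "continuous_on A (%x. T2 F (j0 x) (j1 x) (j2 x))"
  unfolding T2_def T1_def
  by (intro continuous_on_sum continuous_on_add continuous_on_scaleR continuous_on_inner continuous_on_const c comp[OF F2] comp[OF F1])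
 show "continuous_on A (%x. T3 F (j0 x) (j1 x) (j2 x) (j3 x))"
  unfolding T3_def T2_def T1_def
  by (intro continuous_on_sum continuous_on_add continuous_on_scaleR continuous_on_inner continuous_on_const c
    comp[OF F2] comp[OF F1] comp[OF F0])
qed

definition e1 :: "real * real" where "e1 = (1, 0)"
definition e2 :: "real * real" where "e2 = (0, 1)"

lemma dd_e1: "Ck (Suc k) f ==> ((%s. f (s, z)) hvd dd e1 f (s, z)) (at s)"
 using dd_along_line[of k f "(0, z)" e1 s] by (simp add: e1_def)

lemma dd_e2: "Ck (Suc k) f ==> ((%z. f (s, z)) hvd dd e2 f (s, z)) (at z)"
 using dd_along_line[of k f "(s, 0)" e2 z] by (simp add: e2_def)

text \<open>The jet \<open>(u, u\<^sub>t, u\<^sub>x)\<close> in hyperbolic coordinates; a derivative in \<open>z\<close> acts on the arguments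
 by \<open>(X, Y) \<mapsto> (X' - Y, Y' - X)\<close>.\<close>

definition hyp_jet :: "real * real => real ^ 'n::finite => real ^ 'n => real ^ 'n => 'n vec3" where
 "hyp_jet p u X Y = exp (- fst p / 2) *R
  (u, cosh (snd p) *R X - sinh (snd p) *R Y, cosh (snd p) *R Y - sinh (snd p) *R X)"

lemma hyp_jet_derivative:
 assumes "(u hvd u') (at z)" "(X hvd X') (at z)" "(Y hvd Y') (at z)"
 shows "((%z. hyp_jet (s, z) (u z) (X z) (Y z)) hvd hyp_jet (s, z) u' (X' - Y z) (Y' - X z)) (at z)"
proof -
 have c: "(cosh hrd sinh z) (at z)" "(sinh hrd cosh z) (at z)" for z :: real
  by (auto intro!: derivative_eq_intros)
 have "((%z. (u z, cosh z *R X z - sinh z *R Y z, cosh z *R Y z - sinh z *R X z)) has_vector_derivative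
   (u', (cosh z *R X' + sinh z *R X z) - (sinh z *R Y' + cosh z *R Y z),
   (cosh z *R Y' + sinh z *R Y z) - (sinh z *R X' + cosh z *R X z))) (at z)"
  by (intro has_vector_derivative_Pair has_vector_derivative_diff has_vector_derivative_scaleR c assms)
 from bounded_linear.has_vector_derivative[OF bounded_linear_scaleR_right this, of "exp (- s / 2)"]
 show ?thesis by (simp add: hyp_jet_def algebra_simps)
qed

lemma abs_sinh_le_cosh: "\<bar>sinh x\<bar> <= cosh (x::real)"
proof -
 have "sinh x <= cosh x" "- sinh x <= cosh x" by (simp_all add: sinh_def cosh_def field_simps)
 then show ?thesis by linarith
qed

lemma hyp_jet_norm: "norm (hyp_jet (s, z) u X Y) <= exp (- s / 2) * (cosh z * (2 * (norm u + norm X + norm Y)))"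
proof -
 have c: "cosh z >= 1" "\<bar>cosh z\<bar> = cosh z" using cosh_real_ge_1[of z] by auto
 have tri: "norm (cosh z *R A - sinh z *R B) <= cosh z * (norm A + norm B)" for A B :: "real ^ 'a"
 proof -
  have "norm (cosh z *R A - sinh z *R B) <= cosh z * norm A + \<bar>sinh z\<bar> * norm B"
   using norm_triangle_ineq4[of "cosh z *R A" "sinh z *R B"] c by simp
  also have "... <= cosh z * norm A + cosh z * norm B"
   by (intro add_left_mono mult_right_mono abs_sinh_le_cosh) auto
  finally show ?thesis by (simp add: algebra_simps)
 qed
 have "norm (u, cosh z *R X - sinh z *R Y, cosh z *R Y - sinh z *R X) <=
   norm u + (norm (cosh z *R X - sinh z *R Y) + norm (cosh z *R Y - sinh z *R X))"
  by (intro order_trans[OF norm_Pair_le] add_left_mono norm_Pair_le)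
 also have "... <= cosh z * norm u + (cosh z * (norm X + norm Y) + cosh z * (norm Y + norm X))"
  using c by (intro add_mono tri) (simp add: mult_right_mono[of 1 "cosh z" "norm u", simplified])
 also have "... <= cosh z * (2 * (norm u + norm X + norm Y))"
  using c by (simp add: algebra_simps)
 finally show ?thesis
  unfolding hyp_jet_def norm_scaleR fst_conv snd_conv abs_exp_cancel by (rule mult_left_mono) simp
qed

lemma continuous_hyp_jet:
 assumes "continuous_on UNIV u" "continuous_on UNIV X" "continuous_on UNIV Y"
 shows "continuous_on UNIV (%p. hyp_jet p (u p) (X p) (Y p))"
 unfolding hyp_jet_def
 by (intro continuous_on_scaleR continuous_on_Pair continuous_on_diff continuous_on_exp continuous_on_cosh continuous_on_sinh
   continuous_on_divide continuous_on_minus continuous_on_fst continuous_on_snd continuous_on_id continuous_on_const assms) auto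

text \<open>The rescaled unknown on a slab of hyperbolic time. The margins in \<open>supp\<close>
  make the support condition an open one, so that all derivatives vanish for |z| at least
  \<open>R\<close> and s in [0, S]. Five derivatives are needed because the equation for the third
  z-derivative contains the fifth.\<close>

locale kgw =
 fixes m :: "'n::finite => real" and F :: "'n vec3 => real ^ 'n" and CF :: real
  and w :: "real * real => real ^ 'n" and S R m0 :: real
 assumes F: "Ck 4 F" "cubic_growth CF F" and m0: "0 < m0" "!!j. m0 <= m j" and w: "Ck 5 w"
  and pde: "!!p. dd e1 (dd e1 w) p = dd e1 w p - (1/4) *R w p + dd e2 (dd e2 w) p
    - exp (2 * fst p) *R mass m (mass m (w p))
    + exp (fst p) *R (exp (3/2 * fst p) *R F (hyp_jet p (w p) (exp (- fst p) *R (dd e1 w p - (1/2) *R w p)) (exp (- fst p) *R dd e2 w p)))"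
  and supp: "!!s z. s : {-1<..<S+1} ==> \<bar>z\<bar> > R - 1 ==> w (s, z) = 0"
  and S: "S >= 0" and R: "R >= 1"
begin

definition W :: "nat => real * real => real ^ 'n" where "W k = (dd e2 ^^ k) w"
definition V :: "nat => real * real => real ^ 'n" where "V k = dd e1 (W k)"

lemma W_Suc: "W (Suc k) = dd e2 (W k)" and W_0: "W 0 = w"
 by (simp_all add: W_def)

lemma W_Ck: "k <= 5 ==> Ck (5 - k) (W k)"
proof (induction k)
 case (Suc k)
 then have "Ck (5 - k) (W k)" "5 - k = Suc (5 - Suc k)" by simp_all
 then have "Ck (Suc (5 - Suc k)) (W k)" by (simp only:)
 then show ?case unfolding W_Suc by (rule Ck_dd)
qed (simp add: W_0 w)

lemma W_CkI: "k + l <= 5 ==> Ck l (W k)"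
 by (rule Ck_mono[OF W_Ck]) auto

lemma V_CkI: "k + l <= 4 ==> Ck l (V k)"
 unfolding V_def by (rule Ck_dd[OF W_CkI]) auto

lemma W_z: "k <= 4 ==> ((%z. W k (s, z)) hvd W (Suc k) (s, z)) (at z)"
 unfolding W_Suc by (rule dd_e2[of 0]) (rule W_CkI, simp)

lemma W_s: "k <= 4 ==> ((%s. W k (s, z)) hvd V k (s, z)) (at s)"
 unfolding V_def by (rule dd_e1[of 0]) (rule W_CkI, simp)

lemma V_Suc: "k <= 3 ==> V (Suc k) = dd e2 (V k)"
 unfolding V_def W_Suc by (rule ext, rule dd_commute, rule W_CkI) simp

lemma V_z: "k <= 3 ==> ((%z. V k (s, z)) hvd V (Suc k) (s, z)) (at z)"
 by (simp only: V_Suc) (rule dd_e2[of 0], rule V_CkI, simp)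

text \<open>\<open>x\<close> and \<open>y\<close> are the frame derivatives along s and z that feed
  \<open>hyp_jet\<close>. The half of \<open>W k\<close> is subtracted because \<open>u\<close> is
  \<open>w\<close> divided by e^{s/2}.\<close>

definition x :: "nat => real * real => real ^ 'n" where
 "x k p = exp (- fst p) *R (V k p - (1/2) *R W k p)"
definition y :: "nat => real * real => real ^ 'n" where
 "y k p = exp (- fst p) *R W (Suc k) p"

lemma x_z: "k <= 3 ==> ((%z. x k (s, z)) hvd x (Suc k) (s, z)) (at z)"
 unfolding x_def by (auto intro!: bounded_linear.has_vector_derivative[OF bounded_linear_scaleR_right]
   has_vector_derivative_diff V_z W_z)

lemma y_z: "k <= 3 ==> ((%z. y k (s, z)) hvd y (Suc k) (s, z)) (at z)"
 unfolding y_def by (auto intro!: bounded_linear.has_vector_derivative[OF bounded_linear_scaleR_right] W_z)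

definition J0 :: "real * real => 'n vec3" where "J0 p = hyp_jet p (W 0 p) (x 0 p) (y 0 p)"
definition J1 :: "real * real => 'n vec3" where "J1 p = hyp_jet p (W 1 p) (x 1 p - y 0 p) (y 1 p - x 0 p)"
definition J2 :: "real * real => 'n vec3" where
 "J2 p = hyp_jet p (W 2 p) (x 2 p - y 1 p - (y 1 p - x 0 p)) (y 2 p - x 1 p - (x 1 p - y 0 p))"
definition J3 :: "real * real => 'n vec3" where
 "J3 p = hyp_jet p (W 3 p) (x 3 p - y 2 p - (y 2 p - x 1 p) - (y 2 p - x 1 p - (x 1 p - y 0 p)))
   (y 3 p - x 2 p - (x 2 p - y 1 p) - (x 2 p - y 1 p - (y 1 p - x 0 p)))"

lemma J_z: "((%z. J0 (s, z)) hvd J1 (s, z)) (at z)"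
 "((%z. J1 (s, z)) hvd J2 (s, z)) (at z)"
 "((%z. J2 (s, z)) hvd J3 (s, z)) (at z)"
 unfolding J0_def J1_def J2_def J3_def
 by (intro hyp_jet_derivative has_vector_derivative_diff W_z[of 0, simplified] W_z[of 1, simplified Suc_1] W_z[of 2, simplified]
   x_z[of 0, simplified] x_z[of 1, simplified Suc_1] x_z[of 2, simplified] y_z[of 0, simplified] y_z[of 1, simplified Suc_1]
   y_z[of 2, simplified]; simp add: numeral_3_eq_3 numeral_2_eq_2)+

text \<open>The factor \<open>exp (3/2 * fst p)\<close> undoes the decay e^{-s/2} of the three jets,
  so \<open>N\<close> has no intrinsic growth or decay in s.\<close>

definition N :: "nat => real * real => real ^ 'n" where
 "N k p = exp (3/2 * fst p) *R (if k = 0 then F (J0 p) else if k = 1 then T1 F (J0 p) (J1 p)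
  else if k = 2 then T2 F (J0 p) (J1 p) (J2 p) else T3 F (J0 p) (J1 p) (J2 p) (J3 p))"

lemma N_z: "k <= 2 ==> ((%z. N k (s, z)) hvd N (Suc k) (s, z)) (at z)"
proof -
 assume "k <= 2"
 then consider "k = 0" | "k = 1" | "k = 2" by linarith
 then show ?thesis
 proof cases
  case 1
  then show ?thesis unfolding N_def
   using T1_derivative[OF Ck_mono[OF F(1)] J_z(1)]
   by (auto intro!: bounded_linear.has_vector_derivative[OF bounded_linear_scaleR_right])
 next
  case 2
  then show ?thesis unfolding N_def
   using T2_derivative[OF Ck_mono[OF F(1)] J_z(1,2)]
   by (auto intro!: bounded_linear.has_vector_derivative[OF bounded_linear_scaleR_right])
 next
  case 3
  then show ?thesis unfolding N_def
   using T3_derivative[OF Ck_mono[OF F(1)] J_z(1,2,3)]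
   by (auto intro!: bounded_linear.has_vector_derivative[OF bounded_linear_scaleR_right])
 qed
qed

definition rhs :: "nat => real * real => real ^ 'n" where
 "rhs k p = V k p - (1/4) *R W k p + W (k + 2) p - exp (2 * fst p) *R mass m (mass m (W k p)) + exp (fst p) *R N k p"

lemma rhs_z: "k <= 2 ==> ((%z. rhs k (s, z)) hvd rhs (Suc k) (s, z)) (at z)"
 unfolding rhs_def using W_z[of k s z] W_z[of "k + 2" s z] V_z[of k s z] N_z[of k s z]
 by (auto intro!: has_vector_derivative_diff has_vector_derivative_add
   bounded_linear.has_vector_derivative[OF bounded_linear_scaleR_right]
   bounded_linear.has_vector_derivative[OF bounded_linear_mass])

text \<open>The equation is differentiated in z by induction: the z-derivative of
  \<open>rhs k\<close> exists term by term, and by symmetry of second derivatives it also equals the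
  s-derivative of \<open>V (Suc k)\<close>.\<close>

lemma dd_e1_V: "k <= 3 ==> dd e1 (V k) = rhs k"
proof (induction k)
 case 0
 show ?case
  using pde by (auto simp: fun_eq_iff rhs_def V_def W_0 W_Suc numeral_2_eq_2 N_def J0_def x_def y_def)
next
 case (Suc k)
 have "dd e1 (V (Suc k)) p = rhs (Suc k) p" for p
 proof -
  obtain s z where p: "p = (s, z)" by fastforce
  have "dd e1 (V (Suc k)) p = dd e1 (dd e2 (V k)) p" using Suc.prems by (simp add: V_Suc)
  also have "... = dd e2 (dd e1 (V k)) p" by (rule dd_commute[OF V_CkI]) (use Suc.prems in simp)
  also have IH: "dd e1 (V k) = rhs k" using Suc by simp
  finally have *: "dd e1 (V (Suc k)) p = dd e2 (rhs k) p" .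
  have "Ck 1 (dd e1 (V k))" by (rule Ck_dd[OF V_CkI]) (use Suc.prems in simp)
  then have "Ck (Suc 0) (rhs k)" unfolding IH by simp
  from dd_e2[OF this, of s z]
  have "((%z. rhs k (s, z)) hvd dd e1 (V (Suc k)) (s, z)) (at z)"
   using * unfolding p by simp
  moreover have "((%z. rhs k (s, z)) hvd rhs (Suc k) (s, z)) (at z)"
   by (rule rhs_z) (use Suc.prems in simp)
  ultimately show ?thesis unfolding p by (rule vector_derivative_unique_at)
 qed
 then show ?case by (rule ext)
qed

lemma V_s: "k <= 3 ==> ((%s. V k (s, z)) hvd rhs k (s, z)) (at s)"
 using dd_e1[of 0 "V k"] V_CkI[of k 1] by (simp add: fun_cong[OF dd_e1_V, symmetric])

lemma W_continuous: "k <= 5 ==> continuous_on A (W k)"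
 by (rule Ck_continuous[of 0]) (rule W_CkI, simp)

lemma V_continuous: "k <= 4 ==> continuous_on A (V k)"
 by (rule Ck_continuous[of 0]) (rule V_CkI, simp)

lemma xy_continuous: "k <= 4 ==> continuous_on A (x k)" "k <= 4 ==> continuous_on A (y k)"
 unfolding x_def[abs_def] y_def[abs_def]
 by (intro continuous_on_scaleR continuous_on_diff continuous_on_exp continuous_on_minus continuous_on_fst continuous_on_id
   continuous_on_const W_continuous V_continuous; simp)+

lemma J_continuous: "continuous_on UNIV J0" "continuous_on UNIV J1" "continuous_on UNIV J2" "continuous_on UNIV J3"
 unfolding J0_def[abs_def] J1_def[abs_def] J2_def[abs_def] J3_def[abs_def]
 by (intro continuous_hyp_jet continuous_on_diff W_continuous xy_continuous; simp)+

lemma N_continuous: "continuous_on UNIV (N k)"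
 using continuous_T[OF Ck_mono[OF F(1)] J_continuous]
 unfolding N_def[abs_def]
 by (cases "k = 0"; cases "k = 1"; cases "k = 2") (auto intro!: continuous_intros)

lemma supp_W_V:
 assumes "s : {0..S}" "\<bar>z\<bar> >= R"
 shows "W k (s, z) = 0" "V k (s, z) = 0"
proof -
 let ?O = "{-1<..<S+1} \<times> {z. \<bar>z\<bar> > R - 1}"
 have opn: "open ?O" by (intro open_Times open_Collect_less continuous_intros open_greaterThanLessThan)
 have W: "!!p. p : ?O ==> W k p = 0" for k
 proof (induction k)
  case 0
  then show ?case using supp by (auto simp: W_0)
 next
  case (Suc k)
  then show ?case unfolding W_Suc using dd_eq_0_open[OF opn] by blast
 qed
 moreover have "(s, z) : ?O" using assms by auto
 ultimately show "W k (s, z) = 0" "V k (s, z) = 0"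
  unfolding V_def using dd_eq_0_open[OF opn] by blast+
qed


definition E :: "nat => real => real" where "E k = energy m R (W k) (W (Suc k)) (V k)"

lemma E_inequality:
 assumes "k <= 3"
 obtains D where "!!s. s : {0..S} ==> (E k hrd D s) (at s within {0..S})"
  "!!s. s : {0..S} ==> D s <= 2 * 1.1 * E k s + 2 * sqrt (E k s) * sqrt (wL2 R (%z. N k (s, z)))"
  "!!s. s : {0..S} ==> D s <= 2 * sqrt (E k s) * (3 * exp (- s) * sqrt (wL2 R (%z. W (Suc k) (s, z)))
   + sqrt (wL2 R (%z. N k (s, z))))"
proof (rule energy_inequality[of "W k" "V k" "W (Suc k)" "V (Suc k)" "W (k + 2)" m "N k" 0 S R])
 show "((%s. V k (s, z)) hvd V k (s, z) - (1 / 4) *R W k (s, z) + W (k + 2) (s, z) -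
  exp (2 * s) *R mass m (mass m (W k (s, z))) + exp s *R N k (s, z)) (at s)" for s z
  using V_s[OF assms, of z s] by (simp add: rhs_def)
 show "((%z. W (Suc k) (s, z)) hvd W (k + 2) (s, z)) (at z)" for s z
  using W_z[of "Suc k" s z] assms by simp
qed (use assms W_s W_z V_z W_continuous V_continuous N_continuous supp_W_V R that in \<open>auto simp: E_def\<close>)

text \<open>The derivatives in the normalisation in which the energy bounds them without loss;
  \<open>a\<close> agrees with the frame derivative \<open>y\<close>, while \<open>b\<close> differs
  from \<open>x\<close> by a decaying multiple of \<open>W\<close>.\<close>

definition a :: "nat => real * real => real ^ 'n" where "a k p = exp (- fst p) *R W (Suc k) p"
definition b :: "nat => real * real => real ^ 'n" where "b k p = exp (- fst p) *R V k p"

lemma norm_mass: "norm (mass m v) >= m0 * norm v"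
proof -
 have "(m0 * norm v)^2 = (\<Sum>j\<in>UNIV. m0\<^sup>2 * (v $ j)^2)"
  by (simp add: power_mult_distrib norm_vec_def L2_set_def sum_nonneg sum_distrib_left)
 also have "... <= (\<Sum>j\<in>UNIV. (m j)\<^sup>2 * (v $ j)^2)"
  using m0 by (intro sum_mono mult_right_mono power_mono) auto
 also have "... = (norm (mass m v))^2"
  by (simp add: norm_vec_def L2_set_def sum_nonneg mass_def power_mult_distrib)
 finally show ?thesis by (rule power2_le_imp_le) simp
qed

lemma continuous_slice:
 "k <= 4 ==> continuous_on UNIV (%z. W k (s, z))" "k <= 4 ==> continuous_on UNIV (%z. a k (s, z))"
 "k <= 4 ==> continuous_on UNIV (%z. b k (s, z))" "continuous_on UNIV (%z. N k (s, z))"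
 unfolding a_def b_def
 by (auto intro!: continuous_on_scaleR continuous_on_const continuous_on_pair_compose[OF W_continuous]
   continuous_on_pair_compose[OF V_continuous] continuous_on_pair_compose[OF N_continuous] continuous_on_id)

lemma energy_parts:
 assumes "k <= 3"
 shows "wL2 R (%z. b k (s, z)) <= E k s" "wL2 R (%z. a k (s, z)) <= E k s" "m0^2 * wL2 R (%z. W k (s, z)) <= E k s"
proof -
 let ?e = "%z. (om z)\<^sup>2 * (exp (- 2 * s) * (V k (s, z) \<bullet> V k (s, z) + W (Suc k) (s, z) \<bullet> W (Suc k) (s, z)
  + (1/4) * (W k (s, z) \<bullet> W k (s, z))) + mass m (W k (s, z)) \<bullet> mass m (W k (s, z)))"
 have c: "continuous_on {-R..R} (%z. W k (s, z))" "continuous_on {-R..R} (%z. W (Suc k) (s, z))" "continuous_on {-R..R} (%z. V k (s, z))"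
  using assms by (auto intro!: continuous_on_pair_compose[OF W_continuous] continuous_on_pair_compose[OF V_continuous] continuous_on_id)
 have ie: "?e integrable_on {-R..R}"
  by (intro integrable_continuous_real continuous_on_mult continuous_on_add continuous_on_power continuous_om continuous_on_const
    continuous_on_inner c bounded_linear.continuous_on[OF bounded_linear_mass])
 have E: "E k s = integral {-R..R} ?e" by (simp add: E_def energy_def)
 have nb: "(norm (exp (- s) *R v))^2 = exp (- 2 * s) * (v \<bullet> v)" for v :: "real ^ 'n"
 proof -
  have "exp (- 2 * s) = exp (- s) * exp (- s)" by (simp add: exp_add[symmetric])
  then show ?thesis unfolding power2_norm_eq_inner by simp
 qed
 have nn: "0 <= exp (- 2 * s) * (v \<bullet> v)" for v :: "real ^ 'n" by simp
 have nm: "0 <= mass m v \<bullet> mass m v" for v by simp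
 have pt: "(norm (b k (s, z)))^2 <= exp (- 2 * s) * (V k (s, z) \<bullet> V k (s, z) + W (Suc k) (s, z) \<bullet> W (Suc k) (s, z)
  + (1/4) * (W k (s, z) \<bullet> W k (s, z))) + mass m (W k (s, z)) \<bullet> mass m (W k (s, z))"
  "(norm (a k (s, z)))^2 <= exp (- 2 * s) * (V k (s, z) \<bullet> V k (s, z) + W (Suc k) (s, z) \<bullet> W (Suc k) (s, z)
  + (1/4) * (W k (s, z) \<bullet> W k (s, z))) + mass m (W k (s, z)) \<bullet> mass m (W k (s, z))"
  "m0^2 * (norm (W k (s, z)))^2 <= exp (- 2 * s) * (V k (s, z) \<bullet> V k (s, z) + W (Suc k) (s, z) \<bullet> W (Suc k) (s, z)
  + (1/4) * (W k (s, z) \<bullet> W k (s, z))) + mass m (W k (s, z)) \<bullet> mass m (W k (s, z))" for z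
 proof -
  have m: "m0^2 * (norm (W k (s, z)))^2 <= mass m (W k (s, z)) \<bullet> mass m (W k (s, z))"
   using power_mono[OF norm_mass[of "W k (s, z)"], of 2] m0(1) by (simp add: power_mult_distrib power2_norm_eq_inner)
  show "(norm (b k (s, z)))^2 <= exp (- 2 * s) * (V k (s, z) \<bullet> V k (s, z) + W (Suc k) (s, z) \<bullet> W (Suc k) (s, z)
  + (1/4) * (W k (s, z) \<bullet> W k (s, z))) + mass m (W k (s, z)) \<bullet> mass m (W k (s, z))"
   unfolding b_def fst_conv nb distrib_left
   using nn[of "V k (s, z)"] nn[of "W (Suc k) (s, z)"] nn[of "W k (s, z)"] nm[of "W k (s, z)"] by linarith
  show "(norm (a k (s, z)))^2 <= exp (- 2 * s) * (V k (s, z) \<bullet> V k (s, z) + W (Suc k) (s, z) \<bullet> W (Suc k) (s, z)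
  + (1/4) * (W k (s, z) \<bullet> W k (s, z))) + mass m (W k (s, z)) \<bullet> mass m (W k (s, z))"
   unfolding a_def fst_conv nb distrib_left
   using nn[of "V k (s, z)"] nn[of "W (Suc k) (s, z)"] nn[of "W k (s, z)"] nm[of "W k (s, z)"] by linarith
  show "m0^2 * (norm (W k (s, z)))^2 <= exp (- 2 * s) * (V k (s, z) \<bullet> V k (s, z) + W (Suc k) (s, z) \<bullet> W (Suc k) (s, z)
  + (1/4) * (W k (s, z) \<bullet> W k (s, z))) + mass m (W k (s, z)) \<bullet> mass m (W k (s, z))"
   unfolding distrib_left
   using nn[of "V k (s, z)"] nn[of "W (Suc k) (s, z)"] nn[of "W k (s, z)"] m by linarith
 qed
 have "k <= 4" using assms by simp
 note cs = continuous_slice(1-3)[OF this]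
 show "wL2 R (%z. b k (s, z)) <= E k s" "wL2 R (%z. a k (s, z)) <= E k s"
  unfolding E wL2_def by (intro integral_le ie wL2_integrable cs mult_left_mono pt zero_le_power2)+
 have "m0^2 * wL2 R (%z. W k (s, z)) = integral {-R..R} (%z. (om z)\<^sup>2 * (m0^2 * (norm (W k (s, z)))^2))"
  by (simp add: wL2_def mult.left_commute[of "m0^2"] flip: integral_mult_right)
 also have "... <= E k s"
  unfolding E
 proof (intro integral_le ie mult_left_mono pt zero_le_power2)
  show "(%z. (om z)\<^sup>2 * (m0^2 * (norm (W k (s, z)))^2)) integrable_on {-R..R}"
   using integrable_on_mult_right[OF wL2_integrable[OF cs(1)[of s], of R], of "m0^2"] by (simp add: mult_ac)
 qed
 finally show "m0^2 * wL2 R (%z. W k (s, z)) <= E k s" .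
qed

end

section \<open>Energy estimates\<close>

lemma wL2_comb:
 fixes h :: "real => 'b::real_normed_vector" and f g k :: "real => real"
 assumes c: "continuous_on UNIV h" "continuous_on UNIV f" "continuous_on UNIV g" "continuous_on UNIV k"
  and le: "!!z. norm (h z) <= al * f z + \<beta> * g z + ga * k z"
 shows "wL2 R h <= 3 * (al^2 * wL2 R f + \<beta>^2 * wL2 R g + ga^2 * wL2 R k)"
proof -
 have pt: "(norm (h z))^2 <= 3 * (al^2 * (norm (f z))^2 + \<beta>^2 * (norm (g z))^2 + ga^2 * (norm (k z))^2)" for z
 proof -
  have three: "(p + q + r)^2 <= 3 * (p^2 + q^2 + r^2)" for p q r :: real
   using sum_squares_ge_zero[of "p - q" "q - r"] zero_le_power2[of "p - r"]
   by (simp add: power2_eq_square algebra_simps)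
  have "(norm (h z))^2 <= (al * f z + \<beta> * g z + ga * k z)^2" by (rule power_mono[OF le]) simp
  also have "... <= 3 * ((al * f z)^2 + (\<beta> * g z)^2 + (ga * k z)^2)" by (rule three)
  finally show ?thesis by (simp add: power_mult_distrib)
 qed
 have "wL2 R h <= integral {-R..R} (%z. 3 * (al^2 * ((om z)^2 * (norm (f z))^2) + \<beta>^2 * ((om z)^2 * (norm (g z))^2)
   + ga^2 * ((om z)^2 * (norm (k z))^2)))"
  unfolding wL2_def
 proof (intro integral_le wL2_integrable c integrable_on_mult_right integrable_add)
  fix z
  from mult_left_mono[OF pt[of z], of "(om z)^2"]
  show "(om z)^2 * (norm (h z))^2 <= 3 * (al^2 * ((om z)^2 * (norm (f z))^2) + \<beta>^2 * ((om z)^2 * (norm (g z))^2)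
   + ga^2 * ((om z)^2 * (norm (k z))^2))"
   by (simp add: algebra_simps)
 qed
 also have "... = 3 * (al^2 * wL2 R f + \<beta>^2 * wL2 R g + ga^2 * wL2 R k)"
  unfolding wL2_def integral_mult_right
  by (subst integral_add, intro integrable_add integrable_on_mult_right wL2_integrable c,
    intro integrable_on_mult_right wL2_integrable c,
    subst integral_add, (intro integrable_on_mult_right wL2_integrable c)+, simp only: integral_mult_right)
 finally show ?thesis .
qed

text \<open>In \<open>cN\<close>, 4 comes from \<open>cosh_cubed_le_om\<close>, 34 from
  \<open>J_le\<close>, and 3d^3 dominates the combinatorial factors of the chain rule. In
  \<open>cS\<close>, 27 = 3^3 comes from summing squares level by level and 4 is the number of
  levels. \<open>c1\<close> collects 1 + 3/m0 + 3 + 3 in \<open>boot_S1\<close>.\<close>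

definition cN :: "real => real => real" where "cN CF d = 4 * 34 ^ 3 * (3 * d ^ 3 * CF)"
definition cS :: "real => real" where "cS m0 = 27 * (3 * (1 / m0^2 + 2)) * 4"
definition c1 :: "real => real" where "c1 m0 = 7 + 3 / m0"
definition cH :: "real => real => real => real" where
 "cH m0 CF d = sqrt (3 * (cN CF d)^2 * (1 + (c1 m0)^2 + (c1 m0) ^ 4) * cS m0)"
text \<open>The top exponent must exceed the rate 1.1; stepping down gains 1, whence 3/10 = 13/10 -
  1, while the lower ones only have to be positive. The nonlinear terms require 2/5 + 2 gam 1 <= 2
  gam 2, which holds with equality.\<close>

definition gam :: "nat => real" where "gam k = (if k <= 1 then 1/10 else if k = 2 then 3/10 else 13/10)"

lemma cS_pos: "m0 > 0 ==> cS m0 > 0" and c1_pos: "m0 > 0 ==> c1 m0 > 0"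
 by (auto simp: cS_def c1_def intro!: add_pos_pos)

lemma cH_nonneg: "m0 > 0 ==> cH m0 CF d >= 0"
 using cS_pos[of m0] by (auto simp: cH_def intro!: mult_nonneg_nonneg add_nonneg_nonneg)

lemma gam_mono: "k <= l ==> gam k <= gam l"
 by (auto simp: gam_def)

text \<open>The dimension is passed as a real number so that all constants are functions of numbers
  and hence independent of the solution, of \<open>S\<close> and of \<open>R\<close>.\<close>

locale kgw_dim = kgw m F CF w S R m0
 for m :: "'n::finite => real" and F :: "'n vec3 => real ^ 'n" and CF :: real
  and w :: "real * real => real ^ 'n" and S R m0 :: real +
 fixes d :: real
 assumes d: "d = real DIM('n vec3)"
begin

definition Sn :: "nat => real * real => real" where
 "Sn k p = (\<Sum>l\<le>k. norm (W l p) + norm (b l p) + norm (a l p))"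

lemma Sn_nonneg: "Sn k p >= 0"
 unfolding Sn_def by (intro sum_nonneg add_nonneg_nonneg) auto

lemma Sn_ge:
 assumes "l <= k"
 shows "norm (W l p) + norm (b l p) + norm (a l p) <= Sn k p"
 unfolding Sn_def using assms by (intro member_le_sum[of l "{..k}" "%l. norm (W l p) + norm (b l p) + norm (a l p)"]) auto

lemma x_le: "l <= k ==> s >= 0 ==> norm (x l (s, z)) <= Sn k (s, z)"
proof -
 assume l: "l <= k" and s: "s >= 0"
 have "x l (s, z) = b l (s, z) - (exp (- s) / 2) *R W l (s, z)"
  by (simp add: x_def b_def algebra_simps)
 then have "norm (x l (s, z)) <= norm (b l (s, z)) + exp (- s) / 2 * norm (W l (s, z))"
  using norm_triangle_ineq4[of "b l (s, z)" "(exp (- s) / 2) *R W l (s, z)"] by simp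
 also have "exp (- s) / 2 * norm (W l (s, z)) <= 1 * norm (W l (s, z))"
  using s by (intro mult_right_mono) (auto simp: exp_le_one_iff intro: order_trans[of _ 1])
 finally show ?thesis using Sn_ge[OF l, of "(s, z)"] norm_ge_zero[of "a l (s, z)"] by linarith
qed

lemma y_le: "l <= k ==> norm (y l p) <= Sn k p"
proof -
 assume l: "l <= k"
 have eq: "y l p = a l p" by (simp add: y_def a_def)
 show ?thesis unfolding eq using Sn_ge[OF l, of p] norm_ge_zero[of "W l p"] norm_ge_zero[of "b l p"] by linarith
qed

lemma W_le: "l <= k ==> norm (W l p) <= Sn k p"
 using Sn_ge[of l k p] norm_ge_zero[of "a l p"] norm_ge_zero[of "b l p"] by linarith

text \<open>Each z-derivative doubles the number of frame derivatives in an entry of the jet, up to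
  8 at order three; with \<open>hyp_jet_norm\<close> this gives 34 = 2 * (1 + 8 + 8).\<close>

lemma J_le:
 assumes s: "s >= 0"
 shows "norm (J0 (s, z)) <= exp (- s / 2) * cosh z * 34 * Sn 0 (s, z)"
  "norm (J1 (s, z)) <= exp (- s / 2) * cosh z * 34 * Sn 1 (s, z)"
  "norm (J2 (s, z)) <= exp (- s / 2) * cosh z * 34 * Sn 2 (s, z)"
  "norm (J3 (s, z)) <= exp (- s / 2) * cosh z * 34 * Sn 3 (s, z)"
proof -
 have gen: "norm (hyp_jet (s, z) u X Y) <= exp (- s / 2) * cosh z * 34 * Sn k (s, z)"
  if "norm u <= Sn k (s, z)" "norm X <= 8 * Sn k (s, z)" "norm Y <= 8 * Sn k (s, z)" for u X Y k
 proof -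
  have "norm (hyp_jet (s, z) u X Y) <= exp (- s / 2) * (cosh z * (2 * (norm u + norm X + norm Y)))"
   by (rule hyp_jet_norm)
  also have "... <= exp (- s / 2) * (cosh z * (34 * Sn k (s, z)))"
   using that cosh_real_nonneg[of z] by (intro mult_left_mono) auto
  finally show ?thesis by simp
 qed
 note t = norm_triangle_ineq4[THEN order_trans]
 have n: "norm (A - B) <= p + q" if "norm A <= p" "norm B <= q" for A B :: "real ^ 'n" and p q
  using norm_triangle_ineq4[of A B] that by linarith
 show "norm (J0 (s, z)) <= exp (- s / 2) * cosh z * 34 * Sn 0 (s, z)"
  unfolding J0_def using Sn_nonneg[of 0 "(s, z)"] x_le[OF _ s, of 0 0 z] y_le[of 0 0 "(s, z)"]
  by (intro gen W_le) auto
 show "norm (J1 (s, z)) <= exp (- s / 2) * cosh z * 34 * Sn 1 (s, z)"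
  unfolding J1_def
 proof (intro gen W_le)
  note X = x_le[OF _ s, of _ 1 z] and Y = y_le[of _ 1 "(s, z)"]
  show "norm (x 1 (s, z) - y 0 (s, z)) <= 8 * Sn 1 (s, z)"
   using n[OF X[of 1] Y[of 0]] Sn_nonneg[of 1 "(s, z)"] by simp
  show "norm (y 1 (s, z) - x 0 (s, z)) <= 8 * Sn 1 (s, z)"
   using n[OF Y[of 1] X[of 0]] Sn_nonneg[of 1 "(s, z)"] by simp
 qed simp
 show "norm (J2 (s, z)) <= exp (- s / 2) * cosh z * 34 * Sn 2 (s, z)"
  unfolding J2_def
 proof (intro gen W_le)
  note X = x_le[OF _ s, of _ 2 z] and Y = y_le[of _ 2 "(s, z)"]
  show "norm (x 2 (s, z) - y 1 (s, z) - (y 1 (s, z) - x 0 (s, z))) <= 8 * Sn 2 (s, z)"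
   using n[OF n[OF X[of 2] Y[of 1]] n[OF Y[of 1] X[of 0]]] Sn_nonneg[of 2 "(s, z)"] by simp
  show "norm (y 2 (s, z) - x 1 (s, z) - (x 1 (s, z) - y 0 (s, z))) <= 8 * Sn 2 (s, z)"
   using n[OF n[OF Y[of 2] X[of 1]] n[OF X[of 1] Y[of 0]]] Sn_nonneg[of 2 "(s, z)"] by simp
 qed simp
 show "norm (J3 (s, z)) <= exp (- s / 2) * cosh z * 34 * Sn 3 (s, z)"
  unfolding J3_def
 proof (intro gen W_le)
  note X = x_le[OF _ s, of _ 3 z] and Y = y_le[of _ 3 "(s, z)"]
  show "norm (x 3 (s, z) - y 2 (s, z) - (y 2 (s, z) - x 1 (s, z)) - (y 2 (s, z) - x 1 (s, z) - (x 1 (s, z) - y 0 (s, z)))) <= 8 * Sn 3 (s, z)"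
   using n[OF n[OF n[OF X[of 3] Y[of 2]] n[OF Y[of 2] X[of 1]]] n[OF n[OF Y[of 2] X[of 1]] n[OF X[of 1] Y[of 0]]]] by simp
  show "norm (y 3 (s, z) - x 2 (s, z) - (x 2 (s, z) - y 1 (s, z)) - (x 2 (s, z) - y 1 (s, z) - (y 1 (s, z) - x 0 (s, z)))) <= 8 * Sn 3 (s, z)"
   using n[OF n[OF n[OF Y[of 3] X[of 2]] n[OF X[of 2] Y[of 1]]] n[OF n[OF X[of 2] Y[of 1]] n[OF Y[of 1] X[of 0]]]] by simp
 qed simp
qed

lemma d_ge_1: "d >= 1"
 using DIM_positive[where 'a="'n vec3"] unfolding d by linarith

lemma CF_pos: "CF > 0"
 by (rule cubic_growthD(1)[OF F(2)])

text \<open>The cancellation at the heart of the weighted estimates: the powers of e^s compensate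
  exactly, and cosh^3 is absorbed by two weights.\<close>

lemma om_cube:
 assumes "A >= 0" "B >= 0" "C >= 0"
 shows "om z * (exp (3/2 * s) * ((exp (- s / 2) * cosh z * 34 * A) * (exp (- s / 2) * cosh z * 34 * B) * (exp (- s / 2) * cosh z * 34 * C)))
  <= 4 * 34 ^ 3 * ((om z * A) * (om z * B) * (om z * C))"
proof -
 have e: "exp (3/2 * s) * (exp (- s / 2) * exp (- s / 2) * exp (- s / 2)) = 1"
  by (simp add: exp_add[symmetric])
 have "om z * (exp (3/2 * s) * ((exp (- s / 2) * cosh z * 34 * A) * (exp (- s / 2) * cosh z * 34 * B) * (exp (- s / 2) * cosh z * 34 * C)))
   = (exp (3/2 * s) * (exp (- s / 2) * exp (- s / 2) * exp (- s / 2))) * (34 ^ 3 * (om z * (cosh z ^ 3 * (A * B * C))))"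
  by (simp add: power3_eq_cube mult_ac)
 also have "... = 34 ^ 3 * (om z * (cosh z ^ 3 * (A * B * C)))" unfolding e by simp
 also have "... <= 34 ^ 3 * (om z * ((4 * (om z)^2) * (A * B * C)))"
  using assms om_pos[of z] by (intro mult_left_mono mult_right_mono cosh_cubed_le_om) auto
 finally show ?thesis by (simp add: power2_eq_square power3_eq_cube mult_ac)
qed

lemma N_pointwise:
 fixes s z :: real
 assumes s: "s >= 0"
 defines "P \<equiv> %k. om z * Sn k (s, z)"
 shows "om z * norm (N 0 (s, z)) <= cN CF d * (P 0 * P 0 * P 0)"
  "om z * norm (N 1 (s, z)) <= cN CF d * (P 0 * P 0 * P 1)"
  "om z * norm (N 2 (s, z)) <= cN CF d * (P 0 * P 0 * P 2 + P 0 * P 1 * P 1)"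
  "om z * norm (N 3 (s, z)) <= cN CF d * (P 0 * P 0 * P 3 + P 0 * P 1 * P 2 + P 1 * P 1 * P 1)"
proof -
 define Q where "Q k = exp (- s / 2) * cosh z * 34 * Sn k (s, z)" for k
 have Q: "Q k >= 0" for k unfolding Q_def using Sn_nonneg cosh_real_nonneg[of z] by (intro mult_nonneg_nonneg) auto
 have Pn: "P k >= 0" for k unfolding P_def using Sn_nonneg om_pos[of z] by (intro mult_nonneg_nonneg) auto
 have QP: "om z * (exp (3/2 * s) * (Q i * Q j * Q k)) <= 4 * 34 ^ 3 * (P i * P j * P k)" for i j k
  unfolding Q_def P_def by (rule om_cube) (rule Sn_nonneg)+
 note J = J_le[OF s, of z, folded Q_def]
 note G = cubic_growthD[OF F(2)]
 have D: "1 <= d" "d <= 3 * d ^ 3" "3 * d^2 <= 3 * d ^ 3" "d ^ 3 <= 3 * d ^ 3" "1 <= 3 * d ^ 3"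
 proof -
  have "1 <= d ^ 3" "d <= d ^ 3" "d ^ 2 <= d ^ 3"
   using d_ge_1 power_increasing[of 1 3 d] power_increasing[of 2 3 d] by simp_all
  then show "d <= 3 * d ^ 3" "3 * d^2 <= 3 * d ^ 3" "d ^ 3 <= 3 * d ^ 3" "1 <= 3 * d ^ 3" using d_ge_1 by simp_all
 qed (rule d_ge_1)
 have fin: "om z * norm (exp (3/2 * s) *R T) <= cN CF d * X"
  if T: "norm T <= 3 * d ^ 3 * CF * Y" and Y: "om z * (exp (3/2 * s) * Y) <= 4 * 34 ^ 3 * X" for T :: "real ^ 'n" and X Y
 proof -
  have "om z * norm (exp (3/2 * s) *R T) = om z * (exp (3/2 * s) * norm T)" by simp
  also have "... <= om z * (exp (3/2 * s) * (3 * d ^ 3 * CF * Y))"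
   using T om_pos[of z] by (intro mult_left_mono) auto
  also have "... = (3 * d ^ 3 * CF) * (om z * (exp (3/2 * s) * Y))" by (simp add: mult_ac)
  also have "... <= (3 * d ^ 3 * CF) * (4 * 34 ^ 3 * X)" using Y CF_pos d_ge_1 by (intro mult_left_mono) auto
  finally show ?thesis by (simp add: cN_def mult_ac)
 qed
 have g1: "norm (dd b F (J0 (s, z))) <= CF * (Q 0)^2" if "b : Basis" for b
  using J(1) CF_pos by (intro order_trans[OF G(3)[OF that]] mult_left_mono power_mono) auto
 have g2: "norm (dd c (dd b F) (J0 (s, z))) <= CF * Q 0" if "b : Basis" "c : Basis" for b c
  using J(1) CF_pos by (intro order_trans[OF G(4)[OF that]] mult_left_mono) auto
 have n0: "norm (F (J0 (s, z))) <= 3 * d ^ 3 * CF * (Q 0 * Q 0 * Q 0)"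
 proof -
  have "norm (F (J0 (s, z))) <= CF * Q 0 ^ 3"
   using J(1) CF_pos by (intro order_trans[OF G(2)] mult_left_mono power_mono) auto
  also have "... <= (3 * d ^ 3) * (CF * Q 0 ^ 3)"
   using mult_right_mono[OF D(5), of "CF * Q 0 ^ 3"] CF_pos Q[of 0] by simp
  finally show ?thesis by (simp add: power3_eq_cube mult_ac)
 qed
 have n1: "norm (T1 F (J0 (s, z)) (J1 (s, z))) <= 3 * d ^ 3 * CF * (Q 0 * Q 0 * Q 1)"
 proof -
  have "norm (T1 F (J0 (s, z)) (J1 (s, z))) <= d * (norm (J1 (s, z)) * (CF * (Q 0)^2))"
   unfolding d by (rule T1_bound[OF g1])
  also have "... <= (3 * d ^ 3) * (Q 1 * (CF * (Q 0)^2))"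
   using J(2) D(1,2) CF_pos Q by (intro mult_mono) auto
  finally show ?thesis by (simp add: power2_eq_square mult_ac)
 qed
 have n2: "norm (T2 F (J0 (s, z)) (J1 (s, z)) (J2 (s, z))) <= 3 * d ^ 3 * CF * (Q 0 * Q 0 * Q 2 + Q 0 * Q 1 * Q 1)"
 proof -
  have "norm (T2 F (J0 (s, z)) (J1 (s, z)) (J2 (s, z))) <=
    d * (norm (J2 (s, z)) * (CF * (Q 0)^2) + norm (J1 (s, z)) * (d * (norm (J1 (s, z)) * (CF * Q 0))))"
   unfolding d by (rule T2_bound[OF g1 g2])
  also have "... <= d * (Q 2 * (CF * (Q 0)^2) + Q 1 * (d * (Q 1 * (CF * Q 0))))"
   using J CF_pos Q D(1) by (intro mult_left_mono add_mono mult_mono) (auto intro!: mult_nonneg_nonneg)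
  also have "... = d * (CF * (Q 0 * Q 0 * Q 2)) + d^2 * (CF * (Q 0 * Q 1 * Q 1))"
   by (simp add: power2_eq_square algebra_simps)
  also have "... <= (3 * d ^ 3) * (CF * (Q 0 * Q 0 * Q 2)) + (3 * d ^ 3) * (CF * (Q 0 * Q 1 * Q 1))"
   using D CF_pos Q by (intro add_mono mult_right_mono) auto
  finally show ?thesis by (simp add: algebra_simps)
 qed
 have n3: "norm (T3 F (J0 (s, z)) (J1 (s, z)) (J2 (s, z)) (J3 (s, z))) <=
   3 * d ^ 3 * CF * (Q 0 * Q 0 * Q 3 + Q 0 * Q 1 * Q 2 + Q 1 * Q 1 * Q 1)"
 proof -
  let ?j1 = "norm (J1 (s, z))" and ?j2 = "norm (J2 (s, z))" and ?j3 = "norm (J3 (s, z))"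
  have "norm (T3 F (J0 (s, z)) (J1 (s, z)) (J2 (s, z)) (J3 (s, z))) <=
    d * (?j3 * (CF * (Q 0)^2) + ?j2 * (d * (?j1 * (CF * Q 0)))
     + (?j2 * (d * (?j1 * (CF * Q 0))) + ?j1 * (d * (?j2 * (CF * Q 0) + ?j1 * (d * (?j1 * CF))))))"
   unfolding d by (rule T3_bound[OF g1 g2 G(5)])
  also have "... <= d * (Q 3 * (CF * (Q 0)^2) + Q 2 * (d * (Q 1 * (CF * Q 0)))
     + (Q 2 * (d * (Q 1 * (CF * Q 0))) + Q 1 * (d * (Q 2 * (CF * Q 0) + Q 1 * (d * (Q 1 * CF))))))"
   using J CF_pos Q D(1) by (intro mult_left_mono add_mono mult_mono) (auto intro!: add_nonneg_nonneg mult_nonneg_nonneg)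
  also have "... = d * (CF * (Q 0 * Q 0 * Q 3)) + (3 * d^2) * (CF * (Q 0 * Q 1 * Q 2)) + d ^ 3 * (CF * (Q 1 * Q 1 * Q 1))"
   by (simp add: power2_eq_square power3_eq_cube algebra_simps)
  also have "... <= (3 * d ^ 3) * (CF * (Q 0 * Q 0 * Q 3)) + (3 * d ^ 3) * (CF * (Q 0 * Q 1 * Q 2)) + (3 * d ^ 3) * (CF * (Q 1 * Q 1 * Q 1))"
   using D CF_pos Q by (intro add_mono mult_right_mono) auto
  finally show ?thesis by (simp add: algebra_simps)
 qed
 show "om z * norm (N 0 (s, z)) <= cN CF d * (P 0 * P 0 * P 0)"
  unfolding N_def using fin[OF n0 QP] by simp
 show "om z * norm (N 1 (s, z)) <= cN CF d * (P 0 * P 0 * P 1)"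
  unfolding N_def using fin[OF n1 QP] by simp
 have "om z * (exp (3/2 * s) * (Q 0 * Q 0 * Q 2 + Q 0 * Q 1 * Q 1)) <= 4 * 34 ^ 3 * (P 0 * P 0 * P 2 + P 0 * P 1 * P 1)"
  unfolding distrib_left by (intro add_mono QP)
 from fin[OF n2 this] show "om z * norm (N 2 (s, z)) <= cN CF d * (P 0 * P 0 * P 2 + P 0 * P 1 * P 1)"
  unfolding N_def by simp
 have "om z * (exp (3/2 * s) * (Q 0 * Q 0 * Q 3 + Q 0 * Q 1 * Q 2 + Q 1 * Q 1 * Q 1)) <=
   4 * 34 ^ 3 * (P 0 * P 0 * P 3 + P 0 * P 1 * P 2 + P 1 * P 1 * P 1)"
  unfolding distrib_left by (intro add_mono QP)
 from fin[OF n3 this] show "om z * norm (N 3 (s, z)) <= cN CF d * (P 0 * P 0 * P 3 + P 0 * P 1 * P 2 + P 1 * P 1 * P 1)"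
  unfolding N_def by simp
qed

lemma Sn_continuous: "k <= 3 ==> continuous_on UNIV (%z. Sn k (s, z))"
 unfolding Sn_def by (intro continuous_on_sum continuous_on_add continuous_on_norm continuous_slice) auto

lemma wL2_level:
 assumes "k <= 3"
 shows "wL2 R (%z. norm (W k (s, z)) + norm (b k (s, z)) + norm (a k (s, z))) <= 3 * (1 / m0^2 + 2) * E k s"
proof -
 have k: "k <= 4" using assms by simp
 note c = continuous_slice(1-3)[OF k, of s]
 have "wL2 R (%z. norm (W k (s, z)) + norm (b k (s, z)) + norm (a k (s, z))) <=
   3 * (1^2 * wL2 R (%z. norm (W k (s, z))) + 1^2 * wL2 R (%z. norm (b k (s, z))) + 1^2 * wL2 R (%z. norm (a k (s, z))))"
  by (rule wL2_comb) (auto intro!: continuous_on_add continuous_on_norm c)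
 also have "... = 3 * (wL2 R (%z. W k (s, z)) + wL2 R (%z. b k (s, z)) + wL2 R (%z. a k (s, z)))"
  by (simp add: wL2_def)
 also have "... <= 3 * (1 / m0^2 * E k s + E k s + E k s)"
 proof -
  have "wL2 R (%z. W k (s, z)) <= 1 / m0^2 * E k s"
   using energy_parts(3)[OF assms, of s] m0(1) by (simp add: field_simps)
  then show ?thesis using energy_parts(1,2)[OF assms, of s] by simp
 qed
 finally show ?thesis by (simp add: algebra_simps)
qed

lemma E_nonneg: "k <= 3 ==> E k s >= 0"
 using energy_parts(1)[of k s] wL2_nonneg[of R "%z. b k (s, z)"] by linarith

lemma wL2_Sn: "k <= 3 ==> wL2 R (%z. Sn k (s, z)) <= 3 ^ k * (3 * (1 / m0^2 + 2)) * (\<Sum>l\<le>k. E l s)"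
proof (induction k)
 case 0
 then show ?case using wL2_level[of 0 s] by (simp add: Sn_def)
next
 case (Suc k)
 let ?T = "%z. norm (W (Suc k) (s, z)) + norm (b (Suc k) (s, z)) + norm (a (Suc k) (s, z))"
 let ?c = "3 * (1 / m0^2 + 2)"
 have c: "continuous_on UNIV ?T" using Suc.prems by (intro continuous_on_add continuous_on_norm continuous_slice) auto
 have "wL2 R (%z. Sn (Suc k) (s, z)) <= 3 * (1^2 * wL2 R (%z. Sn k (s, z)) + 1^2 * wL2 R ?T + 0^2 * wL2 R ?T)"
 proof (rule wL2_comb)
  show "norm (Sn (Suc k) (s, z)) <= 1 * Sn k (s, z) + 1 * ?T z + 0 * ?T z" for z
   using Sn_nonneg[of "Suc k" "(s, z)"] by (simp add: Sn_def)
 qed (use Suc.prems c Sn_continuous in auto)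
 also have "... <= 3 * (3 ^ k * ?c * (\<Sum>l\<le>k. E l s) + ?c * E (Suc k) s)"
  using Suc wL2_level[OF Suc.prems, of s] by simp
 also have "... <= 3 * (3 ^ k * ?c * (\<Sum>l\<le>k. E l s) + 3 ^ k * (?c * E (Suc k) s))"
 proof -
  have "0 <= ?c * E (Suc k) s" using E_nonneg[OF Suc.prems, of s] m0(1) by (intro mult_nonneg_nonneg) auto
  then have "1 * (?c * E (Suc k) s) <= 3 ^ k * (?c * E (Suc k) s)" by (intro mult_right_mono) auto
  then show ?thesis by simp
 qed
 finally show ?case by (simp add: algebra_simps)
qed

text \<open>The bootstrap hypothesis: zeroth-order quantities are bounded pointwise without growth,
  the energies only up to slow exponential growth.\<close>

definition boot :: "real => real => bool" where
 "boot \<mu> s \<longleftrightarrow> (\<forall>z. om z * Sn 0 (s, z) <= \<mu>) \<and> (\<forall>k\<le>3. sqrt (E k s) <= \<mu> * exp (gam k * s))"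

lemma boot_E:
 assumes "boot \<mu> s" "k <= 3"
 shows "E k s <= \<mu>^2 * exp (2 * gam k * s)"
proof -
 have "(sqrt (E k s))^2 <= (\<mu> * exp (gam k * s))^2"
  using assms E_nonneg[OF assms(2), of s] unfolding boot_def by (intro power_mono) auto
 then show ?thesis
  using E_nonneg[OF assms(2), of s] by (simp add: power_mult_distrib power2_eq_square exp_add[symmetric] algebra_simps)
qed

lemma boot_Sn:
 assumes "boot \<mu> s" "k <= 3" "s >= 0"
 shows "wL2 R (%z. Sn k (s, z)) <= cS m0 * (\<mu>^2 * exp (2 * gam k * s))"
proof -
 let ?c = "3 * (1 / m0^2 + 2)" and ?X = "\<mu>^2 * exp (2 * gam k * s)"
 have c: "?c >= 0" by simp
 have "(\<Sum>l\<le>k. E l s) <= (\<Sum>l\<le>k. ?X)"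
 proof (rule sum_mono)
  fix l assume "l : {..k}"
  then have l: "l <= k" "l <= 3" using assms(2) by auto
  have "E l s <= \<mu>^2 * exp (2 * gam l * s)" by (rule boot_E[OF assms(1) l(2)])
  also have "... <= ?X" using gam_mono[OF l(1)] assms(3) by (intro mult_left_mono) (auto intro!: mult_right_mono)
  finally show "E l s <= ?X" .
 qed
 also have "... = (real k + 1) * ?X" by simp
 also have "... <= 4 * ?X" using assms(2) by (intro mult_right_mono) auto
 finally have "3 ^ k * ?c * (\<Sum>l\<le>k. E l s) <= 3 ^ k * ?c * (4 * ?X)" using c by (intro mult_left_mono) auto
 also have "... <= 27 * ?c * (4 * ?X)"
 proof -
  have "(3::real) ^ k <= 3 ^ 3" using assms(2) by (intro power_increasing) auto
  then show ?thesis using c by (intro mult_right_mono) auto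
 qed
 also have "... = cS m0 * ?X" by (simp add: cS_def algebra_simps)
 finally show ?thesis using order_trans[OF wL2_Sn[OF assms(2)]] by blast
qed

lemma b_z: "k <= 3 ==> ((%z. b k (s, z)) hvd b (Suc k) (s, z)) (at z)"
 unfolding b_def by (auto intro!: bounded_linear.has_vector_derivative[OF bounded_linear_scaleR_right] V_z)

lemma a_z: "k <= 3 ==> ((%z. a k (s, z)) hvd a (Suc k) (s, z)) (at z)"
 unfolding a_def by (auto intro!: bounded_linear.has_vector_derivative[OF bounded_linear_scaleR_right] W_z)

lemma sobolev_E:
 assumes k: "k <= 2" and s: "s : {0..S}"
 shows "(om z * norm (b k (s, z)))^2 <= 3 * E k s + 2 * (sqrt (E k s) * sqrt (E (Suc k) s))"
  "(om z * norm (a k (s, z)))^2 <= 3 * E k s + 2 * (sqrt (E k s) * sqrt (E (Suc k) s))"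
  "(m0 * (om z * norm (W k (s, z))))^2 <= 3 * E k s + 2 * (sqrt (E k s) * sqrt (E (Suc k) s))"
proof -
 have k': "k <= 3" "k <= 4" "Suc k <= 3" "Suc k <= 4" using k by auto
 have up: "3 * wL2 R f + 2 * (sqrt (wL2 R f) * sqrt (wL2 R f')) <= 3 * E k s + 2 * (sqrt (E k s) * sqrt (E (Suc k) s))"
  if "wL2 R f <= E k s" "wL2 R f' <= E (Suc k) s" for f f' :: "real => real ^ 'n"
  using that wL2_nonneg[of R f] wL2_nonneg[of R f'] by (intro add_mono mult_left_mono mult_mono) auto
 have z: "b k (s, z) = 0" "a k (s, z) = 0" "W k (s, z) = 0" if "\<bar>z\<bar> >= R" for z
  using supp_W_V[OF s that] by (auto simp: a_def b_def)
 show "(om z * norm (b k (s, z)))^2 <= 3 * E k s + 2 * (sqrt (E k s) * sqrt (E (Suc k) s))"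
  unfolding power_mult_distrib
  by (rule order_trans[OF sobolev[OF b_z[OF k'(1)] continuous_slice(3)[OF k'(4)] z(1)] up])
   (auto intro: energy_parts k')
 show "(om z * norm (a k (s, z)))^2 <= 3 * E k s + 2 * (sqrt (E k s) * sqrt (E (Suc k) s))"
  unfolding power_mult_distrib
  by (rule order_trans[OF sobolev[OF a_z[OF k'(1)] continuous_slice(2)[OF k'(4)] z(2)] up])
   (auto intro: energy_parts k')
 have e: "sqrt (m0^2 * wL2 R (%z. W j (s, z))) = m0 * sqrt (wL2 R (%z. W j (s, z)))" for j
  using m0(1) by (simp add: real_sqrt_mult)
 have "(m0 * (om z * norm (W k (s, z))))^2 = m0^2 * ((om z)^2 * (norm (W k (s, z)))^2)" by (simp add: power_mult_distrib)
 also have "... <= m0^2 * (3 * wL2 R (%z. W k (s, z)) + 2 * (sqrt (wL2 R (%z. W k (s, z))) * sqrt (wL2 R (%z. W (Suc k) (s, z)))))"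
  by (intro mult_left_mono sobolev[OF W_z[OF k'(2)] continuous_slice(1)[OF k'(4)] z(3)]) auto
 also have "... = 3 * (m0^2 * wL2 R (%z. W k (s, z))) + 2 * (sqrt (m0^2 * wL2 R (%z. W k (s, z))) * sqrt (m0^2 * wL2 R (%z. W (Suc k) (s, z))))"
  unfolding e by (simp add: power2_eq_square algebra_simps)
 also have "... <= 3 * E k s + 2 * (sqrt (E k s) * sqrt (E (Suc k) s))"
  using energy_parts(3)[OF k'(1), of s] energy_parts(3)[OF k'(3), of s] wL2_nonneg[of R "%z. W k (s, z)"] wL2_nonneg[of R "%z. W (Suc k) (s, z)"]
   E_nonneg[OF k'(1), of s]
  by (intro add_mono mult_left_mono mult_mono real_sqrt_le_mono) auto
 finally show "(m0 * (om z * norm (W k (s, z))))^2 <= 3 * E k s + 2 * (sqrt (E k s) * sqrt (E (Suc k) s))" .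
qed


lemma boot_mu: "boot \<mu> s ==> \<mu> >= 0"
 using Sn_nonneg[of 0 "(s, 0)"] om_pos[of 0] mult_nonneg_nonneg[of "om 0" "Sn 0 (s, 0)"]
 unfolding boot_def by (meson less_imp_le order_trans)

text \<open>Sobolev's inequality takes the geometric mean of two consecutive energies, so their
  exponents are averaged. The constant 3 + 2 = 5 is raised to 9 to make the bound a perfect
  square.\<close>

lemma boot_sobolev:
 assumes B: "boot \<mu> s" and s: "s : {0..S}" and k: "k <= 2" and Q: "Q = 3 * E k s + 2 * (sqrt (E k s) * sqrt (E (Suc k) s))"
  and K: "K >= 0" "sqrt (E k s) <= K * exp (g * s)" "sqrt (E (Suc k) s) <= K * exp (h * s)" "g <= h"
 shows "Q <= (3 * (K * exp ((g + h) / 2 * s)))^2"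
proof -
 have k': "k <= 3" "Suc k <= 3" using k by auto
 have s0: "s >= 0" using s by simp
 have e: "exp (g * s) * exp (g * s) <= exp ((g + h) * s)" "exp (g * s) * exp (h * s) = exp ((g + h) * s)"
  using mult_right_mono[OF K(4) s0] by (auto simp: exp_add[symmetric] algebra_simps)
 have "E k s = sqrt (E k s) * sqrt (E k s)" using E_nonneg[OF k'(1), of s] by simp
 also have "... <= (K * exp (g * s)) * (K * exp (g * s))" using K E_nonneg[OF k'(1), of s] by (intro mult_mono) auto
 also have "... = K^2 * (exp (g * s) * exp (g * s))" by (simp add: power2_eq_square)
 also have "... <= K^2 * exp ((g + h) * s)" by (intro mult_left_mono e) simp
 finally have 1: "E k s <= K^2 * exp ((g + h) * s)" .
 have "sqrt (E k s) * sqrt (E (Suc k) s) <= (K * exp (g * s)) * (K * exp (h * s))"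
  using K E_nonneg[OF k'(1), of s] E_nonneg[OF k'(2), of s] by (intro mult_mono) auto
 also have "... = K^2 * (exp (g * s) * exp (h * s))" by (simp add: power2_eq_square)
 finally have 2: "sqrt (E k s) * sqrt (E (Suc k) s) <= K^2 * exp ((g + h) * s)" unfolding e(2) .
 have "Q <= 5 * (K^2 * exp ((g + h) * s))" unfolding Q using 1 2 by linarith
 also have "... <= 9 * (K^2 * exp ((g + h) * s))" by simp
 also have "... = (3 * (K * exp ((g + h) / 2 * s)))^2"
 proof -
  have "exp ((g + h) * s) = (exp ((g + h) / 2 * s))^2" by (simp add: power2_eq_square exp_add[symmetric] algebra_simps)
  then show ?thesis by (simp add: power_mult_distrib)
 qed
 finally show ?thesis .
qed

lemma boot_S1:
 assumes B: "boot \<mu> s" and s: "s : {0..S}"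
 shows "om z * Sn 1 (s, z) <= c1 m0 * (\<mu> * exp (1/5 * s))"
proof -
 have mu: "\<mu> >= 0" by (rule boot_mu[OF B])
 let ?X = "\<mu> * exp (1/5 * s)"
 let ?Q = "3 * E 1 s + 2 * (sqrt (E 1 s) * sqrt (E (Suc 1) s))"
 have X: "\<mu> <= ?X" "?X >= 0" using mu s mult_left_mono[of 1 "exp (1/5 * s)" \<mu>] by auto
 have bk: "sqrt (E k s) <= \<mu> * exp (gam k * s)" if "k <= 3" for k
  using B that unfolding boot_def by blast
 have "sqrt (E 1 s) <= \<mu> * exp (1/10 * s)" "sqrt (E (Suc 1) s) <= \<mu> * exp (3/10 * s)"
  using bk[of 1] bk[of "Suc 1"] by (simp_all add: gam_def)
 from boot_sobolev[OF B s _ refl mu this] have Q: "?Q <= (3 * ?X)^2" by simp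
 have b1: "om z * norm (b 1 (s, z)) <= 3 * ?X"
  by (rule power2_le_imp_le[OF order_trans[OF sobolev_E(1)[OF _ s] Q]]) (use X in auto)
 moreover have "om z * norm (a 1 (s, z)) <= 3 * ?X"
  by (rule power2_le_imp_le[OF order_trans[OF sobolev_E(2)[OF _ s] Q]]) (use X in auto)
 moreover have W1: "m0 * (om z * norm (W 1 (s, z))) <= 3 * ?X"
  by (rule power2_le_imp_le[OF order_trans[OF sobolev_E(3)[OF _ s] Q]]) (use X in auto)
 moreover have "om z * norm (W 1 (s, z)) <= 3 / m0 * ?X"
  using W1 m0(1) by (simp add: field_simps)
 moreover have "om z * Sn 0 (s, z) <= \<mu>" using B unfolding boot_def by blast
 moreover have "om z * Sn 1 (s, z) = om z * Sn 0 (s, z) + om z * norm (W 1 (s, z)) + om z * norm (b 1 (s, z)) + om z * norm (a 1 (s, z))"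
  by (simp add: Sn_def algebra_simps)
 ultimately have "om z * Sn 1 (s, z) <= ?X + 3 / m0 * ?X + 3 * ?X + 3 * ?X" using X by linarith
 also have "... = c1 m0 * ?X" by (simp add: c1_def algebra_simps)
 finally show ?thesis .
qed

lemma cN_nonneg: "cN CF d >= 0"
 using CF_pos d_ge_1 by (auto simp: cN_def)

text \<open>A template for the four levels: \<open>i\<close> and \<open>j\<close> switch on the
  products with intermediate factors, and the side conditions say that the growth of these products
  does not exceed that allowed for level \<open>k\<close>.\<close>

lemma boot_N_gen:
 assumes B: "boot \<mu> s" and s: "s : {0..S}" and k: "k <= 3" "kk <= 3"
  and pw: "!!z. norm (N k (s, z)) <= (cN CF d * \<mu>^2) * Sn k (s, z) + (i * (cN CF d * (\<mu> * (c1 m0 * (\<mu> * exp (1/5 * s)))))) * Sn kk (s, z)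
    + (j * (cN CF d * (c1 m0 * (\<mu> * exp (1/5 * s)))^2)) * Sn 1 (s, z)"
  and ij: "i = 0 \<or> (i = 1 \<and> 2/5 + 2 * gam kk <= 2 * gam k)" "j = 0 \<or> (j = 1 \<and> 1 <= 2 * gam k)"
 shows "sqrt (wL2 R (%z. N k (s, z))) <= cH m0 CF d * \<mu> ^ 3 * exp (gam k * s)"
proof -
 have s0: "s >= 0" using s by simp
 have mu: "\<mu> >= 0" by (rule boot_mu[OF B])
 define Z where "Z = \<mu> ^ 6 * exp (2 * gam k * s)"
 have Z: "Z >= 0" using mu by (simp add: Z_def)
 define c where "c = cN CF d"
 define q where "q = c1 m0"
 have S: "wL2 R (%z. Sn l (s, z)) <= cS m0 * (\<mu>^2 * exp (2 * gam l * s))" if "l <= 3" for l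
  by (rule boot_Sn[OF B that s0])
 have "wL2 R (%z. N k (s, z)) <= 3 * ((c * \<mu>^2)^2 * wL2 R (%z. Sn k (s, z))
   + (i * (c * (\<mu> * (q * (\<mu> * exp (1/5 * s))))))^2 * wL2 R (%z. Sn kk (s, z))
   + (j * (c * (q * (\<mu> * exp (1/5 * s)))^2))^2 * wL2 R (%z. Sn 1 (s, z)))"
  unfolding c_def q_def by (rule wL2_comb) (use pw k continuous_slice(4) Sn_continuous in auto)
 also have "... <= 3 * (c^2 * cS m0 * Z + c^2 * q^2 * cS m0 * Z + c^2 * q ^ 4 * cS m0 * Z)"
 proof (intro mult_left_mono add_mono)
  have "(c * \<mu>^2)^2 * wL2 R (%z. Sn k (s, z)) <= (c * \<mu>^2)^2 * (cS m0 * (\<mu>^2 * exp (2 * gam k * s)))"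
   by (intro mult_left_mono S k) simp
  also have "... = c^2 * cS m0 * Z" by (simp add: Z_def power_mult_distrib power2_eq_square power_numeral_reduce)
  finally show "(c * \<mu>^2)^2 * wL2 R (%z. Sn k (s, z)) <= c^2 * cS m0 * Z" .
  show "(i * (c * (\<mu> * (q * (\<mu> * exp (1/5 * s))))))^2 * wL2 R (%z. Sn kk (s, z)) <= c^2 * q^2 * cS m0 * Z"
  proof (cases "i = 0")
   case True
   then show ?thesis using Z cS_pos[OF m0(1)] by simp
  next
   case False
   then have i: "i = 1" "2/5 + 2 * gam kk <= 2 * gam k" using ij by auto
   have "(i * (c * (\<mu> * (q * (\<mu> * exp (1/5 * s))))))^2 * wL2 R (%z. Sn kk (s, z)) <=
     (c * (\<mu> * (q * (\<mu> * exp (1/5 * s)))))^2 * (cS m0 * (\<mu>^2 * exp (2 * gam kk * s)))"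
    unfolding i mult_1 by (intro mult_left_mono S k) simp
   also have "... = c^2 * q^2 * cS m0 * (\<mu> ^ 6 * (exp (1/5 * s) * exp (1/5 * s) * exp (2 * gam kk * s)))"
    by (simp add: power2_eq_square power_numeral_reduce mult_ac)
   also have "exp (1/5 * s) * exp (1/5 * s) * exp (2 * gam kk * s) = exp ((2/5 + 2 * gam kk) * s)"
    by (simp add: exp_add[symmetric] algebra_simps)
   also have "c^2 * q^2 * cS m0 * (\<mu> ^ 6 * exp ((2/5 + 2 * gam kk) * s)) <= c^2 * q^2 * cS m0 * Z"
    unfolding Z_def using mult_right_mono[OF i(2) s0] mu cS_pos[OF m0(1)] by (intro mult_left_mono) auto
   finally show ?thesis .
  qed
  show "(j * (c * (q * (\<mu> * exp (1/5 * s)))^2))^2 * wL2 R (%z. Sn 1 (s, z)) <= c^2 * q ^ 4 * cS m0 * Z"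
  proof (cases "j = 0")
   case True
   then show ?thesis using Z cS_pos[OF m0(1)] by simp
  next
   case False
   then have j: "j = 1" "1 <= 2 * gam k" using ij by auto
   have "(j * (c * (q * (\<mu> * exp (1/5 * s)))^2))^2 * wL2 R (%z. Sn 1 (s, z)) <=
     (c * (q * (\<mu> * exp (1/5 * s)))^2)^2 * (cS m0 * (\<mu>^2 * exp (2 * gam 1 * s)))"
    unfolding j mult_1 by (intro mult_left_mono S) auto
   also have "... = c^2 * q ^ 4 * cS m0 * (\<mu> ^ 6 * (exp (1/5 * s) * exp (1/5 * s) * exp (1/5 * s) * exp (1/5 * s) * exp (2 * gam 1 * s)))"
    by (simp add: power2_eq_square power_numeral_reduce mult_ac)
   also have "exp (1/5 * s) * exp (1/5 * s) * exp (1/5 * s) * exp (1/5 * s) * exp (2 * gam 1 * s) = exp (1 * s)"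
    by (simp add: exp_add[symmetric] gam_def)
   also have "c^2 * q ^ 4 * cS m0 * (\<mu> ^ 6 * exp (1 * s)) <= c^2 * q ^ 4 * cS m0 * Z"
    unfolding Z_def using mult_right_mono[OF j(2) s0] mu cS_pos[OF m0(1)] by (intro mult_left_mono) auto
   finally show ?thesis .
  qed
 qed simp
 also have "... = (cH m0 CF d)^2 * Z"
  using cS_pos[OF m0(1)] by (simp add: cH_def c_def q_def algebra_simps add_nonneg_nonneg)
 also have "... = (cH m0 CF d * \<mu> ^ 3 * exp (gam k * s))^2"
  by (simp add: Z_def power_mult_distrib power2_eq_square exp_add[symmetric] power_numeral_reduce algebra_simps)
 finally have "sqrt (wL2 R (%z. N k (s, z))) <= sqrt ((cH m0 CF d * \<mu> ^ 3 * exp (gam k * s))^2)"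
  by (rule real_sqrt_le_mono)
 then show ?thesis using cH_nonneg[OF m0(1), of CF d] mu by simp
qed

text \<open>In every product at most one factor carries more than one derivative. It is measured in
  the weighted L^2 norm, the others pointwise, by \<mu> at level 0 and by \<open>M\<close> at level
  1.\<close>

lemma boot_N:
 assumes B: "boot \<mu> s" and s: "s : {0..S}" and k: "k <= 3"
 shows "sqrt (wL2 R (%z. N k (s, z))) <= cH m0 CF d * \<mu> ^ 3 * exp (gam k * s)"
proof -
 have s0: "s >= 0" using s by simp
 have mu: "\<mu> >= 0" by (rule boot_mu[OF B])
 define M where "M = c1 m0 * (\<mu> * exp (1/5 * s))"
 let ?c = "cN CF d"
 have M: "M >= 0" using c1_pos[OF m0(1)] mu by (simp add: M_def)
 have P0: "om z * Sn 0 (s, z) <= \<mu>" for z using B unfolding boot_def by blast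
 have P1: "om z * Sn 1 (s, z) <= M" for z unfolding M_def by (rule boot_S1[OF B s])
 have nn: "om z * Sn l (s, z) >= 0" for l z using om_pos[of z] Sn_nonneg[of l "(s, z)"] by simp
 note pw = N_pointwise[OF s0]
 have div: "norm v <= Y" if "om z * norm v <= om z * Y" for z Y and v :: "real ^ 'n"
  using that om_pos[of z] by simp
 consider "k = 0" | "k = 1" | "k = 2" | "k = 3" using k by linarith
 then show ?thesis
 proof cases
  case 1
  show ?thesis
  proof (rule boot_N_gen[OF B s k, of 0 0 0])
   fix z
   have "om z * norm (N 0 (s, z)) <= ?c * ((om z * Sn 0 (s, z)) * (om z * Sn 0 (s, z)) * (om z * Sn 0 (s, z)))" by (rule pw(1))
   also have "... <= ?c * (\<mu> * \<mu> * (om z * Sn 0 (s, z)))"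
    by (intro mult_left_mono mult_mono P0 nn cN_nonneg less_imp_le[OF om_pos] Sn_nonneg) (auto simp: mu nn)
   finally have "om z * norm (N 0 (s, z)) <= om z * ((?c * \<mu>^2) * Sn 0 (s, z))" by (simp add: power2_eq_square mult_ac)
   from div[OF this] show "norm (N k (s, z)) <= (?c * \<mu>^2) * Sn k (s, z) + (0 * (?c * (\<mu> * (c1 m0 * (\<mu> * exp (1/5 * s)))))) * Sn 0 (s, z)
    + (0 * (?c * (c1 m0 * (\<mu> * exp (1/5 * s)))^2)) * Sn 1 (s, z)" by (simp add: 1)
  qed auto
 next
  case 2
  show ?thesis
  proof (rule boot_N_gen[OF B s k, of 0 0 0])
   fix z
   have "om z * norm (N 1 (s, z)) <= ?c * ((om z * Sn 0 (s, z)) * (om z * Sn 0 (s, z)) * (om z * Sn 1 (s, z)))" by (rule pw(2))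
   also have "... <= ?c * (\<mu> * \<mu> * (om z * Sn 1 (s, z)))"
    by (intro mult_left_mono mult_mono P0 nn cN_nonneg less_imp_le[OF om_pos] Sn_nonneg) (auto simp: mu nn)
   finally have "om z * norm (N 1 (s, z)) <= om z * ((?c * \<mu>^2) * Sn 1 (s, z))" by (simp add: power2_eq_square mult_ac)
   from div[OF this] show "norm (N k (s, z)) <= (?c * \<mu>^2) * Sn k (s, z) + (0 * (?c * (\<mu> * (c1 m0 * (\<mu> * exp (1/5 * s)))))) * Sn 0 (s, z)
    + (0 * (?c * (c1 m0 * (\<mu> * exp (1/5 * s)))^2)) * Sn 1 (s, z)" by (simp add: 2)
  qed auto
 next
  case 3
  show ?thesis
  proof (rule boot_N_gen[OF B s k, of 1 1 0])
   fix z
   have "om z * norm (N 2 (s, z)) <= ?c * ((om z * Sn 0 (s, z)) * (om z * Sn 0 (s, z)) * (om z * Sn 2 (s, z))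
     + (om z * Sn 0 (s, z)) * (om z * Sn 1 (s, z)) * (om z * Sn 1 (s, z)))" by (rule pw(3))
   also have "... <= ?c * (\<mu> * \<mu> * (om z * Sn 2 (s, z)) + \<mu> * M * (om z * Sn 1 (s, z)))"
    by (intro mult_left_mono add_mono mult_mono P0 P1 nn cN_nonneg less_imp_le[OF om_pos] Sn_nonneg) (auto simp: mu nn M)
   finally have "om z * norm (N 2 (s, z)) <= om z * ((?c * \<mu>^2) * Sn 2 (s, z) + (?c * (\<mu> * M)) * Sn 1 (s, z))"
    by (simp add: power2_eq_square algebra_simps)
   from div[OF this] show "norm (N k (s, z)) <= (?c * \<mu>^2) * Sn k (s, z) + (1 * (?c * (\<mu> * (c1 m0 * (\<mu> * exp (1/5 * s)))))) * Sn 1 (s, z)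
    + (0 * (?c * (c1 m0 * (\<mu> * exp (1/5 * s)))^2)) * Sn 1 (s, z)" by (simp add: 3 M_def)
  qed (auto simp: gam_def 3)
 next
  case 4
  show ?thesis
  proof (rule boot_N_gen[OF B s k, of 2 1 1])
   fix z
   have "om z * norm (N 3 (s, z)) <= ?c * ((om z * Sn 0 (s, z)) * (om z * Sn 0 (s, z)) * (om z * Sn 3 (s, z))
     + (om z * Sn 0 (s, z)) * (om z * Sn 1 (s, z)) * (om z * Sn 2 (s, z))
     + (om z * Sn 1 (s, z)) * (om z * Sn 1 (s, z)) * (om z * Sn 1 (s, z)))" by (rule pw(4))
   also have "... <= ?c * (\<mu> * \<mu> * (om z * Sn 3 (s, z)) + \<mu> * M * (om z * Sn 2 (s, z)) + M * M * (om z * Sn 1 (s, z)))"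
    by (intro mult_left_mono add_mono mult_mono P0 P1 nn cN_nonneg less_imp_le[OF om_pos] Sn_nonneg) (auto simp: mu nn M)
   finally have "om z * norm (N 3 (s, z)) <= om z * ((?c * \<mu>^2) * Sn 3 (s, z) + (?c * (\<mu> * M)) * Sn 2 (s, z) + (?c * M^2) * Sn 1 (s, z))"
    by (simp add: power2_eq_square algebra_simps)
   from div[OF this] show "norm (N k (s, z)) <= (?c * \<mu>^2) * Sn k (s, z) + (1 * (?c * (\<mu> * (c1 m0 * (\<mu> * exp (1/5 * s)))))) * Sn 2 (s, z)
    + (1 * (?c * (c1 m0 * (\<mu> * exp (1/5 * s)))^2)) * Sn 1 (s, z)" by (simp add: 4 M_def)
  qed (auto simp: gam_def 4)
 qed
qed

lemma E_within:
 assumes k: "k <= 3" and s': "s' : {0..S}"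
 shows "\<exists>D. \<forall>s\<in>{0..s'}. (E k hrd D s) (at s within {0..s'}) \<and>
  D s <= 2 * 1.1 * E k s + 2 * sqrt (E k s) * sqrt (wL2 R (%z. N k (s, z))) \<and>
  D s <= 2 * sqrt (E k s) * (3 * exp (- s) * sqrt (wL2 R (%z. W (Suc k) (s, z))) + sqrt (wL2 R (%z. N k (s, z))))"
proof (rule E_inequality[OF k])
 fix D assume D: "!!s. s : {0..S} ==> (E k hrd D s) (at s within {0..S})"
  "!!s. s : {0..S} ==> D s <= 2 * 1.1 * E k s + 2 * sqrt (E k s) * sqrt (wL2 R (%z. N k (s, z)))"
  "!!s. s : {0..S} ==> D s <= 2 * sqrt (E k s) * (3 * exp (- s) * sqrt (wL2 R (%z. W (Suc k) (s, z)))
   + sqrt (wL2 R (%z. N k (s, z))))"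
 have sub: "{0..s'} \<subseteq> {0..S}" using s' by auto
 show ?thesis
 proof (intro exI[of _ D] ballI conjI)
  fix s assume "s : {0..s'}"
  then have s: "s : {0..S}" using sub by blast
  show "(E k hrd D s) (at s within {0..s'})" by (rule DERIV_subset[OF D(1)[OF s] sub])
 qed (rule D(2) D(3); use sub in blast)+
qed

text \<open>No higher energy is available, so the cross term is absorbed at the rate 1.1; the factor
  5 is 1 / (13/10 - 1.1).\<close>

lemma top_energy:
 assumes s': "s' : {0..S}" and B: "!!s. s : {0..s'} ==> boot \<mu> s" and i: "sqrt (E 3 0) <= ep" and s: "s : {0..s'}"
 shows "sqrt (E 3 s) <= (ep + 5 * cH m0 CF d * \<mu> ^ 3) * exp (gam 3 * s)"
proof -
 let ?h = "cH m0 CF d * \<mu> ^ 3"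
 have mu: "\<mu> >= 0" by (rule boot_mu[OF B[OF s]])
 have h: "?h >= 0" using cH_nonneg[OF m0(1), of CF d] mu by simp
 have e0: "ep >= 0" using i real_sqrt_ge_zero[OF E_nonneg, of 3 0] by linarith
 obtain D where D: "!!s. s : {0..s'} ==> (E 3 hrd D s) (at s within {0..s'})"
  "!!s. s : {0..s'} ==> D s <= 2 * 1.1 * E 3 s + 2 * sqrt (E 3 s) * sqrt (wL2 R (%z. N 3 (s, z)))"
  using E_within[OF order_refl s'] by blast
 have D2: "D s <= 2 * 1.1 * E 3 s + 2 * sqrt (E 3 s) * (?h * exp (gam 3 * s))" if s: "s : {0..s'}" for s
 proof -
  have "sqrt (wL2 R (%z. N 3 (s, z))) <= ?h * exp (gam 3 * s)"
   by (rule boot_N[OF B[OF s]]) (use s s' in auto)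
  then have "2 * sqrt (E 3 s) * sqrt (wL2 R (%z. N 3 (s, z))) <= 2 * sqrt (E 3 s) * (?h * exp (gam 3 * s))"
   by (intro mult_left_mono) (auto simp: E_nonneg)
  then show ?thesis using D(2)[OF s] by linarith
 qed
 have "sqrt (E 3 s) <= exp (1.1 * (s - 0)) * sqrt (E 3 0) + ?h / (gam 3 - 1.1) * exp (gam 3 * s)"
  by (rule sqrt_gronwall[OF D(1) _ D2 _ _ h s]) (auto simp: E_nonneg gam_def)
 also have "exp (1.1 * (s - 0)) * sqrt (E 3 0) <= exp (gam 3 * s) * ep"
  using i s e0 by (intro mult_mono) (auto simp: gam_def E_nonneg)
 also have "?h / (gam 3 - 1.1) = 5 * ?h" by (simp add: gam_def)
 finally show ?thesis by (simp add: algebra_simps)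
qed

text \<open>Here the cross term is paid with the next energy and the gain e^{-s}. No homogeneous
  growth remains, and the level inherits \<open>gam (Suc k) - 1\<close>, which is at most
  \<open>gam k\<close>.\<close>

lemma descend_energy:
 assumes s': "s' : {0..S}" and B: "!!s. s : {0..s'} ==> boot \<mu> s" and i: "sqrt (E k 0) <= ep" and s: "s : {0..s'}"
  and k: "k <= 2" and K: "!!s. s : {0..s'} ==> sqrt (E (Suc k) s) <= K * exp (gam (Suc k) * s)" "K >= 0"
 shows "sqrt (E k s) <= (ep + (3 * K / m0 + cH m0 CF d * \<mu> ^ 3) / gam k) * exp (gam k * s)"
proof -
 let ?h = "3 * K / m0 + cH m0 CF d * \<mu> ^ 3"
 have k': "k <= 3" "Suc k <= 3" using k by auto
 have mu: "\<mu> >= 0" by (rule boot_mu[OF B[OF s]])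
 have h: "?h >= 0" using cH_nonneg[OF m0(1), of CF d] mu K m0(1) by simp
 have e0: "ep >= 0" using i real_sqrt_ge_zero[OF E_nonneg[OF k'(1)], of 0] by linarith
 have g: "gam k > 0" "gam (Suc k) - 1 <= gam k" using k by (auto simp: gam_def)
 obtain D where D: "!!s. s : {0..s'} ==> (E k hrd D s) (at s within {0..s'})"
  "!!s. s : {0..s'} ==> D s <= 2 * sqrt (E k s) * (3 * exp (- s) * sqrt (wL2 R (%z. W (Suc k) (s, z)))
   + sqrt (wL2 R (%z. N k (s, z))))"
  using E_within[OF k'(1) s'] by blast
 have D2: "D s <= 2 * 0 * E k s + 2 * sqrt (E k s) * (?h * exp (gam k * s))" if s: "s : {0..s'}" for s
 proof -
  have sS: "s : {0..S}" "s >= 0" using s s' by auto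
  have 1: "sqrt (wL2 R (%z. N k (s, z))) <= cH m0 CF d * \<mu> ^ 3 * exp (gam k * s)"
   by (rule boot_N[OF B[OF s] sS(1) k'(1)])
  have "m0 * sqrt (wL2 R (%z. W (Suc k) (s, z))) = sqrt (m0^2 * wL2 R (%z. W (Suc k) (s, z)))"
   using m0(1) by (simp add: real_sqrt_mult)
  also have "... <= sqrt (E (Suc k) s)" by (intro real_sqrt_le_mono energy_parts(3) k')
  also have "... <= K * exp (gam (Suc k) * s)" by (rule K(1)[OF s])
  finally have "sqrt (wL2 R (%z. W (Suc k) (s, z))) <= K / m0 * exp (gam (Suc k) * s)"
   using m0(1) by (simp add: field_simps)
  then have "3 * exp (- s) * sqrt (wL2 R (%z. W (Suc k) (s, z))) <= 3 * exp (- s) * (K / m0 * exp (gam (Suc k) * s))"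
   by (intro mult_left_mono) auto
  also have "... = 3 * K / m0 * exp ((gam (Suc k) - 1) * s)" by (simp add: algebra_simps exp_diff exp_minus field_simps)
  also have "... <= 3 * K / m0 * exp (gam k * s)"
   using g sS K m0(1) by (intro mult_left_mono) (auto intro!: mult_right_mono)
  finally have "3 * exp (- s) * sqrt (wL2 R (%z. W (Suc k) (s, z))) + sqrt (wL2 R (%z. N k (s, z))) <= ?h * exp (gam k * s)"
   using 1 by (simp add: algebra_simps)
  then have "2 * sqrt (E k s) * (3 * exp (- s) * sqrt (wL2 R (%z. W (Suc k) (s, z))) + sqrt (wL2 R (%z. N k (s, z))))
    <= 2 * sqrt (E k s) * (?h * exp (gam k * s))"
   by (intro mult_left_mono) (auto simp: E_nonneg k')
  then show ?thesis using D(2)[OF s] by linarith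
 qed
 have "sqrt (E k s) <= exp (0 * (s - 0)) * sqrt (E k 0) + ?h / (gam k - 0) * exp (gam k * s)"
  by (rule sqrt_gronwall[OF D(1) _ D2 _ _ h s]) (use g in \<open>auto simp: E_nonneg k'\<close>)
 also have "exp (0 * (s - 0)) * sqrt (E k 0) <= exp (gam k * s) * ep"
  using i s e0 g by (intro mult_mono) (auto simp: E_nonneg k')
 finally show ?thesis by (simp add: algebra_simps)
qed

end

text \<open>The constants of the downward recursion, starting with the top energy; their sum
  dominates all four levels.\<close>

definition cE3 :: "real => real => real => real" where "cE3 m0 CF d = 1 + 5 * cH m0 CF d"
definition cE2 :: "real => real => real => real" where "cE2 m0 CF d = 1 + (3 * cE3 m0 CF d / m0 + cH m0 CF d) / gam 2"
definition cE1 :: "real => real => real => real" where "cE1 m0 CF d = 1 + (3 * cE2 m0 CF d / m0 + cH m0 CF d) / gam 1"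
definition cE0 :: "real => real => real => real" where "cE0 m0 CF d = 1 + (3 * cE1 m0 CF d / m0 + cH m0 CF d) / gam 0"
definition cE :: "real => real => real => real" where "cE m0 CF d = cE0 m0 CF d + cE1 m0 CF d + cE2 m0 CF d + cE3 m0 CF d"

lemma cE_ge:
 assumes "m0 > 0"
 shows "cE3 m0 CF d >= 1" "cE2 m0 CF d >= 1" "cE1 m0 CF d >= 1" "cE0 m0 CF d >= 1"
proof -
 note h = cH_nonneg[OF assms, of CF d]
 show 3: "cE3 m0 CF d >= 1" using h by (simp add: cE3_def)
 show 2: "cE2 m0 CF d >= 1" using 3 h assms by (simp add: cE2_def gam_def)
 show 1: "cE1 m0 CF d >= 1" using 2 h assms by (simp add: cE1_def gam_def)
 show "cE0 m0 CF d >= 1" using 1 h assms by (simp add: cE0_def gam_def)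
qed

context kgw_dim
begin

lemma improved_energy:
 assumes s': "s' : {0..S}" and B: "!!s. s : {0..s'} ==> boot \<mu> s" and i: "!!k. k <= 3 ==> sqrt (E k 0) <= ep"
  and s: "s : {0..s'}" and k: "k <= 3"
 shows "sqrt (E k s) <= cE m0 CF d * (ep + \<mu> ^ 3) * exp (gam k * s)"
proof -
 note c = cE_ge[OF m0(1), of CF d] and h = cH_nonneg[OF m0(1), of CF d]
 have mu: "\<mu> ^ 3 >= 0" using boot_mu[OF B[OF s]] by simp
 have e0: "ep >= 0" using i[of 0] real_sqrt_ge_zero[OF E_nonneg, of 0 0] by linarith
 define Y where "Y = ep + \<mu> ^ 3"
 have Y: "Y >= 0" "ep <= Y" "\<mu> ^ 3 <= Y" using mu e0 by (auto simp: Y_def)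
 have hY: "cH m0 CF d * \<mu> ^ 3 <= cH m0 CF d * Y" using h Y by (intro mult_left_mono) auto
 have lift: "sqrt (E k s) <= C' * Y * exp (gam k * s)"
  if "sqrt (E k s) <= C * exp (gam k * s)" "C <= C' * Y" for k s C C'
  by (rule order_trans[OF that(1)], rule mult_right_mono[OF that(2)]) simp
 have 3: "sqrt (E 3 s) <= cE3 m0 CF d * Y * exp (gam 3 * s)" if "s : {0..s'}" for s
  by (rule lift[OF top_energy[OF s' B i that]]) (use hY Y in \<open>auto simp: cE3_def algebra_simps\<close>)
 have step: "sqrt (E k s) <= (1 + (3 * C / m0 + cH m0 CF d) / gam k) * Y * exp (gam k * s)"
  if k: "k <= 2" and K: "!!s. s : {0..s'} ==> sqrt (E (Suc k) s) <= C * Y * exp (gam (Suc k) * s)" and C: "C >= 1"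
   and s: "s : {0..s'}" for k C s
 proof (rule lift[OF descend_energy[OF s' B i s k K]])
  have g: "gam k > 0" by (auto simp: gam_def)
  have "ep + (3 * (C * Y) / m0 + cH m0 CF d * \<mu> ^ 3) / gam k <= Y + (3 * (C * Y) / m0 + cH m0 CF d * Y) / gam k"
   using hY Y g m0(1) by (intro add_mono divide_right_mono) auto
  also have "... = (1 + (3 * C / m0 + cH m0 CF d) / gam k) * Y" using m0(1) g by (simp add: field_simps)
  finally show "ep + (3 * (C * Y) / m0 + cH m0 CF d * \<mu> ^ 3) / gam k <= (1 + (3 * C / m0 + cH m0 CF d) / gam k) * Y" .
 qed (use k C Y in auto)
 have 2: "sqrt (E 2 s) <= cE2 m0 CF d * Y * exp (gam 2 * s)" if "s : {0..s'}" for s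
  unfolding cE2_def by (rule step) (use 3 c that in auto)
 have 1: "sqrt (E 1 s) <= cE1 m0 CF d * Y * exp (gam 1 * s)" if "s : {0..s'}" for s
  unfolding cE1_def by (rule step) (use 2 c that in \<open>auto simp: Suc_1 simp del: One_nat_def\<close>)
 have 0: "sqrt (E 0 s) <= cE0 m0 CF d * Y * exp (gam 0 * s)" if "s : {0..s'}" for s
  unfolding cE0_def by (rule step) (use 1 c that in auto)
 have fin: "sqrt (E k s) <= cE m0 CF d * Y * exp (gam k * s)" if "sqrt (E k s) <= C * Y * exp (gam k * s)" "C <= cE m0 CF d" for k C
  by (rule lift[OF that(1)]) (use that(2) Y in \<open>intro mult_right_mono\<close>)
 consider "k = 0" | "k = 1" | "k = 2" | "k = 3" using k by linarith
 then show ?thesis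
  unfolding Y_def[symmetric]
  by cases (use fin[OF 0[OF s]] fin[OF 1[OF s]] fin[OF 2[OF s]] fin[OF 3[OF s]] c in \<open>auto simp: cE_def\<close>)
qed

end

section \<open>The profile equation\<close>

text \<open>The class of amplitudes that can be integrated by parts against an oscillation: value
  and derivative share one bound. This costs a factor 2 per product but makes the constants
  multiplicative.\<close>

definition tame :: "real set => real => (real => complex) => bool" where
 "tame T C h \<longleftrightarrow> (\<exists>h'. \<forall>s\<in>T. (h hvd h' s) (at s) \<and> norm (h s) <= C \<and> norm (h' s) <= C)"

lemma tame_const: "norm c <= C ==> tame T C (%s. c)"
 unfolding tame_def by (intro exI[of _ "%s. 0"]) (auto intro: order_trans[OF norm_ge_zero])

lemma tame_mult:
 assumes "tame T C f" "tame T D g" "C >= 0"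
 shows "tame T (2 * C * D) (%s. f s * g s)"
proof -
 obtain f' where f: "!!s. s : T ==> (f hvd f' s) (at s)" "!!s. s : T ==> norm (f s) <= C" "!!s. s : T ==> norm (f' s) <= C"
  using assms(1) unfolding tame_def by blast
 obtain g' where g: "!!s. s : T ==> (g hvd g' s) (at s)" "!!s. s : T ==> norm (g s) <= D" "!!s. s : T ==> norm (g' s) <= D"
  using assms(2) unfolding tame_def by blast
 show ?thesis
  unfolding tame_def
 proof (intro exI[of _ "%s. f s * g' s + f' s * g s"] ballI conjI)
  fix s assume s: "s : T"
  have D: "D >= 0" using g(2)[OF s] norm_ge_zero order_trans by blast
  show "((%s. f s * g s) hvd f s * g' s + f' s * g s) (at s)"
   by (rule has_vector_derivative_mult[OF f(1)[OF s] g(1)[OF s]])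
  have fg: "norm (f s * g s) <= C * D" "norm (f s * g' s) <= C * D" "norm (f' s * g s) <= C * D"
   unfolding norm_mult using f(2,3)[OF s] g(2,3)[OF s] assms(3) by (auto intro: mult_mono)
  moreover have "0 <= C * D" using assms(3) D by simp
  ultimately show "norm (f s * g s) <= 2 * C * D" by linarith
  show "norm (f s * g' s + f' s * g s) <= 2 * C * D"
   using norm_triangle_ineq[of "f s * g' s" "f' s * g s"] fg by linarith
 qed
qed

lemma tame_sum:
 assumes "finite I" "!!i. i : I ==> tame T (C i) (f i)"
 shows "tame T (\<Sum>i\<in>I. C i) (%s. \<Sum>i\<in>I. f i s)"
proof -
 have "\<forall>i\<in>I. \<exists>h'. \<forall>s\<in>T. (f i hvd h' s) (at s) \<and> norm (f i s) <= C i \<and> norm (h' s) <= C i"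
  using assms(2) unfolding tame_def by blast
 then obtain f' where f': "!!i s. i : I ==> s : T ==> (f i hvd f' i s) (at s) \<and> norm (f i s) <= C i \<and> norm (f' i s) <= C i"
  by metis
 show ?thesis
  unfolding tame_def using f'
  by (intro exI[of _ "%s. \<Sum>i\<in>I. f' i s"] ballI conjI has_vector_derivative_sum sum_norm_le) auto
qed

lemma tame_mono: "tame T C f ==> C <= D ==> tame T D f"
 unfolding tame_def by (blast intro: order_trans)

lemma tame_cnj: "tame T C f ==> tame T C (%s. cnj (f s))"
proof -
 assume "tame T C f"
 then obtain f' where "\<forall>s\<in>T. (f hvd f' s) (at s) \<and> norm (f s) <= C \<and> norm (f' s) <= C"
  unfolding tame_def by blast
 then show ?thesis
  unfolding tame_def
  by (intro exI[of _ "%s. cnj (f' s)"]) (auto intro: bounded_linear.has_vector_derivative[OF bounded_linear_cnj])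
qed

lemma tame_conj_sign: "tame T C f ==> tame T C (%s. conj_sign i (f s))"
 unfolding conj_sign_def using tame_cnj by (cases "i = 1") auto

section \<open>Resonant and nonresonant parts of the cubic nonlinearity\<close>

definition signs :: "(int \<times> int \<times> int) set" where "signs = {1, -1} \<times> {1, -1} \<times> {1, -1}"

text \<open>The detuning of a cubic product from the j-th oscillator; its zeros are the mass
  resonances.\<close>

definition phase :: "('n => real) => 'n => 'n \<times> 'n \<times> 'n => int \<times> int \<times> int => real" where
 "phase m j a sg = (case a of (a1, a2, a3) => case sg of (s1, s2, s3) =>
  of_int s1 * m a1 + of_int s2 * m a2 + of_int s3 * m a3 - m j)"

definition monomial :: "('n::finite => real) => 'n coeffs => real * real => 'n => 'n \<times> 'n \<times> 'n => int \<times> int \<times> int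
  => (complex ^ 'n) => complex" where
 "monomial m c \<omega> j a sg Y = (case a of (a1, a2, a3) => case sg of (s1, s2, s3) =>
  \<Sum>I\<in>MI1. \<Sum>J\<in>MI1. \<Sum>K\<in>MI1.
    of_real (c j (a1, a2, a3) I J K) *
    p_symb m \<omega> I a1 * p_symb m \<omega> J a2 * p_symb m \<omega> K a3 *
    of_int (s1 ^ mlen I * s2 ^ mlen J * s3 ^ mlen K) *
    conj_sign s1 (Y $ a1) * conj_sign s2 (Y $ a2) * conj_sign s3 (Y $ a3))"

lemma MI1_eq: "MI1 = {(0, 0), (1, 0), (0, 1)}"
 unfolding MI1_def mlen_def by (auto simp: le_Suc_eq)

lemma finite_signs: "finite signs" by (simp add: signs_def)

lemma res_signs_eq: "res_signs m j a = {sg : signs. phase m j a sg = 0}"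
proof (rule set_eqI)
 fix sg :: "int \<times> int \<times> int"
 obtain s1 s2 s3 where sg: "sg = (s1, s2, s3)" by (metis prod.exhaust)
 obtain a1 a2 a3 where a: "a = (a1, a2, a3)" by (metis prod.exhaust)
 have "(m j = X) = (X - m j = 0)" for X by auto
 then show "sg : res_signs m j a \<longleftrightarrow> sg : {sg : signs. phase m j a sg = 0}"
  by (simp only: sg a res_signs_def signs_def phase_def prod.case mem_Collect_eq mem_Times_iff fst_conv snd_conv conj_assoc)
qed

lemma F_red_eq:
 "F_red m c \<omega> Y $ j = 1 / of_real (m j) * (\<Sum>a\<in>res_set m j. \<Sum>sg\<in>res_signs m j a. monomial m c \<omega> j a sg Y)"
 unfolding F_red_def monomial_def by (simp add: case_prod_unfold)

lemma sum_signs: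
 fixes f :: "int => int => int => complex"
 shows "(\<Sum>sg\<in>signs. case sg of (s1, s2, s3) => f s1 s2 s3) = (\<Sum>s1\<in>{1, -1}. \<Sum>s2\<in>{1, -1}. \<Sum>s3\<in>{1, -1}. f s1 s2 s3)"
 unfolding signs_def sum.cartesian_product by (simp add: case_prod_unfold)

text \<open>One of the two complex exponentials in a real oscillation; a jet component is half the
  sum of the two. The sign power appears because conjugation changes the sign of the symbols of
  first-order derivatives.\<close>

definition osc :: "('n => real) => real * real => nat \<times> nat => 'n => real => complex ^ 'n => int => complex" where
 "osc m \<omega> I k \<tau> Y s = p_symb m \<omega> I k * of_int (s ^ mlen I) * conj_sign s (Y $ k) * cis (of_int s * (m k * \<tau>))"

lemma osc_sum:
 assumes "I : MI1"
 shows "osc m \<omega> I k \<tau> Y 1 + osc m \<omega> I k \<tau> Y (-1) = 2 * of_real (Re (p_symb m \<omega> I k * (Y $ k) * cis (m k * \<tau>)))"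
proof -
 have "cnj (p_symb m \<omega> I k) = p_symb m \<omega> I k * of_int ((-1) ^ mlen I)"
  using assms by (auto simp: MI1_eq p_symb_def mlen_def)
 then have "osc m \<omega> I k \<tau> Y (-1) = cnj (p_symb m \<omega> I k * (Y $ k) * cis (m k * \<tau>))"
  by (simp add: osc_def conj_sign_def cis_cnj)
 moreover have "osc m \<omega> I k \<tau> Y 1 = p_symb m \<omega> I k * (Y $ k) * cis (m k * \<tau>)"
  by (simp add: osc_def conj_sign_def)
 ultimately show ?thesis
  using complex_add_cnj[of "p_symb m \<omega> I k * (Y $ k) * cis (m k * \<tau>)"] by (simp only: of_real_mult of_real_numeral)
qed

lemma jet_comp_osc:
 fixes w b :: "real ^ 'n::finite"
 assumes I: "I : MI1" and w: "!!k. w $ k = Re (Y $ k * cis (m k * \<tau>))" and b: "!!k. b $ k = Re (\<i> * of_real (m k) * (Y $ k) * cis (m k * \<tau>))"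
 shows "complex_of_real (jet_comp I k (w, x *R b, (- y) *R b)) = (1/2) * (osc m (x, y) I k \<tau> Y 1 + osc m (x, y) I k \<tau> Y (-1))"
proof -
 have "jet_comp I k (w, x *R b, (- y) *R b) = Re (p_symb m (x, y) I k * (Y $ k) * cis (m k * \<tau>))"
  using I unfolding MI1_eq by (auto simp: jet_comp_def p_symb_def w b algebra_simps)
 then show ?thesis by (simp add: osc_sum[OF I])
qed

lemma osc_product:
 "osc m \<omega> I a1 \<tau> Y s1 * osc m \<omega> J a2 \<tau> Y s2 * osc m \<omega> K a3 \<tau> Y s3 =
  p_symb m \<omega> I a1 * p_symb m \<omega> J a2 * p_symb m \<omega> K a3 * of_int (s1 ^ mlen I * s2 ^ mlen J * s3 ^ mlen K) *
  conj_sign s1 (Y $ a1) * conj_sign s2 (Y $ a2) * conj_sign s3 (Y $ a3) * cis (m j * \<tau>) * cis (phase m j (a1, a2, a3) (s1, s2, s3) * \<tau>)"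
proof -
 have "cis (of_int s1 * (m a1 * \<tau>)) * cis (of_int s2 * (m a2 * \<tau>)) * cis (of_int s3 * (m a3 * \<tau>))
   = cis (m j * \<tau>) * cis (phase m j (a1, a2, a3) (s1, s2, s3) * \<tau>)"
  by (simp add: cis_mult phase_def algebra_simps)
 then show ?thesis unfolding osc_def by (simp add: mult_ac)
qed

lemma half_sum_cube:
 fixes f g h :: "int => complex"
 shows "C * ((1/2) * (f 1 + f (-1))) * ((1/2) * (g 1 + g (-1))) * ((1/2) * (h 1 + h (-1))) =
  (1/8) * (\<Sum>s1\<in>{1, -1}. \<Sum>s2\<in>{1, -1}. \<Sum>s3\<in>{1, -1}. C * (f s1 * g s2 * h s3))"
proof -
 have "C * ((1/2) * (f 1 + f (-1))) * ((1/2) * (g 1 + g (-1))) * ((1/2) * (h 1 + h (-1)))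
   = (1/8) * (C * ((f 1 + f (-1)) * (g 1 + g (-1)) * (h 1 + h (-1))))" by simp
 then show ?thesis by (simp add: algebra_simps)
qed

text \<open>Three jet components with two exponentials each give eight sign patterns and the factor
  1/8. The argument is the leading jet, in which only the s-derivative contributes to the
  first-order entries; \<open>b\<close> stands for e^{-s} times that derivative.\<close>

lemma cubic_decomposition:
 fixes w b :: "real ^ 'n::finite"
 assumes w: "!!k. w $ k = Re (Y $ k * cis (m k * \<tau>))" and b: "!!k. b $ k = Re (\<i> * of_real (m k) * (Y $ k) * cis (m k * \<tau>))"
 shows "cis (- (m j * \<tau>)) * complex_of_real (F_cubic m c j (w, x *R b, (- y) *R b)) =
  (1/8) * (\<Sum>a\<in>res_set m j. \<Sum>sg\<in>signs. monomial m c (x, y) j a sg Y * cis (phase m j a sg * \<tau>))"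
proof -
 let ?o = "osc m (x, y)" and ?J = "(w, x *R b, (- y) *R b)"
 have tm: "complex_of_real (c j (a1, a2, a3) I J K * jet_comp I a1 ?J * jet_comp J a2 ?J * jet_comp K a3 ?J) =
   (1/8) * (\<Sum>s1\<in>{1, -1}. \<Sum>s2\<in>{1, -1}. \<Sum>s3\<in>{1, -1}.
    of_real (c j (a1, a2, a3) I J K) * (?o I a1 \<tau> Y s1 * ?o J a2 \<tau> Y s2 * ?o K a3 \<tau> Y s3))"
  if "I : MI1" "J : MI1" "K : MI1" for I J K a1 a2 a3
  unfolding of_real_mult jet_comp_osc[OF that(1) w b] jet_comp_osc[OF that(2) w b] jet_comp_osc[OF that(3) w b]
  by (rule half_sum_cube)
 have one: "cis (- (m j * \<tau>)) * cis (m j * \<tau>) = 1" by (simp add: cis_mult)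
 have a: "cis (- (m j * \<tau>)) * (\<Sum>I\<in>MI1. \<Sum>J\<in>MI1. \<Sum>K\<in>MI1.
   complex_of_real (c j (a1, a2, a3) I J K * jet_comp I a1 ?J * jet_comp J a2 ?J * jet_comp K a3 ?J)) =
   (1/8) * (\<Sum>sg\<in>signs. monomial m c (x, y) j (a1, a2, a3) sg Y * cis (phase m j (a1, a2, a3) sg * \<tau>))" for a1 a2 a3
 proof -
  let ?t = "%I J K s1 s2 s3. of_real (c j (a1, a2, a3) I J K) *
    p_symb m (x, y) I a1 * p_symb m (x, y) J a2 * p_symb m (x, y) K a3 *
    of_int (s1 ^ mlen I * s2 ^ mlen J * s3 ^ mlen K) *
    conj_sign s1 (Y $ a1) * conj_sign s2 (Y $ a2) * conj_sign s3 (Y $ a3) * cis (phase m j (a1, a2, a3) (s1, s2, s3) * \<tau>)"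
  have "cis (- (m j * \<tau>)) * (\<Sum>I\<in>MI1. \<Sum>J\<in>MI1. \<Sum>K\<in>MI1.
   complex_of_real (c j (a1, a2, a3) I J K * jet_comp I a1 ?J * jet_comp J a2 ?J * jet_comp K a3 ?J)) =
   (\<Sum>I\<in>MI1. \<Sum>J\<in>MI1. \<Sum>K\<in>MI1. (1/8) * (\<Sum>s1\<in>{1, -1}. \<Sum>s2\<in>{1, -1}. \<Sum>s3\<in>{1, -1}. ?t I J K s1 s2 s3))"
   unfolding sum_distrib_left
  proof (intro sum.cong refl)
   fix I J K assume IJK: "I : MI1" "J : MI1" "K : MI1"
   have t: "cis (- (m j * \<tau>)) * (of_real (c j (a1, a2, a3) I J K) * (?o I a1 \<tau> Y s1 * ?o J a2 \<tau> Y s2 * ?o K a3 \<tau> Y s3)) = ?t I J K s1 s2 s3" for s1 s2 s3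
    unfolding osc_product[where j=j] using one by (simp add: mult_ac)
   show "cis (- (m j * \<tau>)) * complex_of_real (c j (a1, a2, a3) I J K * jet_comp I a1 ?J * jet_comp J a2 ?J * jet_comp K a3 ?J) =
    (\<Sum>s1\<in>{1, -1}. \<Sum>s2\<in>{1, -1}. \<Sum>s3\<in>{1, -1}. (1/8) * ?t I J K s1 s2 s3)"
    unfolding tm[OF IJK] t[symmetric] sum_distrib_left by (intro sum.cong refl) (simp add: mult_ac)
  qed
  also have "... = (1/8) * (\<Sum>I\<in>MI1. \<Sum>J\<in>MI1. \<Sum>K\<in>MI1. \<Sum>sg\<in>signs. case sg of (s1, s2, s3) => ?t I J K s1 s2 s3)"
   unfolding sum_signs by (simp only: sum_distrib_left)
  also have "(\<Sum>I\<in>MI1. \<Sum>J\<in>MI1. \<Sum>K\<in>MI1. \<Sum>sg\<in>signs. case sg of (s1, s2, s3) => ?t I J K s1 s2 s3)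
    = (\<Sum>sg\<in>signs. \<Sum>I\<in>MI1. \<Sum>J\<in>MI1. \<Sum>K\<in>MI1. case sg of (s1, s2, s3) => ?t I J K s1 s2 s3)"
   by (simp only: sum.swap[of _ signs])
  also have "... = (\<Sum>sg\<in>signs. monomial m c (x, y) j (a1, a2, a3) sg Y * cis (phase m j (a1, a2, a3) sg * \<tau>))"
   unfolding monomial_def by (intro sum.cong refl) (auto simp: sum_distrib_right split: prod.splits)
  finally show ?thesis .
 qed
 have "complex_of_real (F_cubic m c j ?J) = (\<Sum>a\<in>res_set m j. case a of (a1, a2, a3) => \<Sum>I\<in>MI1. \<Sum>J\<in>MI1. \<Sum>K\<in>MI1.
   complex_of_real (c j (a1, a2, a3) I J K * jet_comp I a1 ?J * jet_comp J a2 ?J * jet_comp K a3 ?J))"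
  unfolding F_cubic_def of_real_sum case_prod_unfold ..
 then have "cis (- (m j * \<tau>)) * complex_of_real (F_cubic m c j ?J) = (\<Sum>a\<in>res_set m j. cis (- (m j * \<tau>)) * (case a of (a1, a2, a3) => \<Sum>I\<in>MI1. \<Sum>J\<in>MI1. \<Sum>K\<in>MI1.
   complex_of_real (c j (a1, a2, a3) I J K * jet_comp I a1 ?J * jet_comp J a2 ?J * jet_comp K a3 ?J)))"
  by (simp only: sum_distrib_left[of "cis (- (m j * \<tau>))" _ "res_set m j"])
 also have "... = (\<Sum>a'\<in>res_set m j. (1/8) * (\<Sum>sg\<in>signs. monomial m c (x, y) j a' sg Y * cis (phase m j a' sg * \<tau>)))"
 proof (intro sum.cong refl)
  fix a' :: "'n \<times> 'n \<times> 'n"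
  obtain a1 a2 a3 where "a' = (a1, a2, a3)" by (metis prod.exhaust)
  then show "cis (- (m j * \<tau>)) * (case a' of (a1, a2, a3) => \<Sum>I\<in>MI1. \<Sum>J\<in>MI1. \<Sum>K\<in>MI1.
   complex_of_real (c j (a1, a2, a3) I J K * jet_comp I a1 ?J * jet_comp J a2 ?J * jet_comp K a3 ?J))
   = (1/8) * (\<Sum>sg\<in>signs. monomial m c (x, y) j a' sg Y * cis (phase m j a' sg * \<tau>))"
   by (simp only: prod.case a)
 qed
 also have "... = (1/8) * (\<Sum>a'\<in>res_set m j. \<Sum>sg\<in>signs. monomial m c (x, y) j a' sg Y * cis (phase m j a' sg * \<tau>))"
  by (rule sum_distrib_left[symmetric])
 finally show ?thesis .
qed

text \<open>For resonant signs the phase is 0 and the exponential is 1; the remaining sum is the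
  reduced nonlinearity without its prefactor 1/m_j.\<close>

lemma cubic_resonant_split:
 assumes "m j > 0"
 shows "(\<Sum>a\<in>res_set m j. \<Sum>sg\<in>signs. monomial m c \<omega> j a sg Y * cis (phase m j a sg * \<tau>)) =
  of_real (m j) * F_red m c \<omega> Y $ j +
  (\<Sum>a\<in>res_set m j. \<Sum>sg\<in>signs - res_signs m j a. monomial m c \<omega> j a sg Y * cis (phase m j a sg * \<tau>))"
proof -
 have "(\<Sum>sg\<in>signs. monomial m c \<omega> j a sg Y * cis (phase m j a sg * \<tau>)) =
  (\<Sum>sg\<in>res_signs m j a. monomial m c \<omega> j a sg Y) +
  (\<Sum>sg\<in>signs - res_signs m j a. monomial m c \<omega> j a sg Y * cis (phase m j a sg * \<tau>))" for a
 proof -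
  have sub: "res_signs m j a \<subseteq> signs" by (auto simp: res_signs_eq)
  have "(\<Sum>sg\<in>res_signs m j a. monomial m c \<omega> j a sg Y * cis (phase m j a sg * \<tau>)) = (\<Sum>sg\<in>res_signs m j a. monomial m c \<omega> j a sg Y)"
   by (intro sum.cong refl) (simp add: res_signs_eq)
  then show ?thesis
   using sum.subset_diff[OF sub finite_signs, of "%sg. monomial m c \<omega> j a sg Y * cis (phase m j a sg * \<tau>)"]
   by (simp only: add.commute)
 qed
 then show ?thesis unfolding F_red_eq using assms by (simp add: sum.distrib)
qed

lemma p_symb_bound:
 fixes m :: "'n::finite => real"
 assumes "!!j. m j > 0"
 shows "norm (p_symb m (cosh z, sinh z) I k) <= cosh z * (1 + (\<Sum>j\<in>UNIV. m j))"
proof -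
 have c: "cosh z >= 1" by (rule cosh_real_ge_1)
 have mk: "m k <= (\<Sum>j\<in>UNIV. m j)" by (rule member_le_sum) (use assms in \<open>auto intro: less_imp_le\<close>)
 have M: "1 <= 1 + (\<Sum>j\<in>UNIV. m j)" using assms by (simp add: sum_nonneg less_imp_le)
 have 1: "1 * 1 <= cosh z * (1 + (\<Sum>j\<in>UNIV. m j))" using c M by (intro mult_mono) auto
 have 2: "cosh z * m k <= cosh z * (1 + (\<Sum>j\<in>UNIV. m j))" using c mk by (intro mult_left_mono) auto
 have 3: "\<bar>sinh z\<bar> * m k <= cosh z * (1 + (\<Sum>j\<in>UNIV. m j))"
  using abs_sinh_le_cosh[of z] assms[of k] by (intro order_trans[OF mult_right_mono 2]) auto
 have "norm (\<i> * complex_of_real (cosh z * m k)) = cosh z * m k" "norm (- \<i> * complex_of_real (sinh z * m k)) = \<bar>sinh z\<bar> * m k"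
  using c assms[of k] by (simp_all add: norm_mult abs_mult)
 then show ?thesis
  using 1 2 3 by (cases "I = (0, 0)"; cases "I = (1, 0)") (simp_all add: p_symb_def)
qed


lemma cis_derivative:
 assumes "(th hrd th') (at s)"
 shows "((%s. cis (th s)) hvd (\<i> * of_real th') * cis (th s)) (at s)"
proof -
 have "((%z. exp (\<i> * z)) has_field_derivative \<i> * exp (\<i> * of_real (th s))) (at (of_real (th s)))"
  by (auto intro!: derivative_eq_intros)
 from has_vector_derivative_real_field[OF this]
 have "((%x. cis x) hvd \<i> * cis (th s)) (at (th s))" unfolding cis_conv_exp .
 from vector_diff_chain_at[OF assms[unfolded has_real_derivative_iff_has_vector_derivative] this]
 show ?thesis by (simp add: o_def scaleR_conv_of_real mult_ac)
qed

text \<open>In the time variable \<tau> = e^s the pair (w, b) is a harmonic oscillator up to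
  forcing. The complex amplitude is w - i b / m, and the exponential undoes its rotation.\<close>

definition profile :: "('n::finite => real) => real => real ^ 'n => real ^ 'n => complex ^ 'n" where
 "profile m \<tau> w b = (\<chi> j. cis (- (m j * \<tau>)) * (of_real (w $ j) - (\<i> / of_real (m j)) * of_real (b $ j)))"

lemma profile_inverse:
 assumes "m k > 0"
 shows "w $ k = Re (profile m \<tau> w b $ k * cis (m k * \<tau>))" "b $ k = Re (\<i> * of_real (m k) * (profile m \<tau> w b $ k) * cis (m k * \<tau>))"
proof -
 have "cis (- (m k * \<tau>)) * cis (m k * \<tau>) = 1" by (simp add: cis_mult)
 then have eq: "profile m \<tau> w b $ k * cis (m k * \<tau>) = of_real (w $ k) - (\<i> / of_real (m k)) * of_real (b $ k)"
  by (simp add: profile_def algebra_simps)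
 show "w $ k = Re (profile m \<tau> w b $ k * cis (m k * \<tau>))" unfolding eq by (simp add: complex_eq_iff Re_divide Im_divide)
 show "b $ k = Re (\<i> * of_real (m k) * (profile m \<tau> w b $ k) * cis (m k * \<tau>))"
  unfolding mult.assoc[of _ "profile m \<tau> w b $ k"] eq using assms by (simp add: algebra_simps)
qed

lemma profile_norm:
 assumes "m0 > 0" "m0 <= m k" "norm w + norm b <= M"
 shows "norm (profile m \<tau> w b $ k) <= M * (1 + 1 / m0)"
proof -
 have "norm (profile m \<tau> w b $ k) <= \<bar>w $ k\<bar> + (1 / m k) * \<bar>b $ k\<bar>"
  using norm_triangle_ineq4[of "complex_of_real (w $ k)" "(\<i> / of_real (m k)) * of_real (b $ k)"] assms
  by (simp add: profile_def norm_mult norm_divide)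
 also have "... <= norm w + (1 / m0) * norm b"
  using assms component_le_norm_cart[of w k] component_le_norm_cart[of b k] by (intro add_mono mult_mono) (auto simp: frac_le)
 also have "... <= M + (1 / m0) * M"
 proof -
  have "norm w <= M" "norm b <= M" using assms(3) norm_ge_zero[of w] norm_ge_zero[of b] by linarith+
  then show ?thesis using assms(1) by (intro add_mono mult_left_mono) auto
 qed
 finally show ?thesis by (simp add: algebra_simps)
qed

text \<open>The rotation cancels both the mass term and the coupling of \<open>w\<close> to
  \<open>b\<close>, so that only the forcing \<open>h\<close> is left.\<close>

lemma profile_derivative:
 assumes m: "m j > 0"
  and w: "(w hvd exp s *R b s) (at s)" and b: "(b hvd h - exp s *R mass m (mass m (w s))) (at s)"
 shows "((%s. profile m (exp s) (w s) (b s) $ j) has_vector_derivative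
   (- \<i> / of_real (m j)) * (cis (- (m j * exp s)) * of_real (h $ j))) (at s)"
proof -
 have wj: "((%s. complex_of_real (w s $ j)) hvd of_real (exp s * (b s $ j))) (at s)"
  using bounded_linear.has_vector_derivative[OF bounded_linear_compose[OF bounded_linear_of_real bounded_linear_vec_nth[of j]] w] by simp
 have bj: "((%s. complex_of_real (b s $ j)) hvd of_real (h $ j - exp s * (m j * (m j * (w s $ j))))) (at s)"
  using bounded_linear.has_vector_derivative[OF bounded_linear_compose[OF bounded_linear_of_real bounded_linear_vec_nth[of j]] b]
  by (simp add: mass_def)
 have "((%s. - (m j * exp s)) hrd - (m j * exp s)) (at s)" by (auto intro!: derivative_eq_intros)
 note c = cis_derivative[OF this]
 have "((%s. cis (- (m j * exp s)) * (of_real (w s $ j) - (\<i> / of_real (m j)) * of_real (b s $ j))) has_vector_derivative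
   cis (- (m j * exp s)) * (of_real (exp s * (b s $ j)) - (\<i> / of_real (m j)) * of_real (h $ j - exp s * (m j * (m j * (w s $ j)))))
   + (\<i> * of_real (- (m j * exp s))) * cis (- (m j * exp s)) * (of_real (w s $ j) - (\<i> / of_real (m j)) * of_real (b s $ j))) (at s)"
  by (intro has_vector_derivative_mult c has_vector_derivative_diff wj bounded_linear.has_vector_derivative[OF bounded_linear_mult_right bj])
 moreover have "cis (- (m j * exp s)) * (of_real (exp s * (b s $ j)) - (\<i> / of_real (m j)) * of_real (h $ j - exp s * (m j * (m j * (w s $ j)))))
   + (\<i> * of_real (- (m j * exp s))) * cis (- (m j * exp s)) * (of_real (w s $ j) - (\<i> / of_real (m j)) * of_real (b s $ j))
   = (- \<i> / of_real (m j)) * (cis (- (m j * exp s)) * of_real (h $ j))"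
  using m by (simp add: field_simps)
 ultimately show ?thesis by (simp add: profile_def)
qed

lemma cdot_hermitian: "hermitian A ==> cdot Y (A *v Z) = cdot (A *v Y) Z"
proof -
 assume A: "hermitian A"
 have "cdot Y (A *v Z) = (\<Sum>i\<in>UNIV. \<Sum>j\<in>UNIV. cnj (Y $ i) * (A $ i $ j * Z $ j))"
  by (simp add: cdot_def matrix_vector_mult_def sum_distrib_left)
 also have "... = (\<Sum>j\<in>UNIV. \<Sum>i\<in>UNIV. cnj (Y $ i) * (A $ i $ j * Z $ j))" by (rule sum.swap)
 also have "... = (\<Sum>j\<in>UNIV. \<Sum>i\<in>UNIV. cnj (A $ j $ i * Y $ i) * Z $ j)"
 proof (intro sum.cong refl)
  fix i j
  have "A $ i $ j = cnj (A $ j $ i)" using A unfolding hermitian_def by blast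
  then show "cnj (Y $ i) * (A $ i $ j * Z $ j) = cnj (A $ j $ i * Y $ i) * Z $ j" by (simp only: complex_cnj_mult mult_ac)
 qed
 also have "... = cdot (A *v Y) Z"
  by (simp add: cdot_def matrix_vector_mult_def sum_distrib_right)
 finally show ?thesis .
qed

lemma cdot_cnj: "cnj (cdot Y Z) = cdot Z Y"
 by (simp add: cdot_def mult.commute)

lemma quadratic_form_derivative:
 fixes al :: "real => complex ^ 'n::finite"
 assumes A: "hermitian A" and a: "!!j. ((%s. al s $ j) hvd al' $ j) (at s)"
 shows "((%s. Re (cdot (al s) (A *v al s))) hrd 2 * Re (cdot (A *v al s) al')) (at s)"
proof -
 have Aa: "((%s. (A *v al s) $ j) hvd (A *v al') $ j) (at s)" for j
  unfolding matrix_vector_mult_def vec_lambda_beta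
  by (intro has_vector_derivative_sum bounded_linear.has_vector_derivative[OF bounded_linear_mult_right] a)
 have ca: "((%s. cnj (al s $ j)) hvd cnj (al' $ j)) (at s)" for j
  by (rule bounded_linear.has_vector_derivative[OF bounded_linear_cnj a])
 have "((%s. cdot (al s) (A *v al s)) has_vector_derivative
   (\<Sum>j\<in>UNIV. cnj (al s $ j) * (A *v al') $ j + cnj (al' $ j) * (A *v al s) $ j)) (at s)"
  unfolding cdot_def by (intro has_vector_derivative_sum has_vector_derivative_mult Aa ca)
 also have "(\<Sum>j\<in>UNIV. cnj (al s $ j) * (A *v al') $ j + cnj (al' $ j) * (A *v al s) $ j)
   = cdot (al s) (A *v al') + cdot al' (A *v al s)" by (simp add: cdot_def sum.distrib)
 also have "... = cdot (A *v al s) al' + cnj (cdot (A *v al s) al')"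
  using cdot_hermitian[OF A] by (simp add: cdot_cnj)
 finally have "((%s. cdot (al s) (A *v al s)) hvd cdot (A *v al s) al' + cnj (cdot (A *v al s) al')) (at s)" .
 from bounded_linear.has_vector_derivative[OF bounded_linear_Re this]
 show ?thesis by (simp add: has_real_derivative_iff_has_vector_derivative)
qed

text \<open>The constant is the minimum over the compact unit sphere; homogeneity of degree two
  carries it to all vectors.\<close>

lemma positive_definite_lower_bound:
 fixes A :: "complex ^ 'n::finite ^ 'n"
 assumes "positive_definite A"
 obtains l where "l > 0" "!!Y. l * (norm Y)^2 <= Re (cdot Y (A *v Y))"
proof -
 let ?q = "%Y. Re (cdot Y (A *v Y))"
 have "continuous_on (sphere 0 1) ?q"
  unfolding cdot_def matrix_vector_mult_def vec_lambda_beta by (intro continuous_intros)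
 moreover have "sphere (0 :: complex ^ 'n) 1 ~= {}" by simp
 ultimately obtain Y0 where Y0: "Y0 : sphere 0 1" "!!Y. Y : sphere 0 1 ==> ?q Y0 <= ?q Y"
  using continuous_attains_inf[OF compact_sphere] by blast
 have "Y0 ~= 0" using Y0(1) by auto
 then have pos: "?q Y0 > 0" using assms unfolding positive_definite_def by blast
 have "?q Y0 * (norm Y)^2 <= ?q Y" for Y
 proof (cases "Y = 0")
  case False
  define Z where "Z = (1 / norm Y) *R Y"
  have Y: "Y = norm Y *R Z" using False by (simp add: Z_def)
  have "?q (c *R X) = c^2 * ?q X" for c X
  proof -
   have "cdot (c *R X) (A *v (c *R X)) = of_real (c^2) * cdot X (A *v X)"
    unfolding cdot_def matrix_vector_mult_def vec_lambda_beta vector_scaleR_component sum_distrib_left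
    by (intro sum.cong refl) (simp add: scaleR_conv_of_real power2_eq_square mult_ac)
   then show ?thesis by simp
  qed
  then have "?q Y = (norm Y)^2 * ?q Z" using Y by metis
  moreover have "Z : sphere 0 1" using False by (simp add: Z_def)
  ultimately show ?thesis using Y0(2)[of Z] by (simp add: mult.commute[of _ "(norm Y)^2"] mult_left_mono)
 qed (simp add: cdot_def)
 then show ?thesis using that pos by blast
qed

text \<open>The factor 8 is one factor 2 for each of the three products with an amplitude, and the
  cube of cosh comes from the three symbols.\<close>

lemma monomial_tame:
 fixes m :: "'n::finite => real" and al :: "real => complex ^ 'n"
 assumes m: "!!j. m j > 0" and a: "!!k. tame T M (%s. al s $ k)" and M: "M >= 0" and sg: "sg : signs"
 shows "tame T (8 * (cosh z * (1 + (\<Sum>j\<in>UNIV. m j))) ^ 3 * M ^ 3 * (\<Sum>I\<in>MI1. \<Sum>J\<in>MI1. \<Sum>K\<in>MI1. \<bar>c j a I J K\<bar>))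
  (%s. monomial m c (cosh z, sinh z) j a sg (al s))"
proof -
 obtain a1 a2 a3 where a_eq: "a = (a1, a2, a3)" by (metis prod.exhaust)
 obtain s1 s2 s3 where s_eq: "sg = (s1, s2, s3)" by (metis prod.exhaust)
 let ?P = "cosh z * (1 + (\<Sum>j\<in>UNIV. m j))" and ?p = "p_symb m (cosh z, sinh z)"
 have s: "\<bar>s1\<bar> = 1" "\<bar>s2\<bar> = 1" "\<bar>s3\<bar> = 1" using sg by (auto simp: signs_def s_eq)
 have P: "?P >= 0" using cosh_real_nonneg[of z] m by (simp add: sum_nonneg less_imp_le)
 have fin: "finite MI1" by (simp add: MI1_eq)
 have "tame T (\<Sum>I\<in>MI1. \<Sum>J\<in>MI1. \<Sum>K\<in>MI1. 2 * (2 * (2 * (\<bar>c j a I J K\<bar> * ?P ^ 3) * M) * M) * M)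
  (%s. \<Sum>I\<in>MI1. \<Sum>J\<in>MI1. \<Sum>K\<in>MI1. (of_real (c j (a1, a2, a3) I J K) * ?p I a1 * ?p J a2 * ?p K a3 *
    of_int (s1 ^ mlen I * s2 ^ mlen J * s3 ^ mlen K)) * conj_sign s1 (al s $ a1) * conj_sign s2 (al s $ a2) * conj_sign s3 (al s $ a3))"
 proof (intro tame_sum fin tame_mult tame_const tame_conj_sign a)
  fix I J K
  have "norm (of_int (s1 ^ mlen I * s2 ^ mlen J * s3 ^ mlen K) :: complex) = 1"
  proof -
   have "\<bar>s1 ^ mlen I * s2 ^ mlen J * s3 ^ mlen K\<bar> = 1" using s by (simp add: abs_mult power_abs)
   then show ?thesis unfolding norm_of_int by (metis of_int_1 of_int_abs)
  qed
  then have "norm (of_real (c j (a1, a2, a3) I J K) * ?p I a1 * ?p J a2 * ?p K a3 * of_int (s1 ^ mlen I * s2 ^ mlen J * s3 ^ mlen K))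
    = \<bar>c j a I J K\<bar> * (norm (?p I a1) * norm (?p J a2) * norm (?p K a3))"
   by (simp add: norm_mult a_eq)
  also have "... <= \<bar>c j a I J K\<bar> * (?P * ?P * ?P)"
   using P by (intro mult_left_mono mult_mono p_symb_bound m) auto
  finally show "norm (of_real (c j (a1, a2, a3) I J K) * ?p I a1 * ?p J a2 * ?p K a3 * of_int (s1 ^ mlen I * s2 ^ mlen J * s3 ^ mlen K))
    <= \<bar>c j a I J K\<bar> * ?P ^ 3" by (simp add: power3_eq_cube)
 qed (use P M in auto)
 moreover have "(\<Sum>I\<in>MI1. \<Sum>J\<in>MI1. \<Sum>K\<in>MI1. 2 * (2 * (2 * (\<bar>c j a I J K\<bar> * ?P ^ 3) * M) * M) * M)
   = 8 * ?P ^ 3 * M ^ 3 * (\<Sum>I\<in>MI1. \<Sum>J\<in>MI1. \<Sum>K\<in>MI1. \<bar>c j a I J K\<bar>)"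
 proof -
  have "2 * (2 * (2 * (e * P ^ 3) * M) * M) * M = 8 * P ^ 3 * M ^ 3 * e" for e P :: real by (simp add: power3_eq_cube)
  then show ?thesis by (simp only: sum_distrib_left)
 qed
 ultimately show ?thesis unfolding monomial_def a_eq s_eq by (simp add: a_eq)
qed

text \<open>Dividing the oscillation by i \<nu> e^s gives an antiderivative up to a remainder which
  is again \<open>q\<close>, of size e^{-s}: the phase accelerates exponentially, so a single
  integration by parts yields an integrable error.\<close>

lemma oscillating_integral:
 assumes s: "\<nu> ~= 0"
 defines "q \<equiv> %s. cis (\<nu> * exp s) * (of_real (exp (- s)) * (- \<i> / of_real \<nu>))"
 shows "(q hvd cis (\<nu> * exp s) - q s) (at s)" "norm (q s) = exp (- s) / \<bar>\<nu>\<bar>"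
proof -
 have "((%s. \<nu> * exp s) hrd \<nu> * exp s) (at s)" by (auto intro!: derivative_eq_intros)
 note c = cis_derivative[OF this]
 have "((%s. exp (- s)) hrd - exp (- s)) (at s)" by (auto intro!: derivative_eq_intros)
 from bounded_linear.has_vector_derivative[OF bounded_linear_of_real this[unfolded has_real_derivative_iff_has_vector_derivative]]
 have e: "((%s. complex_of_real (exp (- s))) hvd of_real (- exp (- s))) (at s)" .
 have eq: "cis (\<nu> * exp s) * (of_real (- exp (- s)) * (- \<i> / of_real \<nu>)) +
   (\<i> * of_real (\<nu> * exp s)) * cis (\<nu> * exp s) * (of_real (exp (- s)) * (- \<i> / of_real \<nu>)) = cis (\<nu> * exp s) - q s"
 proof -
  have ee: "complex_of_real (exp s) * of_real (exp (- s)) = 1"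
   by (simp flip: of_real_mult exp_add)
  have "(\<i> * of_real (\<nu> * exp s)) * cis (\<nu> * exp s) * (of_real (exp (- s)) * (- \<i> / of_real \<nu>))
    = (of_real (exp s) * of_real (exp (- s))) * ((\<i> * of_real \<nu>) * (- \<i> / of_real \<nu>)) * cis (\<nu> * exp s)"
   by (simp only: of_real_mult mult_ac)
  also have "(\<i> * of_real \<nu>) * (- \<i> / of_real \<nu>) = 1" using s by simp
  finally show ?thesis unfolding ee q_def by simp
 qed
 have "(q hvd cis (\<nu> * exp s) * (of_real (- exp (- s)) * (- \<i> / of_real \<nu>)) +
   (\<i> * of_real (\<nu> * exp s)) * cis (\<nu> * exp s) * (of_real (exp (- s)) * (- \<i> / of_real \<nu>))) (at s)"
  unfolding q_def
  by (intro has_vector_derivative_mult c bounded_linear.has_vector_derivative[OF bounded_linear_mult_left e])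
 then show "(q hvd cis (\<nu> * exp s) - q s) (at s)" unfolding eq .
 show "norm (q s) = exp (- s) / \<bar>\<nu>\<bar>" unfolding q_def by (simp add: norm_mult norm_divide)
qed

text \<open>Subtracting the boundary terms \<open>X\<close> of an integration by parts removes the
  oscillating part of the derivative. Everything left decays exponentially and is
  integrable.\<close>

lemma oscillating_gronwall:
 fixes H :: "'i => real => complex"
 assumes T: "T = {0..s'}" "0 <= s'" and fin: "finite I"
  and \<rho>: "!!s. s : T ==> (\<rho> hrd \<rho>' s) (at s)"
  and le: "!!s. s : T ==> \<rho>' s <= (\<Sum>i\<in>I. Re (H i s * cis (\<nu> i * exp s))) + He * exp (- s / 5)"
  and \<nu>: "!!i. i : I ==> \<nu> i ~= 0" and H: "!!i. i : I ==> tame T (D i) (H i)" and He: "He >= 0" and s: "s : T"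
 shows "\<rho> s <= \<rho> 0 + 4 * (\<Sum>i\<in>I. D i / \<bar>\<nu> i\<bar>) + 5 * He"
proof -
 have "\<forall>i\<in>I. \<exists>h'. \<forall>s\<in>T. (H i hvd h' s) (at s) \<and> norm (H i s) <= D i \<and> norm (h' s) <= D i"
  using H unfolding tame_def by blast
 then obtain H' where H': "!!i s. i : I ==> s : T ==> (H i hvd H' i s) (at s) \<and> norm (H i s) <= D i \<and> norm (H' i s) <= D i"
  by metis
 define q where "q i = (%s. cis (\<nu> i * exp s) * (of_real (exp (- s)) * (- \<i> / of_real (\<nu> i))))" for i
 define G where "G = (\<Sum>i\<in>I. D i / \<bar>\<nu> i\<bar>)"
 have q: "(q i hvd cis (\<nu> i * exp s) - q i s) (at s)" "norm (q i s) = exp (- s) / \<bar>\<nu> i\<bar>" if "i : I" for i s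
  unfolding q_def by (rule oscillating_integral[OF \<nu>[OF that]])+
 have prod: "norm (x * q i t) <= D i / \<bar>\<nu> i\<bar> * exp (- t)" if "i : I" "norm x <= D i" for x i t
 proof -
  have "norm (x * q i t) = norm x * (exp (- t) / \<bar>\<nu> i\<bar>)" by (simp add: norm_mult q(2)[OF that(1)])
  also have "... <= D i * (exp (- t) / \<bar>\<nu> i\<bar>)" using that by (intro mult_right_mono) auto
  finally show ?thesis by (simp add: mult_ac)
 qed
 define X where "X t = (\<Sum>i\<in>I. Re (H i t * q i t))" for t
 have Xb: "\<bar>X t\<bar> <= G * exp (- t)" if "t : T" for t
 proof -
  have "\<bar>X t\<bar> <= (\<Sum>i\<in>I. \<bar>Re (H i t * q i t)\<bar>)" unfolding X_def by (rule sum_abs)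
  also have "... <= (\<Sum>i\<in>I. D i / \<bar>\<nu> i\<bar> * exp (- t))"
   using H'[OF _ that] prod by (intro sum_mono order_trans[OF abs_Re_le_cmod]) auto
  finally show ?thesis by (simp add: G_def sum_distrib_right)
 qed
 have G: "G >= 0"
 proof -
  have "0 <= G * exp (- s)" using abs_ge_zero[of "X s"] Xb[OF s] by linarith
  then show ?thesis by (simp add: zero_le_mult_iff)
 qed
 \<comment> \<open>The exponentials added here have derivatives that cancel the remainders 2G e^{-t}
   and He e^{-t/5}, so \<open>Ph\<close> is nonincreasing. The constant 4 below collects G from
   \<open>X\<close> at each end and 2G from the initial correction.\<close>
 define Ph where "Ph t = \<rho> t - X t + 2 * G * exp (- t) + 5 * He * exp (- t / 5)" for t
 have "\<exists>y. (Ph hrd y) (at t) \<and> y <= 0" if t: "0 <= t" "t <= s" for t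
 proof -
  have tT: "t : T" using t s T by auto
  have dX: "(X hrd (\<Sum>i\<in>I. Re (H i t * (cis (\<nu> i * exp t) - q i t) + H' i t * q i t))) (at t)"
   unfolding X_def
  proof (intro DERIV_sum)
   fix i assume i: "i : I"
   have Hi: "(H i hvd H' i t) (at t)" using H'[OF i tT] by blast
   show "((%t. Re (H i t * q i t)) hrd Re (H i t * (cis (\<nu> i * exp t) - q i t) + H' i t * q i t)) (at t)"
    unfolding has_real_derivative_iff_has_vector_derivative
    by (rule bounded_linear.has_vector_derivative[OF bounded_linear_Re has_vector_derivative_mult[OF Hi q(1)[OF i]]])
  qed
  let ?d = "\<rho>' t - (\<Sum>i\<in>I. Re (H i t * (cis (\<nu> i * exp t) - q i t) + H' i t * q i t)) + 2 * G * (- exp (- t)) + 5 * He * (exp (- t / 5) * (- 1 / 5))"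
  have e1: "((%t. 2 * G * exp (- t)) hrd 2 * G * (- exp (- t))) (at t)"
   by (auto intro!: derivative_eq_intros)
  have e2: "((%t. 5 * He * exp (- t / 5)) hrd 5 * He * (exp (- t / 5) * (- 1 / 5))) (at t)"
   by (auto intro!: derivative_eq_intros)
  have "(Ph hrd ?d) (at t)"
   unfolding Ph_def by (rule DERIV_add[OF DERIV_add[OF DERIV_diff[OF \<rho>[OF tT] dX] e1] e2])
  moreover have "?d <= 0"
  proof -
   have "(\<Sum>i\<in>I. Re (H i t * cis (\<nu> i * exp t))) - (\<Sum>i\<in>I. Re (H i t * (cis (\<nu> i * exp t) - q i t) + H' i t * q i t))
     = (\<Sum>i\<in>I. Re (H i t * q i t) - Re (H' i t * q i t))"
    unfolding sum_subtractf[symmetric] by (intro sum.cong refl) (simp add: algebra_simps)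
   also have "... <= (\<Sum>i\<in>I. D i / \<bar>\<nu> i\<bar> * exp (- t) + D i / \<bar>\<nu> i\<bar> * exp (- t))"
   proof (rule sum_mono)
    fix i assume i: "i : I"
    have "\<bar>Re (H i t * q i t)\<bar> <= D i / \<bar>\<nu> i\<bar> * exp (- t)" "\<bar>Re (H' i t * q i t)\<bar> <= D i / \<bar>\<nu> i\<bar> * exp (- t)"
     using order_trans[OF abs_Re_le_cmod prod[OF i]] H'[OF i tT] by blast+
    then show "Re (H i t * q i t) - Re (H' i t * q i t) <= D i / \<bar>\<nu> i\<bar> * exp (- t) + D i / \<bar>\<nu> i\<bar> * exp (- t)" by linarith
   qed
   also have "... = 2 * G * exp (- t)" unfolding sum.distrib sum_distrib_right[symmetric] G_def by simp
   finally show ?thesis using le[OF tT] by simp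
  qed
  ultimately show ?thesis by blast
 qed
 moreover have "0 <= s" using s T by auto
 ultimately have "Ph s <= Ph 0" by (rule DERIV_nonpos_imp_nonincreasing[rotated])
 moreover have "\<bar>X 0\<bar> <= G * exp (- 0)" by (rule Xb) (use T in auto)
 moreover have "G * exp (- s) <= G" "0 <= G * exp (- s)" "0 <= He * exp (- s / 5)"
  using G He s T by (auto intro!: mult_left_le)
 ultimately show ?thesis using Xb[OF s] unfolding Ph_def G_def[symmetric] by simp
qed

lemma norm_square_le_components:
 fixes x :: "'a::real_normed_vector ^ 'n::finite" and y :: "'b::real_normed_vector ^ 'n"
 assumes "!!i. norm (x $ i) <= K * norm (y $ i)" "K >= 0"
 shows "(norm x)^2 <= K^2 * (norm y)^2"
proof -
 have "norm x <= L2_set (%i. K * norm (y $ i)) UNIV"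
  unfolding norm_vec_def by (rule L2_set_mono) (use assms in auto)
 also have "... = K * norm y" unfolding norm_vec_def using assms by (simp add: L2_set_right_distrib)
 finally show ?thesis using power_mono[of "norm x" "K * norm y" 2] by (simp add: power_mult_distrib)
qed

lemma matrix_vector_bound:
 fixes A :: "complex ^ 'n::finite ^ 'n"
 assumes "!!k. norm (v $ k) <= M" "M >= 0"
 shows "norm ((A *v v) $ j) <= (\<Sum>i\<in>UNIV. \<Sum>k\<in>UNIV. norm (A $ i $ k)) * M"
proof -
 have "norm ((A *v v) $ j) <= (\<Sum>k\<in>UNIV. norm (A $ j $ k) * M)"
  unfolding matrix_vector_mult_def vec_lambda_beta
  by (rule sum_norm_le) (use assms in \<open>auto simp: norm_mult intro: mult_left_mono\<close>)
 also have "... = (\<Sum>k\<in>UNIV. norm (A $ j $ k)) * M" by (simp add: sum_distrib_right)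
 also have "... <= (\<Sum>i\<in>UNIV. \<Sum>k\<in>UNIV. norm (A $ i $ k)) * M"
  using assms by (intro mult_right_mono member_le_sum[of j UNIV "%i. \<Sum>k\<in>UNIV. norm (A $ i $ k)"]) (auto intro: sum_nonneg)
 finally show ?thesis .
qed

lemma profile_bounds:
 fixes m :: "'n::finite => real"
 assumes m: "!!k. m k > 0"
 shows "(norm w)^2 + (norm b)^2 <= (1 + (\<Sum>k\<in>UNIV. m k)^2) * (norm (profile m \<tau> w b))^2"
proof -
 let ?al = "profile m \<tau> w b"
 have mS: "(\<Sum>k\<in>UNIV. m k) >= 0" using m by (simp add: sum_nonneg less_imp_le)
 have "norm (w $ k) <= 1 * norm (?al $ k)" for k
 proof -
  have "norm (w $ k) = \<bar>Re (?al $ k * cis (m k * \<tau>))\<bar>" using profile_inverse(1)[where m=m and k=k and w=w and \<tau>=\<tau> and b=b, OF m] by simp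
  also have "... <= norm (?al $ k * cis (m k * \<tau>))" by (rule abs_Re_le_cmod)
  finally show ?thesis by (simp add: norm_mult)
 qed
 from norm_square_le_components[OF this] have 1: "(norm w)^2 <= (norm ?al)^2" by simp
 have "norm (b $ k) <= (\<Sum>k\<in>UNIV. m k) * norm (?al $ k)" for k
 proof -
  have "norm (b $ k) <= m k * norm (?al $ k)"
  proof -
   have "norm (b $ k) = \<bar>Re (\<i> * of_real (m k) * (?al $ k) * cis (m k * \<tau>))\<bar>" using profile_inverse(2)[where m=m and k=k and w=w and \<tau>=\<tau> and b=b, OF m] by simp
   also have "... <= norm (\<i> * of_real (m k) * (?al $ k) * cis (m k * \<tau>))" by (rule abs_Re_le_cmod)
   finally show ?thesis using m[of k] by (simp add: norm_mult)
  qed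
  also have "... <= (\<Sum>k\<in>UNIV. m k) * norm (?al $ k)"
   by (intro mult_right_mono member_le_sum) (use m in \<open>auto intro: less_imp_le\<close>)
  finally show ?thesis .
 qed
 from norm_square_le_components[OF this mS] 1 show ?thesis unfolding distrib_right mult_1 by linarith
qed

lemma profile_tame:
 assumes m0: "m0 > 0" "!!k. m0 <= m k" and M: "!!s. s : T ==> norm (w s) + norm (b s) <= M" "!!s. s : T ==> norm (h s) <= M"
  and w: "!!s. s : T ==> (w hvd exp s *R b s) (at s)"
  and b: "!!s. s : T ==> (b hvd h s - exp s *R mass m (mass m (w s))) (at s)" and M0: "M >= 0"
 shows "tame T (M * (1 + 1 / m0)) (%s. profile m (exp s) (w s) (b s) $ j)"
 unfolding tame_def
proof (intro exI[of _ "%s. (- \<i> / of_real (m j)) * (cis (- (m j * exp s)) * of_real (h s $ j))"] ballI conjI)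
 fix s assume s: "s : T"
 have mj: "m j > 0" using m0(1) m0(2)[of j] by linarith
 show "((%s. profile m (exp s) (w s) (b s) $ j) hvd (- \<i> / of_real (m j)) * (cis (- (m j * exp s)) * of_real (h s $ j))) (at s)"
  by (rule profile_derivative[OF mj w[OF s] b[OF s]])
 show "norm (profile m (exp s) (w s) (b s) $ j) <= M * (1 + 1 / m0)" by (rule profile_norm[OF m0 M(1)[OF s]])
 have "norm ((- \<i> / of_real (m j)) * (cis (- (m j * exp s)) * of_real (h s $ j))) = (1 / m j) * \<bar>h s $ j\<bar>"
  using mj by (simp add: norm_mult norm_divide)
 also have "... <= (1 / m0) * M"
  using m0 mj M0 component_le_norm_cart[of "h s" j] M(2)[OF s] by (intro mult_mono frac_le) auto
 also have "... <= M * (1 + 1 / m0)" using M0 by (simp add: algebra_simps)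
 finally show "norm ((- \<i> / of_real (m j)) * (cis (- (m j * exp s)) * of_real (h s $ j))) <= M * (1 + 1 / m0)" .
qed

lemma matrix_vector_tame:
 fixes A :: "complex ^ 'n::finite ^ 'n" and al :: "real => complex ^ 'n"
 assumes "!!k. tame T M (%s. al s $ k)" "M >= 0"
 shows "tame T (2 * (\<Sum>i\<in>UNIV. \<Sum>k\<in>UNIV. norm (A $ i $ k)) * M) (%s. (A *v al s) $ j)"
proof -
 have "tame T (\<Sum>k\<in>UNIV. 2 * norm (A $ j $ k) * M) (%s. \<Sum>k\<in>UNIV. A $ j $ k * al s $ k)"
  by (intro tame_sum tame_mult tame_const assms) auto
 then have "tame T (\<Sum>k\<in>UNIV. 2 * norm (A $ j $ k) * M) (%s. (A *v al s) $ j)"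
  by (simp add: matrix_vector_mult_def)
 moreover have "(\<Sum>k\<in>UNIV. norm (A $ j $ k)) <= (\<Sum>i\<in>UNIV. \<Sum>k\<in>UNIV. norm (A $ i $ k))"
  by (intro member_le_sum[of j UNIV "%i. \<Sum>k\<in>UNIV. norm (A $ i $ k)"]) (auto intro: sum_nonneg)
 then have "2 * (\<Sum>k\<in>UNIV. norm (A $ j $ k)) * M <= 2 * (\<Sum>i\<in>UNIV. \<Sum>k\<in>UNIV. norm (A $ i $ k)) * M"
  using assms(2) by (intro mult_right_mono mult_left_mono) auto
 then have "(\<Sum>k\<in>UNIV. 2 * norm (A $ j $ k) * M) <= 2 * (\<Sum>i\<in>UNIV. \<Sum>k\<in>UNIV. norm (A $ i $ k)) * M"
  by (simp add: sum_distrib_left sum_distrib_right)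
 ultimately show ?thesis by (rule tame_mono)
qed

lemma quadratic_form_upper_bound:
 fixes A :: "complex ^ 'n::finite ^ 'n"
 assumes v: "!!k. norm (v $ k) <= M" "M >= 0"
 shows "Re (cdot v (A *v v)) <= real CARD('n) * (\<Sum>i\<in>UNIV. \<Sum>k\<in>UNIV. norm (A $ i $ k)) * M^2"
proof -
 let ?a = "\<Sum>i\<in>UNIV. \<Sum>k\<in>UNIV. norm (A $ i $ k)"
 have "norm (cdot v (A *v v)) <= (\<Sum>j\<in>(UNIV :: 'n set). M * (?a * M))"
  unfolding cdot_def
  by (rule sum_norm_le) (unfold norm_mult complex_mod_cnj, intro mult_mono v matrix_vector_bound, auto)
 moreover have "(\<Sum>j\<in>(UNIV :: 'n set). M * (?a * M)) = real CARD('n) * ?a * M^2" by (simp add: power2_eq_square)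
 ultimately show ?thesis using complex_Re_le_cmod[of "cdot v (A *v v)"] by linarith
qed

text \<open>The resonant part of the nonlinearity is the reduced one and drops out by dissipativity; only the
 oscillating nonresonant terms and the remainder survive.\<close>
lemma quadratic_form_derivative_bound:
 fixes m :: "'n::finite => real" and A :: "complex ^ 'n ^ 'n"
 assumes m0: "m0 > 0" "!!k. m0 <= m k"
  and diss: "!!Y. Im (cdot (A *v Y) (F_red m c (cosh z, sinh z) Y)) <= 0"
  and Y: "Y = profile m \<tau> w b" and Yb: "!!k. norm (Y $ k) <= M" "M >= 0"
  and h: "norm (h - (\<chi> j. F_cubic m c j (w, cosh z *R b, (- sinh z) *R b))) <= \<eta>"
  and Y': "!!j. Y' $ j = (- \<i> / of_real (m j)) * (cis (- (m j * \<tau>)) * of_real (h $ j))"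
 shows "2 * Re (cdot (A *v Y) Y') <=
  (\<Sum>j\<in>UNIV. \<Sum>a\<in>res_set m j. \<Sum>sg\<in>signs - res_signs m j a.
   Re (cnj ((A *v Y) $ j) * ((- \<i> / (4 * of_real (m j))) * monomial m c (cosh z, sinh z) j a sg Y) * cis (phase m j a sg * \<tau>)))
  + 2 * (real CARD('n) * (\<Sum>i\<in>UNIV. \<Sum>k\<in>UNIV. norm (A $ i $ k)) / m0) * M * \<eta>"
proof -
 have mp: "m k > 0" for k using m0(1) m0(2)[of k] by linarith
 let ?a = "\<Sum>i\<in>UNIV. \<Sum>k\<in>UNIV. norm (A $ i $ k)"
 define f where "f j = F_cubic m c j (w, cosh z *R b, (- sinh z) *R b)" for j
 define nr where "nr j = (\<Sum>a\<in>res_set m j. \<Sum>sg\<in>signs - res_signs m j a. monomial m c (cosh z, sinh z) j a sg Y * cis (phase m j a sg * \<tau>))" for j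
 define r where "r j = (- \<i> / of_real (m j)) * (cis (- (m j * \<tau>)) * of_real (h $ j - f j))" for j
 have fj: "cis (- (m j * \<tau>)) * of_real (f j) = (1/8) * (of_real (m j) * F_red m c (cosh z, sinh z) Y $ j + nr j)" for j
 proof -
  have "cis (- (m j * \<tau>)) * complex_of_real (f j) = (1/8) * (\<Sum>a\<in>res_set m j. \<Sum>sg\<in>signs. monomial m c (cosh z, sinh z) j a sg Y * cis (phase m j a sg * \<tau>))"
   unfolding f_def Y by (rule cubic_decomposition) (rule profile_inverse[OF mp])+
  also have "... = (1/8) * (of_real (m j) * F_red m c (cosh z, sinh z) Y $ j + nr j)"
   unfolding nr_def by (subst cubic_resonant_split[OF mp]) (rule refl)
  finally show ?thesis .
 qed
 have Y'': "Y' $ j = (- \<i> / 8) * F_red m c (cosh z, sinh z) Y $ j + (- \<i> / (8 * of_real (m j))) * nr j + r j" for j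
 proof -
  have "Y' $ j = (- \<i> / of_real (m j)) * (cis (- (m j * \<tau>)) * of_real (f j)) + r j"
   unfolding Y' r_def by (simp add: algebra_simps)
  also have "... = (- \<i> / of_real (m j)) * ((1/8) * (of_real (m j) * F_red m c (cosh z, sinh z) Y $ j + nr j)) + r j" unfolding fj ..
  also have "... = (- \<i> / 8) * F_red m c (cosh z, sinh z) Y $ j + (- \<i> / (8 * of_real (m j))) * nr j + r j"
   using mp[of j] by (simp add: field_simps)
  finally show ?thesis .
 qed
 let ?A = "A *v Y"
 have split: "cdot ?A Y' = (- \<i> / 8) * cdot ?A (F_red m c (cosh z, sinh z) Y)
   + (\<Sum>j\<in>UNIV. cnj (?A $ j) * ((- \<i> / (8 * of_real (m j))) * nr j)) + (\<Sum>j\<in>UNIV. cnj (?A $ j) * r j)"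
  unfolding cdot_def Y'' sum_distrib_left sum.distrib[symmetric] by (intro sum.cong refl) (simp add: algebra_simps)
 have "Re ((- \<i> / 8) * cdot ?A (F_red m c (cosh z, sinh z) Y)) = Im (cdot ?A (F_red m c (cosh z, sinh z) Y)) / 8" by simp
 then have p1: "Re ((- \<i> / 8) * cdot ?A (F_red m c (cosh z, sinh z) Y)) <= 0" using diss by simp
 have rj: "norm (cnj (?A $ j) * r j) <= ?a * M * (\<eta> / m0)" for j
 proof -
  have "\<bar>h $ j - f j\<bar> = \<bar>(h - (\<chi> j. F_cubic m c j (w, cosh z *R b, (- sinh z) *R b))) $ j\<bar>" unfolding f_def by simp
  also have "... <= \<eta>" using component_le_norm_cart h order_trans by blast
  finally have hf: "\<bar>h $ j - f j\<bar> <= \<eta>" .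
  have "norm (r j) = \<bar>h $ j - f j\<bar> / m j" unfolding r_def using mp[of j] by (simp add: norm_mult norm_divide del: of_real_diff)
  also have "... <= \<eta> / m0" using hf m0 by (intro frac_le) auto
  finally have "norm (r j) <= \<eta> / m0" .
  moreover have "0 <= ?a * M" using Yb(2) by (intro mult_nonneg_nonneg sum_nonneg) auto
  ultimately show ?thesis unfolding norm_mult complex_mod_cnj by (intro mult_mono matrix_vector_bound Yb) auto
 qed
 have "norm (\<Sum>j\<in>UNIV. cnj (?A $ j) * r j) <= (\<Sum>j\<in>(UNIV::'n set). ?a * M * (\<eta> / m0))"
  by (intro sum_norm_le rj)
 then have p3: "Re (\<Sum>j\<in>UNIV. cnj (?A $ j) * r j) <= (real CARD('n) * ?a / m0) * M * \<eta>"
  using complex_Re_le_cmod[of "\<Sum>j\<in>UNIV. cnj (?A $ j) * r j"] by simp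
 have p2: "2 * Re (\<Sum>j\<in>UNIV. cnj (?A $ j) * ((- \<i> / (8 * of_real (m j))) * nr j)) =
  (\<Sum>j\<in>UNIV. \<Sum>a\<in>res_set m j. \<Sum>sg\<in>signs - res_signs m j a.
   Re (cnj ((A *v Y) $ j) * ((- \<i> / (4 * of_real (m j))) * monomial m c (cosh z, sinh z) j a sg Y) * cis (phase m j a sg * \<tau>)))"
 proof -
  have q: "2 * (p * ((- \<i> / (8 * M)) * (x * y))) = p * ((- \<i> / (4 * M)) * x) * y" for p M x y :: complex
   by (cases "M = 0") (simp_all add: field_simps)
  have "2 * Re X = Re (2 * X)" for X by simp
  then have "2 * Re (\<Sum>j\<in>UNIV. cnj (?A $ j) * ((- \<i> / (8 * of_real (m j))) * nr j)) = Re (2 * (\<Sum>j\<in>UNIV. cnj (?A $ j) * ((- \<i> / (8 * of_real (m j))) * nr j)))" .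
  also have "2 * (\<Sum>j\<in>UNIV. cnj (?A $ j) * ((- \<i> / (8 * of_real (m j))) * nr j)) =
  (\<Sum>j\<in>UNIV. \<Sum>a\<in>res_set m j. \<Sum>sg\<in>signs - res_signs m j a.
   (cnj ((A *v Y) $ j) * ((- \<i> / (4 * of_real (m j))) * monomial m c (cosh z, sinh z) j a sg Y) * cis (phase m j a sg * \<tau>)))"
   unfolding nr_def sum_distrib_left
   by (intro sum.cong refl q)
  finally show ?thesis by (simp only: Re_sum)
 qed
 have "2 * Re (x + y + w) = 2 * Re x + 2 * Re y + 2 * Re w" for x y w by simp
 note this[of "(- \<i> / 8) * cdot ?A (F_red m c (cosh z, sinh z) Y)" "\<Sum>j\<in>UNIV. cnj (?A $ j) * ((- \<i> / (8 * of_real (m j))) * nr j)"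
   "\<Sum>j\<in>UNIV. cnj (?A $ j) * r j", folded split]
 then show ?thesis using p1 p2 p3 by linarith
qed

lemma nested_sum_Sigma:
 fixes f :: "'n::finite => 'a::finite => 'c => real"
 assumes "!!j a. finite (B j a)"
 shows "(\<Sum>j\<in>UNIV. \<Sum>a\<in>A j. \<Sum>sg\<in>B j a. f j a sg) = (\<Sum>(j, a, sg)\<in>(SIGMA j:UNIV. SIGMA a:A j. B j a). f j a sg)"
proof -
 have "(\<Sum>a\<in>A j. \<Sum>sg\<in>B j a. f j a sg) = (\<Sum>(a, sg)\<in>(SIGMA a:A j. B j a). f j a sg)" for j
  by (rule sum.Sigma) (use assms in auto)
 then have "(\<Sum>j\<in>UNIV. \<Sum>a\<in>A j. \<Sum>sg\<in>B j a. f j a sg) = (\<Sum>j\<in>UNIV. \<Sum>(a, sg)\<in>(SIGMA a:A j. B j a). f j a sg)" by simp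
 also have "... = (\<Sum>(j, p)\<in>(SIGMA j:UNIV. SIGMA a:A j. B j a). case p of (a, sg) => f j a sg)"
  by (rule sum.Sigma) (use assms in auto)
 finally show ?thesis by (simp add: case_prod_unfold)
qed

text \<open>The dissipative structure enters the bootstrap only through this statement: the matrix
  has disappeared, and one constant serves all rays z, all times and all trajectories. The term with
  M^4 comes from nonresonant products, M\<eta> from the error in the forcing.\<close>

definition ode_bound :: "('n::finite => real) => 'n coeffs => real => bool" where
 "ode_bound m c C \<longleftrightarrow> (\<forall>z s' M \<eta> w b h. 0 <= s' --> 0 <= M --> 0 <= \<eta> -->
  (\<forall>s\<in>{0..s'}. (w hvd exp s *R b s) (at s) \<and>
   (b hvd h s - exp s *R mass m (mass m (w s))) (at s) \<and>
   norm (w s) + norm (b s) <= M \<and> norm (h s) <= M \<and>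
   norm (h s - (\<chi> j. F_cubic m c j (w s, cosh z *R b s, (- sinh z) *R b s))) <= \<eta> * exp (- s / 5)) -->
  (\<forall>s\<in>{0..s'}. (norm (w s))\<^sup>2 + (norm (b s))^2 <= C * ((norm (w 0))^2 + (norm (b 0))^2 + cosh z ^ 3 * M ^ 4 + M * \<eta>)))"

text \<open>The quadratic form of \<open>A\<close> at the profile is a Lyapunov function up to
  oscillating and decaying terms. Positive definiteness turns its bound back into one for the
  profile, hence for \<open>w\<close> and \<open>b\<close>.\<close>

lemma profile_ode_bound:
 fixes m :: "'n::finite => real" and A :: "complex ^ 'n ^ 'n"
 assumes m0: "m0 > 0" "!!k. m0 <= m k" and A: "hermitian A" "positive_definite A"
  and diss: "!!\<omega> Y. \<omega> : hyperboloid_plus ==> Im (cdot (A *v Y) (F_red m c \<omega> Y)) <= 0"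
 shows "\<exists>C>0. ode_bound m c C"
proof -
 have mp: "m k > 0" for k using m0(1) m0(2)[of k] by linarith
 obtain l where l: "l > 0" "!!Y. l * (norm Y)^2 <= Re (cdot Y (A *v Y))" using positive_definite_lower_bound[OF A(2)] by blast
 define a where "a = (\<Sum>i\<in>UNIV. \<Sum>k\<in>UNIV. norm (A $ i $ k))"
 define n where "n = real CARD('n)"
 define K where "K = 1 + 1 / m0"
 define Pm where "Pm = 1 + (\<Sum>j\<in>UNIV. m j)"
 \<comment> \<open>All nonresonant triples. The set is finite and its phases are nonzero, so no
   lower bound on the phases has to be assumed.\<close>
 define I where "I = (SIGMA j:(UNIV::'n set). SIGMA a:res_set m j. signs - res_signs m j a)"
 define Cc where "Cc j a' = (\<Sum>I\<in>MI1. \<Sum>J\<in>MI1. \<Sum>K\<in>MI1. \<bar>c j a' I J K\<bar>)" for j a'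
 \<comment> \<open>The bound of the amplitude of a nonresonant term with cosh^3 and M^4 factored
   out, so that it depends on neither the ray nor the trajectory.\<close>
 define D' where "D' = (%(j, a', sg :: int \<times> int \<times> int). 2 * (2 * a * K) * (2 * (1 / (4 * m j)) * (8 * Pm ^ 3 * K ^ 3 * Cc j a')))"
 define \<nu> where "\<nu> = (%(j, a', sg). phase m j a' sg)"
 define G where "G = (\<Sum>i\<in>I. D' i / \<bar>\<nu> i\<bar>)"
 define Mm where "Mm = 1 + (\<Sum>k\<in>UNIV. m k)^2"
 have a0: "a >= 0" and n0: "n >= 0" and K0: "K >= 1" and Pm0: "Pm >= 0" and Mm0: "Mm > 0"
  using m0(1) mp by (auto simp: a_def n_def K_def Pm_def Mm_def sum_nonneg less_imp_le add_nonneg_nonneg add_pos_nonneg)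
 have Cc0: "Cc j a' >= 0" for j a' by (simp add: Cc_def sum_nonneg)
 have D0: "D' i >= 0" for i
  unfolding D'_def using a0 K0 Pm0 Cc0 mp by (auto simp: less_imp_le split: prod.splits intro!: mult_nonneg_nonneg)
 have G0: "G >= 0" unfolding G_def by (intro sum_nonneg divide_nonneg_nonneg D0) auto
 have finI: "finite I" unfolding I_def by (intro finite_SigmaI finite_Diff finite_signs) auto
 define Q where "Q = 2 * n * a * K^2 + 4 * G + 5 * (2 * (n * a / m0) * K)"
 have Q0: "Q >= 0" unfolding Q_def using n0 a0 K0 G0 m0 by (intro add_nonneg_nonneg mult_nonneg_nonneg divide_nonneg_nonneg) auto
 define C where "C = Mm / l * Q + 1"
 have C0: "C > 0" unfolding C_def using Mm0 l(1) Q0 by (intro add_nonneg_pos mult_nonneg_nonneg) auto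
 show ?thesis
  unfolding ode_bound_def
 proof (intro exI[of _ C] conjI C0 allI impI ballI)
  fix z s' M \<eta> :: real and w b h :: "real => real ^ 'n" and s
  assume s': "0 <= s'" and M: "0 <= M" and \<eta>: "0 <= \<eta>"
   and all: "\<forall>s\<in>{0..s'}. (w hvd exp s *R b s) (at s) \<and>
   (b hvd h s - exp s *R mass m (mass m (w s))) (at s) \<and>
   norm (w s) + norm (b s) <= M \<and> norm (h s) <= M \<and>
   norm (h s - (\<chi> j. F_cubic m c j (w s, cosh z *R b s, (- sinh z) *R b s))) <= \<eta> * exp (- s / 5)"
   and s: "s : {0..s'}"
  define T where "T = {0..s'}"
  have w: "(w hvd exp s *R b s) (at s)" and b: "(b hvd h s - exp s *R mass m (mass m (w s))) (at s)"
   and wb: "norm (w s) + norm (b s) <= M" and hM: "norm (h s) <= M"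
   and he: "norm (h s - (\<chi> j. F_cubic m c j (w s, cosh z *R b s, (- sinh z) *R b s))) <= \<eta> * exp (- s / 5)" if "s : T" for s
   using all that unfolding T_def by blast+
  define al where "al s = profile m (exp s) (w s) (b s)" for s
  define al' where "al' s = (\<chi> j. (- \<i> / of_real (m j)) * (cis (- (m j * exp s)) * of_real (h s $ j)))" for s
  have ald: "((%s. al s $ j) hvd al' s $ j) (at s)" if "s : T" for s j
   unfolding al_def al'_def vec_lambda_beta by (rule profile_derivative[OF mp w[OF that] b[OF that]])
  have alt: "tame T (M * K) (%s. al s $ j)" for j
   unfolding al_def K_def by (rule profile_tame[OF m0 wb hM w b M])
  have alb: "norm (al s $ k) <= M * K" if "s : T" for s k
   unfolding al_def K_def by (rule profile_norm[OF m0 wb[OF that]])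
  have MK: "M * K >= 0" using M K0 by simp
  define \<rho> where "\<rho> s = Re (cdot (al s) (A *v al s))" for s
  have \<rho>d: "(\<rho> hrd 2 * Re (cdot (A *v al s) (al' s))) (at s)" if "s : T" for s
   unfolding \<rho>_def by (rule quadratic_form_derivative[OF A(1) ald[OF that]])
  define H where "H = (%(j, a', sg) s. cnj ((A *v al s) $ j) * ((- \<i> / (4 * of_real (m j))) * monomial m c (cosh z, sinh z) j a' sg (al s)))"
  define q where "q = cosh z ^ 3 * M ^ 4"
  have Ht: "tame T (D' i * q) (H i)" if "i : I" for i
  proof -
   obtain j a' sg where i: "i = (j, a', sg)" by (metis prod.exhaust)
   have sg: "sg : signs" using that unfolding i I_def by auto
   have 1: "tame T (2 * a * (M * K)) (%s. cnj ((A *v al s) $ j))"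
    unfolding a_def by (intro tame_cnj matrix_vector_tame alt MK)
   have 2: "tame T (1 / (4 * m j)) (%s. - \<i> / (4 * of_real (m j)))"
    using mp[of j] by (intro tame_const) (simp add: norm_divide norm_mult)
   have 3: "tame T (8 * (cosh z * Pm) ^ 3 * (M * K) ^ 3 * Cc j a') (%s. monomial m c (cosh z, sinh z) j a' sg (al s))"
    unfolding Pm_def Cc_def by (rule monomial_tame[OF mp alt MK sg])
   have "tame T (2 * (2 * a * (M * K)) * (2 * (1 / (4 * m j)) * (8 * (cosh z * Pm) ^ 3 * (M * K) ^ 3 * Cc j a'))) (H i)"
    unfolding i H_def prod.case using a0 MK mp[of j]
    by (intro tame_mult 1 2 3) auto
   moreover have "2 * (2 * a * (M * K)) * (2 * (1 / (4 * m j)) * (8 * (cosh z * Pm) ^ 3 * (M * K) ^ 3 * Cc j a')) = D' i * q"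
    unfolding i D'_def q_def by (simp add: power_mult_distrib power4_eq_xxxx power3_eq_cube mult_ac)
   ultimately show ?thesis by simp
  qed
  have hyp: "(cosh z, sinh z) : hyperboloid_plus"
   using cosh_real_pos[of z] hyperbolic_pythagoras[of z] by (simp add: hyperboloid_plus_def)
  have le: "2 * Re (cdot (A *v al s) (al' s)) <= (\<Sum>i\<in>I. Re (H i s * cis (\<nu> i * exp s))) + (2 * (n * a / m0) * (M * K) * \<eta>) * exp (- s / 5)"
   if sT: "s : T" for s
  proof -
   have "2 * Re (cdot (A *v al s) (al' s)) <=
    (\<Sum>j\<in>UNIV. \<Sum>a\<in>res_set m j. \<Sum>sg\<in>signs - res_signs m j a.
     Re (cnj ((A *v al s) $ j) * ((- \<i> / (4 * of_real (m j))) * monomial m c (cosh z, sinh z) j a sg (al s)) * cis (phase m j a sg * exp s)))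
    + 2 * (n * a / m0) * (M * K) * (\<eta> * exp (- s / 5))"
    unfolding n_def a_def
    by (rule quadratic_form_derivative_bound[OF m0 diss[OF hyp] al_def alb[OF sT] MK he[OF sT]]) (simp add: al'_def)
   also have "(\<Sum>j\<in>UNIV. \<Sum>a\<in>res_set m j. \<Sum>sg\<in>signs - res_signs m j a.
     Re (cnj ((A *v al s) $ j) * ((- \<i> / (4 * of_real (m j))) * monomial m c (cosh z, sinh z) j a sg (al s)) * cis (phase m j a sg * exp s)))
    = (\<Sum>i\<in>I. Re (H i s * cis (\<nu> i * exp s)))"
    unfolding I_def H_def \<nu>_def
    by (subst nested_sum_Sigma) (auto simp: finite_signs intro!: sum.cong split: prod.splits simp del: times_complex.sel)
   finally show ?thesis by (simp only: mult.assoc)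
  qed
  have \<nu>0: "\<nu> i ~= 0" if "i : I" for i using that unfolding I_def \<nu>_def by (auto simp: res_signs_eq)
  have He: "0 <= 2 * (n * a / m0) * (M * K) * \<eta>"
   using n0 a0 m0 M K0 \<eta> by (intro mult_nonneg_nonneg divide_nonneg_nonneg) auto
  have "\<rho> s <= \<rho> 0 + 4 * (\<Sum>i\<in>I. (D' i * q) / \<bar>\<nu> i\<bar>) + 5 * (2 * (n * a / m0) * (M * K) * \<eta>)"
   by (rule oscillating_gronwall[OF T_def s' finI \<rho>d le \<nu>0 Ht He]) (use s T_def in auto)
  also have "(\<Sum>i\<in>I. (D' i * q) / \<bar>\<nu> i\<bar>) = G * q" unfolding G_def sum_distrib_right by (intro sum.cong refl) simp
  also have "\<rho> 0 <= 2 * n * a * K^2 * ((norm (w 0))^2 + (norm (b 0))^2)"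
  proof -
   have "\<rho> 0 <= n * a * ((norm (w 0) + norm (b 0)) * K)^2"
    unfolding \<rho>_def n_def a_def
   proof (rule quadratic_form_upper_bound)
    show "norm (al 0 $ k) <= (norm (w 0) + norm (b 0)) * K" for k
     unfolding al_def K_def by (rule profile_norm[OF m0 order_refl])
    show "0 <= (norm (w 0) + norm (b 0)) * K" using K0 by simp
   qed
   also have "... = n * a * K^2 * (norm (w 0) + norm (b 0))^2" by (simp add: power_mult_distrib)
   also have "... <= n * a * K^2 * (2 * ((norm (w 0))^2 + (norm (b 0))^2))"
   proof (intro mult_left_mono)
    show "(norm (w 0) + norm (b 0))^2 <= 2 * ((norm (w 0))^2 + (norm (b 0))^2)"
     using zero_le_power2[of "norm (w 0) - norm (b 0)"] by (simp add: power2_eq_square algebra_simps)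
   qed (use n0 a0 in auto)
   finally show ?thesis by (simp add: algebra_simps)
  qed
  finally have \<rho>s: "\<rho> s <= 2 * n * a * K^2 * ((norm (w 0))^2 + (norm (b 0))^2) + 4 * (G * q) + 5 * (2 * (n * a / m0) * (M * K) * \<eta>)" by simp
  define B where "B = (norm (w 0))^2 + (norm (b 0))^2 + q + M * \<eta>"
  have q0: "q >= 0" unfolding q_def using cosh_real_nonneg[of z] by simp
  have B: "(norm (w 0))^2 + (norm (b 0))^2 <= B" "q <= B" "M * \<eta> <= B" "0 <= B" unfolding B_def using q0 M \<eta> by auto
  have "0 <= 2 * n * a * K^2" "0 <= 4 * G" "0 <= 5 * (2 * (n * a / m0) * K)"
   using n0 a0 K0 G0 m0 by (auto intro!: mult_nonneg_nonneg divide_nonneg_nonneg)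
  note le3 = mult_left_mono[OF B(1) this(1)] mult_left_mono[OF B(2) this(2)] mult_left_mono[OF B(3) this(3)]
  have "Q * B = 2 * n * a * K^2 * B + 4 * G * B + 5 * (2 * (n * a / m0) * K) * B" unfolding Q_def by (simp only: distrib_right)
  moreover have "4 * (G * q) = 4 * G * q" "5 * (2 * (n * a / m0) * (M * K) * \<eta>) = 5 * (2 * (n * a / m0) * K) * (M * \<eta>)"
   by (simp_all only: mult_ac)
  ultimately have "\<rho> s <= Q * B" using \<rho>s le3 by linarith
  then have l2: "(norm (al s))^2 <= Q * B / l"
   using l(2)[of "al s"] l(1) unfolding \<rho>_def by (simp add: field_simps)
  have "(norm (w s))^2 + (norm (b s))^2 <= Mm * (norm (al s))^2" unfolding Mm_def al_def by (rule profile_bounds[OF mp])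
  also have "... <= Mm * (Q * B / l)" using l2 Mm0 by (intro mult_left_mono) auto
  also have "... <= C * B" unfolding C_def using B(4) by (simp add: algebra_simps)
  finally show "(norm (w s))^2 + (norm (b s))^2 <= C * ((norm (w 0))^2 + (norm (b 0))^2 + cosh z ^ 3 * M ^ 4 + M * \<eta>)"
   unfolding B_def q_def .
 qed
qed

section \<open>The bootstrap argument\<close>

definition Fc :: "('n::finite => real) => 'n coeffs => 'n jet => real ^ 'n" where
 "Fc m c y = (\<chi> j. F_cubic m c j y)"

lemma jet_comp_scaleR: "jet_comp I k (r *R y) = r * jet_comp I k y"
 and jet_comp_diff: "jet_comp I k (y - y') = jet_comp I k y - jet_comp I k y'"
 by (simp_all add: jet_comp_def case_prod_unfold)

lemma jet_comp_le: "\<bar>jet_comp I k y\<bar> <= norm y"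
proof -
 obtain u v w where y: "y = (u, v, w)" by (metis prod.exhaust)
 have "norm u <= norm y" "norm v <= norm y" "norm w <= norm y"
  unfolding y using norm_fst_le[of u "(v, w)"] norm_snd_le[of "(v, w)" u] norm_fst_le[of v w] norm_snd_le[of w v] by linarith+
 then show ?thesis
  using component_le_norm_cart[of u k] component_le_norm_cart[of v k] component_le_norm_cart[of w k]
  by (simp add: jet_comp_def y)
qed

lemma Fc_scaleR: "Fc m c (r *R y) = r ^ 3 *R Fc m c y"
proof -
 have "c0 * (r * x1) * (r * x2) * (r * x3) = r ^ 3 * (c0 * x1 * x2 * x3)" for c0 x1 x2 x3 :: real
  by (simp add: power3_eq_cube)
 note eq = this
 show ?thesis
  unfolding vec_eq_iff Fc_def F_cubic_def jet_comp_scaleR case_prod_unfold vec_lambda_beta vector_scaleR_component real_scaleR_def eq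
  by (simp only: sum_distrib_left simp_thms)
qed

lemma trilinear_difference:
 fixes x1 x2 x3 :: real
 assumes "\<bar>x1\<bar> <= P" "\<bar>x2\<bar> <= P" "\<bar>x3\<bar> <= P" "\<bar>y1\<bar> <= Q" "\<bar>y2\<bar> <= Q" "\<bar>y3\<bar> <= Q"
  "\<bar>x1 - y1\<bar> <= D" "\<bar>x2 - y2\<bar> <= D" "\<bar>x3 - y3\<bar> <= D"
 shows "\<bar>x1 * x2 * x3 - y1 * y2 * y3\<bar> <= 3 * (P + Q)^2 * D"
proof -
 let ?M = "P + Q"
 note P = order_trans[OF abs_ge_zero assms(1)] order_trans[OF abs_ge_zero assms(4)] order_trans[OF abs_ge_zero assms(7)]
 have t: "\<bar>u * v * w\<bar> <= ?M\<^sup>2 * D" if "\<bar>u\<bar> <= ?M" "\<bar>v\<bar> <= ?M" "\<bar>w\<bar> <= D" for u v w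
  unfolding abs_mult power2_eq_square using that P by (intro mult_mono) auto
 have "x1 * x2 * x3 - y1 * y2 * y3 = x2 * x3 * (x1 - y1) + y1 * x3 * (x2 - y2) + y1 * y2 * (x3 - y3)"
  by (simp add: algebra_simps)
 moreover have b: "\<bar>x2\<bar> <= ?M" "\<bar>x3\<bar> <= ?M" "\<bar>y1\<bar> <= ?M" "\<bar>y2\<bar> <= ?M" using assms(1-6) P by linarith+
 ultimately show ?thesis using t[OF b(1,2) assms(7)] t[OF b(3,2) assms(8)] t[OF b(3,4) assms(9)] by linarith
qed

lemma Fc_Lipschitz:
 fixes m :: "'n::finite => real"
 shows "\<exists>C>0. \<forall>y y'. norm (Fc m c y - Fc m c y') <= C * (norm y + norm y')^2 * norm (y - y')"
proof -
 define B where "B j = (\<Sum>a\<in>res_set m j. \<Sum>I\<in>MI1. \<Sum>J\<in>MI1. \<Sum>K\<in>MI1. \<bar>c j a I J K\<bar>)" for j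
 have B0: "B j >= 0" for j unfolding B_def by (simp add: sum_nonneg)
 have j: "\<bar>F_cubic m c j y - F_cubic m c j y'\<bar> <= B j * (3 * (norm y + norm y')^2 * norm (y - y'))" for j and y y' :: "'n jet"
 proof -
  let ?X = "3 * (norm y + norm y')^2 * norm (y - y')"
  have t: "\<bar>e * jet_comp I a1 y * jet_comp J a2 y * jet_comp K a3 y - e * jet_comp I a1 y' * jet_comp J a2 y' * jet_comp K a3 y'\<bar> <= \<bar>e\<bar> * ?X"
   for e I J K a1 a2 a3
  proof -
   have "\<bar>jet_comp I a1 y * jet_comp J a2 y * jet_comp K a3 y - jet_comp I a1 y' * jet_comp J a2 y' * jet_comp K a3 y'\<bar> <= ?X"
    by (rule trilinear_difference) (auto intro: jet_comp_le simp flip: jet_comp_diff)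
   from mult_left_mono[OF this abs_ge_zero[of e]] show ?thesis
    unfolding abs_mult[symmetric] by (simp only: right_diff_distrib mult.assoc)
  qed
  have "F_cubic m c j y - F_cubic m c j y' = (\<Sum>a\<in>res_set m j. \<Sum>I\<in>MI1. \<Sum>J\<in>MI1. \<Sum>K\<in>MI1.
   (c j a I J K * jet_comp I (fst a) y * jet_comp J (fst (snd a)) y * jet_comp K (snd (snd a)) y -
    c j a I J K * jet_comp I (fst a) y' * jet_comp J (fst (snd a)) y' * jet_comp K (snd (snd a)) y'))"
   unfolding F_cubic_def case_prod_unfold sum_subtractf by simp
  also have "\<bar>...\<bar> <= (\<Sum>a\<in>res_set m j. \<Sum>I\<in>MI1. \<Sum>J\<in>MI1. \<Sum>K\<in>MI1. \<bar>c j a I J K\<bar> * ?X)"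
   by (rule order_trans[OF sum_abs], rule sum_mono)+ (rule t)
  also have "... = B j * ?X" unfolding B_def sum_distrib_right ..
  finally show ?thesis .
 qed
 show ?thesis
 proof (intro exI[of _ "3 * (\<Sum>j\<in>UNIV. B j) + 1"] conjI allI)
  show "0 < 3 * (\<Sum>j\<in>UNIV. B j) + 1" using B0 by (simp add: sum_nonneg add_nonneg_pos)
  fix y y' :: "'n jet"
  let ?X = "(norm y + norm y')^2 * norm (y - y')"
  have "norm (Fc m c y - Fc m c y') <= (\<Sum>j\<in>UNIV. \<bar>(Fc m c y - Fc m c y') $ j\<bar>)" by (rule norm_le_l1_cart)
  also have "... <= (\<Sum>j\<in>UNIV. B j * (3 * (norm y + norm y')^2 * norm (y - y')))"
   by (rule sum_mono) (simp add: Fc_def j)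
  also have "... = 3 * (\<Sum>j\<in>UNIV. B j) * ?X" by (simp add: sum_distrib_right sum_distrib_left mult_ac)
  also have "... <= (3 * (\<Sum>j\<in>UNIV. B j) + 1) * ?X" by (intro mult_right_mono) auto
  finally show "norm (Fc m c y - Fc m c y') <= (3 * (\<Sum>j\<in>UNIV. B j) + 1) * (norm y + norm y')^2 * norm (y - y')" by (simp only: mult.assoc)
 qed
qed

text \<open>The three summands are the errors in the forcing: the z-derivatives
  (\<open>h_N\<close>), the quartic remainder of the nonlinearity, and the passage from the full jet
  to its leading part, where 37 = 34 + 3. \<open>cM\<close> bounds \<open>W 0\<close>,
  \<open>b 0\<close> and the forcing itself.\<close>

definition cEta :: "real => real => real => real => real => real" where
 "cEta m0 CF d C3 C4 = 6 / m0 * cE m0 CF d + 4 * 34 ^ 4 * C4 + 4 * 37^2 * C3 * (1 + 2 * c1 m0)"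
definition cM :: "real => real => real => real" where
 "cM m0 CF d = 1 + 12 / m0 * cE m0 CF d + cN CF d"
definition c5 :: "real => real => real => real => real => real => real" where
 "c5 m0 CF d C3 C4 Co = Co * (1 + 4 * cM m0 CF d ^ 4 + cM m0 CF d * cEta m0 CF d C3 C4)"
text \<open>The factor by which the solution may exceed the data. Its summands make it at least 2,
  at least 128 \<open>c5\<close> and at least 8 (3/m0 + 1) \<open>cE\<close>, which is what halving
  the bootstrap bound requires.\<close>

definition Lam :: "real => real => real => real => real => real => real" where
 "Lam m0 CF d C3 C4 Co = 2 + 128 * c5 m0 CF d C3 C4 Co + 8 * (3 / m0 + 1) * cE m0 CF d"

locale kgw_cubic = kgw_dim m F CF w S R m0 d
 for m :: "'n::finite => real" and F :: "'n vec3 => real ^ 'n" and CF :: real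
  and w :: "real * real => real ^ 'n" and S R m0 d :: real +
 fixes c :: "'n coeffs" and C3 C4 Co :: real
 assumes C3: "C3 > 0" "!!y y'. norm (Fc m c y - Fc m c y') <= C3 * (norm y + norm y')^2 * norm (y - y')"
  and C4: "C4 > 0" "!!y. norm (F y - Fc m c y) <= C4 * norm y ^ 4"
  and Co: "Co > 0" "ode_bound m c Co"
begin

lemma cE_pos: "cE m0 CF d >= 1"
 using cE_ge[OF m0(1), of CF d] unfolding cE_def by linarith

text \<open>The forcing of the oscillator in s. The second z-derivative appears as a perturbation
  with factor e^{-s} rather than as a principal term; this loss of derivatives is the reason for the
  energies.\<close>

definition h :: "real * real => real ^ 'n" where
 "h p = exp (- fst p) *R (W 2 p - (1/4) *R W 0 p) + N 0 p"

lemma W_b_ode: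
 "((%s. W 0 (s, z)) hvd exp s *R b 0 (s, z)) (at s)"
 "((%s. b 0 (s, z)) hvd h (s, z) - exp s *R mass m (mass m (W 0 (s, z)))) (at s)"
proof -
 have e: "exp s * exp (- s) = 1" "exp (- s) * exp s = 1" "exp (- s) * exp (2 * s) = exp s" "exp (- s) * exp (s * 2) = exp s" by (simp_all flip: exp_add)
 have "exp s *R b 0 (s, z) = V 0 (s, z)" by (simp add: b_def e)
 then show "((%s. W 0 (s, z)) hvd exp s *R b 0 (s, z)) (at s)" using W_s[of 0 z s] by simp
 have "((%s. exp (- s)) hrd - exp (- s)) (at s)" by (auto intro!: derivative_eq_intros)
 from has_vector_derivative_scaleR[OF this V_s[of 0 z s]]
 have "((%s. b 0 (s, z)) hvd exp (- s) *R rhs 0 (s, z) + (- exp (- s)) *R V 0 (s, z)) (at s)" by (simp add: b_def)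
 also have "exp (- s) *R rhs 0 (s, z) + (- exp (- s)) *R V 0 (s, z) = h (s, z) - exp s *R mass m (mass m (W 0 (s, z)))"
  unfolding rhs_def h_def by (simp add: algebra_simps e numeral_2_eq_2)
 finally show "((%s. b 0 (s, z)) hvd h (s, z) - exp s *R mass m (mass m (W 0 (s, z)))) (at s)" .
qed

lemma om_cosh_4: "cosh z ^ 4 <= 4 * om z ^ 3"
proof -
 have "cosh \<bar>z\<bar> <= cosh \<bar>3/2 * z\<bar>" by (subst cosh_real_nonneg_le_iff) (auto simp: abs_mult)
 then have "cosh z <= om z" unfolding om_def by (simp only: cosh_real_abs)
 then have "cosh z ^ 3 * cosh z <= 4 * (om z)^2 * om z"
  using cosh_cubed_le_om[of z] cosh_real_nonneg[of z] by (intro mult_mono) auto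
 then show ?thesis by (simp add: power3_eq_cube power4_eq_xxxx power2_eq_square)
qed

lemma cEta_nonneg: "cEta m0 CF d C3 C4 >= 0" and cM_ge_1: "cM m0 CF d >= 1"
proof -
 have "4 * 34 ^ 4 * C4 + 4 * 37^2 * C3 * (1 + 2 * c1 m0) >= 0" using C3(1) C4(1) c1_pos[OF m0(1)] by (intro add_nonneg_nonneg mult_nonneg_nonneg) auto
 moreover have cE0: "0 <= 6 / m0 * cE m0 CF d" using cE_pos m0(1) by simp
 ultimately show "cEta m0 CF d C3 C4 >= 0" unfolding cEta_def by linarith
 show "cM m0 CF d >= 1" unfolding cM_def using cE0 cN_nonneg by simp
qed

lemma c5_nonneg: "c5 m0 CF d C3 C4 Co >= 0"
 unfolding c5_def using Co(1) cEta_nonneg cM_ge_1 by (intro mult_nonneg_nonneg add_nonneg_nonneg) auto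

context
 fixes \<mu> ep s' :: real
 assumes s': "s' : {0..S}" and B: "!!s. s : {0..s'} ==> boot \<mu> s" and mu: "\<mu> <= 1" "ep <= \<mu>"
  and init: "!!k. k <= 3 ==> sqrt (E k 0) <= ep" "!!z. om z * Sn 0 (0, z) <= ep"
begin

definition "KE = cE m0 CF d * (ep + \<mu> ^ 3)"

lemma eps0: "ep >= 0" using init(1)[of 0] real_sqrt_ge_zero[OF E_nonneg, of 0 0] by linarith
lemma mu0: "\<mu> >= 0" using eps0 mu by linarith
lemma mu3: "\<mu> ^ 3 >= 0" "\<mu> ^ 3 <= \<mu>" "\<mu> ^ 4 <= \<mu> ^ 3"
proof -
 show "\<mu> ^ 3 >= 0" using mu0 by simp
 show "\<mu> ^ 3 <= \<mu>" using power_decreasing[of 1 3 \<mu>] mu0 mu by simp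
 show "\<mu> ^ 4 <= \<mu> ^ 3" using power_decreasing[of 3 4 \<mu>] mu0 mu by simp
qed
lemma KE0: "KE >= 0" unfolding KE_def using cE_pos eps0 mu3 by simp

lemma energy_KE: "s : {0..s'} ==> k <= 3 ==> sqrt (E k s) <= KE * exp (gam k * s)"
 unfolding KE_def by (rule improved_energy[OF s' B init(1)])

text \<open>The exponents are the means of consecutive values of \<open>gam\<close>. The decisive
  one is 4/5 < 1, for the second derivative.\<close>

lemma W_KE:
 assumes s: "s : {0..s'}"
 shows "om z * norm (W 0 (s, z)) <= 3 / m0 * KE * exp (1/10 * s)"
  "om z * norm (W 1 (s, z)) <= 3 / m0 * KE * exp (1/5 * s)"
  "om z * norm (W 2 (s, z)) <= 3 / m0 * KE * exp (4/5 * s)"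
proof -
 have sS: "s : {0..S}" using s s' by auto
 have g: "om z * norm (W k (s, z)) <= 3 / m0 * KE * exp ((gam k + gam (Suc k)) / 2 * s)" if k: "k <= 2" for k
 proof -
  have "(m0 * (om z * norm (W k (s, z))))^2 <= 3 * E k s + 2 * (sqrt (E k s) * sqrt (E (Suc k) s))" by (rule sobolev_E(3)[OF k sS])
  also have "... <= (3 * (KE * exp ((gam k + gam (Suc k)) / 2 * s)))^2"
   by (rule boot_sobolev[OF B[OF s] sS k refl KE0 energy_KE[OF s] energy_KE[OF s] gam_mono]) (use k in auto)
  finally have "m0 * (om z * norm (W k (s, z))) <= 3 * (KE * exp ((gam k + gam (Suc k)) / 2 * s))"
   by (rule power2_le_imp_le) (use KE0 in simp)
  then show ?thesis using m0(1) by (simp add: field_simps)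
 qed
 show "om z * norm (W 0 (s, z)) <= 3 / m0 * KE * exp (1/10 * s)" using g[of 0] by (simp add: gam_def)
 show "om z * norm (W 1 (s, z)) <= 3 / m0 * KE * exp (1/5 * s)" using g[of 1] by (simp add: gam_def)
 show "om z * norm (W 2 (s, z)) <= 3 / m0 * KE * exp (4/5 * s)" using g[of 2] by (simp add: gam_def)
qed

lemma a_KE: "s : {0..s'} ==> om z * norm (a 0 (s, z)) <= 3 / m0 * KE"
proof -
 assume s: "s : {0..s'}"
 have "om z * norm (a 0 (s, z)) = exp (- s) * (om z * norm (W 1 (s, z)))" by (simp add: a_def)
 also have "... <= exp (- s) * (3 / m0 * KE * exp (1/5 * s))" using W_KE(2)[OF s] by (intro mult_left_mono) auto
 also have "... = 3 / m0 * KE * exp (- (4/5) * s)" by (simp flip: exp_add)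
 also have "... <= 3 / m0 * KE * 1" using s KE0 m0(1) by (intro mult_left_mono) auto
 finally show ?thesis by simp
qed

text \<open>The factor e^{-s} beats the growth e^{4s/5} of the second derivative and leaves the rate
  1/5 that \<open>ode_bound\<close> expects; 6 is twice the Sobolev factor 3.\<close>

lemma h_N:
 assumes s: "s : {0..s'}"
 shows "om z * norm (h (s, z) - N 0 (s, z)) <= 6 / m0 * KE * exp (- s / 5)"
proof -
 let ?K = "3 / m0 * KE"
 have K: "?K >= 0" using KE0 m0(1) by simp
 have "h (s, z) - N 0 (s, z) = exp (- s) *R (W 2 (s, z) - (1/4) *R W 0 (s, z))" by (simp add: h_def)
 moreover have "norm ((1/4) *R W 0 (s, z)) = norm (W 0 (s, z)) / 4" by simp
 then have "norm (W 2 (s, z) - (1/4) *R W 0 (s, z)) <= norm (W 2 (s, z)) + norm (W 0 (s, z))"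
  using norm_triangle_ineq4[of "W 2 (s, z)" "(1/4) *R W 0 (s, z)"] norm_ge_zero[of "W 0 (s, z)"] by linarith
 ultimately have "norm (h (s, z) - N 0 (s, z)) <= exp (- s) * (norm (W 2 (s, z)) + norm (W 0 (s, z)))" by simp
 then have "om z * norm (h (s, z) - N 0 (s, z)) <= om z * (exp (- s) * (norm (W 2 (s, z)) + norm (W 0 (s, z))))"
  using om_pos[of z] by (intro mult_left_mono) auto
 also have "... = exp (- s) * (om z * norm (W 2 (s, z)) + om z * norm (W 0 (s, z)))" by (simp add: algebra_simps)
 also have "... <= exp (- s) * (?K * exp (4/5 * s) + ?K * exp (1/10 * s))"
  using W_KE[OF s, of z] by (intro mult_left_mono add_mono) auto
 also have "... <= exp (- s) * (?K * exp (4/5 * s) + ?K * exp (4/5 * s))"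
  using s K by (intro mult_left_mono add_mono) auto
 also have "... = 2 * ?K * (exp (- s) * exp (4/5 * s))" by simp
 also have "exp (- s) * exp (4/5 * s) = exp (- s / 5)" by (simp flip: exp_add)
 finally show ?thesis by simp
qed

text \<open>\<open>j1\<close> is the jet without its decay e^{-s/2}; \<open>j0\<close> keeps the
  leading part to which the resonance analysis applies. They differ by e^{-s} times multiples of
  \<open>W 0\<close> and \<open>W 1\<close>.\<close>

definition j1 :: "real * real => 'n vec3" where
 "j1 p = (W 0 p, cosh (snd p) *R x 0 p - sinh (snd p) *R y 0 p, cosh (snd p) *R y 0 p - sinh (snd p) *R x 0 p)"
definition j0 :: "real * real => 'n vec3" where
 "j0 p = (W 0 p, cosh (snd p) *R b 0 p, (- sinh (snd p)) *R b 0 p)"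

lemma J0_j1: "J0 p = exp (- fst p / 2) *R j1 p"
 by (simp add: J0_def hyp_jet_def j1_def)

lemma j_bounds:
 assumes s: "s : {0..s'}"
 shows "norm (j1 (s, z)) <= 34 * cosh z * Sn 0 (s, z)" "norm (j0 (s, z)) <= 3 * cosh z * Sn 0 (s, z)"
  "om z * norm (j1 (s, z) - j0 (s, z)) <= cosh z * ((1 + 2 * c1 m0) * \<mu> * exp (- s / 5))"
proof -
 have s0: "s >= 0" and sS: "s : {0..S}" using s s' by auto
 have e: "exp (s / 2) * exp (- s / 2) = 1" by (simp flip: exp_add)
 have "exp (s / 2) * exp (- (s / 2)) = 1" by (simp flip: exp_add)
 then have "j1 (s, z) = exp (s / 2) *R J0 (s, z)" unfolding J0_j1 by simp
 then have "norm (j1 (s, z)) = exp (s / 2) * norm (J0 (s, z))" by simp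
 also have "... <= exp (s / 2) * (exp (- s / 2) * cosh z * 34 * Sn 0 (s, z))" by (intro mult_left_mono J_le(1)[OF s0]) simp
 also have "... = (exp (s / 2) * exp (- s / 2)) * (34 * cosh z * Sn 0 (s, z))" by (simp only: mult_ac)
 finally show "norm (j1 (s, z)) <= 34 * cosh z * Sn 0 (s, z)" unfolding e by simp
 have c: "cosh z >= 1" "\<bar>sinh z\<bar> <= cosh z" using cosh_real_ge_1[of z] abs_sinh_le_cosh[of z] by auto
 have P: "norm (u, v, v') <= norm u + norm v + norm v'" for u v v' :: "real ^ 'n"
  using norm_Pair_le[of u "(v, v')"] norm_Pair_le[of v v'] by linarith
 have nb: "norm (b 0 (s, z)) <= Sn 0 (s, z)" and nw: "norm (W 0 (s, z)) <= Sn 0 (s, z)"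
  using Sn_ge[of 0 0 "(s, z)"] norm_ge_zero[of "a 0 (s, z)"] norm_ge_zero[of "b 0 (s, z)"] norm_ge_zero[of "W 0 (s, z)"] by linarith+
 have "norm (j0 (s, z)) <= norm (W 0 (s, z)) + cosh z * norm (b 0 (s, z)) + \<bar>sinh z\<bar> * norm (b 0 (s, z))"
  using P[of "W 0 (s, z)" "cosh z *R b 0 (s, z)" "(- sinh z) *R b 0 (s, z)"] c by (simp add: j0_def)
 also have "... <= cosh z * Sn 0 (s, z) + cosh z * Sn 0 (s, z) + cosh z * Sn 0 (s, z)"
  using nb c Sn_nonneg[of 0 "(s, z)"] nw mult_right_mono[OF c(1) Sn_nonneg[of 0 "(s, z)"]] by (intro add_mono mult_mono) auto
 finally show "norm (j0 (s, z)) <= 3 * cosh z * Sn 0 (s, z)" by simp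
 define \<delta> where "\<delta> = x 0 (s, z) - b 0 (s, z)"
 have \<delta>: "norm \<delta> <= exp (- s) / 2 * norm (W 0 (s, z))" by (simp add: \<delta>_def x_def b_def algebra_simps)
 have ny: "norm (y 0 (s, z)) = exp (- s) * norm (W 1 (s, z))" by (simp add: y_def)
 have "j1 (s, z) - j0 (s, z) = (0, cosh z *R \<delta> - sinh z *R y 0 (s, z), cosh z *R y 0 (s, z) - sinh z *R \<delta>)"
  by (simp add: j1_def j0_def \<delta>_def algebra_simps)
 then have "norm (j1 (s, z) - j0 (s, z)) <= norm (cosh z *R \<delta> - sinh z *R y 0 (s, z)) + norm (cosh z *R y 0 (s, z) - sinh z *R \<delta>)"
  using P[of 0] by simp
 also have "... <= (cosh z * norm \<delta> + \<bar>sinh z\<bar> * norm (y 0 (s, z))) + (cosh z * norm (y 0 (s, z)) + \<bar>sinh z\<bar> * norm \<delta>)"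
  using norm_triangle_ineq4[of "cosh z *R \<delta>" "sinh z *R y 0 (s, z)"] norm_triangle_ineq4[of "cosh z *R y 0 (s, z)" "sinh z *R \<delta>"] c by simp
 also have "... <= (cosh z * norm \<delta> + cosh z * norm (y 0 (s, z))) + (cosh z * norm (y 0 (s, z)) + cosh z * norm \<delta>)"
  using c by (intro add_mono mult_right_mono) auto
 also have "... = cosh z * (2 * norm \<delta> + 2 * norm (y 0 (s, z)))" by (simp add: algebra_simps)
 also have "... <= cosh z * (exp (- s) * (norm (W 0 (s, z)) + 2 * norm (W 1 (s, z))))"
  using \<delta> ny c by (intro mult_left_mono) (auto simp: algebra_simps)
 finally have "om z * norm (j1 (s, z) - j0 (s, z)) <= om z * (cosh z * (exp (- s) * (norm (W 0 (s, z)) + 2 * norm (W 1 (s, z)))))"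
  using om_pos[of z] by (intro mult_left_mono) auto
 also have "... = cosh z * (exp (- s) * (om z * norm (W 0 (s, z)) + 2 * (om z * norm (W 1 (s, z)))))" by (simp add: algebra_simps)
 also have "... <= cosh z * (exp (- s) * ((1 + 2 * c1 m0) * \<mu> * exp (4/5 * s)))"
 proof -
  have "om z * norm (W 0 (s, z)) <= om z * Sn 0 (s, z)" using nw om_pos[of z] by (intro mult_left_mono) auto
  also have "... <= \<mu>" using B[OF s] unfolding boot_def by blast
  also have "\<mu> <= \<mu> * exp (1/5 * s)" using mu0 s0 by (simp add: mult_le_cancel_left1)
  finally have 1: "om z * norm (W 0 (s, z)) <= \<mu> * exp (1/5 * s)" .
  have "om z * norm (W 1 (s, z)) <= om z * Sn 1 (s, z)" using W_le[of 1 1 "(s, z)"] om_pos[of z] by (intro mult_left_mono) auto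
  also have "... <= c1 m0 * (\<mu> * exp (1/5 * s))" by (rule boot_S1[OF B[OF s] sS])
  finally have 2: "om z * norm (W 1 (s, z)) <= c1 m0 * (\<mu> * exp (1/5 * s))" .
  have "om z * norm (W 0 (s, z)) + 2 * (om z * norm (W 1 (s, z))) <= (1 + 2 * c1 m0) * \<mu> * exp (1/5 * s)"
   using 1 2 by (simp add: algebra_simps)
  also have "... <= (1 + 2 * c1 m0) * \<mu> * exp (4/5 * s)"
   using s0 mu0 c1_pos[OF m0(1)] by (intro mult_left_mono) auto
  finally show ?thesis using c by (intro mult_left_mono) auto
 qed
 also have "... = cosh z * ((1 + 2 * c1 m0) * \<mu> * (exp (- s) * exp (4/5 * s)))" by (simp only: mult_ac)
 also have "exp (- s) * exp (4/5 * s) = exp (- s / 5)" by (simp flip: exp_add)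
 finally show "om z * norm (j1 (s, z) - j0 (s, z)) <= cosh z * ((1 + 2 * c1 m0) * \<mu> * exp (- s / 5))" .
qed

text \<open>Two errors: the remainder of order four has one jet more than the scaling compensates
  and so gains e^{-s/2}; the cubic part is Lipschitz with two factors to spare, and the difference
  of the jets decays.\<close>

lemma N_error:
 assumes s: "s : {0..s'}"
 shows "om z * norm (N 0 (s, z) - Fc m c (j0 (s, z))) <= (4 * 34 ^ 4 * C4 + 4 * 37^2 * C3 * (1 + 2 * c1 m0)) * \<mu> ^ 3 * exp (- s / 5)"
proof -
 let ?S = "Sn 0 (s, z)"
 have s0: "s >= 0" using s by auto
 have S0: "?S >= 0" by (rule Sn_nonneg)
 have oS: "om z * ?S <= \<mu>" using B[OF s] unfolding boot_def by blast
 have oS0: "0 <= om z * ?S" using om_pos[of z] S0 by simp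
 have c0: "cosh z >= 0" by (rule cosh_real_nonneg)
 have e3: "exp (3/2 * s) * exp (- s / 2) ^ 3 = 1" "exp (3/2 * s) * exp (- s / 2) ^ 4 = exp (- s / 2)"
  by (simp_all add: power3_eq_cube power4_eq_xxxx flip: exp_add)
 have "Fc m c (J0 (s, z)) = exp (- s / 2) ^ 3 *R Fc m c (j1 (s, z))" unfolding J0_j1 fst_conv by (rule Fc_scaleR)
 then have "Fc m c (j1 (s, z)) = exp (3/2 * s) *R Fc m c (J0 (s, z))" using e3 by simp
 then have eq: "N 0 (s, z) - Fc m c (j0 (s, z)) = exp (3/2 * s) *R (F (J0 (s, z)) - Fc m c (J0 (s, z))) + (Fc m c (j1 (s, z)) - Fc m c (j0 (s, z)))"
  by (simp add: N_def algebra_simps)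
 have p1: "om z * norm (exp (3/2 * s) *R (F (J0 (s, z)) - Fc m c (J0 (s, z)))) <= 4 * 34 ^ 4 * C4 * \<mu> ^ 3 * exp (- s / 5)"
 proof -
  have "norm (J0 (s, z)) = exp (- s / 2) * norm (j1 (s, z))" unfolding J0_j1 by simp
  also have "... <= exp (- s / 2) * (34 * cosh z * ?S)" by (intro mult_left_mono j_bounds(1)[OF s]) simp
  finally have "norm (J0 (s, z)) ^ 4 <= (exp (- s / 2) * (34 * cosh z * ?S)) ^ 4" by (rule power_mono) simp
  then have "norm (F (J0 (s, z)) - Fc m c (J0 (s, z))) <= C4 * (exp (- s / 2) * (34 * cosh z * ?S)) ^ 4"
   using order_trans[OF C4(2) mult_left_mono] C4(1) by (metis less_imp_le)
  then have "om z * (exp (3/2 * s) * norm (F (J0 (s, z)) - Fc m c (J0 (s, z)))) <= om z * (exp (3/2 * s) * (C4 * (exp (- s / 2) * (34 * cosh z * ?S)) ^ 4))"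
   using om_pos[of z] by (intro mult_left_mono) auto
  also have "... = (exp (3/2 * s) * exp (- s / 2) ^ 4) * (34 ^ 4 * C4 * (om z * ?S ^ 4 * cosh z ^ 4))" unfolding power_mult_distrib by (simp only: mult_ac)
  also have "... <= exp (- s / 5) * (34 ^ 4 * C4 * (om z * ?S ^ 4 * (4 * om z ^ 3)))"
   unfolding e3 using s0 C4(1) om_pos[of z] S0 c0 by (intro mult_mono om_cosh_4 mult_left_mono) auto
  also have "om z * ?S ^ 4 * (4 * om z ^ 3) = 4 * (om z * ?S) ^ 4" by (simp add: power_mult_distrib power4_eq_xxxx power3_eq_cube)
  also have "exp (- s / 5) * (34 ^ 4 * C4 * (4 * (om z * ?S) ^ 4)) <= exp (- s / 5) * (34 ^ 4 * C4 * (4 * \<mu> ^ 3))"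
   using power_mono[OF oS oS0, of 4] mu3(3) C4(1) by (intro mult_left_mono) auto
  finally show ?thesis by (simp add: mult_ac)
 qed
 have p2: "om z * norm (Fc m c (j1 (s, z)) - Fc m c (j0 (s, z))) <= 4 * 37^2 * C3 * (1 + 2 * c1 m0) * \<mu> ^ 3 * exp (- s / 5)"
 proof -
  let ?e = "(1 + 2 * c1 m0) * \<mu> * exp (- s / 5)"
  have e0: "?e >= 0" using mu0 c1_pos[OF m0(1)] by simp
  have X0: "0 <= 37^2 * C3 * ?e" using C3(1) by (intro mult_nonneg_nonneg[OF _ e0]) auto
  have "norm (j1 (s, z)) + norm (j0 (s, z)) <= 37 * cosh z * ?S" using j_bounds(1,2)[OF s, of z] by (simp add: algebra_simps)
  then have q: "(norm (j1 (s, z)) + norm (j0 (s, z)))^2 <= (37 * cosh z * ?S)^2" by (rule power_mono) simp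
  have "om z * norm (Fc m c (j1 (s, z)) - Fc m c (j0 (s, z))) <= om z * (C3 * (norm (j1 (s, z)) + norm (j0 (s, z)))^2 * norm (j1 (s, z) - j0 (s, z)))"
   using om_pos[of z] by (intro mult_left_mono C3(2)) auto
  also have "... = C3 * ((norm (j1 (s, z)) + norm (j0 (s, z)))^2 * (om z * norm (j1 (s, z) - j0 (s, z))))" by (simp only: mult_ac)
  also have "... <= C3 * ((37 * cosh z * ?S)^2 * (cosh z * ?e))"
   using C3(1) om_pos[of z] by (intro mult_left_mono mult_mono[OF q j_bounds(3)[OF s, of z]]) auto
  also have "... = 37^2 * C3 * ?e * (?S\<^sup>2 * cosh z ^ 3)" by (simp add: power_mult_distrib power2_eq_square power3_eq_cube)
  also have "... <= 37^2 * C3 * ?e * (?S\<^sup>2 * (4 * (om z)^2))"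
   by (rule mult_left_mono[OF _ X0]) (intro mult_left_mono cosh_cubed_le_om, simp)
  also have "?S\<^sup>2 * (4 * (om z)^2) = 4 * (om z * ?S)^2" by (simp add: power_mult_distrib)
  also have "37^2 * C3 * ?e * (4 * (om z * ?S)^2) <= 37^2 * C3 * ?e * (4 * \<mu>^2)"
   using power_mono[OF oS oS0, of 2] by (intro mult_left_mono[OF _ X0]) auto
  also have "... = 4 * 37^2 * C3 * (1 + 2 * c1 m0) * \<mu> ^ 3 * exp (- s / 5)" by (simp add: power2_eq_square power3_eq_cube)
  finally show ?thesis .
 qed
 have "om z * norm (N 0 (s, z) - Fc m c (j0 (s, z))) <= om z * norm (exp (3/2 * s) *R (F (J0 (s, z)) - Fc m c (J0 (s, z)))) + om z * norm (Fc m c (j1 (s, z)) - Fc m c (j0 (s, z)))"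
  unfolding eq using mult_left_mono[OF norm_triangle_ineq less_imp_le[OF om_pos[of z]]] by (simp only: distrib_left)
 then show ?thesis using p1 p2 by (simp add: distrib_right)
qed

text \<open>On a fixed ray the weight is a constant, so \<open>ode_bound\<close> is applied with
  \<open>M / o'\<close> and \<open>\<eta> / o'\<close>. After multiplication by the squared weight,
  cosh^3 M^4 / om^2 is at most 4 M^4, uniformly in z.\<close>

lemma W_b_improved:
 assumes s: "s : {0..s'}"
 shows "(om z * norm (W 0 (s, z)))^2 + (om z * norm (b 0 (s, z)))^2 <= c5 m0 CF d C3 C4 Co * (ep^2 + \<mu> * ep + \<mu> ^ 4)"
proof -
 define o' where "o' = om z"
 have o: "o' > 0" "o' >= 1" unfolding o'_def by (rule om_pos, rule om_ge_1)
 define M where "M = cM m0 CF d * \<mu>"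
 define \<eta> where "\<eta> = cEta m0 CF d C3 C4 * (ep + \<mu> ^ 3)"
 let ?n = "4 * 34 ^ 4 * C4 + 4 * 37^2 * C3 * (1 + 2 * c1 m0)"
 have n0: "?n >= 0" using C3(1) C4(1) c1_pos[OF m0(1)] by (intro add_nonneg_nonneg mult_nonneg_nonneg) auto
 note cEta0 = cEta_nonneg and cM0 = cM_ge_1
 have M0: "M >= 0" unfolding M_def using cM0 mu0 by simp
 have \<eta>0: "\<eta> >= 0" unfolding \<eta>_def using cEta0 eps0 mu3 by simp
 have KE_le: "6 / m0 * KE <= 12 / m0 * cE m0 CF d * \<mu>"
 proof -
  have "KE <= cE m0 CF d * (2 * \<mu>)" unfolding KE_def using cE_pos mu mu3 by (intro mult_left_mono) auto
  then have "6 / m0 * KE <= 6 / m0 * (cE m0 CF d * (2 * \<mu>))" using m0(1) by (intro mult_left_mono) auto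
  then show ?thesis by simp
 qed
 have key: "norm (W 0 (s, z)) + norm (b 0 (s, z)) <= M / o' \<and> norm (h (s, z)) <= M / o' \<and>
   norm (h (s, z) - Fc m c (j0 (s, z))) <= \<eta> / o' * exp (- s / 5)" if s: "s : {0..s'}" for s
 proof (intro conjI)
  have oS: "om z * Sn 0 (s, z) <= \<mu>" using B[OF s] unfolding boot_def by blast
  have "norm (W 0 (s, z)) + norm (b 0 (s, z)) <= Sn 0 (s, z)"
   using Sn_ge[of 0 0 "(s, z)"] norm_ge_zero[of "a 0 (s, z)"] by linarith
  then have "o' * (norm (W 0 (s, z)) + norm (b 0 (s, z))) <= o' * Sn 0 (s, z)" using o by (intro mult_left_mono) auto
  also have "... <= 1 * \<mu>" using oS unfolding o'_def by simp
  also have "... <= M" unfolding M_def using cM0 mu0 by (intro mult_right_mono) auto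
  finally show "norm (W 0 (s, z)) + norm (b 0 (s, z)) <= M / o'" using o by (simp add: field_simps)
  have hN: "o' * norm (h (s, z) - N 0 (s, z)) <= 6 / m0 * KE * exp (- s / 5)" unfolding o'_def by (rule h_N[OF s])
  have "6 / m0 * KE * exp (- s / 5) <= 6 / m0 * KE * 1" using KE0 m0(1) s by (intro mult_left_mono) auto
  then have hN': "o' * norm (h (s, z) - N 0 (s, z)) <= 12 / m0 * cE m0 CF d * \<mu>" using hN KE_le by linarith
  have "o' * norm (N 0 (s, z)) <= cN CF d * ((om z * Sn 0 (s, z)) * (om z * Sn 0 (s, z)) * (om z * Sn 0 (s, z)))"
   unfolding o'_def using s by (intro N_pointwise(1)) auto
  also have "... <= cN CF d * (\<mu> * \<mu> * \<mu>)"
   using oS Sn_nonneg[of 0 "(s, z)"] om_pos[of z] mu0 cN_nonneg by (intro mult_left_mono mult_mono) auto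
  also have "... <= cN CF d * \<mu>" using mu3(2) cN_nonneg by (intro mult_left_mono) (auto simp: power3_eq_cube)
  finally have "o' * norm (N 0 (s, z)) <= cN CF d * \<mu>" .
  moreover have "o' * norm (h (s, z)) <= o' * (norm (h (s, z) - N 0 (s, z)) + norm (N 0 (s, z)))"
   using norm_triangle_ineq[of "h (s, z) - N 0 (s, z)" "N 0 (s, z)"] o by (intro mult_left_mono) auto
  ultimately have "o' * norm (h (s, z)) <= 12 / m0 * cE m0 CF d * \<mu> + cN CF d * \<mu>" using hN' unfolding distrib_left by linarith
  also have "... <= M" unfolding M_def cM_def distrib_right using mu0 by simp
  finally show "norm (h (s, z)) <= M / o'" using o by (simp add: field_simps)
  have "o' * norm (h (s, z) - Fc m c (j0 (s, z))) <= o' * (norm (h (s, z) - N 0 (s, z)) + norm (N 0 (s, z) - Fc m c (j0 (s, z))))"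
   using norm_triangle_ineq[of "h (s, z) - N 0 (s, z)" "N 0 (s, z) - Fc m c (j0 (s, z))"] o by (intro mult_left_mono) auto
  also have "... <= 6 / m0 * KE * exp (- s / 5) + ?n * \<mu> ^ 3 * exp (- s / 5)"
   using hN N_error[OF s, of z] unfolding o'_def distrib_left by linarith
  also have "... = (6 / m0 * KE + ?n * \<mu> ^ 3) * exp (- s / 5)" by (simp only: distrib_right)
  also have "... <= \<eta> * exp (- s / 5)"
  proof (rule mult_right_mono)
   have "?n * \<mu> ^ 3 <= ?n * (ep + \<mu> ^ 3)" using n0 eps0 by (intro mult_left_mono) auto
   moreover have "\<eta> = 6 / m0 * KE + ?n * (ep + \<mu> ^ 3)"
    unfolding \<eta>_def cEta_def KE_def by (simp only: distrib_right mult.assoc add.assoc)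
   ultimately show "6 / m0 * KE + ?n * \<mu> ^ 3 <= \<eta>" by linarith
  qed simp
  finally show "norm (h (s, z) - Fc m c (j0 (s, z))) <= \<eta> / o' * exp (- s / 5)" using o by (simp add: field_simps)
 qed
 have ode: "(norm (W 0 (s, z)))^2 + (norm (b 0 (s, z)))^2 <=
   Co * ((norm (W 0 (0, z)))^2 + (norm (b 0 (0, z)))^2 + cosh z ^ 3 * (M / o') ^ 4 + M / o' * (\<eta> / o'))"
 proof -
  have pre: "\<forall>s\<in>{0..s'}. ((%s. W 0 (s, z)) hvd exp s *R b 0 (s, z)) (at s) \<and>
   ((%s. b 0 (s, z)) hvd h (s, z) - exp s *R mass m (mass m (W 0 (s, z)))) (at s) \<and>
   norm (W 0 (s, z)) + norm (b 0 (s, z)) <= M / o' \<and> norm (h (s, z)) <= M / o' \<and>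
   norm (h (s, z) - (\<chi> j. F_cubic m c j (W 0 (s, z), cosh z *R b 0 (s, z), (- sinh z) *R b 0 (s, z)))) <= \<eta> / o' * exp (- s / 5)"
   using key W_b_ode unfolding Fc_def j0_def snd_conv by blast
  have "0 <= s'" "0 <= M / o'" "0 <= \<eta> / o'" using s M0 \<eta>0 o by auto
  with Co(2)[unfolded ode_bound_def, rule_format, of s' "M / o'" "\<eta> / o'" "%s. W 0 (s, z)" "%s. b 0 (s, z)" "%s. h (s, z)" z s] pre s
  show ?thesis by blast
 qed
 have "(o' * norm (W 0 (s, z)))^2 + (o' * norm (b 0 (s, z)))^2 = o'^2 * ((norm (W 0 (s, z)))^2 + (norm (b 0 (s, z)))^2)"
  by (simp add: power_mult_distrib distrib_left)
 also have "... <= o'^2 * (Co * ((norm (W 0 (0, z)))^2 + (norm (b 0 (0, z)))^2 + cosh z ^ 3 * (M / o') ^ 4 + M / o' * (\<eta> / o')))"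
  by (intro mult_left_mono ode) simp
 also have "... = Co * (((o' * norm (W 0 (0, z)))^2 + (o' * norm (b 0 (0, z)))^2) + cosh z ^ 3 * (M ^ 4 / o'^2) + M * \<eta>)"
 proof -
  have a: "o'^2 * (M / o') ^ 4 = M ^ 4 / o'^2" using o by (simp add: power_divide power2_eq_square power4_eq_xxxx)
  have b: "o'^2 * (M / o' * (\<eta> / o')) = M * \<eta>" using o by (simp add: power2_eq_square)
  have "q * (Co * (u + v + p * x + y)) = Co * ((q * u + q * v) + p * (q * x) + q * y)" for q u v p x y :: real
   by (simp only: distrib_left mult_ac)
  from this[of "o'^2" "(norm (W 0 (0, z)))^2" "(norm (b 0 (0, z)))^2" "cosh z ^ 3" "(M / o') ^ 4" "M / o' * (\<eta> / o')"]
  show ?thesis unfolding a b power_mult_distrib .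
 qed
 also have "... <= Co * (ep^2 + 4 * M ^ 4 + M * \<eta>)"
 proof (intro mult_left_mono add_mono)
  let ?u = "o' * norm (W 0 (0, z))" and ?v = "o' * norm (b 0 (0, z))"
  have "norm (W 0 (0, z)) + norm (b 0 (0, z)) <= Sn 0 (0, z)"
   using Sn_ge[of 0 0 "(0, z)"] norm_ge_zero[of "a 0 (0, z)"] by linarith
  then have "o' * (norm (W 0 (0, z)) + norm (b 0 (0, z))) <= o' * Sn 0 (0, z)" using o by (intro mult_left_mono) auto
  then have "?u + ?v <= ep" using init(2)[of z] unfolding o'_def distrib_left by linarith
  then have "(?u + ?v)^2 <= ep^2" using o by (intro power_mono) auto
  moreover have "0 <= ?u * ?v" using o by simp
  ultimately show "?u\<^sup>2 + ?v\<^sup>2 <= ep^2" unfolding power2_sum by linarith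
  have "cosh z ^ 3 * (M ^ 4 / o'^2) <= (4 * o'^2) * (M ^ 4 / o'^2)"
   unfolding o'_def using cosh_cubed_le_om[of z] by (intro mult_right_mono) auto
  also have "... = 4 * M ^ 4" using o by simp
  finally show "cosh z ^ 3 * (M ^ 4 / o'^2) <= 4 * M ^ 4" .
 qed (use Co(1) M0 in auto)
 also have "... <= c5 m0 CF d C3 C4 Co * (ep^2 + \<mu> * ep + \<mu> ^ 4)"
 proof -
  let ?Z = "ep^2 + \<mu> * ep + \<mu> ^ 4"
  have z: "ep^2 <= ?Z" "\<mu> ^ 4 <= ?Z" "\<mu> * ep + \<mu> ^ 4 <= ?Z" using mu0 eps0 by auto
  have "4 * M ^ 4 = 4 * cM m0 CF d ^ 4 * \<mu> ^ 4" by (simp add: M_def power_mult_distrib)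
  also have "... <= 4 * cM m0 CF d ^ 4 * ?Z" using z cM0 by (intro mult_left_mono) auto
  finally have 1: "4 * M ^ 4 <= 4 * cM m0 CF d ^ 4 * ?Z" .
  have "M * \<eta> = cM m0 CF d * cEta m0 CF d C3 C4 * (\<mu> * ep + \<mu> ^ 4)"
   by (simp add: M_def \<eta>_def algebra_simps power3_eq_cube power4_eq_xxxx)
  also have "... <= cM m0 CF d * cEta m0 CF d C3 C4 * ?Z" using z cM0 cEta0 by (intro mult_left_mono) auto
  finally have 2: "M * \<eta> <= cM m0 CF d * cEta m0 CF d C3 C4 * ?Z" .
  have "ep^2 + 4 * M ^ 4 + M * \<eta> <= (1 + 4 * cM m0 CF d ^ 4 + cM m0 CF d * cEta m0 CF d C3 C4) * ?Z"
   unfolding distrib_right[of _ _ ?Z] mult_1 using z(1) 1 2 by linarith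
  then have "Co * (ep^2 + 4 * M ^ 4 + M * \<eta>) <= Co * ((1 + 4 * cM m0 CF d ^ 4 + cM m0 CF d * cEta m0 CF d C3 C4) * ?Z)"
   using Co(1) by (intro mult_left_mono) auto
  then show ?thesis unfolding c5_def by (simp only: mult.assoc)
 qed
 finally show ?thesis unfolding o'_def .
qed

lemma Sn_improved:
 assumes s: "s : {0..s'}"
 shows "om z * Sn 0 (s, z) <= 2 * sqrt (c5 m0 CF d C3 C4 Co * (ep^2 + \<mu> * ep + \<mu> ^ 4)) + 3 / m0 * (cE m0 CF d * (ep + \<mu> ^ 3))"
proof -
 let ?Q = "c5 m0 CF d C3 C4 Co * (ep^2 + \<mu> * ep + \<mu> ^ 4)"
 let ?u = "om z * norm (W 0 (s, z))" and ?v = "om z * norm (b 0 (s, z))"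
 have "?u\<^sup>2 <= ?Q" "?v\<^sup>2 <= ?Q" using W_b_improved[OF s, of z] zero_le_power2[of ?u] zero_le_power2[of ?v] by linarith+
 then have "?u <= sqrt ?Q" "?v <= sqrt ?Q" by (auto intro: real_le_rsqrt)
 moreover have "om z * norm (a 0 (s, z)) <= 3 / m0 * (cE m0 CF d * (ep + \<mu> ^ 3))" using a_KE[OF s, of z] unfolding KE_def .
 moreover have "om z * Sn 0 (s, z) = ?u + ?v + om z * norm (a 0 (s, z))" by (simp add: Sn_def distrib_left)
 ultimately show ?thesis by linarith
qed

end

lemma E_continuous: "k <= 3 ==> continuous_on {0..S} (E k)"
proof -
 assume k: "k <= 3"
 obtain D where "!!s. s : {0..S} ==> (E k hrd D s) (at s within {0..S})" by (rule E_inequality[OF k]) (rule that)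
 then show ?thesis by (rule DERIV_continuous_on)
qed

lemma Sn_0_continuous: "continuous_on A (Sn 0)"
proof -
 have "Sn 0 = (%p. norm (W 0 p) + norm (exp (- fst p) *R V 0 p) + norm (exp (- fst p) *R W 1 p))"
  by (rule ext) (simp add: Sn_def b_def a_def)
 then show ?thesis by (auto intro!: continuous_intros W_continuous V_continuous)
qed

lemma Sn_0_outside: "s : {0..S} ==> \<bar>z\<bar> >= R ==> Sn 0 (s, z) = 0"
 by (simp add: Sn_def b_def a_def supp_W_V)

text \<open>The bootstrap runs with \<mu> = L ep, and its hypotheses are improved from \<mu> to
  \<mu>/2: a quarter comes from the oscillator bound and a quarter from the energies.\<close>

theorem global_bound:
 assumes ep: "0 < ep" "ep <= 1 / (Lam m0 CF d C3 C4 Co)^2"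
  and init: "!!k. k <= 3 ==> sqrt (E k 0) <= ep" "!!z. om z * Sn 0 (0, z) <= ep"
  and s: "s : {0..S}"
 shows "om z * Sn 0 (s, z) <= Lam m0 CF d C3 C4 Co * ep"
proof -
 define L where "L = Lam m0 CF d C3 C4 Co"
 define \<mu> where "\<mu> = L * ep"
 let ?c5 = "c5 m0 CF d C3 C4 Co" and ?k = "(3 / m0 + 1) * cE m0 CF d"
 have k0: "?k >= 0" using cE_pos m0(1) by simp
 have L: "L >= 2" "128 * ?c5 <= L" "8 * ?k <= L"
 proof -
  have "L = 2 + 128 * ?c5 + 8 * ?k" unfolding L_def Lam_def by (simp only: mult.assoc)
  then show "L >= 2" "128 * ?c5 <= L" "8 * ?k <= L" using k0 c5_nonneg by linarith+
 qed
 \<comment> \<open>The only smallness used: it gives \<mu>^4 <= ep^2 and \<mu>^3 <= ep, so the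
   nonlinear contributions are no larger than those of the data.\<close>
 have e1: "L^2 * ep <= 1" using ep(2) L(1) unfolding L_def[symmetric] by (simp add: field_simps)
 have mu_pos: "\<mu> > 0" unfolding \<mu>_def using L(1) ep by simp
 have "2 * (L * ep) <= L * (L * ep)" using L(1) mu_pos unfolding \<mu>_def by (intro mult_right_mono) auto
 then have mu1: "\<mu> <= 1" using e1 mu_pos unfolding \<mu>_def by (simp add: power2_eq_square)
 have "1 * ep <= L * ep" using L(1) ep by (intro mult_right_mono) auto
 then have mu2: "ep <= \<mu>" "ep < \<mu>" using L(1) ep(1) unfolding \<mu>_def by auto
 have m4: "\<mu> ^ 4 <= ep^2"
 proof -
  have "\<mu> ^ 4 = (L^2 * ep)^2 * ep^2" unfolding \<mu>_def by (simp add: power_mult_distrib power2_eq_square power4_eq_xxxx)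
  also have "... <= 1^2 * ep^2" using e1 ep(1) L(1) by (intro mult_right_mono power_mono) auto
  finally show ?thesis by simp
 qed
 have m3: "\<mu> ^ 3 <= ep"
 proof -
  have "\<mu> ^ 3 = (L^2 * ep) * (\<mu> * ep)" unfolding \<mu>_def by (simp add: power_mult_distrib power2_eq_square power3_eq_cube)
  also have "... <= 1 * (1 * ep)" using e1 mu1 mu_pos ep(1) L(1) by (intro mult_mono) auto
  finally show ?thesis by simp
 qed
 have num1: "2 * sqrt (?c5 * (ep^2 + \<mu> * ep + \<mu> ^ 4)) <= \<mu> / 4"
 proof -
  have "?c5 * (ep^2 + \<mu> * ep + \<mu> ^ 4) <= ?c5 * (ep^2 + \<mu> * ep + ep^2)" using m4 c5_nonneg by (intro mult_left_mono) auto
  also have "... = ?c5 * ((2 + L) * ep^2)" unfolding \<mu>_def by (simp add: algebra_simps power2_eq_square)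
  also have "... <= ?c5 * ((2 * L) * ep^2)" using L(1) c5_nonneg by (intro mult_left_mono mult_right_mono) auto
  also have "... = (128 * ?c5) * (L * ep^2) / 64" by simp
  also have "... <= L * (L * ep^2) / 64" using L by (intro divide_right_mono mult_right_mono) auto
  also have "... = (\<mu> / 8)^2" unfolding \<mu>_def by (simp add: power2_eq_square)
  finally have "sqrt (?c5 * (ep^2 + \<mu> * ep + \<mu> ^ 4)) <= \<mu> / 8" by (rule real_le_lsqrt[rotated]) (use mu_pos in auto)
  then show ?thesis by simp
 qed
 have num2: "?k * (ep + \<mu> ^ 3) <= \<mu> / 4"
 proof -
  have "?k * (ep + \<mu> ^ 3) <= ?k * (2 * ep)" using m3 k0 by (intro mult_left_mono) auto
  also have "... = (8 * ?k) * ep / 4" by simp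
  also have "... <= L * ep / 4" using L(3) ep(1) by (intro divide_right_mono mult_right_mono) auto
  finally show ?thesis unfolding \<mu>_def .
 qed
 have k12: "3 / m0 * (cE m0 CF d * (ep + \<mu> ^ 3)) <= ?k * (ep + \<mu> ^ 3)" "cE m0 CF d * (ep + \<mu> ^ 3) <= ?k * (ep + \<mu> ^ 3)"
 proof -
  have "0 <= cE m0 CF d * (ep + \<mu> ^ 3)" using cE_pos ep(1) mu_pos by (intro mult_nonneg_nonneg add_nonneg_nonneg) auto
  moreover have "0 <= 3 / m0 * (cE m0 CF d * (ep + \<mu> ^ 3))" using m0(1) by (intro mult_nonneg_nonneg[OF _ calculation]) auto
  moreover have "?k * (ep + \<mu> ^ 3) = 3 / m0 * (cE m0 CF d * (ep + \<mu> ^ 3)) + cE m0 CF d * (ep + \<mu> ^ 3)"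
   by (simp only: distrib_right mult_1 mult.assoc)
  ultimately show "3 / m0 * (cE m0 CF d * (ep + \<mu> ^ 3)) <= ?k * (ep + \<mu> ^ 3)" "cE m0 CF d * (ep + \<mu> ^ 3) <= ?k * (ep + \<mu> ^ 3)"
   by linarith+
 qed
 define e where "e k s = sqrt (E k s) * exp (- (gam k * s))" for k s
 \<comment> \<open>All bootstrap quantities in one continuous function. The energies are divided by
   their permitted growth; the compact range of z suffices because \<open>Sn 0\<close> vanishes
   outside it.\<close>
 define f where "f p = max (om (snd p) * Sn 0 p) (max (max (e 0 (fst p)) (e 1 (fst p))) (max (e 2 (fst p)) (e 3 (fst p))))" for p
 have ek: "e k s <= B \<longleftrightarrow> sqrt (E k s) <= B * exp (gam k * s)" for k s B
  unfolding e_def exp_minus by (simp add: field_simps)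
 have f_le: "f (s, z) <= B \<longleftrightarrow> om z * Sn 0 (s, z) <= B \<and> (\<forall>k\<le>3. sqrt (E k s) <= B * exp (gam k * s))" for s z B
 proof -
  have "(\<forall>k\<le>3. e k s <= B) \<longleftrightarrow> e 0 s <= B \<and> e 1 s <= B \<and> e 2 s <= B \<and> e 3 s <= B"
   by (auto simp: numeral_3_eq_3 numeral_2_eq_2 le_Suc_eq)
  then show ?thesis unfolding f_def ek[symmetric] by auto
 qed
 have econt: "continuous_on ({0..S} \<times> {-R..R}) (%p. e k (fst p))" if "k <= 3" for k
  unfolding e_def
  by (intro continuous_intros continuous_on_compose2[OF E_continuous[OF that]]) auto
 have fcont: "continuous_on ({0..S} \<times> {-R..R}) f"
  unfolding f_def om_def by (intro continuous_on_max continuous_intros econt Sn_0_continuous) auto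
 have "f (s, z) <= \<mu> / 2" if z: "z : {-R..R}" for z
 proof (rule bootstrap[OF fcont _ _ _ s z])
  show "0 < \<mu> / 2" using mu_pos by simp
  have "f (0, z) <= ep" for z unfolding f_le using init by simp
  then show "f (0, z) < 2 * (\<mu> / 2)" for z using mu2(2) by (metis order_le_less_trans field_sum_of_halves mult_2)
  fix s' z' assume s': "s' : {0..S}" and le: "!!s z. s : {0..s'} ==> z : {-R..R} ==> f (s, z) <= 2 * (\<mu> / 2)" and z': "z' : {-R..R}"
  have B: "boot \<mu> s" if s: "s : {0..s'}" for s
   unfolding boot_def
  proof (intro conjI allI)
   have 0: "f (s, z) <= \<mu>" if "z : {-R..R}" for z using le[OF s that] by simp
   have sS: "s : {0..S}" using s s' by auto
   show "om z * Sn 0 (s, z) <= \<mu>" for z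
   proof (cases "z : {-R..R}")
    case True
    then show ?thesis using 0 f_le by blast
   next
    case False
    then have "Sn 0 (s, z) = 0" by (intro Sn_0_outside[OF sS]) auto
    then show ?thesis using mu_pos by simp
   qed
   show "k <= 3 --> sqrt (E k s) <= \<mu> * exp (gam k * s)" for k using 0[OF z'] f_le by blast
  qed
  have s'': "s' : {0..s'}" using s' by auto
  have "om z' * Sn 0 (s', z') <= \<mu> / 2"
   using Sn_improved[OF s' B mu1 mu2(1) init s'', of z'] num1 num2 k12(1) by linarith
  moreover have "sqrt (E k s') <= \<mu> / 2 * exp (gam k * s')" if k: "k <= 3" for k
  proof -
   have "sqrt (E k s') <= cE m0 CF d * (ep + \<mu> ^ 3) * exp (gam k * s')" by (rule improved_energy[OF s' B init(1) s'' k])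
   also have "... <= \<mu> / 2 * exp (gam k * s')" using num2 k12(2) mu_pos by (intro mult_right_mono) auto
   finally show ?thesis .
  qed
  ultimately show "f (s', z') <= \<mu> / 2" unfolding f_le by blast
 qed
 then have in_R: "om z * Sn 0 (s, z) <= \<mu>" if "z : {-R..R}" for z
 proof -
  have "om z * Sn 0 (s, z) <= \<mu> / 2" using \<open>z : {-R..R} ==> f (s, z) <= \<mu> / 2\<close> that f_le by blast
  then show ?thesis using mu_pos by linarith
 qed
 show ?thesis
 proof (cases "z : {-R..R}")
  case True
  then show ?thesis using in_R unfolding \<mu>_def L_def by blast
 next
  case False
  then have "Sn 0 (s, z) = 0" by (intro Sn_0_outside[OF s]) auto
  then show ?thesis using mu_pos unfolding \<mu>_def L_def by simp
 qed
qed

end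

section \<open>Return to the original coordinates\<close>

text \<open>The mean value inequality in the parameter: vanishing at \<open>ep = 0\<close> and
  differentiability in \<open>ep\<close> give a bound linear in \<open>ep\<close>. This replaces
  quantitative estimates of the solution between the data and the hyperboloid.\<close>

lemma small_parameter_bound:
 fixes G :: "real * (real * real) => 'b::real_normed_vector"
 assumes G: "Ck 1 G" and 0: "!!s z. G (s, z, 0) = 0"
 shows "\<exists>C\<ge>0. \<forall>z\<in>{-r..r}. \<forall>ep\<in>{0..1}. norm (G (0, z, ep)) <= C * ep"
proof -
 let ?K = "{0::real} \<times> {-r..r} \<times> {0..1::real}" and ?e = "(0::real, 0::real, 1::real)"
 have "Ck 0 (dd ?e G)" using Ck_dd[of 0 G ?e] G by simp
 then have "continuous_on ?K (dd ?e G)" by (rule Ck_continuous)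
 then have "compact ((dd ?e G) ` ?K)" by (intro compact_continuous_image compact_Times compact_Icc) auto
 then have "bounded ((dd ?e G) ` ?K)" by (rule compact_imp_bounded)
 then obtain C where C': "\<forall>y\<in>(dd ?e G) ` ?K. norm y <= C" unfolding bounded_iff by blast
 have C: "norm (dd ?e G p) <= C" if "p : ?K" for p using C' that by blast
 have "norm (G (0, z, ep)) <= \<bar>C\<bar> * ep" if z: "z : {-r..r}" and e: "ep : {0..1}" for z ep
 proof -
  have "((%h. G (0, z, h)) hvd dd ?e G (0, z, h)) (at h)" for h
   using dd_along_line[of 0 G "(0, z, 0)" ?e h] G by simp
  then have d: "((%h. G (0, z, h)) has_derivative (%k. k *R dd ?e G (0, z, h))) (at h within {0..1})" for h
   unfolding has_vector_derivative_def by (rule has_derivative_at_withinI)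
  have o: "onorm (%k. k *R dd ?e G (0, z, h)) <= \<bar>C\<bar>" if "h : {0..1}" for h
  proof (rule onorm_bound)
   fix k :: real
   have "norm (dd ?e G (0, z, h)) <= \<bar>C\<bar>" using C[of "(0, z, h)"] z that by auto
   from mult_right_mono[OF this abs_ge_zero[of k]]
   show "norm (k *R dd ?e G (0, z, h)) <= \<bar>C\<bar> * norm k" by (simp add: mult.commute)
  qed simp
  have "norm (G (0, z, ep) - G (0, z, 0)) <= \<bar>C\<bar> * norm (ep - 0)"
   by (rule differentiable_bound[OF convex_real_interval(5) d o]) (use e in auto)
  then show ?thesis using 0 e by simp
 qed
 then show ?thesis by (intro exI[of _ "\<bar>C\<bar>"]) auto
qed

lemma slice_Ck: "Ck k G ==> Ck k (%p :: real * real. G (fst p, snd p, ep :: real))"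
proof -
 have "Ck k (%p :: real * real. (fst p, snd p, ep))" by (intro Ck_Pair Ck_fst Ck_snd Ck_id Ck_const)
 then show "Ck k G ==> Ck k (%p :: real * real. G (fst p, snd p, ep))" by (rule Ck_compose[rotated])
qed

lemma slice_dd:
 fixes G :: "real * (real * real) => 'b::real_normed_vector"
 assumes G: "Ck (Suc k) G"
 shows "dd e1 (%p. G (fst p, snd p, ep)) = (%p. dd et G (fst p, snd p, ep))"
  "dd e2 (%p. G (fst p, snd p, ep)) = (%p. dd ex G (fst p, snd p, ep))"
proof -
 have "((%p. G (fst p, snd p, ep)) has_derivative (%v. dd (fst v, snd v, 0) G (fst p, snd p, ep))) (at p)" for p
 proof -
  have "((%p :: real * real. (fst p, snd p, ep)) has_derivative (%v. (fst v, snd v, 0))) (at p)"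
   by (auto intro!: derivative_eq_intros)
  from has_derivative_compose[OF this Ck_has_derivative[OF G]] show ?thesis .
 qed
 note d = dd_eq[OF this]
 show "dd e1 (%p. G (fst p, snd p, ep)) = (%p. dd et G (fst p, snd p, ep))"
  by (rule ext) (simp only: d, simp add: e1_def et_def)
 show "dd e2 (%p. G (fst p, snd p, ep)) = (%p. dd ex G (fst p, snd p, ep))"
  by (rule ext) (simp only: d, simp add: e2_def ex_def)
qed

lemma Ck_iterate: "Ck (k + l) G ==> Ck l ((dd ex ^^ k) G)"
 by (induction k arbitrary: l) (auto intro: Ck_dd)

lemma slice_iterate:
 fixes G :: "real * (real * real) => 'b::real_normed_vector"
 shows "Ck k G ==> (dd e2 ^^ k) (%p. G (fst p, snd p, ep)) = (%p. (dd ex ^^ k) G (fst p, snd p, ep))"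
proof (induction k)
 case (Suc k)
 have c: "Ck (Suc 0) ((dd ex ^^ k) G)" by (rule Ck_iterate) (use Suc in simp)
 have IH: "(dd e2 ^^ k) (%p. G (fst p, snd p, ep)) = (%p. (dd ex ^^ k) G (fst p, snd p, ep))"
  by (rule Suc.IH[OF Ck_SucD[OF Suc.prems]])
 show ?case unfolding funpow.simps o_def IH by (rule slice_dd(2)[OF c])
qed simp

lemma dd_zero: "dd v (%p. 0) = (%p. 0)" by (simp add: frechet_derivative_const)

lemma iterate_zero: "(dd v ^^ k) (%p. 0) = (%p. 0)"
 by (induction k) (auto simp: dd_zero)

lemma zero_open_iterate:
 assumes "open X" "!!y. y : X ==> h y = 0" "y : X"
 shows "(dd v ^^ k) h y = 0"
proof -
 have "\<forall>y\<in>X. (dd v ^^ k) h y = 0"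
 proof (induction k)
  case (Suc k)
  then show ?case using dd_eq_0_open[OF assms(1), of "(dd v ^^ k) h"] by simp
 qed (use assms in simp)
 then show ?thesis using assms(3) by blast
qed

lemma hyp_chain:
 fixes h :: "real * (real * real) => 'b::real_normed_vector" and \<beta> ep :: real
 assumes h: "Ck (Suc k) h"
 defines "Ph \<equiv> %s z. (exp s * cosh z - \<beta>, exp s * sinh z, ep)"
 shows "((%s. h (Ph s z)) hvd (exp s * cosh z) *R dd et h (Ph s z) + (exp s * sinh z) *R dd ex h (Ph s z)) (at s)"
  "((%z. h (Ph s z)) hvd (exp s * sinh z) *R dd et h (Ph s z) + (exp s * cosh z) *R dd ex h (Ph s z)) (at z)"
proof -
 have lin: "dd (T, Y, 0) h p = T *R dd et h p + Y *R dd ex h p" for T Y p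
 proof -
  have "linear (%v. dd v h p)" using has_derivative_linear[OF Ck_has_derivative[OF h]] .
  moreover have "(T, Y, 0) = T *R et + Y *R ex" by (simp add: et_def ex_def)
  ultimately show ?thesis by (simp only: linear_add linear_scale)
 qed
 have comp: "((%s. h (ga s)) hvd dd v h (ga s)) (at s)" if "(ga hvd v) (at s)" for ga v s
  using vector_derivative_diff_chain_within[OF that has_derivative_at_withinI[OF Ck_has_derivative[OF h]]] by (simp add: o_def)
 have "((%s. exp s * cosh z - \<beta>) hrd exp s * cosh z) (at s)" "((%s. exp s * sinh z) hrd exp s * sinh z) (at s)"
  by (auto intro!: derivative_eq_intros)
 then have "((%s. Ph s z) hvd (exp s * cosh z, exp s * sinh z, 0)) (at s)"
  unfolding Ph_def has_real_derivative_iff_has_vector_derivative by (intro has_vector_derivative_Pair has_vector_derivative_const) auto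
 from comp[OF this] show "((%s. h (Ph s z)) hvd (exp s * cosh z) *R dd et h (Ph s z) + (exp s * sinh z) *R dd ex h (Ph s z)) (at s)"
  unfolding lin .
 have "((%z. exp s * cosh z - \<beta>) hrd exp s * sinh z) (at z)" "((%z. exp s * sinh z) hrd exp s * cosh z) (at z)"
  by (auto intro!: derivative_eq_intros)
 then have "((%z. Ph s z) hvd (exp s * sinh z, exp s * cosh z, 0)) (at z)"
  unfolding Ph_def has_real_derivative_iff_has_vector_derivative by (intro has_vector_derivative_Pair has_vector_derivative_const) auto
 from comp[OF this] show "((%z. h (Ph s z)) hvd (exp s * sinh z) *R dd et h (Ph s z) + (exp s * cosh z) *R dd ex h (Ph s z)) (at z)"
  unfolding lin .
qed

locale kg_cone =
 fixes m :: "'n::finite => real" and F :: "'n vec3 => real ^ 'n" and u :: "real * (real * real) => real ^ 'n" and B :: real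
 assumes u: "Ck 6 u"
  and eq: "!!p. dd et (dd et u) p - dd ex (dd ex u) p = F (u p, dd et u p, dd ex u p) - mass m (mass m (u p))"
  and supp: "!!t x ep. \<bar>x\<bar> > \<bar>t\<bar> + B ==> u (t, x, ep) = 0" and zero: "!!t x. u (t, x, 0) = 0" and B: "B >= 1"
begin

text \<open>Hyperbolic coordinates with apex at t = -2B, so that the points with t >= 0 and |x| <= t
  + B satisfy s >= 0. The curve s = 0 passes through negative times, which is harmless since the
  equation holds for all t.\<close>

definition Ph :: "real => real => real => real * real * real" where
 "Ph ep s z = (exp s * cosh z - 2 * B, exp s * sinh z, ep)"

definition U :: "real * (real * real) => real ^ 'n" where
 "U q = exp (1/2 * fst q) *R u (exp (fst q) * cosh (fst (snd q)) - 2 * B, exp (fst q) * sinh (fst (snd q)), snd (snd q))"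

definition wv :: "real => real * real => real ^ 'n" where
 "wv ep p = U (fst p, snd p, ep)"

lemma U_Ck: "Ck 6 U"
proof -
 have e: "Ck 6 (%q :: real * (real * real). exp (fst q))" "Ck 6 (%q :: real * (real * real). exp (1/2 * fst q))"
  "Ck 6 (%q :: real * (real * real). cosh (fst (snd q)))" "Ck 6 (%q :: real * (real * real). sinh (fst (snd q)))"
  by (intro Ck_compose[OF Ck_exp] Ck_compose[OF Ck_cosh] Ck_compose[OF Ck_sinh] Ck_mult Ck_const Ck_fst Ck_snd Ck_id)+
 show ?thesis unfolding U_def
  by (intro Ck_scaleR e Ck_compose[OF u] Ck_Pair Ck_diff Ck_mult Ck_const Ck_fst Ck_snd Ck_id)
qed

lemma wv_Ck: "Ck 6 (wv ep)"
 unfolding wv_def[abs_def] by (rule slice_Ck[OF U_Ck])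

lemma wv_eq: "wv ep (s, z) = exp (1/2 * s) *R u (Ph ep s z)"
 by (simp add: wv_def U_def Ph_def)

lemma wv_zero: "wv 0 = (%p. 0)"
 by (rule ext) (simp add: wv_def U_def zero)

lemma u_Ck: "Ck (Suc 4) (dd v u)" "Ck (Suc 5) u"
 using Ck_dd[of 5 u v] u by (simp_all add: numeral_eq_Suc del: Ck.simps)

lemma exp_half: "((%s. exp (1/2 * s)) hrd (1/2) * exp (1/2 * s)) (at (s::real))"
 by (auto intro!: derivative_eq_intros)

lemma wv_s: "dd e1 (wv ep) (s, z) = exp (1/2 * s) *R ((1/2) *R u (Ph ep s z) + (exp s * cosh z) *R dd et u (Ph ep s z) + (exp s * sinh z) *R dd ex u (Ph ep s z))"
proof -
 have "((%s. wv ep (s, z)) hvd dd e1 (wv ep) (s, z)) (at s)"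
  using dd_e1[of 5 "wv ep"] wv_Ck by (simp add: numeral_eq_Suc del: Ck.simps)
 moreover have "((%s. wv ep (s, z)) hvd exp (1/2 * s) *R ((exp s * cosh z) *R dd et u (Ph ep s z) + (exp s * sinh z) *R dd ex u (Ph ep s z))
  + ((1/2) * exp (1/2 * s)) *R u (Ph ep s z)) (at s)"
  unfolding wv_eq using has_vector_derivative_scaleR[OF exp_half hyp_chain(1)[OF u_Ck(2), where \<beta>="2 * B" and ep=ep]] unfolding Ph_def .
 ultimately have "dd e1 (wv ep) (s, z) = exp (1/2 * s) *R ((exp s * cosh z) *R dd et u (Ph ep s z) + (exp s * sinh z) *R dd ex u (Ph ep s z))
  + ((1/2) * exp (1/2 * s)) *R u (Ph ep s z)" by (rule vector_derivative_unique_at)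
 then show ?thesis by (simp add: algebra_simps)
qed

lemma wv_z: "dd e2 (wv ep) (s, z) = exp (1/2 * s) *R ((exp s * sinh z) *R dd et u (Ph ep s z) + (exp s * cosh z) *R dd ex u (Ph ep s z))"
proof -
 have "((%z. wv ep (s, z)) hvd dd e2 (wv ep) (s, z)) (at z)"
  using dd_e2[of 5 "wv ep"] wv_Ck by (simp add: numeral_eq_Suc del: Ck.simps)
 moreover have "((%z. wv ep (s, z)) hvd exp (1/2 * s) *R ((exp s * sinh z) *R dd et u (Ph ep s z) + (exp s * cosh z) *R dd ex u (Ph ep s z))) (at z)"
  unfolding wv_eq
  using bounded_linear.has_vector_derivative[OF bounded_linear_scaleR_right hyp_chain(2)[OF u_Ck(2), where \<beta>="2 * B" and ep=ep]] unfolding Ph_def .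
 ultimately show ?thesis by (rule vector_derivative_unique_at)
qed

lemma wv_ss: 
 defines "p \<equiv> dd et u" and "q \<equiv> dd ex u"
 shows "dd e1 (dd e1 (wv ep)) (s, z) = exp (1/2 * s) *R ((1/4) *R u (Ph ep s z) + (2 * (exp s * cosh z)) *R p (Ph ep s z) + (2 * (exp s * sinh z)) *R q (Ph ep s z)
  + (exp s * cosh z) *R ((exp s * cosh z) *R dd et p (Ph ep s z) + (exp s * sinh z) *R dd ex p (Ph ep s z))
  + (exp s * sinh z) *R ((exp s * cosh z) *R dd et q (Ph ep s z) + (exp s * sinh z) *R dd ex q (Ph ep s z)))"
proof -
 have T: "((%s. exp s * cosh z) hrd exp s * cosh z) (at s)" "((%s. exp s * sinh z) hrd exp s * sinh z) (at s)"
  by (auto intro!: derivative_eq_intros)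
 note ch0 = hyp_chain(1)[where \<beta>="2 * B" and ep=ep and z=z and s=s, folded Ph_def]
 note ch = ch0[OF u_Ck(2)] ch0[OF u_Ck(1)[of et]] ch0[OF u_Ck(1)[of ex]]
 have "((%s. dd e1 (wv ep) (s, z)) hvd dd e1 (dd e1 (wv ep)) (s, z)) (at s)"
  using dd_e1[of 4 "dd e1 (wv ep)"] Ck_dd[of 5 "wv ep" e1] wv_Ck by (simp add: numeral_eq_Suc del: Ck.simps)
 moreover have "((%s. dd e1 (wv ep) (s, z)) has_vector_derivative
  exp (1/2 * s) *R ((1/2) *R ((exp s * cosh z) *R p (Ph ep s z) + (exp s * sinh z) *R q (Ph ep s z))
   + ((exp s * cosh z) *R ((exp s * cosh z) *R dd et p (Ph ep s z) + (exp s * sinh z) *R dd ex p (Ph ep s z)) + (exp s * cosh z) *R p (Ph ep s z))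
   + ((exp s * sinh z) *R ((exp s * cosh z) *R dd et q (Ph ep s z) + (exp s * sinh z) *R dd ex q (Ph ep s z)) + (exp s * sinh z) *R q (Ph ep s z)))
  + ((1/2) * exp (1/2 * s)) *R ((1/2) *R u (Ph ep s z) + (exp s * cosh z) *R p (Ph ep s z) + (exp s * sinh z) *R q (Ph ep s z))) (at s)"
  unfolding wv_s p_def q_def
  by (intro has_vector_derivative_scaleR exp_half has_vector_derivative_add T bounded_linear.has_vector_derivative[OF bounded_linear_scaleR_right] ch)
 ultimately have "dd e1 (dd e1 (wv ep)) (s, z) =
  exp (1/2 * s) *R ((1/2) *R ((exp s * cosh z) *R p (Ph ep s z) + (exp s * sinh z) *R q (Ph ep s z))
   + ((exp s * cosh z) *R ((exp s * cosh z) *R dd et p (Ph ep s z) + (exp s * sinh z) *R dd ex p (Ph ep s z)) + (exp s * cosh z) *R p (Ph ep s z))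
   + ((exp s * sinh z) *R ((exp s * cosh z) *R dd et q (Ph ep s z) + (exp s * sinh z) *R dd ex q (Ph ep s z)) + (exp s * sinh z) *R q (Ph ep s z)))
  + ((1/2) * exp (1/2 * s)) *R ((1/2) *R u (Ph ep s z) + (exp s * cosh z) *R p (Ph ep s z) + (exp s * sinh z) *R q (Ph ep s z))"
  by (rule vector_derivative_unique_at)
 also have "... = exp (1/2 * s) *R ((1/4) *R u (Ph ep s z) + (2 * (exp s * cosh z)) *R p (Ph ep s z) + (2 * (exp s * sinh z)) *R q (Ph ep s z)
  + (exp s * cosh z) *R ((exp s * cosh z) *R dd et p (Ph ep s z) + (exp s * sinh z) *R dd ex p (Ph ep s z))
  + (exp s * sinh z) *R ((exp s * cosh z) *R dd et q (Ph ep s z) + (exp s * sinh z) *R dd ex q (Ph ep s z)))"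
  unfolding vec_eq_iff by (simp add: field_simps)
 finally show ?thesis .
qed

lemma wv_zz:
 defines "p \<equiv> dd et u" and "q \<equiv> dd ex u"
 shows "dd e2 (dd e2 (wv ep)) (s, z) = exp (1/2 * s) *R ((exp s * cosh z) *R p (Ph ep s z) + (exp s * sinh z) *R q (Ph ep s z)
  + (exp s * sinh z) *R ((exp s * sinh z) *R dd et p (Ph ep s z) + (exp s * cosh z) *R dd ex p (Ph ep s z))
  + (exp s * cosh z) *R ((exp s * sinh z) *R dd et q (Ph ep s z) + (exp s * cosh z) *R dd ex q (Ph ep s z)))"
proof -
 have T: "((%z. exp s * cosh z) hrd exp s * sinh z) (at z)" "((%z. exp s * sinh z) hrd exp s * cosh z) (at z)"
  by (auto intro!: derivative_eq_intros)
 note ch0 = hyp_chain(2)[where \<beta>="2 * B" and ep=ep and z=z and s=s, folded Ph_def]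
 note ch = ch0[OF u_Ck(1)[of et]] ch0[OF u_Ck(1)[of ex]]
 have "((%z. dd e2 (wv ep) (s, z)) hvd dd e2 (dd e2 (wv ep)) (s, z)) (at z)"
  using dd_e2[of 4 "dd e2 (wv ep)"] Ck_dd[of 5 "wv ep" e2] wv_Ck by (simp add: numeral_eq_Suc del: Ck.simps)
 moreover have "((%z. dd e2 (wv ep) (s, z)) has_vector_derivative
  exp (1/2 * s) *R (((exp s * sinh z) *R ((exp s * sinh z) *R dd et p (Ph ep s z) + (exp s * cosh z) *R dd ex p (Ph ep s z)) + (exp s * cosh z) *R p (Ph ep s z))
   + ((exp s * cosh z) *R ((exp s * sinh z) *R dd et q (Ph ep s z) + (exp s * cosh z) *R dd ex q (Ph ep s z)) + (exp s * sinh z) *R q (Ph ep s z)))) (at z)"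
  unfolding wv_z p_def q_def
  by (intro bounded_linear.has_vector_derivative[OF bounded_linear_scaleR_right] has_vector_derivative_add has_vector_derivative_scaleR T ch)
 ultimately have "dd e2 (dd e2 (wv ep)) (s, z) =
  exp (1/2 * s) *R (((exp s * sinh z) *R ((exp s * sinh z) *R dd et p (Ph ep s z) + (exp s * cosh z) *R dd ex p (Ph ep s z)) + (exp s * cosh z) *R p (Ph ep s z))
   + ((exp s * cosh z) *R ((exp s * sinh z) *R dd et q (Ph ep s z) + (exp s * cosh z) *R dd ex q (Ph ep s z)) + (exp s * sinh z) *R q (Ph ep s z)))"
  by (rule vector_derivative_unique_at)
 then show ?thesis by (simp only: add_ac)
qed

lemma wv_jet:
 "hyp_jet (s, z) (wv ep (s, z)) (exp (- s) *R (dd e1 (wv ep) (s, z) - (1/2) *R wv ep (s, z))) (exp (- s) *R dd e2 (wv ep) (s, z))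
  = (u (Ph ep s z), dd et u (Ph ep s z), dd ex u (Ph ep s z))"
proof -
 let ?p = "dd et u (Ph ep s z)" and ?q = "dd ex u (Ph ep s z)" and ?E = "exp (1/2 * s)"
 have e: "exp (- s) * exp s = 1" "exp (- s / 2) * ?E = 1" by (simp_all flip: exp_add)
 have X: "exp (- s) *R (dd e1 (wv ep) (s, z) - (1/2) *R wv ep (s, z)) = ?E *R (cosh z *R ?p + sinh z *R ?q)"
 proof -
  have "exp (- s) *R (dd e1 (wv ep) (s, z) - (1/2) *R wv ep (s, z)) = (exp (- s) * exp s) *R (?E *R (cosh z *R ?p + sinh z *R ?q))"
   unfolding wv_s wv_eq by (simp add: algebra_simps)
  then show ?thesis unfolding e by simp
 qed
 have Y: "exp (- s) *R dd e2 (wv ep) (s, z) = ?E *R (sinh z *R ?p + cosh z *R ?q)"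
 proof -
  have "exp (- s) *R dd e2 (wv ep) (s, z) = (exp (- s) * exp s) *R (?E *R (sinh z *R ?p + cosh z *R ?q))"
   unfolding wv_z by (simp add: algebra_simps)
  then show ?thesis unfolding e by simp
 qed
 have cs: "cosh z * cosh z = 1 + sinh z * sinh z" using hyperbolic_pythagoras[of z] by (simp add: power2_eq_square)
 have t: "c * (E * (c * a + d * b)) - d * (E * (d * a + c * b)) = E * a" if "c * c = 1 + d * d" for a b c d E :: real
 proof -
  have "c * (E * (c * a + d * b)) - d * (E * (d * a + c * b)) = E * a * (c * c - d * d)" by (simp add: algebra_simps)
  then show ?thesis using that by simp
 qed
 have tv: "cosh z *R ?E *R (cosh z *R a + sinh z *R b) - sinh z *R ?E *R (sinh z *R a + cosh z *R b) = ?E *R a" for a b :: "real ^ 'n"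
  unfolding vec_eq_iff by (simp only: vector_scaleR_component vector_add_component vector_minus_component real_scaleR_def t[OF cs] simp_thms)
 note 1 = tv[of ?p ?q] and 2 = tv[of ?q ?p, unfolded add.commute[of "cosh z *R ?q"] add.commute[of "sinh z *R ?q"]]
 show ?thesis unfolding hyp_jet_def fst_conv snd_conv X Y 1 2 unfolding wv_eq using e(2) by simp
qed

text \<open>The difference of the second s- and z-derivatives recombines into the wave operator
  because T^2 - Y^2 = e^{2s} for T = e^s cosh z and Y = e^s sinh z. The mixed derivatives cancel,
  and the factor e^{s/2} produces the lower-order terms.\<close>

lemma wv_pde:
 "dd e1 (dd e1 (wv ep)) p = dd e1 (wv ep) p - (1/4) *R wv ep p + dd e2 (dd e2 (wv ep)) p
    - exp (2 * fst p) *R mass m (mass m (wv ep p))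
    + exp (fst p) *R (exp (3/2 * fst p) *R F (hyp_jet p (wv ep p) (exp (- fst p) *R (dd e1 (wv ep) p - (1/2) *R wv ep p)) (exp (- fst p) *R dd e2 (wv ep) p)))"
proof -
 obtain s z where p: "p = (s, z)" by (metis prod.exhaust)
 let ?P = "Ph ep s z" and ?E = "exp (1/2 * s)" and ?T = "exp s * cosh z" and ?Y = "exp s * sinh z"
 define fF where "fF = F (u ?P, dd et u ?P, dd ex u ?P)"
 define M where "M = mass m (mass m (u ?P))"
 have eqP: "dd et (dd et u) ?P = dd ex (dd ex u) ?P + fF - M" using eq[of ?P] unfolding fF_def M_def by (simp add: algebra_simps)
 have com: "dd et (dd ex u) ?P = dd ex (dd et u) ?P" by (rule dd_commute[OF Ck_mono[OF u]]) simp
 have TY: "?T * ?T = ?Y * ?Y + exp (2 * s)"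
 proof -
  have "?T * ?T = exp s * exp s * (cosh z * cosh z)" by (simp only: mult_ac)
  also have "cosh z * cosh z = 1 + sinh z * sinh z" using hyperbolic_pythagoras[of z] by (simp add: power2_eq_square)
  finally show ?thesis by (simp add: algebra_simps flip: exp_add)
 qed
 have mE: "mass m (mass m (?E *R u ?P)) = ?E *R M" unfolding M_def by (simp add: linear_scale[OF bounded_linear.linear[OF bounded_linear_mass]])
 have e5: "exp s * exp (3/2 * s) = ?E * exp (2 * s)" by (simp flip: exp_add)
 have "dd e1 (dd e1 (wv ep)) (s, z) = dd e1 (wv ep) (s, z) - (1/4) *R wv ep (s, z) + dd e2 (dd e2 (wv ep)) (s, z)
  - exp (2 * s) *R (?E *R M) + (?E * exp (2 * s)) *R fF"
 proof -
  show ?thesis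
   unfolding wv_ss wv_zz wv_s wv_eq eqP com
   unfolding vec_eq_iff
  proof
   fix i
   have "E * (1/4 * u0 + 2 * T * p0 + 2 * Y * q0 + T * (T * (qx + f0 - M0) + Y * r) + Y * (T * r + Y * qx))
    = E * (1/2 * u0 + T * p0 + Y * q0) - 1/4 * (E * u0) + E * (T * p0 + Y * q0 + Y * (Y * (qx + f0 - M0) + T * r) + T * (Y * r + T * qx))
    - e * (E * M0) + E * e * f0" if "T * T = Y * Y + e" for E u0 p0 q0 T Y qx f0 M0 r e :: real
   proof -
    have "E * (1/4 * u0 + 2 * T * p0 + 2 * Y * q0 + T * (T * (qx + f0 - M0) + Y * r) + Y * (T * r + Y * qx))
     - (E * (1/2 * u0 + T * p0 + Y * q0) - 1/4 * (E * u0) + E * (T * p0 + Y * q0 + Y * (Y * (qx + f0 - M0) + T * r) + T * (Y * r + T * qx))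
     - e * (E * M0) + E * e * f0) = E * ((T * T - Y * Y - e) * (f0 - M0))"
     by (simp add: algebra_simps)
    then show ?thesis using that by simp
   qed
   from this[OF TY] show "(?E *R ((1/4) *R u ?P + (2 * ?T) *R dd et u ?P + (2 * ?Y) *R dd ex u ?P
     + ?T *R (?T *R (dd ex (dd ex u) ?P + fF - M) + ?Y *R dd ex (dd et u) ?P) + ?Y *R (?T *R dd ex (dd et u) ?P + ?Y *R dd ex (dd ex u) ?P))) $ i
    = (?E *R ((1/2) *R u ?P + ?T *R dd et u ?P + ?Y *R dd ex u ?P) - (1/4) *R (?E *R u ?P)
     + ?E *R (?T *R dd et u ?P + ?Y *R dd ex u ?P + ?Y *R (?Y *R (dd ex (dd ex u) ?P + fF - M) + ?T *R dd ex (dd et u) ?P) + ?T *R (?Y *R dd ex (dd et u) ?P + ?T *R dd ex (dd ex u) ?P))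
     - exp (2 * s) *R (?E *R M) + (?E * exp (2 * s)) *R fF) $ i"
    by (simp only: vector_scaleR_component vector_add_component vector_minus_component real_scaleR_def)
  qed
 qed
 moreover have mw: "mass m (mass m (wv ep (s, z))) = ?E *R M" unfolding wv_eq by (rule mE)
 ultimately show ?thesis unfolding p fst_conv wv_jet mw fF_def[symmetric] by (simp only: scaleR_scaleR e5)
qed

text \<open>In light-cone variables t + 2B - |x| and t + 2B + |x| equal e^{s-|z|} and e^{s+|z|}, so
  the two hypotheses together say |x| > |t| + B.\<close>

lemma wv_support:
 assumes "exp (s - \<bar>z\<bar>) < B" "exp (s + \<bar>z\<bar>) > 3 * B"
 shows "wv ep (s, z) = 0"
proof -
 have cs: "cosh z - \<bar>sinh z\<bar> = exp (- \<bar>z\<bar>)" "cosh z + \<bar>sinh z\<bar> = exp \<bar>z\<bar>"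
  by (cases "z >= 0"; simp add: cosh_def sinh_def abs_real_def field_simps)+
 have "exp (s - \<bar>z\<bar>) = exp s * exp (- \<bar>z\<bar>)" "exp (s + \<bar>z\<bar>) = exp s * exp \<bar>z\<bar>" by (simp_all flip: exp_add)
 then have 1: "exp s * cosh z - exp s * \<bar>sinh z\<bar> < B" and 2: "exp s * cosh z + exp s * \<bar>sinh z\<bar> > 3 * B"
  using assms unfolding cs[symmetric] distrib_left right_diff_distrib by linarith+
 have "\<bar>exp s * sinh z\<bar> = exp s * \<bar>sinh z\<bar>" by (simp add: abs_mult)
 then have "\<bar>exp s * sinh z\<bar> > \<bar>exp s * cosh z - 2 * B\<bar> + B" using 1 2 by linarith
 from supp[OF this] show ?thesis unfolding wv_eq Ph_def by simp
qed

definition "R0 = ln (3 * B)"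

lemma R0: "R0 >= 0" "exp R0 = 3 * B" using B by (auto simp: R0_def)

lemma open_out: "open {p :: real * real. exp (fst p - \<bar>snd p\<bar>) < B \<and> exp (fst p + \<bar>snd p\<bar>) > 3 * B}"
 by (intro open_Collect_conj open_Collect_less continuous_intros)

lemma out_zero:
 assumes "\<bar>z\<bar> > R0"
 shows "(dd e2 ^^ k) (wv ep) (0, z) = 0" "dd e1 ((dd e2 ^^ k) (wv ep)) (0, z) = 0"
proof -
 let ?X = "{p :: real * real. exp (fst p - \<bar>snd p\<bar>) < B \<and> exp (fst p + \<bar>snd p\<bar>) > 3 * B}"
 have "exp \<bar>z\<bar> > 3 * B" using assms R0(2) by (metis exp_less_mono)
 moreover have "exp (- \<bar>z\<bar>) < 1" using assms R0(1) by simp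
 then have "exp (- \<bar>z\<bar>) < B" using B by linarith
 ultimately have X: "(0, z) : ?X" by simp
 have w: "wv ep p = 0" if "p : ?X" for p using wv_support[of "fst p" "snd p"] that by simp
 have k: "(dd e2 ^^ k) (wv ep) p = 0" if "p : ?X" for p by (rule zero_open_iterate[OF open_out w that])
 show "(dd e2 ^^ k) (wv ep) (0, z) = 0" by (rule k[OF X])
 show "dd e1 ((dd e2 ^^ k) (wv ep)) (0, z) = 0" by (rule dd_eq_0_open[OF open_out k X])
qed

text \<open>For |z| beyond \<open>R0\<close> the solution vanishes near the hyperboloid; on the
  compact rest smallness comes from the parameter. Four z-derivatives, one in s and one in the
  parameter make up the six derivatives demanded of the solution.\<close>

lemma initial_small:
 "\<exists>D>0. \<forall>k\<le>4. \<forall>z. \<forall>ep\<in>{0..1}. norm ((dd e2 ^^ k) (wv ep) (0, z)) <= D * ep \<and> norm (dd e1 ((dd e2 ^^ k) (wv ep)) (0, z)) <= D * ep"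
proof -
 define G where "G k = (dd ex ^^ k) U" for k
 have Gk: "Ck l (G k)" if "k + l <= 6" for k l unfolding G_def by (rule Ck_iterate[OF Ck_mono[OF U_Ck that]])
 have sl: "(dd e2 ^^ k) (wv ep) = (%p. G k (fst p, snd p, ep))" if "k <= 4" for k ep
  unfolding wv_def[abs_def] G_def by (rule slice_iterate[OF Ck_mono[OF U_Ck]]) (use that in simp)
 have sl1: "dd e1 ((dd e2 ^^ k) (wv ep)) = (%p. dd et (G k) (fst p, snd p, ep))" if "k <= 4" for k ep
  unfolding sl[OF that] by (rule slice_dd(1)[of 0]) (use Gk[of k 1] that in simp)
 have z0: "G k (s, z, 0) = 0" "dd et (G k) (s, z, 0) = 0" if "k <= 4" for k s z
  using fun_cong[OF sl[OF that, of 0], of "(s, z)"] fun_cong[OF sl1[OF that, of 0], of "(s, z)"]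
  unfolding wv_zero iterate_zero dd_zero by simp_all
 have "\<exists>C\<ge>0. \<forall>z\<in>{-R0..R0}. \<forall>ep\<in>{0..1}. norm (G k (0, z, ep)) <= C * ep" if "k <= 4" for k
  by (rule small_parameter_bound[OF Gk z0(1)[OF that]]) (use that in simp)
 then obtain C where C: "!!k. k <= 4 ==> C k >= 0 \<and> (\<forall>z\<in>{-R0..R0}. \<forall>ep\<in>{0..1}. norm (G k (0, z, ep)) <= C k * ep)" by metis
 have Ck1: "Ck 1 (dd et (G k))" if "k <= 4" for k
  using Ck_dd[of 1 "G k" et] Gk[of k 2] that by (simp add: numeral_2_eq_2 del: Ck.simps)
 have "\<exists>C\<ge>0. \<forall>z\<in>{-R0..R0}. \<forall>ep\<in>{0..1}. norm (dd et (G k) (0, z, ep)) <= C * ep" if "k <= 4" for k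
  by (rule small_parameter_bound[OF Ck1[OF that] z0(2)[OF that]])
 then obtain C' where C': "!!k. k <= 4 ==> C' k >= 0 \<and> (\<forall>z\<in>{-R0..R0}. \<forall>ep\<in>{0..1}. norm (dd et (G k) (0, z, ep)) <= C' k * ep)" by metis
 define D where "D = (\<Sum>k\<le>4. C k + C' k) + 1"
 have s0: "(\<Sum>k\<le>4. C k + C' k) >= 0" by (rule sum_nonneg) (use C C' in \<open>simp add: add_nonneg_nonneg\<close>)
 have Dk: "C k <= D" "C' k <= D" if "k <= 4" for k
 proof -
  have "C k + C' k <= (\<Sum>k\<le>4. C k + C' k)"
   by (rule member_le_sum[of k "{..4}" "%k. C k + C' k"]) (use that C C' in \<open>auto simp: add_nonneg_nonneg\<close>)
  then show "C k <= D" "C' k <= D" using C[OF that] C'[OF that] unfolding D_def by linarith+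
 qed
 show ?thesis
 proof (intro exI[of _ D] conjI allI impI ballI)
  show "D > 0" unfolding D_def using s0 by linarith
  fix k :: nat and z ep :: real assume k: "k <= 4" and e: "ep : {0..1}"
  have D0: "0 <= D * ep" unfolding D_def using s0 e by (intro mult_nonneg_nonneg) auto
  show "norm ((dd e2 ^^ k) (wv ep) (0, z)) <= D * ep"
  proof (cases "\<bar>z\<bar> > R0")
   case False
   then have "z : {-R0..R0}" by auto
   then have "norm (G k (0, z, ep)) <= C k * ep" using C[OF k] e by blast
   also have "... <= D * ep" using Dk[OF k] e by (intro mult_right_mono) auto
   finally show ?thesis unfolding sl[OF k] by simp
  qed (use out_zero(1) D0 in simp)
  show "norm (dd e1 ((dd e2 ^^ k) (wv ep)) (0, z)) <= D * ep"
  proof (cases "\<bar>z\<bar> > R0")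
   case False
   then have "z : {-R0..R0}" by auto
   then have "norm (dd et (G k) (0, z, ep)) <= C' k * ep" using C'[OF k] e by blast
   also have "... <= D * ep" using Dk[OF k] e by (intro mult_right_mono) auto
   finally have fin: "norm (dd et (G k) (0, z, ep)) <= D * ep" .
   have "dd e1 ((dd e2 ^^ k) (wv ep)) (0, z) = dd et (G k) (0, z, ep)"
    using fun_cong[OF sl1[OF k, of ep], of "(0, z)"] by (simp only: fst_conv snd_conv)
   then show ?thesis using fin by (simp only:)
  next
   case True
   then show ?thesis using out_zero(2)[OF True, of k ep] D0 by (simp only: norm_zero)
  qed
 qed
qed

lemma om_mono: "\<bar>z\<bar> <= r ==> om z <= om r"
proof -
 assume z: "\<bar>z\<bar> <= r"
 have "cosh \<bar>3/2 * z\<bar> <= cosh (3/2 * r)"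
  by (subst cosh_real_nonneg_le_iff) (use z in \<open>auto simp: abs_mult\<close>)
 then show ?thesis unfolding om_def by (simp only: cosh_real_abs)
qed

text \<open>T^2 - x^2 is at least (t + 2B)^2 - (t + B)^2 = 2tB + 3B^2 and hence at least 1, so s is
  defined and nonnegative; z is then forced by x.\<close>

lemma cone_coordinates:
 assumes "t >= 0" "\<bar>x\<bar> <= t + B"
 obtains s z where "s >= 0" "exp s * cosh z = t + 2 * B" "exp s * sinh z = x"
proof -
 let ?T = "t + 2 * B"
 have "x^2 <= (t + B)^2" using assms by (simp add: abs_le_square_iff[symmetric])
 moreover have "?T\<^sup>2 - (t + B)\<^sup>2 = 2 * t * B + 3 * (B * B)" by (simp add: power2_eq_square algebra_simps)
 moreover have "1 * 1 <= B * B" using B by (intro mult_mono) auto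
 moreover have "0 <= 2 * t * B" using assms B by simp
 ultimately have q: "?T\<^sup>2 - x\<^sup>2 >= 1" by linarith
 define s where "s = ln (?T\<^sup>2 - x\<^sup>2) / 2"
 have es: "exp s * exp s = ?T\<^sup>2 - x\<^sup>2" unfolding s_def using q by (simp flip: exp_add)
 define z where "z = arsinh (x * exp (- s))"
 have sz: "exp s * sinh z = x" unfolding z_def sinh_arsinh_real by (simp add: exp_minus)
 have "(exp s * cosh z)^2 = ?T\<^sup>2"
 proof -
  have "(exp s * cosh z)^2 = exp s * exp s * (1 + (sinh z)^2)"
   using hyperbolic_pythagoras[of z] by (simp add: power_mult_distrib power2_eq_square)
  also have "... = exp s * exp s + (exp s * sinh z)^2" by (simp add: power2_eq_square algebra_simps)
  finally show ?thesis unfolding sz es by simp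
 qed
 then have "exp s * cosh z = ?T" by (rule power2_eq_imp_eq) (use assms B cosh_real_nonneg[of z] in auto)
 moreover have "s >= 0" unfolding s_def using q by simp
 ultimately show ?thesis using that sz by blast
qed

text \<open>The bootstrap is run separately for each point, on the slab that ends at the hyperbolic
  time of that point; this is legitimate because none of its constants depends on the slab. Points
  outside the cone are covered by finite propagation speed.\<close>

theorem jet_decay:
 assumes F: "Ck 4 F" "cubic_growth CF F" and m0: "0 < m0" "!!j. m0 <= m j"
  and C3: "C3 > 0" "!!y y'. norm (Fc m c y - Fc m c y') <= C3 * (norm y + norm y')^2 * norm (y - y')"
  and C4: "C4 > 0" "!!y. norm (F y - Fc m c y) <= C4 * norm y ^ 4"
  and Co: "Co > 0" "ode_bound m c Co"
 shows "\<exists>ep0>0. \<exists>K>0. \<forall>ep\<in>{0<..ep0}. \<forall>t\<ge>0. \<forall>x.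
  norm (u (t, x, ep), dd et u (t, x, ep), dd ex u (t, x, ep)) <= K * ep / sqrt (t + 2 * B)"
proof -
 obtain D where D: "D > 0" "!!k z ep. k <= 4 ==> ep : {0..1} ==> norm ((dd e2 ^^ k) (wv ep) (0, z)) <= D * ep \<and> norm (dd e1 ((dd e2 ^^ k) (wv ep)) (0, z)) <= D * ep"
  using initial_small by blast
 define dm where "dm = real DIM('n vec3)"
 define L where "L = Lam m0 CF dm C3 C4 Co"
 obtain Mm where Mm: "Mm > 0" "!!v. norm (mass m v) <= norm v * Mm" using bounded_linear.pos_bounded[OF bounded_linear_mass] by blast
 define \<Omega> where "\<Omega> = om R0"
 have \<Omega>: "\<Omega> >= 1" unfolding \<Omega>_def by (rule om_ge_1)
 define c2 where "c2 = \<Omega>^2 * ((3 + Mm^2) * D^2) * (2 * R0)"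
 have c20: "c2 >= 0" unfolding c2_def using R0(1) by simp
 \<comment> \<open>Covers both initial bounds of \<open>global_bound\<close>: the energies through
   \<open>c2\<close>, which contains the length 2R0 of the support, and the three terms of
   \<open>Sn 0\<close> through 3\<Omega>D.\<close>
 define Ci where "Ci = sqrt c2 + 3 * \<Omega> * D + 1"
 have Ci: "Ci > 0" "sqrt c2 <= Ci" "3 * \<Omega> * D <= Ci"
 proof -
  have "0 <= sqrt c2" "0 <= 3 * \<Omega> * D" using c20 \<Omega> D(1) by auto
  then show "Ci > 0" "sqrt c2 <= Ci" "3 * \<Omega> * D <= Ci" unfolding Ci_def by linarith+
 qed
 \<comment> \<open>Makes \<open>Ci * ep\<close> at most 1/L^2. The added 1 keeps the denominator
   positive at this stage, where L >= 2 is not yet at hand.\<close>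
 define ep0 where "ep0 = min 1 (1 / ((L^2 + 1) * Ci))"
 have L1: "L^2 + 1 > 0" by (simp add: add_nonneg_pos)
 have ep0: "ep0 > 0" unfolding ep0_def using L1 Ci(1) by simp
 \<comment> \<open>68 = 2 * 34: the factor 34 of \<open>J_le\<close> and the 2 from cosh^3 <= (2
   om)^2.\<close>
 define K where "K = 68 * (\<bar>L\<bar> * Ci) + 1"
 have K: "K > 0" unfolding K_def using Ci(1) by (intro add_nonneg_pos mult_nonneg_nonneg) auto
 have main: "norm (u (t, x, ep), dd et u (t, x, ep), dd ex u (t, x, ep)) <= K * ep / sqrt (t + 2 * B)"
  if e: "ep : {0<..ep0}" and t: "t >= 0" for ep t x
 proof (cases "\<bar>x\<bar> <= t + B")
  case False
  let ?X = "{p :: real * real * real. \<bar>fst p\<bar> + B < \<bar>fst (snd p)\<bar>}"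
  have "open ?X" by (intro open_Collect_less continuous_intros)
  moreover have X0: "u p = 0" if "p : ?X" for p using supp[of "fst p" "fst (snd p)" "snd (snd p)"] that by simp
  moreover have X: "(t, x, ep) : ?X" using False t by simp
  ultimately have "dd v u (t, x, ep) = 0" for v by (rule dd_eq_0_open)
  moreover have "u (t, x, ep) = 0" by (rule X0[OF X])
  moreover have "0 <= K * ep / sqrt (t + 2 * B)" using K e t B by simp
  ultimately show ?thesis by (simp add: zero_prod_def[symmetric])
 next
  case True
  obtain s z where s: "s >= 0" and T: "exp s * cosh z = t + 2 * B" and Y: "exp s * sinh z = x"
   using cone_coordinates[OF t True] .
  \<comment> \<open>For s' in (-1, s + 1) and |z'| > R - 1 = s + 1 + R0 one has s' - |z'| < 0 and s'
    + |z'| > R0, the two conditions of \<open>wv_support\<close>.\<close>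
  define R where "R = s + 2 + R0"
  have R: "R >= 1" "R0 <= R" unfolding R_def using s R0(1) by auto
  have e01: "ep : {0..1}" "0 < ep" using e unfolding ep0_def by auto
  have sup: "wv ep (s', z') = 0" if "s' : {-1<..<s+1}" "\<bar>z'\<bar> > R - 1" for s' z'
  proof (rule wv_support)
   have "s' - \<bar>z'\<bar> < 0" using that R0(1) unfolding R_def by auto
   then have "exp (s' - \<bar>z'\<bar>) < 1" by simp
   then show "exp (s' - \<bar>z'\<bar>) < B" using B by linarith
   have "s' + \<bar>z'\<bar> > R0" using that s unfolding R_def by auto
   then show "exp (s' + \<bar>z'\<bar>) > 3 * B" using R0(2) by (metis exp_less_mono)
  qed
  interpret K: kgw_cubic m F CF "wv ep" s R m0 dm c C3 C4 Co
  proof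
   show "Ck 5 (wv ep)" by (rule Ck_mono[OF wv_Ck]) simp
  qed (use F m0 wv_pde sup s R(1) dm_def C3 C4 Co in auto)
  have Wk: "norm (K.W k (0, z)) <= D * ep" "norm (K.V k (0, z)) <= D * ep" if "k <= 4" for k z
   using D(2)[OF that e01(1), of z] unfolding K.V_def K.W_def by auto
  have Wo: "K.W k (0, z) = 0" "K.V k (0, z) = 0" if "\<bar>z\<bar> > R0" for k z
   using out_zero[OF that, of k ep] unfolding K.V_def K.W_def by auto
  have Ei: "sqrt (K.E k 0) <= Ci * ep" if k: "k <= 3" for k
  proof -
   define g where "g z = (om z)^2 * (exp (- 2 * 0) * (K.V k (0, z) \<bullet> K.V k (0, z) + K.W (Suc k) (0, z) \<bullet> K.W (Suc k) (0, z) + (1/4) * (K.W k (0, z) \<bullet> K.W k (0, z)))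
   + mass m (K.W k (0, z)) \<bullet> mass m (K.W k (0, z)))" for z
   have E: "K.E k 0 = integral {-R..R} g" unfolding K.E_def energy_def g_def ..
   have cW: "continuous_on UNIV (%z. K.W j (0, z))" if "j <= 4" for j
    by (rule continuous_on_compose2[OF K.W_continuous[of j UNIV]]) (use that in \<open>auto intro!: continuous_intros\<close>)
   have cV: "continuous_on UNIV (%z. K.V k (0, z))"
    by (rule continuous_on_compose2[OF K.V_continuous[of k UNIV]]) (use k in \<open>auto intro!: continuous_intros\<close>)
   have cW': "continuous_on UNIV (%z. K.W k (0, z))" "continuous_on UNIV (%z. K.W (Suc k) (0, z))" using cW k by auto
   have "continuous_on {-R0..R0} g" unfolding g_def om_def
    by (intro continuous_intros continuous_on_subset[OF cW'(1)] continuous_on_subset[OF cW'(2)] continuous_on_subset[OF cV]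
      linear_continuous_on_compose[OF _ bounded_linear.linear[OF bounded_linear_mass]]) auto
   then have gi: "g integrable_on {-R0..R0}" by (rule integrable_continuous_interval)
   have "(g has_integral integral {-R0..R0} g) {-R..R}"
   proof (rule has_integral_on_superset[OF integrable_integral[OF gi]])
    fix z assume "z \<notin> {-R0..R0}"
    then have "\<bar>z\<bar> > R0" by auto
    then show "g z = 0" unfolding g_def by (simp add: Wo linear_0[OF bounded_linear.linear[OF bounded_linear_mass]])
   qed (use R in auto)
   then have "K.E k 0 = integral {-R0..R0} g" unfolding E by (rule integral_unique)
   also have "... <= integral {-R0..R0} (%z. \<Omega>\<^sup>2 * ((3 + Mm^2) * (D * ep)^2))"
   proof (rule integral_le[OF gi])
    fix z assume z: "z : {-R0..R0}"
    have o: "(om z)^2 <= \<Omega>^2" unfolding \<Omega>_def using om_mono[of z R0] z om_pos[of z] by (intro power_mono) auto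
    have sq: "v \<bullet> v <= (D * ep)^2" if "norm v <= D * ep" for v :: "real ^ 'n"
     unfolding dot_square_norm using that by (intro power_mono) auto
    have De: "0 <= D * ep" using D(1) e01 by simp
    have "mass m (K.W k (0, z)) \<bullet> mass m (K.W k (0, z)) <= ((D * ep) * Mm)^2"
     unfolding dot_square_norm
    proof (rule power_mono)
     have "norm (mass m (K.W k (0, z))) <= norm (K.W k (0, z)) * Mm" by (rule Mm(2))
     also have "... <= (D * ep) * Mm" using Wk(1)[of k z] k Mm(1) by (intro mult_right_mono) auto
     finally show "norm (mass m (K.W k (0, z))) <= D * ep * Mm" .
    qed simp
    moreover have "K.V k (0, z) \<bullet> K.V k (0, z) <= (D * ep)^2" "K.W (Suc k) (0, z) \<bullet> K.W (Suc k) (0, z) <= (D * ep)^2" "K.W k (0, z) \<bullet> K.W k (0, z) <= (D * ep)^2"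
     by (rule sq, rule Wk, use k in simp)+
    moreover have "((D * ep) * Mm)^2 = Mm^2 * (D * ep)^2" by (simp add: power_mult_distrib)
    moreover have "0 <= (D * ep)^2" by simp
    moreover have "exp (- 2 * 0 :: real) = 1" by simp
    ultimately have "exp (- 2 * 0) * (K.V k (0, z) \<bullet> K.V k (0, z) + K.W (Suc k) (0, z) \<bullet> K.W (Suc k) (0, z) + (1/4) * (K.W k (0, z) \<bullet> K.W k (0, z)))
      + mass m (K.W k (0, z)) \<bullet> mass m (K.W k (0, z)) <= (3 + Mm^2) * (D * ep)^2" unfolding distrib_right by (simp only: mult_1)
    with o show "g z <= \<Omega>^2 * ((3 + Mm^2) * (D * ep)^2)"
     unfolding g_def by (intro mult_mono) auto
   qed auto
   also have "... = c2 * ep^2" using R0(1) unfolding c2_def by (simp add: power_mult_distrib)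
   finally have "sqrt (K.E k 0) <= sqrt (c2 * ep^2)" by (rule real_sqrt_le_mono)
   also have "... = sqrt c2 * ep" using e01 by (simp add: real_sqrt_mult)
   also have "... <= Ci * ep" using Ci(2) e01 by (intro mult_right_mono) auto
   finally show ?thesis .
  qed
  have Si: "om z * K.Sn 0 (0, z) <= Ci * ep" for z
  proof (cases "\<bar>z\<bar> > R0")
   case True
   then have "K.Sn 0 (0, z) = 0" by (simp add: K.Sn_def K.b_def K.a_def Wo)
   then show ?thesis using Ci(1) e01 by simp
  next
   case False
   have "K.Sn 0 (0, z) <= 3 * (D * ep)"
    using Wk(1)[of 0 z] Wk(1)[of 1 z] Wk(2)[of 0 z] by (simp add: K.Sn_def K.b_def K.a_def)
   then have "om z * K.Sn 0 (0, z) <= \<Omega> * (3 * (D * ep))"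
    using om_mono[of z R0] False om_pos[of z] K.Sn_nonneg[of 0 "(0, z)"] unfolding \<Omega>_def by (intro mult_mono) auto
   also have "... = 3 * \<Omega> * D * ep" by simp
   also have "... <= Ci * ep" using Ci(3) e01 by (intro mult_right_mono) auto
   finally show ?thesis .
  qed
  have L2: "L >= 2"
  proof -
   have "0 <= 8 * (3 / m0 + 1) * cE m0 CF dm" using K.cE_pos m0(1) by (intro mult_nonneg_nonneg) auto
   then show ?thesis unfolding L_def Lam_def using K.c5_nonneg by linarith
  qed
  have "Ci * ep <= 1 / L^2"
  proof -
   have "ep <= 1 / ((L^2 + 1) * Ci)" using e unfolding ep0_def by auto
   then have "Ci * ep <= Ci * (1 / ((L^2 + 1) * Ci))" using Ci(1) by (intro mult_left_mono) auto
   also have "... = 1 / (L^2 + 1)" using Ci(1) by simp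
   also have "... <= 1 / L^2" by (rule frac_le) (use L2 in auto)
   finally show ?thesis .
  qed
  then have gb: "om z * K.Sn 0 (s, z) <= L * (Ci * ep)"
   unfolding L_def by (intro K.global_bound Ei Si) (use Ci(1) e01 s in auto)
  have P: "Ph ep s z = (t, x, ep)" unfolding Ph_def T Y by simp
  have "K.J0 (s, z) = (u (t, x, ep), dd et u (t, x, ep), dd ex u (t, x, ep))"
   using wv_jet[of s z ep] unfolding K.J0_def K.x_def K.y_def K.V_def K.W_0 K.W_Suc P fst_conv .
  then have "norm (u (t, x, ep), dd et u (t, x, ep), dd ex u (t, x, ep)) <= exp (- s / 2) * cosh z * 34 * K.Sn 0 (s, z)"
   using K.J_le(1)[OF s, of z] by simp
  also have "... <= K * ep / sqrt (t + 2 * B)"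
  proof -
   have Tp: "t + 2 * B > 0" using t B by simp
   \<comment> \<open>As t + 2B = e^s cosh z, the rate sqrt (t + 2B) of the claim times the loss
     e^{-s/2} cosh z is the power 3/2 of cosh z, which is exactly what the weight can
     absorb.\<close>
   have "(sqrt (t + 2 * B) * (exp (- s / 2) * cosh z))^2 = (t + 2 * B) * (exp (- s / 2) * exp (- s / 2)) * (cosh z)^2"
    using Tp by (simp add: power_mult_distrib power2_eq_square)
   also have "exp (- s / 2) * exp (- s / 2) = exp (- s)" by (simp flip: exp_add)
   also have "(t + 2 * B) * exp (- s) * (cosh z)^2 = cosh z ^ 3"
    unfolding T[symmetric] by (simp add: exp_minus power2_eq_square power3_eq_cube)
   also have "... <= (2 * om z)^2" using cosh_cubed_le_om[of z] by (simp add: power_mult_distrib)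
   finally have "sqrt (t + 2 * B) * (exp (- s / 2) * cosh z) <= 2 * om z" by (rule power2_le_imp_le) (use om_pos[of z] in simp)
   then have "(sqrt (t + 2 * B) * (exp (- s / 2) * cosh z)) * (34 * K.Sn 0 (s, z)) <= 2 * om z * (34 * K.Sn 0 (s, z))"
    using K.Sn_nonneg[of 0 "(s, z)"] by (intro mult_right_mono) auto
   also have "... = 68 * (om z * K.Sn 0 (s, z))" by simp
   also have "... <= 68 * (L * (Ci * ep))" using gb by (intro mult_left_mono) auto
   also have "... <= K * ep" unfolding K_def using L2 e01 by (simp add: algebra_simps)
   finally show ?thesis using Tp by (simp add: field_simps)
  qed
  finally show ?thesis .
 qed
 show ?thesis using ep0 K main by blast
qed

end

section \<open>Classical solutions\<close>

lemma at_within_Ici_not_bot: "(t::real) >= 0 ==> at t within {0..} ~= bot"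
proof
 assume "t >= 0" "at t within {0..} = bot"
 moreover from this have "at_right t <= at t within {0..}" by (intro at_le) auto
 ultimately have "at_right t = bot" by (simp only: le_bot)
 then show False using trivial_limit_at_right_real[of t] by blast
qed

lemma at_within_Ici: "(t::real) > 0 ==> at t within {0..} = at t"
 by (intro at_within_interior) (simp add: interior_Ici[of "-1" 0] less_eq_real_def)

lemma Dt_eq: "t >= 0 ==> ((%s. u (s, x)) hvd D) (at t within {0..}) ==> Dt u (t, x) = D"
 unfolding Dt_def prod.case by (rule vector_derivative_within[OF at_within_Ici_not_bot])

lemma Dx_eq: "((%y. u (t, y)) hvd D) (at x) ==> Dx u (t, x) = D"
 unfolding Dx_def prod.case by (rule vector_derivative_at)

text \<open>Values at negative times carry no meaning for classical solutions. All notions built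
  from \<open>Dt\<close>, \<open>Dx\<close> and \<open>Ck_half\<close> respect this relation, so a
  globally defined smooth function can represent a solution.\<close>

definition eq_half :: "(real * real => 'b) => (real * real => 'b) => bool" where
 "eq_half u v \<longleftrightarrow> (\<forall>t\<ge>0. \<forall>x. u (t, x) = v (t, x))"

lemma eq_half_sym: "eq_half u v ==> eq_half v u"
 by (simp add: eq_half_def)

lemma eq_half_vd:
 assumes "eq_half u v" "t >= 0"
 shows "((%s. u (s, x)) hvd D) (at t within {0..}) \<longleftrightarrow> ((%s. v (s, x)) hvd D) (at t within {0..})"
 by (rule has_vector_derivative_cong_ev) (use assms in \<open>auto simp: eq_half_def\<close>)

lemma Dt_cong: "eq_half u v ==> eq_half (Dt u) (Dt v)"
proof -
 assume uv: "eq_half u v"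
 have "Dt u (t, x) = Dt v (t, x)" if t: "t >= 0" for t x
  unfolding Dt_def prod.case vector_derivative_def by (simp only: eq_half_vd[OF uv t])
 then show ?thesis unfolding eq_half_def by blast
qed

lemma Dx_cong: "eq_half u v ==> eq_half (Dx u) (Dx v)"
proof -
 assume uv: "eq_half u v"
 have "(%y. u (t, y)) = (%y. v (t, y))" if "t >= 0" for t using uv that by (auto simp: eq_half_def)
 then show ?thesis unfolding eq_half_def Dx_def by simp
qed

lemma Ck_half_cong: "eq_half u v ==> Ck_half k u ==> Ck_half k v"
proof (induction k arbitrary: u v)
 case 0
 then show ?case by (auto simp: eq_half_def elim!: continuous_on_eq)
next
 case (Suc k)
 note uv = Suc.prems(1) and u = Suc.prems(2)
 have c: "continuous_on ({0..} \<times> UNIV) v"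
  using u uv by (auto simp: eq_half_def elim!: continuous_on_eq)
 have d: "(%s. v (s, x)) differentiable (at t within {0..}) \<and> (%y. v (t, y)) differentiable (at x)" if t: "t >= 0" for t x
 proof
  have "(%s. u (s, x)) differentiable (at t within {0..})" using u t by simp
  then have "((%s. u (s, x)) hvd vector_derivative (%s. u (s, x)) (at t within {0..})) (at t within {0..})"
   by (simp only: vector_derivative_works)
  then show "(%s. v (s, x)) differentiable (at t within {0..})" unfolding eq_half_vd[OF uv t] by (rule differentiableI_vector)
  have e: "(%y. u (t, y)) = (%y. v (t, y))" using uv t by (auto simp: eq_half_def)
  have "(%y. u (t, y)) differentiable (at x)" using u t by simp
  then show "(%y. v (t, y)) differentiable (at x)" unfolding e .
 qed
 have "Ck_half k (Dt v)" "Ck_half k (Dx v)"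
  using Suc.IH[OF Dt_cong[OF uv]] Suc.IH[OF Dx_cong[OF uv]] u by simp_all
 then show ?case using c d by simp
qed

lemma Ck_imp_partials:
 assumes "Ck (Suc k) h"
 shows "((%s. h (s, x)) hvd dd e1 h (t, x)) (at t within {0..})" "((%y. h (t, y)) hvd dd e2 h (t, x)) (at x)"
  "eq_half (Dt h) (dd e1 h)" "eq_half (Dx h) (dd e2 h)"
proof -
 show 1: "((%s. h (s, x)) hvd dd e1 h (t, x)) (at t within {0..})" for t x
  by (rule has_vector_derivative_at_within[OF dd_e1[OF assms]])
 show 2: "((%y. h (t, y)) hvd dd e2 h (t, x)) (at x)" for t x
  by (rule dd_e2[OF assms])
 show "eq_half (Dt h) (dd e1 h)" unfolding eq_half_def using Dt_eq[OF _ 1] by blast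
 show "eq_half (Dx h) (dd e2 h)" unfolding eq_half_def using Dx_eq[OF 2] by blast
qed

lemma Ck_imp_Ck_half: "Ck k h ==> Ck_half k h"
proof (induction k arbitrary: h)
 case 0
 then show ?case using continuous_on_subset by auto
next
 case (Suc k)
 note p = Ck_imp_partials[OF Suc.prems]
 have "Ck_half k (Dt h)" by (rule Ck_half_cong[OF eq_half_sym[OF p(3)] Suc.IH[OF Ck_dd[OF Suc.prems]]])
 moreover have "Ck_half k (Dx h)" by (rule Ck_half_cong[OF eq_half_sym[OF p(4)] Suc.IH[OF Ck_dd[OF Suc.prems]]])
 moreover have "continuous_on ({0..} \<times> UNIV) h" by (rule Ck_continuous[OF Suc.prems])
 moreover have "(%s. h (s, x)) differentiable (at t within {0..})" "(%y. h (t, y)) differentiable (at x)" for t x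
  by (rule differentiableI_vector[OF p(1)], rule differentiableI_vector[OF p(2)])
 ultimately show ?case by simp
qed

section \<open>Classical solutions and their characteristics\<close>

lemma characteristic_integral:
 fixes w :: "real * real => 'b::banach"
 assumes c: "continuous_on ({0..} \<times> UNIV) w"
  and w1: "!!t x. t > 0 ==> ((%s. w (s, x)) hvd f1 (t, x)) (at t)"
  and w2: "!!t x. t > 0 ==> ((%y. w (t, y)) hvd f2 (t, x)) (at x)"
  and c12: "!!p. fst p > 0 ==> isCont f1 p" "!!p. fst p > 0 ==> isCont f2 p"
  and H: "!!t x. t > 0 ==> H (t, x) = f1 (t, x) - r *R f2 (t, x)" and t: "t >= 0"
 shows "((%sg. t *R H (t * sg, x + r * (t * (1 - sg)))) has_integral w (t, x) - w (0, x + r * t)) {0..1}"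
proof (cases "t = 0")
 case True
 then show ?thesis using has_integral_0[of "{0..1::real}"] by simp
next
 case False
 then have tp: "t > 0" using t by simp
 define ga where "ga sg = (t * sg, x + r * (t * (1 - sg)))" for sg
 \<comment> \<open>At time 0 only continuity is used: the fundamental theorem needs derivatives in
   the interior alone, where the partial derivatives are continuous on an open set and the chain
   rule applies.\<close>
 have "((%sg. t *R H (ga sg)) has_integral w (ga 1) - w (ga 0)) {0..1}"
 proof (rule fundamental_theorem_of_calculus_interior)
  show "continuous_on {0..1} (%sg. w (ga sg))"
   by (rule continuous_on_compose2[OF c]) (use tp in \<open>auto simp: ga_def intro!: continuous_intros\<close>)
  fix sg :: real assume s: "sg : {0<..<1}"
  have op: "open {p :: real * real. 0 < fst p}" by (intro open_Collect_less continuous_intros)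
  have pos: "t * sg > 0" using tp s by simp
  have hd: "(w has_derivative (%v. fst v *R f1 (ga sg) + snd v *R f2 (ga sg))) (at (ga sg))"
   unfolding ga_def by (rule has_derivative_two_partials[OF op]) (use w1 w2 c12 pos in auto)
  have g1: "((%sg. t * sg) hrd t) (at sg)" "((%sg. x + r * (t * (1 - sg))) hrd - (r * t)) (at sg)"
   by (auto intro!: derivative_eq_intros)
  have "(ga hvd (t, - (r * t))) (at sg)"
   unfolding ga_def using g1 unfolding has_real_derivative_iff_has_vector_derivative by (intro has_vector_derivative_Pair)
  from vector_derivative_diff_chain_within[OF this has_derivative_at_withinI[OF hd]]
  have "((%sg. w (ga sg)) hvd t *R f1 (ga sg) + (- (r * t)) *R f2 (ga sg)) (at sg)" by (simp add: o_def)
  also have "t *R f1 (ga sg) + (- (r * t)) *R f2 (ga sg) = t *R H (ga sg)"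
   unfolding ga_def H[OF pos] by (simp add: algebra_simps)
  finally show "((%sg. w (ga sg)) hvd t *R H (ga sg)) (at sg)" .
 qed simp
 then show ?thesis by (simp add: ga_def)
qed

lemma Ck_half_partials:
 assumes "Ck_half (Suc k) u"
 shows "t >= 0 ==> ((%s. u (s, x)) hvd Dt u (t, x)) (at t within {0..})"
  "t > 0 ==> ((%s. u (s, x)) hvd Dt u (t, x)) (at t)"
  "t >= 0 ==> ((%y. u (t, y)) hvd Dx u (t, x)) (at x)"
  "continuous_on ({0..} \<times> UNIV) u" "Ck_half k (Dt u)" "Ck_half k (Dx u)"
proof -
 show 1: "t >= 0 ==> ((%s. u (s, x)) hvd Dt u (t, x)) (at t within {0..})"
  using assms unfolding Dt_def prod.case vector_derivative_works[symmetric] by simp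
 show "t > 0 ==> ((%s. u (s, x)) hvd Dt u (t, x)) (at t)" using 1 at_within_Ici by simp
 show "t >= 0 ==> ((%y. u (t, y)) hvd Dx u (t, x)) (at x)"
  using assms unfolding Dx_def prod.case vector_derivative_works[symmetric] by simp
qed (use assms in auto)

lemma Ck_half_isCont: "Ck_half k u ==> fst p > 0 ==> isCont u p"
proof -
 assume u: "Ck_half k u" and p: "fst p > 0"
 have "continuous_on ({0..} \<times> UNIV) u" using u by (cases k) auto
 then have "continuous_on {p. 0 < fst p} u" by (rule continuous_on_subset) auto
 moreover have "open {p :: real * real. 0 < fst p}" by (intro open_Collect_less continuous_intros)
 ultimately show ?thesis using p continuous_on_eq_continuous_at by blast
qed

lemma Ck_half_mixed:
 fixes u :: "real * real => real ^ 'n::finite"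
 assumes u: "Ck_half 2 u" and t: "t > 0"
 shows "Dt (Dx u) (t, x) = Dx (Dt u) (t, x)"
proof -
 let ?S = "{p :: real * real. 0 < fst p}"
 have op: "open ?S" by (intro open_Collect_less continuous_intros)
 have 2: "2 = Suc (Suc 0)" by simp
 note U = Ck_half_partials[OF u[unfolded 2]]
 note P = Ck_half_partials[OF U(5)] and Q = Ck_half_partials[OF U(6)]
 have hd: "((%p. h p $ j) has_derivative (%v. fst v * h1 p $ j + snd v * h2 p $ j)) (at p)"
  if "!!t x. t > 0 ==> ((%s. h (s, x)) hvd h1 (t, x)) (at t)"
   "!!t x. t >= 0 ==> ((%y. h (t, y)) hvd h2 (t, x)) (at x)"
   "isCont h1 p" "isCont h2 p" "p : ?S"
  for h h1 h2 :: "real * real => real ^ 'n" and p j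
 proof -
  obtain s y where p: "p = (s, y)" by (metis prod.exhaust)
  have i: "isCont h1 (s, y)" "isCont h2 (s, y)" using that(3,4) unfolding p by auto
  have "(h has_derivative (%v. fst v *R h1 (s, y) + snd v *R h2 (s, y))) (at (s, y))"
   by (rule has_derivative_two_partials[OF op _ _ _ i]) (use that p in auto)
  from bounded_linear.has_derivative[OF bounded_linear_vec_nth this] show ?thesis unfolding p by simp
 qed
 have "Dx (Dt u) (t, x) $ j = Dt (Dx u) (t, x) $ j" for j
 proof -
  have "(%y v. fst v * Dt (Dt u) y $ j + snd v * Dx (Dt u) y $ j) (t, x) (0, 1) = (%y v. fst v * Dt (Dx u) y $ j + snd v * Dx (Dx u) y $ j) (t, x) (1, 0)"
  proof (rule mixed_derivatives_commute[OF op, where f="%p. u p $ j" and Df="%p v. fst v * Dt u p $ j + snd v * Dx u p $ j" and v="(1, 0)" and w="(0, 1)"])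
   show "(t, x) : ?S" using t by simp
   fix p assume p: "p : ?S"
   show "((%p. u p $ j) has_derivative (%v. fst v * Dt u p $ j + snd v * Dx u p $ j)) (at p)"
    by (rule hd[OF U(2,3) _ _ p]) (use Ck_half_isCont[OF U(5)] Ck_half_isCont[OF U(6)] p in auto)
   have "((%p. Dt u p $ j) has_derivative (%v. fst v * Dt (Dt u) p $ j + snd v * Dx (Dt u) p $ j)) (at p)"
    by (rule hd[OF P(2,3) _ _ p]) (use Ck_half_isCont[OF P(5)] Ck_half_isCont[OF P(6)] p in auto)
   then show "((%y. fst (1, 0) * Dt u y $ j + snd (1, 0) * Dx u y $ j) has_derivative (%v. fst v * Dt (Dt u) p $ j + snd v * Dx (Dt u) p $ j)) (at p)" by simp
   have "((%p. Dx u p $ j) has_derivative (%v. fst v * Dt (Dx u) p $ j + snd v * Dx (Dx u) p $ j)) (at p)"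
    by (rule hd[OF Q(2,3) _ _ p]) (use Ck_half_isCont[OF Q(5)] Ck_half_isCont[OF Q(6)] p in auto)
   then show "((%y. fst (0, 1) * Dt u y $ j + snd (0, 1) * Dx u y $ j) has_derivative (%v. fst v * Dt (Dx u) p $ j + snd v * Dx (Dx u) p $ j)) (at p)" by simp
  next
   have "isCont (Dx (Dt u)) (t, x)" "isCont (Dt (Dx u)) (t, x)" using Ck_half_isCont[OF P(6)] Ck_half_isCont[OF Q(5)] t by auto
   from this[THEN isCont_o2[OF _ bounded_linear.isCont[OF bounded_linear_vec_nth[of j] continuous_ident]]]
   show "isCont (%y. fst (0, 1) * Dt (Dt u) y $ j + snd (0, 1) * Dx (Dt u) y $ j) (t, x)"
    "isCont (%y. fst (1, 0) * Dt (Dx u) y $ j + snd (1, 0) * Dx (Dx u) y $ j) (t, x)"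
    by simp_all
  qed
  then show ?thesis by simp
 qed
 then show ?thesis by (simp add: vec_eq_iff)
qed

text \<open>Uniqueness is claimed for the original nonlinearity, without cut-off, so a Lipschitz
  bound is available only on bounded sets of jets.\<close>

lemma Lipschitz_on_balls:
 fixes F :: "'a::euclidean_space => 'b::euclidean_space"
 assumes F: "Ck 1 F"
 shows "\<exists>L\<ge>0. \<forall>y\<in>cball 0 r. \<forall>y'\<in>cball 0 r. norm (F y - F y') <= L * norm (y - y')"
proof -
 have F1: "Ck (Suc 0) F" using F by simp
 have "\<exists>C. \<forall>y\<in>cball 0 r. norm (dd b F y) <= C" for b
 proof -
  have "continuous_on (cball 0 r) (dd b F)" by (rule Ck_continuous[OF Ck_dd[OF F1]])
  then have "bounded (dd b F ` cball 0 r)" by (intro compact_imp_bounded compact_continuous_image) auto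
  then show ?thesis unfolding bounded_iff by blast
 qed
 then obtain C where C: "!!b y. y : cball 0 r ==> norm (dd b F y) <= C b" by metis
 define L where "L = (\<Sum>b\<in>Basis. \<bar>C b\<bar>)"
 have o: "onorm (%v. dd v F y) <= L" if y: "y : cball 0 r" for y
 proof (rule onorm_bound)
  show "0 <= L" unfolding L_def by (simp add: sum_nonneg)
  fix v
  have "norm (dd v F y) <= (\<Sum>b\<in>Basis. norm ((v \<bullet> b) *R dd b F y))" unfolding dd_eq_sum_Basis[OF F1, where v=v and x=y] by (rule norm_sum)
  also have "... <= (\<Sum>b\<in>Basis. norm v * \<bar>C b\<bar>)"
  proof (rule sum_mono)
   fix b :: 'a assume b: "b : Basis"
   have "norm (dd b F y) <= \<bar>C b\<bar>" using C[OF y, of b] by linarith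
   then show "norm ((v \<bullet> b) *R dd b F y) <= norm v * \<bar>C b\<bar>" unfolding norm_scaleR using Basis_le_norm[OF b, of v] by (intro mult_mono) auto
  qed
  also have "... = L * norm v" unfolding L_def by (simp add: sum_distrib_left mult.commute)
  finally show "norm (dd v F y) <= L * norm v" .
 qed
 have "norm (F y - F y') <= L * norm (y - y')" if "y : cball 0 r" "y' : cball 0 r" for y y'
  by (rule differentiable_bound[OF convex_cball has_derivative_at_withinI[OF Ck_has_derivative[OF F1]] o that])
 moreover have "L >= 0" unfolding L_def by (simp add: sum_nonneg)
 ultimately show ?thesis by blast
qed

lemma Lp_norm_bound:
 fixes h :: "real => 'b::real_normed_vector"
 assumes h: "continuous_on UNIV h" and M: "!!x. norm (h x) <= M" and supp: "!!x. \<bar>x\<bar> > r ==> h x = 0" and r: "r >= 0" and p: "p >= 2"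
 shows "Lp_norm p h <= ennreal (M * (2 * r) powr enn2real (1 / p)) \<or> (p = \<infinity> \<and> Lp_norm p h <= ennreal M)"
proof (cases "p = \<infinity>")
 case True
 have "esssup lborel (%x. ennreal (norm (h x))) <= ennreal M"
 proof (rule esssup_I)
  have "continuous_on UNIV (%x. norm (h x))" by (intro continuous_intros h)
  then have "(%x. norm (h x)) : borel_measurable borel" by (rule borel_measurable_continuous_onI)
  then show "(%x. ennreal (norm (h x))) : borel_measurable lborel" by simp
  show "AE x in lborel. ennreal (norm (h x)) <= ennreal M" by (rule AE_I2) (use M in \<open>simp add: ennreal_leI\<close>)
 qed
 then show ?thesis using True by (simp add: Lp_norm_def)
next
 case False
 define q where "q = enn2real p"
 have pq: "p = ennreal q" unfolding q_def using False by (cases p) auto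
 have q2: "q >= 2" using p unfolding pq by (metis ennreal_le_iff2 ennreal_numeral not_numeral_le_zero zero_le_numeral)
 have M0: "M >= 0" using M[of 0] norm_ge_zero order_trans by blast
 define S where "S = (\<integral>\<^sup>+x. ennreal (norm (h x) powr q) \<partial>lborel)"
 have "S <= (\<integral>\<^sup>+x. ennreal (M powr q) * indicator {-r..r} x \<partial>lborel)"
  unfolding S_def
 proof (rule nn_integral_mono)
  fix x
  show "ennreal (norm (h x) powr q) <= ennreal (M powr q) * indicator {-r..r} x"
  proof (cases "\<bar>x\<bar> > r")
   case True
   then show ?thesis using supp q2 by simp
  next
   case False
   then have "x : {-r..r}" by auto
   then show ?thesis using M[of x] q2 by (simp add: ennreal_leI powr_mono2)
  qed
 qed
 also have "... = ennreal (M powr q) * ennreal (2 * r)" using r by (simp add: nn_integral_cmult_indicator)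
 also have "... = ennreal (M powr q * (2 * r))" by (simp add: ennreal_mult' r)
 finally have S: "S <= ennreal (M powr q * (2 * r))" .
 then have fin: "S ~= \<infinity>" by (auto simp: top_unique)
 have "enn2real S <= M powr q * (2 * r)" using S r by (simp add: enn2real_leI)
 then have "enn2real S powr (1 / q) <= (M powr q * (2 * r)) powr (1 / q)" using q2 by (intro powr_mono2) auto
 also have "... = M * (2 * r) powr (1 / q)" using M0 r q2 by (simp add: powr_mult powr_powr)
 finally have X: "enn2real S powr (1 / q) <= M * (2 * r) powr (1 / q)" .
 have q1: "enn2real (1 / p) = 1 / q"
 proof -
  have "1 / p = ennreal (1 / q)" unfolding pq using divide_ennreal[of 1 q] q2 by simp
  then show ?thesis using q2 by simp
 qed
 have "Lp_norm p h <= ennreal (M * (2 * r) powr enn2real (1 / p))"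
  using False fin X unfolding q1 Lp_norm_def q_def[symmetric] S_def[symmetric] Let_def by (simp add: ennreal_leI)
 then show ?thesis ..
qed

definition jet :: "(real * real => real ^ 'n) => real * real => 'n::finite jet" where
 "jet v p = (v p, Dt v p, Dx v p)"

definition source :: "('n => real) => ('n jet => real ^ 'n) => (real * real => real ^ 'n) => real * real => real ^ 'n::finite" where
 "source m F v p = F (jet v p) - mass m (mass m (v p))"

lemma pd_simps: "pd (0, 0) u = u" "pd (1, 0) u = Dt u" "pd (0, 1) u = Dx u" "pd (2, 0) u = Dt (Dt u)" "pd (0, 2) u = Dx (Dx u)"
 by (simp_all add: pd_def numeral_2_eq_2)

lemma classical_solution_iff:
 "classical_solution m F f g ep v \<longleftrightarrow> Ck_half 2 v \<and> (\<forall>t>0. \<forall>x. Dt (Dt v) (t, x) - Dx (Dx v) (t, x) = source m F v (t, x))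
  \<and> (\<forall>x. v (0, x) = (\<chi> j. ep * f j x) \<and> Dt v (0, x) = (\<chi> j. ep * g j x))"
proof -
 have "(\<forall>j. a $ j - b $ j + (m j)^2 * c $ j = d $ j) \<longleftrightarrow> a - b = d - mass m (mass m c)" for a b c d :: "real ^ 'a"
  unfolding vec_eq_iff by (simp add: mass_def power2_eq_square algebra_simps)
 then show ?thesis
  unfolding classical_solution_def pd_simps source_def jet_def by (simp add: vec_eq_iff all_conj_distrib)
qed

lemma classical_characteristics:
 fixes v :: "real * real => real ^ 'n::finite"
 assumes v: "Ck_half 2 v" and pde: "!!t x. t > 0 ==> Dt (Dt v) (t, x) - Dx (Dx v) (t, x) = source m F v (t, x)" and t: "t >= 0"
 shows "((%sg. t *R source m F v (t * sg, x + 1 * (t * (1 - sg)))) has_integral (Dt v (t, x) + Dx v (t, x)) - (Dt v (0, x + 1 * t) + Dx v (0, x + 1 * t))) {0..1}"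
  "((%sg. t *R source m F v (t * sg, x + (-1) * (t * (1 - sg)))) has_integral (Dt v (t, x) - Dx v (t, x)) - (Dt v (0, x + (-1) * t) - Dx v (0, x + (-1) * t))) {0..1}"
  "((%sg. t *R (%p. Dt v p + Dx v p) (t * sg, x + (-1) * (t * (1 - sg)))) has_integral v (t, x) - v (0, x + (-1) * t)) {0..1}"
proof -
 have 2: "2 = Suc (Suc 0)" by simp
 note U = Ck_half_partials[OF v[unfolded 2]]
 note P = Ck_half_partials[OF U(5)] and Q = Ck_half_partials[OF U(6)]
 note i = Ck_half_isCont[OF P(5)] Ck_half_isCont[OF P(6)] Ck_half_isCont[OF Q(5)] Ck_half_isCont[OF Q(6)] Ck_half_isCont[OF U(5)] Ck_half_isCont[OF U(6)]
 have H1: "source m F v (t, x) = (Dt (Dt v) (t, x) + Dt (Dx v) (t, x)) - 1 *R (Dx (Dt v) (t, x) + Dx (Dx v) (t, x))" if "t > 0" for t x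
  using pde[OF that, of x] Ck_half_mixed[OF v that, of x] by simp
 have H2: "source m F v (t, x) = (Dt (Dt v) (t, x) - Dt (Dx v) (t, x)) - (-1) *R (Dx (Dt v) (t, x) - Dx (Dx v) (t, x))" if "t > 0" for t x
  using pde[OF that, of x] Ck_half_mixed[OF v that, of x] by simp
 show "((%sg. t *R source m F v (t * sg, x + 1 * (t * (1 - sg)))) has_integral (Dt v (t, x) + Dx v (t, x)) - (Dt v (0, x + 1 * t) + Dx v (0, x + 1 * t))) {0..1}"
  by (rule characteristic_integral[where w="%p. Dt v p + Dx v p" and ?f1.0="%p. Dt (Dt v) p + Dt (Dx v) p" and ?f2.0="%p. Dx (Dt v) p + Dx (Dx v) p", OF _ _ _ _ _ H1 t])
   (auto intro!: continuous_on_add P(4) Q(4) has_vector_derivative_add P(2,3) Q(2,3) isCont_add i)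
 show "((%sg. t *R source m F v (t * sg, x + (-1) * (t * (1 - sg)))) has_integral (Dt v (t, x) - Dx v (t, x)) - (Dt v (0, x + (-1) * t) - Dx v (0, x + (-1) * t))) {0..1}"
  by (rule characteristic_integral[where w="%p. Dt v p - Dx v p" and ?f1.0="%p. Dt (Dt v) p - Dt (Dx v) p" and ?f2.0="%p. Dx (Dt v) p - Dx (Dx v) p", OF _ _ _ _ _ H2 t])
   (auto intro!: continuous_on_diff P(4) Q(4) has_vector_derivative_diff P(2,3) Q(2,3) isCont_diff i)
 show "((%sg. t *R (%p. Dt v p + Dx v p) (t * sg, x + (-1) * (t * (1 - sg)))) has_integral v (t, x) - v (0, x + (-1) * t)) {0..1}"
  by (rule characteristic_integral[where w=v and ?f1.0="Dt v" and ?f2.0="Dx v" and H="%p. Dt v p + Dx v p", OF _ _ _ _ _ _ t])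
   (auto intro!: U(2,3,4) i)
qed

text \<open>The difference of two solutions in characteristic variables solves the integral equation
  of the transport system with zero data; on the compact domain of dependence both jets are bounded,
  so Gronwall's estimate applies with a local Lipschitz constant.\<close>

theorem classical_solution_unique:
 fixes F :: "'n::finite jet => real ^ 'n"
 assumes F: "Ck 1 F" and c1: "classical_solution m F f g ep v1" and c2: "classical_solution m F f g ep v2"
 shows "eq_half v1 v2"
 unfolding eq_half_def
proof (intro allI impI)
 fix t0 x0 :: real assume t0: "t0 >= 0"
 note C1 = c1[unfolded classical_solution_iff] and C2 = c2[unfolded classical_solution_iff]
 have k1: "Ck_half 2 v1" and k2: "Ck_half 2 v2" using C1 C2 by blast+
 note h1 = classical_characteristics[of v1 m F, OF k1] and h2 = classical_characteristics[of v2 m F, OF k2]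
 have pde1: "t > 0 ==> Dt (Dt v1) (t, x) - Dx (Dx v1) (t, x) = source m F v1 (t, x)"
  and pde2: "t > 0 ==> Dt (Dt v2) (t, x) - Dx (Dx v2) (t, x) = source m F v2 (t, x)" for t x using C1 C2 by blast+
 have v0: "v1 (0, x) = v2 (0, x)" "Dt v1 (0, x) = Dt v2 (0, x)" for x using C1 C2 by auto
 have "Dx v1 (0, x) = Dx v2 (0, x)" for x unfolding Dx_def using v0(1) by simp
 note v0 = v0 this
 define D where "D p = (Dt v1 p + Dx v1 p - (Dt v2 p + Dx v2 p), Dt v1 p - Dx v1 p - (Dt v2 p - Dx v2 p), v1 p - v2 p)" for p
 define h where "h p = source m F v1 p - source m F v2 p" for p
 define Gd where "Gd p = (h p, h p, fst (D p))" for p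
 \<comment> \<open>Extended to negative times by its values at time 0, which are zero, and made
   independent of the parameter variable, so that it is a function on the whole space of the
   transport system.\<close>
 define V where "V p = D (max 0 (fst p), fst (snd p))" for p :: "real * real * real"
 define G where "G p = Gd (max 0 (fst p), fst (snd p))" for p :: "real * real * real"
 have D0: "D (0, x) = 0" and G0: "Gd (0, x) = 0" for x
  unfolding D_def Gd_def h_def source_def jet_def v0 by (simp_all add: zero_prod_def)
 have 2: "2 = Suc (Suc 0)" by simp
 note U1 = Ck_half_partials[OF k1[unfolded 2]] and U2 = Ck_half_partials[OF k2[unfolded 2]]
 note cc = U1(4) U2(4) Ck_half_partials(4)[OF U1(5)] Ck_half_partials(4)[OF U1(6)] Ck_half_partials(4)[OF U2(5)] Ck_half_partials(4)[OF U2(6)]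
 have cj: "continuous_on ({0..} \<times> UNIV) (jet v1)" "continuous_on ({0..} \<times> UNIV) (jet v2)"
  unfolding jet_def[abs_def] by (intro continuous_on_Pair cc)+
 have cD: "continuous_on ({0..} \<times> UNIV) D" unfolding D_def by (intro continuous_on_Pair continuous_on_diff continuous_on_add cc)
 have cm: "continuous_on S (%p. mass m (u p))" if "continuous_on S u" for S and u :: "real * real => real ^ 'n"
  by (rule linear_continuous_on_compose[OF that bounded_linear.linear[OF bounded_linear_mass]])
 have cF: "continuous_on ({0..} \<times> UNIV) (%p. F (jet v1 p))" "continuous_on ({0..} \<times> UNIV) (%p. F (jet v2 p))"
  by (rule continuous_on_compose2[OF Ck_continuous[OF F, of UNIV] cj(1)], simp, rule continuous_on_compose2[OF Ck_continuous[OF F, of UNIV] cj(2)], simp)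
 have ch: "continuous_on ({0..} \<times> UNIV) h" unfolding h_def source_def by (intro continuous_on_diff cF cm cc)
 have cG: "continuous_on ({0..} \<times> UNIV) Gd" unfolding Gd_def by (intro continuous_on_Pair ch continuous_on_fst cD)
 have cl: "continuous_on UNIV (%p :: real * real * real. (max 0 (fst p), fst (snd p)))" by (intro continuous_intros)
 have cV: "continuous_on UNIV V" unfolding V_def by (rule continuous_on_compose2[OF cD cl]) auto
 have cGG: "continuous_on UNIV G" unfolding G_def by (rule continuous_on_compose2[OF cG cl]) auto
 have duh: "V p = 0 + kg.duh G p" for p
 proof -
  obtain t x e where p: "p = (t, x, e)" by (metis prod.exhaust)
  show ?thesis
  proof (cases "t >= 0")
   case False
   \<comment> \<open>For negative times the extended source is its value at time 0, where the two
     solutions have equal jets; both sides of the integral equation are then 0.\<close>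
   have "kg.ray G p sg = 0" if "sg : {0..1}" for sg
   proof -
    have "t * sg <= 0" using False that by (simp add: mult_le_0_iff)
    then have "G (t * sg, zt) = 0" for zt unfolding G_def by (simp add: max_absorb1 G0)
    then show ?thesis unfolding kg.ray_def p by (simp add: leftgoing_def rightgoing_def zero_prod_def)
   qed
   then have "kg.duh G p = 0" unfolding kg.duh_def by (subst integral_cong[where g="%sg. 0"]) auto
   moreover have "V p = 0" unfolding V_def p using False by (simp add: D0)
   ultimately show ?thesis by simp
  next
   case True
   have b: "bounded_linear (%y :: real ^ 'n. (y, 0 :: real ^ 'n, 0 :: real ^ 'n))" "bounded_linear (%y :: real ^ 'n. (0 :: real ^ 'n, y, 0 :: real ^ 'n))"
    "bounded_linear (%y :: real ^ 'n. (0 :: real ^ 'n, 0 :: real ^ 'n, y))"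
    by (intro bounded_linear_Pair bounded_linear_ident bounded_linear_zero)+
   note i1 = has_integral_diff[OF h1(1)[OF pde1 True, of x] h2(1)[OF pde2 True, of x]]
   note i2 = has_integral_diff[OF h1(2)[OF pde1 True, of x] h2(2)[OF pde2 True, of x]]
   note i3 = has_integral_diff[OF h1(3)[OF pde1 True, of x] h2(3)[OF pde2 True, of x]]
   note I = has_integral_add[OF has_integral_linear[OF i1 b(1)] has_integral_add[OF has_integral_linear[OF i2 b(2)] has_integral_linear[OF i3 b(3)]]]
   have "(kg.ray G p has_integral V p) {0..1}"
   proof (rule has_integral_eq_rhs[OF has_integral_eq[OF _ I]])
    show "V p = (Dt v1 (t, x) + Dx v1 (t, x) - (Dt v1 (0, x + 1 * t) + Dx v1 (0, x + 1 * t)) - (Dt v2 (t, x) + Dx v2 (t, x) - (Dt v2 (0, x + 1 * t) + Dx v2 (0, x + 1 * t))), 0, 0) +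
     ((0, Dt v1 (t, x) - Dx v1 (t, x) - (Dt v1 (0, x + -1 * t) - Dx v1 (0, x + -1 * t)) - (Dt v2 (t, x) - Dx v2 (t, x) - (Dt v2 (0, x + -1 * t) - Dx v2 (0, x + -1 * t))), 0) +
     (0, 0, v1 (t, x) - v1 (0, x + -1 * t) - (v2 (t, x) - v2 (0, x + -1 * t))))"
     unfolding V_def D_def p v0 using True by simp
    fix sg :: real assume s: "sg : {0..1}"
    have m: "max 0 (t * sg) = t * sg" using True s by simp
    have Gs: "G (t * sg, zt) = (h (t * sg, fst zt), h (t * sg, fst zt), fst (D (t * sg, fst zt)))" for zt
     unfolding G_def Gd_def fst_conv snd_conv m ..
    show "((%y. (y, 0, 0)) \<circ> (%sg. t *R source m F v1 (t * sg, x + 1 * (t * (1 - sg))) - t *R source m F v2 (t * sg, x + 1 * (t * (1 - sg))))) sg +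
     (((%y. (0, y, 0)) \<circ> (%sg. t *R source m F v1 (t * sg, x + -1 * (t * (1 - sg))) - t *R source m F v2 (t * sg, x + -1 * (t * (1 - sg))))) sg +
     ((%y. (0, 0, y)) \<circ> (%sg. t *R (Dt v1 (t * sg, x + -1 * (t * (1 - sg))) + Dx v1 (t * sg, x + -1 * (t * (1 - sg)))) -
       t *R (Dt v2 (t * sg, x + -1 * (t * (1 - sg))) + Dx v2 (t * sg, x + -1 * (t * (1 - sg)))))) sg) = kg.ray G p sg"
     unfolding kg.ray_def p prod.case leftgoing_def rightgoing_def Gs o_def
     by (simp add: h_def D_def scaleR_diff_right)
   qed
   then show ?thesis unfolding kg.duh_def by (simp add: integral_unique)
  qed
 qed
 let ?K = "{0..t0} \<times> {x0 - t0..x0 + t0}"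
 have "bounded (jet v1 ` ?K \<union> jet v2 ` ?K)"
  by (intro bounded_Un[THEN iffD2] conjI compact_imp_bounded compact_continuous_image compact_Times compact_Icc
    continuous_on_subset[OF cj(1)] continuous_on_subset[OF cj(2)]) auto
 then obtain \<rho> where \<rho>: "\<forall>y\<in>jet v1 ` ?K \<union> jet v2 ` ?K. norm y <= \<rho>" unfolding bounded_iff by blast
 obtain L where L: "L >= 0" "!!y y'. y : cball 0 \<rho> ==> y' : cball 0 \<rho> ==> norm (F y - F y') <= L * norm (y - y')"
  using Lipschitz_on_balls[OF F] by blast
 obtain Mm where Mm: "Mm > 0" "!!v. norm (mass m v) <= norm v * Mm" using bounded_linear.pos_bounded[OF bounded_linear_mass] by blast
 define L' where "L' = 2 * (3 * L + Mm * Mm) + 1"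
 have L': "L' >= 0" unfolding L'_def using L Mm by simp
 have bound: "norm (G p) <= 0 + L' * norm (V p)" if p: "p : diamond (x0, 0) t0" for p
 proof -
  define q where "q = (max 0 (fst p), fst (snd p))"
  have "\<bar>fst p\<bar> <= t0" by (rule diamond_time[OF p])
  moreover have "\<bar>fst (snd p) - x0\<bar> <= t0"
  proof -
   have z: "snd p - (x0, 0) = (fst (snd p) - x0, snd (snd p))" by (simp add: prod_eq_iff)
   have "\<bar>fst (snd p) - x0\<bar> <= norm (snd p - (x0, 0))" unfolding z using norm_fst_le[of "fst (snd p) - x0" "snd (snd p)"] by simp
   then show ?thesis using p abs_ge_zero[of "fst p"] unfolding diamond_def by simp
  qed
  ultimately have qK: "q : ?K" unfolding q_def using t0 by auto
  obtain A B C where Dq: "D q = (A, B, C)" by (metis prod.exhaust)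
  have n: "norm A <= norm (D q)" "norm B <= norm (D q)" "norm C <= norm (D q)"
   unfolding Dq using norm_fst_le[of A "(B, C)"] norm_snd_le[of "(B, C)" A] norm_fst_le[of B C] norm_snd_le[of C B] by linarith+
  have ABC: "A = Dt v1 q + Dx v1 q - (Dt v2 q + Dx v2 q)" "B = Dt v1 q - Dx v1 q - (Dt v2 q - Dx v2 q)" "C = v1 q - v2 q"
   using Dq unfolding D_def by auto
  have hA: "Dt v1 q - Dt v2 q = (1/2) *R (A + B)" "Dx v1 q - Dx v2 q = (1/2) *R (A - B)"
   unfolding ABC vec_eq_iff by (simp_all add: field_simps)
  have "jet v1 q - jet v2 q = (C, (1/2) *R (A + B), (1/2) *R (A - B))" unfolding jet_def hA[symmetric] ABC(3) by simp
  then have "norm (jet v1 q - jet v2 q) <= norm C + (norm ((1/2) *R (A + B)) + norm ((1/2) *R (A - B)))"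
   using norm_Pair_le[of C "((1/2) *R (A + B), (1/2) *R (A - B))"] norm_Pair_le[of "(1/2) *R (A + B)" "(1/2) *R (A - B)"] by simp
  also have "... <= norm C + ((1/2) * (norm A + norm B) + (1/2) * (norm A + norm B))"
   using norm_triangle_ineq[of A B] norm_triangle_ineq4[of A B] by simp
  also have "... <= 3 * norm (D q)" using n by simp
  finally have j: "norm (jet v1 q - jet v2 q) <= 3 * norm (D q)" .
  have "norm (F (jet v1 q) - F (jet v2 q)) <= L * norm (jet v1 q - jet v2 q)" by (rule L(2)) (use \<rho> qK in auto)
  also have "... <= L * (3 * norm (D q))" using j L(1) by (rule mult_left_mono)
  finally have f1: "norm (F (jet v1 q) - F (jet v2 q)) <= L * (3 * norm (D q))" .
  have "mass m (mass m (v1 q)) - mass m (mass m (v2 q)) = mass m (mass m C)" unfolding ABC by (simp add: vec_eq_iff mass_def algebra_simps)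
  moreover have "norm (mass m (mass m C)) <= norm (D q) * Mm * Mm"
   using Mm(2)[of "mass m C"] mult_right_mono[OF Mm(2)[of C], of Mm] mult_right_mono[OF mult_right_mono[OF n(3), of Mm], of Mm] Mm(1) by linarith
  ultimately have f2: "norm (mass m (mass m (v1 q)) - mass m (mass m (v2 q))) <= norm (D q) * Mm * Mm" by simp
  have "h q = (F (jet v1 q) - F (jet v2 q)) - (mass m (mass m (v1 q)) - mass m (mass m (v2 q)))" unfolding h_def source_def by (simp add: algebra_simps)
  then have hq: "norm (h q) <= L * (3 * norm (D q)) + norm (D q) * Mm * Mm"
   using norm_triangle_ineq4[of "F (jet v1 q) - F (jet v2 q)" "mass m (mass m (v1 q)) - mass m (mass m (v2 q))"] f1 f2 by simp
  have "norm (Gd q) <= norm (h q) + (norm (h q) + norm A)"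
   unfolding Gd_def Dq fst_conv using norm_Pair_le[of "h q" "(h q, A)"] norm_Pair_le[of "h q" A] by linarith
  also have "... <= L' * norm (D q)" unfolding L'_def using hq n(1) by (simp add: algebra_simps)
  finally show ?thesis unfolding G_def V_def q_def[symmetric] by simp
 qed
 have "norm (V (t0, x0, 0)) <= 2 * (0 + 2 * 0 * t0) * exp ((4 * L' + 1) * t0)"
  by (rule kg.gronwall[OF cV cGG t0 L' order_refl duh _ bound]) (use t0 in \<open>auto simp: diamond_def\<close>)
 then have "D (t0, x0) = 0" unfolding V_def using t0 by simp
 then show "v1 (t0, x0) = v2 (t0, x0)" unfolding D_def by (simp add: zero_prod_def)
qed

section \<open>Decay in Lebesgue norms and conclusion\<close>

lemma cubic_expansion_bound:
 fixes F :: "'n::finite jet => real ^ 'n"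
 assumes "cubic_expansion m c F"
 shows "\<exists>r>0. \<exists>C>0. \<forall>y. norm y < r --> norm (F y - Fc m c y) <= C * norm y ^ 4"
proof -
 have "\<exists>C>0. eventually (%y. \<bar>(F y - Fc m c y) $ j\<bar> <= C * norm y ^ 4) (nhds 0)" for j
 proof -
  have "(%z. F z $ j - F_cubic m c j z) : O[nhds 0](%(u, ut, ux). (norm u + norm ut + norm ux) ^ 4)"
   using assms unfolding cubic_expansion_def by blast
  then obtain C where C: "C > 0" "eventually (%z. norm (F z $ j - F_cubic m c j z) <= C * norm ((%(u, ut, ux). (norm u + norm ut + norm ux) ^ 4) z)) (nhds 0)"
   by (rule landau_o.bigE)
  have "eventually (%y. \<bar>(F y - Fc m c y) $ j\<bar> <= (C * 81) * norm y ^ 4) (nhds 0)"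
   using C(2)
  proof eventually_elim
   fix y assume y: "norm (F y $ j - F_cubic m c j y) <= C * norm ((%(u, ut, ux). (norm u + norm ut + norm ux) ^ 4) y)"
   obtain u ut ux where yy: "y = (u, ut, ux)" by (metis prod.exhaust)
   have "norm u <= norm y" "norm ut <= norm y" "norm ux <= norm y"
    unfolding yy using norm_fst_le[of u "(ut, ux)"] norm_snd_le[of "(ut, ux)" u] norm_fst_le[of ut ux] norm_snd_le[of ux ut] by linarith+
   then have "(norm u + norm ut + norm ux) ^ 4 <= (3 * norm y) ^ 4" by (intro power_mono) auto
   then have "C * (norm u + norm ut + norm ux) ^ 4 <= C * (81 * norm y ^ 4)" using C(1) by (intro mult_left_mono) (auto simp: power_mult_distrib)
   moreover have "(F y - Fc m c y) $ j = F y $ j - F_cubic m c j y" by (simp add: Fc_def)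
   ultimately show "\<bar>(F y - Fc m c y) $ j\<bar> <= (C * 81) * norm y ^ 4" using y by (simp add: yy)
  qed
  then show ?thesis using C(1) by (intro exI[of _ "C * 81"]) simp
 qed
 then have "\<forall>j. \<exists>C. C > 0 \<and> eventually (%y. \<bar>(F y - Fc m c y) $ j\<bar> <= C * norm y ^ 4) (nhds 0)" by blast
 from choice[OF this] obtain C where C': "\<forall>j. C j > 0 \<and> eventually (%y. \<bar>(F y - Fc m c y) $ j\<bar> <= C j * norm y ^ 4) (nhds 0)" ..
 have C: "C j > 0" "eventually (%y. \<bar>(F y - Fc m c y) $ j\<bar> <= C j * norm y ^ 4) (nhds 0)" for j using C' by blast+
 have "eventually (%y. \<forall>j. \<bar>(F y - Fc m c y) $ j\<bar> <= C j * norm y ^ 4) (nhds 0)" using C(2) by (rule eventually_all_finite)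
 then obtain r where r: "r > 0" "!!y j. dist y 0 < r ==> \<bar>(F y - Fc m c y) $ j\<bar> <= C j * norm y ^ 4" unfolding eventually_nhds_metric by blast
 have "norm (F y - Fc m c y) <= (\<Sum>j\<in>UNIV. C j) * norm y ^ 4" if "norm y < r" for y
 proof -
  have "norm (F y - Fc m c y) <= (\<Sum>j\<in>UNIV. \<bar>(F y - Fc m c y) $ j\<bar>)" by (rule norm_le_l1_cart)
  also have "... <= (\<Sum>j\<in>UNIV. C j * norm y ^ 4)" by (rule sum_mono) (use r(2) that in simp)
  finally show ?thesis by (simp add: sum_distrib_right)
 qed
 moreover have "(\<Sum>j\<in>UNIV. C j) > 0" using C(1) by (intro sum_pos) auto
 ultimately show ?thesis using r(1) by blast
qed

lemma test_functions_support:
 fixes f :: "'n::finite => real => real"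
 assumes "!!j. test_function (f j)"
 obtains B where "B >= 1" "!!j x. \<bar>x\<bar> > B ==> f j x = 0"
proof -
 have "\<exists>b. \<forall>x. \<bar>x\<bar> > b --> f j x = 0" for j
 proof -
  have "bounded (closure {x. f j x ~= 0})" using assms[of j] unfolding test_function_def by (blast intro: compact_imp_bounded)
  then obtain b where "\<forall>x\<in>closure {x. f j x ~= 0}. norm x <= b" unfolding bounded_iff by blast
  then have "f j x = 0" if "\<bar>x\<bar> > b" for x using closure_subset[of "{x. f j x ~= 0}"] that by force
  then show ?thesis by blast
 qed
 then have "\<forall>j. \<exists>b. \<forall>x. \<bar>x\<bar> > b --> f j x = 0" by blast
 from choice[OF this] obtain b where b': "\<forall>j x. \<bar>x\<bar> > b j --> f j x = 0" ..
 have b: "f j x = 0" if "\<bar>x\<bar> > b j" for j x using b' that by blast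
 have "\<bar>b j\<bar> <= (\<Sum>j\<in>UNIV. \<bar>b j\<bar>)" for j by (rule member_le_sum) auto
 then have "f j x = 0" if "\<bar>x\<bar> > 1 + (\<Sum>j\<in>UNIV. \<bar>b j\<bar>)" for j x
 proof -
  have "\<bar>b j\<bar> <= (\<Sum>j\<in>UNIV. \<bar>b j\<bar>)" by fact
  then have "\<bar>x\<bar> > b j" using that by linarith
  then show ?thesis by (rule b)
 qed
 moreover have "(\<Sum>j\<in>UNIV. \<bar>b j\<bar>) >= 0" by (simp add: sum_nonneg)
 ultimately show ?thesis using that[of "1 + (\<Sum>j\<in>UNIV. \<bar>b j\<bar>)"] by simp
qed

lemma inverse_exponent:
 fixes p :: ennreal
 assumes "p >= 2"
 shows "0 <= enn2real (1 / p)" "enn2real (1 / p) <= 1 / 2"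
proof -
 show "0 <= enn2real (1 / p)" by simp
 show "enn2real (1 / p) <= 1 / 2"
 proof (cases p)
  case (real q)
  have q2: "q >= 2" using assms unfolding real(2) by (metis ennreal_le_iff2 ennreal_numeral not_numeral_le_zero zero_le_numeral)
  have "1 / p = ennreal (1 / q)" unfolding real(2) using divide_ennreal[of 1 q] q2 by simp
  then show ?thesis using q2 by (simp add: field_simps)
 qed simp
qed

text \<open>Sup bound times the length of the support to the power 1/p. Both are powers of t + 2B up
  to a factor 2^{1/p} <= 2, and the resulting exponent is at most 0, so t + 2B may be replaced by 1
  + t.\<close>

lemma Lp_decay:
 fixes h :: "real => 'b::real_normed_vector"
 assumes h: "continuous_on UNIV h" and M: "!!x. norm (h x) <= A / sqrt (t + 2 * B)" and supp: "!!x. \<bar>x\<bar> > t + B ==> h x = 0"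
  and t: "t >= 0" and B: "B >= 1" and A: "A >= 0" and p: "p >= 2"
 shows "Lp_norm p h <= ennreal (2 * A * (1 + t) powr (- (1 / 2 - enn2real (1 / p))))"
proof -
 define e where "e = enn2real (1 / p)"
 have e: "0 <= e" "e <= 1 / 2" unfolding e_def by (rule inverse_exponent[OF p])+
 let ?T = "t + 2 * B"
 have T: "?T > 0" "1 + t <= ?T" using t B by auto
 have "?T powr (- (1/2)) = inverse (?T powr (1/2))" by (rule powr_minus)
 also have "?T powr (1/2) = sqrt ?T" by (rule powr_half_sqrt) (use T in simp)
 finally have sq: "A / sqrt ?T = A * ?T powr (- (1/2))" by (simp only: divide_inverse)
 have mono: "?T powr (- (1/2 - e)) <= (1 + t) powr (- (1/2 - e))" by (rule powr_mono2') (use e T t in auto)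
 have "Lp_norm p h <= ennreal (A / sqrt ?T * (2 * (t + B)) powr e) \<or> (p = \<infinity> \<and> Lp_norm p h <= ennreal (A / sqrt ?T))"
  unfolding e_def by (rule Lp_norm_bound[OF h M supp _ p]) (use t B in auto)
 then show ?thesis
 proof
  assume L: "Lp_norm p h <= ennreal (A / sqrt ?T * (2 * (t + B)) powr e)"
  have "(2 * (t + B)) powr e <= (2 * ?T) powr e" by (rule powr_mono2) (use e t B in auto)
  also have "... = 2 powr e * ?T powr e" by (rule powr_mult; use T in simp)
  also have "... <= 2 powr 1 * ?T powr e" using e by (intro mult_right_mono powr_mono) auto
  finally have "(2 * (t + B)) powr e <= 2 * ?T powr e" by simp
  then have "A / sqrt ?T * (2 * (t + B)) powr e <= A / sqrt ?T * (2 * ?T powr e)" using A T by (intro mult_left_mono) auto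
  also have "... = 2 * A * (?T powr (- (1/2)) * ?T powr e)" unfolding sq by simp
  also have "?T powr (- (1/2)) * ?T powr e = ?T powr (- (1/2 - e))" by (simp flip: powr_add)
  also have "2 * A * ?T powr (- (1/2 - e)) <= 2 * A * (1 + t) powr (- (1/2 - e))" using mono A by (intro mult_left_mono) auto
  finally show ?thesis using L unfolding e_def[symmetric] by (meson ennreal_leI order_trans)
 next
  assume L: "p = \<infinity> \<and> Lp_norm p h <= ennreal (A / sqrt ?T)"
  then have e0: "e = 0" unfolding e_def by simp
  have "A / sqrt ?T <= A * (1 + t) powr (- (1/2 - e))" unfolding sq using mono A unfolding e0 by (intro mult_left_mono) auto
  also have "... <= 2 * A * (1 + t) powr (- (1/2 - e))" using A by (intro mult_right_mono) auto
  finally show ?thesis using L unfolding e_def[symmetric] by (meson ennreal_leI order_trans)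
 qed
qed

context kg_cone
begin

definition sol :: "real => real * real => real ^ 'n" where "sol ep p = u (fst p, snd p, ep)"

lemma sol_Ck: "Ck 6 (sol ep)"
 unfolding sol_def[abs_def] by (rule slice_Ck[OF u])

lemma sol_partials:
 "eq_half (Dt (sol ep)) (%p. dd et u (fst p, snd p, ep))" "eq_half (Dx (sol ep)) (%p. dd ex u (fst p, snd p, ep))"
 "eq_half (Dt (Dt (sol ep))) (%p. dd et (dd et u) (fst p, snd p, ep))" "eq_half (Dx (Dx (sol ep))) (%p. dd ex (dd ex u) (fst p, snd p, ep))"
proof -
 have c: "Ck (Suc 5) (sol ep)" using sol_Ck by (simp add: numeral_eq_Suc del: Ck.simps)
 have d: "dd e1 (sol ep) = (%p. dd et u (fst p, snd p, ep))" "dd e2 (sol ep) = (%p. dd ex u (fst p, snd p, ep))"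
  unfolding sol_def[abs_def] by (rule slice_dd[OF u_Ck(2)])+
 show 1: "eq_half (Dt (sol ep)) (%p. dd et u (fst p, snd p, ep))" and 2: "eq_half (Dx (sol ep)) (%p. dd ex u (fst p, snd p, ep))"
  using Ck_imp_partials(3,4)[OF c] unfolding d .
 have tr: "eq_half a b ==> eq_half b c ==> eq_half a c" for a b c :: "real * real => real ^ 'n" by (simp add: eq_half_def)
 show "eq_half (Dt (Dt (sol ep))) (%p. dd et (dd et u) (fst p, snd p, ep))"
  using tr[OF Dt_cong[OF 1] Ck_imp_partials(3)[OF slice_Ck[OF u_Ck(1)[of et]]]] unfolding slice_dd(1)[OF u_Ck(1)[of et]] .
 show "eq_half (Dx (Dx (sol ep))) (%p. dd ex (dd ex u) (fst p, snd p, ep))"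
  using tr[OF Dx_cong[OF 2] Ck_imp_partials(4)[OF slice_Ck[OF u_Ck(1)[of ex]]]] unfolding slice_dd(2)[OF u_Ck(1)[of ex]] .
qed

lemma sol_jet: "t >= 0 ==> jet (sol ep) (t, x) = (u (t, x, ep), dd et u (t, x, ep), dd ex u (t, x, ep))"
 using sol_partials(1,2) unfolding jet_def eq_half_def by (simp add: sol_def)

lemma sol_jet_support: "t >= 0 ==> \<bar>x\<bar> > t + B ==> jet (sol ep) (t, x) = 0"
proof -
 assume t: "t >= 0" and x: "\<bar>x\<bar> > t + B"
 let ?X = "{p :: real * real * real. \<bar>fst p\<bar> + B < \<bar>fst (snd p)\<bar>}"
 have op: "open ?X" by (intro open_Collect_less continuous_intros)
 have X0: "u p = 0" if "p : ?X" for p using supp[of "fst p" "fst (snd p)" "snd (snd p)"] that by simp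
 have X: "(t, x, ep) : ?X" using x t by simp
 have "dd v u (t, x, ep) = 0" for v by (rule dd_eq_0_open[OF op X0 X])
 then show ?thesis unfolding sol_jet[OF t] using X0[OF X] by (simp add: zero_prod_def)
qed

text \<open>As long as the jet stays in the unit ball the cut-off is inactive, and the solution of
  the modified equation solves the original one.\<close>

lemma sol_classical:
 assumes FF: "!!y. norm y <= 1 ==> F y = F' y" and small: "!!t x. t >= 0 ==> norm (jet (sol ep) (t, x)) <= 1"
  and i: "!!x j. u (0, x, ep) $ j = ep * f j x" "!!x j. dd et u (0, x, ep) $ j = ep * g j x"
 shows "classical_solution m F' f g ep (sol ep)"
 unfolding classical_solution_iff
proof (intro conjI allI impI)
 show "Ck_half 2 (sol ep)" by (rule Ck_imp_Ck_half[OF Ck_mono[OF sol_Ck]]) simp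
 show "sol ep (0, x) = (\<chi> j. ep * f j x)" for x by (simp add: sol_def vec_eq_iff i)
 have "Dt (sol ep) (0, x) = dd et u (0, x, ep)" for x using sol_partials(1)[of ep] unfolding eq_half_def by simp
 then show "Dt (sol ep) (0, x) = (\<chi> j. ep * g j x)" for x by (simp add: vec_eq_iff i)
 fix t x :: real assume t: "0 < t"
 have "Dt (Dt (sol ep)) (t, x) - Dx (Dx (sol ep)) (t, x) = dd et (dd et u) (t, x, ep) - dd ex (dd ex u) (t, x, ep)"
  using sol_partials(3,4)[of ep] t unfolding eq_half_def by simp
 also have "... = F (jet (sol ep) (t, x)) - mass m (mass m (sol ep (t, x)))" using t by (simp add: eq sol_jet sol_def)
 also have "F (jet (sol ep) (t, x)) = F' (jet (sol ep) (t, x))" by (rule FF[OF small]) (use t in simp)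
 finally show "Dt (Dt (sol ep)) (t, x) - Dx (Dx (sol ep)) (t, x) = source m F' (sol ep) (t, x)" unfolding source_def .
qed

end

lemma pd_jet:
 assumes "ga : MI1"
 shows "norm (pd ga v p) <= norm (jet v p)" "jet v p = 0 ==> pd ga v p = 0"
proof -
 have "norm (v p) <= norm (jet v p)" "norm (Dt v p) <= norm (jet v p)" "norm (Dx v p) <= norm (jet v p)"
  unfolding jet_def using norm_fst_le[of "v p" "(Dt v p, Dx v p)"] norm_snd_le[of "(Dt v p, Dx v p)" "v p"]
   norm_fst_le[of "Dt v p" "Dx v p"] norm_snd_le[of "Dx v p" "Dt v p"] by linarith+
 then show "norm (pd ga v p) <= norm (jet v p)" using assms unfolding MI1_eq by (auto simp: pd_simps simp del: One_nat_def)
 then show "jet v p = 0 ==> pd ga v p = 0" by simp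
qed

lemma pd_slice_continuous:
 assumes "Ck_half 2 v" "ga : MI1" "t >= 0"
 shows "continuous_on UNIV (%x. pd ga v (t, x))"
proof -
 have 2: "2 = Suc (Suc 0)" by simp
 note U = Ck_half_partials[OF assms(1)[unfolded 2]]
 have "continuous_on ({0..} \<times> UNIV) (pd ga v)"
  using assms(2) U(4) Ck_half_partials(4)[OF U(5)] Ck_half_partials(4)[OF U(6)] unfolding MI1_eq by (auto simp: pd_simps simp del: One_nat_def)
 then show ?thesis by (rule continuous_on_compose2) (use assms(3) in \<open>auto intro!: continuous_intros\<close>)
qed

theorem theorem2p1:
  fixes m :: "'n::{finite,linorder} \<Rightarrow> real"
    and f g :: "'n \<Rightarrow> real \<Rightarrow> real"
    and F :: "'n jet \<Rightarrow> real ^ ('n::{finite,linorder})"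
    and c :: "'n coeffs"
  assumes "\<forall>j. 0 < m j" and "mono m"
    and "\<forall>j. test_function (f j)" and "\<forall>j. test_function (g j)"
    and "smooth F" and "cubic_expansion m c F"
    and "\<exists>A. hermitian A \<and> positive_definite A \<and>
           (\<forall>\<omega>\<in>hyperboloid_plus. \<forall>Y. Im (cdot (A *v Y) (F_red m c \<omega> Y)) \<le> 0)"
  shows "\<exists>\<epsilon>0>0.
    (\<forall>\<epsilon>\<in>{0<..\<epsilon>0}. \<exists>u. classical_solution m F f g \<epsilon> u \<and>
       (\<forall>v. classical_solution m F f g \<epsilon> v \<longrightarrow> (\<forall>t\<ge>0. \<forall>x. v (t, x) = u (t, x)))) \<and>
    (\<exists>C>0. \<forall>\<epsilon>\<in>{0<..\<epsilon>0}. \<forall>u. classical_solution m F f g \<epsilon> u \<longrightarrow>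
       (\<forall>t\<ge>0. \<forall>p\<ge>2. (\<Sum>\<gamma>\<in>MI1. Lp_norm p (\<lambda>x. pd \<gamma> u (t, x)))
          \<le> ennreal (C * \<epsilon> * (1 + t) powr (- (1 / 2 - enn2real (1 / p))))))"
proof -
 define m0 where "m0 = Min (range m)"
 have m0_in: "m0 : range m" unfolding m0_def by (rule Min_in) auto
 have m0: "0 < m0" "!!j. m0 <= m j"
 proof -
  show "0 < m0" using m0_in assms(1) by auto
  show "m0 <= m j" for j unfolding m0_def by (rule Min_le) auto
 qed
 obtain A where A: "hermitian A" "positive_definite A" "!!\<omega> Y. \<omega> : hyperboloid_plus ==> Im (cdot (A *v Y) (F_red m c \<omega> Y)) <= 0"
  using assms(7) by blast
 obtain Co where Co: "Co > 0" "ode_bound m c Co" using profile_ode_bound[OF m0 A] by blast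
 obtain C3 where C3: "C3 > 0" "!!y y'. norm (Fc m c y - Fc m c y') <= C3 * (norm y + norm y')^2 * norm (y - y')"
  using Fc_Lipschitz[of m c] by blast
 have Fc0: "Fc m c 0 = 0" using Fc_scaleR[of m c 0 0] by simp
 have Fc3: "norm (Fc m c y) <= C3 * norm y ^ 3" for y
  using C3(2)[of y 0] by (simp add: Fc0 power2_eq_square power3_eq_cube mult.assoc)
 obtain r1 C1 where r1: "r1 > 0" "C1 > 0" "!!y. norm y < r1 ==> norm (F y - Fc m c y) <= C1 * norm y ^ 4"
  using cubic_expansion_bound[OF assms(6)] by blast
 define r where "r = min r1 1"
 have r: "r > 0" "r <= r1" "r <= 1" unfolding r_def using r1(1) by auto
 have F3: "norm (F y) <= (C3 + C1) * norm y ^ 3" if y: "norm y < r" for y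
 proof -
  have "norm y ^ 4 <= norm y ^ 3" using power_decreasing[of 3 4 "norm y"] y r by simp
  then have "C1 * norm y ^ 4 <= C1 * norm y ^ 3" using r1(2) by (intro mult_left_mono) auto
  moreover have "norm (F y - Fc m c y) <= C1 * norm y ^ 4" by (rule r1(3)) (use y r in simp)
  moreover have "norm (F y) <= norm (F y - Fc m c y) + norm (Fc m c y)" using norm_triangle_ineq[of "F y - Fc m c y" "Fc m c y"] by simp
  ultimately show ?thesis using Fc3[of y] unfolding distrib_right by linarith
 qed
 have C31: "C3 + C1 > 0" using C3(1) r1(2) by simp
 have k46: "(6::nat) >= 4" by simp
 \<comment> \<open>Six derivatives: five for the energy method and, on the initial hyperboloid, four
   in z, one in s and one in the parameter.\<close>
 obtain Ft CF where Ft: "Ck 6 Ft" "!!y. norm y <= 1 ==> Ft y = F y" "cubic_growth CF Ft" "!!y y'. norm (Ft y - Ft y') <= CF * norm (y - y')"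
  by (rule truncation[OF assms(5) k46 r(1) C31 F3], assumption, rule that)
 note CF = cubic_growthD(1,2)[OF Ft(3)]
 \<comment> \<open>The quartic bound on the remainder must hold for all jets. Outside radius
   \<open>r\<close> both parts are at most cubic, and one power of |y| is gained by dividing by
   \<open>r\<close>.\<close>
 define C4 where "C4 = C1 + (CF + C3) / r"
 have C4: "C4 > 0" "norm (Ft y - Fc m c y) <= C4 * norm y ^ 4" for y
 proof -
  have q: "0 < (CF + C3) / r" using CF(1) C3(1) r(1) by simp
  then show "C4 > 0" unfolding C4_def using r1(2) by simp
  show "norm (Ft y - Fc m c y) <= C4 * norm y ^ 4"
  proof (cases "norm y < r")
   case True
   then have "Ft y = F y" using Ft(2)[of y] r by simp
   then have "norm (Ft y - Fc m c y) <= C1 * norm y ^ 4" using r1(3)[of y] True r by simp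
   also have "... <= C4 * norm y ^ 4" unfolding C4_def using q by (intro mult_right_mono) auto
   finally show ?thesis .
  next
   case False
   have "norm (Ft y - Fc m c y) <= CF * norm y ^ 3 + C3 * norm y ^ 3"
    using norm_triangle_ineq4[of "Ft y" "Fc m c y"] CF(2)[of y] Fc3[of y] by linarith
   also have "... = (CF + C3) / r * (r * norm y ^ 3)" using r(1) by (simp add: field_simps)
   also have "... <= (CF + C3) / r * (norm y * norm y ^ 3)" using q False by (intro mult_left_mono mult_right_mono) auto
   also have "... = (CF + C3) / r * norm y ^ 4" by (simp add: power3_eq_cube power4_eq_xxxx)
   also have "... <= C4 * norm y ^ 4" unfolding C4_def using r1(2) by (intro mult_right_mono) auto
   finally show ?thesis .
  qed
 qed
 obtain B1 where B1: "B1 >= 1" "!!j x. \<bar>x\<bar> > B1 ==> f j x = 0" by (rule test_functions_support[OF assms(3)[rule_format]], rule that)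
 obtain B2 where B2: "B2 >= 1" "!!j x. \<bar>x\<bar> > B2 ==> g j x = 0" by (rule test_functions_support[OF assms(4)[rule_format]], rule that)
 define B where "B = max B1 B2"
 have B: "B >= 1" "!!j x. \<bar>x\<bar> > B ==> f j x = 0 \<and> g j x = 0" unfolding B_def using B1 B2 by auto
 have Ft0: "Ft 0 = 0" using CF(2)[of 0] by simp
 have sm: "smooth (f j)" "smooth (g j)" for j using assms(3,4) unfolding test_function_def by blast+
 have k26: "(6::nat) >= 2" by simp
 obtain u :: "real * (real * real) => (real, 'n) vec" where u: "Ck 6 u"
  "!!p. dd et (dd et u) p - dd ex (dd ex u) p = Ft (u p, dd et u p, dd ex u p) - mass m (mass m (u p))"
  "!!x ep j. u (0, x, ep) $ j = ep * f j x" "!!x ep j. dd et u (0, x, ep) $ j = ep * g j x"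
  "!!t x ep. \<bar>x\<bar> > \<bar>t\<bar> + B ==> u (t, x, ep) = 0" "!!t x. u (t, x, 0) = 0"
  by (rule kg_solution[OF Ft(1) k26 Ft0 Ft(4) sm B(2)], assumption, rule that)
 interpret K: kg_cone m Ft u B by standard (rule u(1), rule u(2), rule u(5), assumption, rule u(6), rule B(1))
 have Ft4: "Ck 4 Ft" by (rule Ck_mono[OF Ft(1)]) simp
 obtain ep1 K where K: "ep1 > 0" "K > 0" "!!ep t x. ep : {0<..ep1} ==> t >= 0 ==>
   norm (u (t, x, ep), dd et u (t, x, ep), dd ex u (t, x, ep)) <= K * ep / sqrt (t + 2 * B)"
  using K.jet_decay[OF Ft4 Ft(3) m0 C3 C4 Co] by blast
 \<comment> \<open>The second entry gives \<open>K * ep <= 1\<close>, which together with t + 2B >=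
   1 keeps the jet in the unit ball, where the truncated and the original nonlinearity
   agree.\<close>
 define ep0 where "ep0 = min ep1 (1 / K)"
 have ep0: "ep0 > 0" unfolding ep0_def using K by simp
 have jet: "norm (jet (K.sol ep) (t, x)) <= K * ep / sqrt (t + 2 * B)" if "ep : {0<..ep0}" "t >= 0" for ep t x
  unfolding K.sol_jet[OF that(2)] by (rule K(3)[OF _ that(2)]) (use that(1) in \<open>auto simp: ep0_def\<close>)
 have sol: "classical_solution m F f g ep (K.sol ep)" if e: "ep : {0<..ep0}" for ep
 proof (rule K.sol_classical)
  fix t x :: real assume t: "t >= 0"
  have "ep <= 1 / K" using e unfolding ep0_def by auto
  then have Ke: "K * ep <= 1" using K(2) by (simp add: field_simps)
  have "1 <= sqrt (t + 2 * B)" using t B(1) by simp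
  then have "K * ep / sqrt (t + 2 * B) <= 1 / 1" using Ke by (intro frac_le) auto
  then show "norm (jet (K.sol ep) (t, x)) <= 1" using jet[OF e t, of x] by linarith
 qed (rule Ft(2), assumption, rule u(3), rule u(4))
 have F1: "Ck 1 F" using assms(5) unfolding smooth_def by blast
 have uniq: "eq_half v (K.sol ep)" if "ep : {0<..ep0}" "classical_solution m F f g ep v" for ep v
  by (rule classical_solution_unique[OF F1 that(2) sol[OF that(1)]])
 \<comment> \<open>By uniqueness any solution has the jet of the constructed one, so the decay may
   be claimed for all; 6 is three multi-indices times the factor 2 of
   \<open>Lp_decay\<close>.\<close>
 have Lp: "(\<Sum>ga\<in>MI1. Lp_norm p (%x. pd ga v (t, x))) <= ennreal (6 * K * ep * (1 + t) powr (- (1 / 2 - enn2real (1 / p))))"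
  if e: "ep : {0<..ep0}" and v: "classical_solution m F f g ep v" and t: "t >= 0" and p: "p >= 2" for ep v t p
 proof -
  have eqh: "eq_half v (K.sol ep)" by (rule uniq[OF e v])
  have jv: "jet v (t, x) = jet (K.sol ep) (t, x)" for x
   using eqh Dt_cong[OF eqh] Dx_cong[OF eqh] t unfolding eq_half_def jet_def by simp
  have Ke: "K * ep >= 0" using K(2) e by simp
  let ?X = "2 * (K * ep) * (1 + t) powr (- (1 / 2 - enn2real (1 / p)))"
  have "Lp_norm p (%x. pd ga v (t, x)) <= ennreal ?X" if ga: "ga : MI1" for ga
  proof (rule Lp_decay[OF _ _ _ t B(1) Ke p])
   show "continuous_on UNIV (%x. pd ga v (t, x))" by (rule pd_slice_continuous[OF _ ga t]) (use v classical_solution_def in blast)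
   show "norm (pd ga v (t, x)) <= K * ep / sqrt (t + 2 * B)" for x
    using pd_jet(1)[OF ga, of v "(t, x)"] jet[OF e t, of x] unfolding jv by linarith
   show "pd ga v (t, x) = 0" if "t + B < \<bar>x\<bar>" for x
    by (rule pd_jet(2)[OF ga]) (use K.sol_jet_support[OF t that] jv in simp)
  qed
  then have "(\<Sum>ga\<in>MI1. Lp_norm p (%x. pd ga v (t, x))) <= (\<Sum>ga\<in>MI1. ennreal ?X)" by (rule sum_mono)
  also have "... = ennreal (\<Sum>ga\<in>MI1. ?X)" by (rule sum_ennreal) (use Ke in simp)
  also have "(\<Sum>ga\<in>MI1. ?X) = 6 * K * ep * (1 + t) powr (- (1 / 2 - enn2real (1 / p)))" by (simp add: MI1_eq)
  finally show ?thesis .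
 qed
 show ?thesis
 proof (rule exI[of _ ep0], intro conjI ballI)
  show "0 < ep0" by (rule ep0)
  fix ep assume e: "ep : {0<..ep0}"
  show "\<exists>u. classical_solution m F f g ep u \<and> (\<forall>v. classical_solution m F f g ep v --> (\<forall>t\<ge>0. \<forall>x. v (t, x) = u (t, x)))"
   using sol[OF e] uniq[OF e] unfolding eq_half_def by blast
 next
  have "6 * K > 0" using K(2) by simp
  then show "\<exists>C>0. \<forall>ep\<in>{0<..ep0}. \<forall>u. classical_solution m F f g ep u -->
   (\<forall>t\<ge>0. \<forall>p\<ge>2. (\<Sum>ga\<in>MI1. Lp_norm p (%x. pd ga u (t, x)))
     <= ennreal (C * ep * (1 + t) powr (- (1 / 2 - enn2real (1 / p)))))"
   using Lp by blast
 qed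
qed

end
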